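(* Let $\mathbb{W}$ be a super-reflexive Banach space, normed so that $\mathbb{W}$ is uniformly smooth and strictly convex, let $\mathbb{U}$ be a separable Hilbert space identified with its own dual, $T>0$, $\alpha>0$, $\beta\ge0$, $0<\nu<1$, and let $\mathrm{A}:D(\mathrm{A})\subseteq\mathbb{W}\to\mathbb{W}$ be a closed, densely defined linear operator which is sectorial of angle $\frac{\nu\pi}{2}$ and such that $(\lambda_0\mathrm{I}-\mathrm{A})^{-1}$ is compact for some $\lambda_0\in\rho(\mathrm{A})$. Let $(\mathscr{G}(t))_{t\ge0}$ be the $(\alpha,\beta,\nu)$-resolvent family generated by $\mathrm{A}$, let $N$ be a constant with $\sup_{t\in[0,T]}\|\mathscr{G}(t)\|_{\mathcal{L}(\mathbb{W})}\le N$, let $\mathrm{B}:\mathbb{U}\to\mathbb{W}$ be a bounded linear operator, and let $\kappa(t)=\alpha e^{-\beta t}\frac{t^{\nu-1}}{\Gamma(\nu)}$. Let $f:[0,T]\times\mathbb{W}\to\mathbb{W}$ satisfy: (i) for a.e. $t\in[0,T]$ the map $f(t,\cdot):\mathbb{W}\to\mathbb{W}$ is continuous, and for each $w\in\mathbb{W}$ the map $t\mapsto f(t,w)$ is strongly measurable on $[0,T]$; (ii) for each $r>0$ there exists a positive function $\gamma_r\in\mathrm{L}^1([0,T];\mathbb{R}^+)$ such that $\|f(t,w)\|_{\mathbb{W}}\le\gamma_r(t)$ for a.e. $t\in[0,T]$ and all $w\in\mathbb{W}$ with $\|w\|_{\mathbb{W}}\le r$. Assume that the linear system $$w'(t)=\mathrm{A}w(t)+\int_0^t\kappa(t-s)\mathrm{A}w(s)\,\mathrm{d}s+\mathrm{B}u(t),\quad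 t\in(0,T],\qquad w(0)=\zeta,$$ is approximately controllable on $[0,T]$. For $t\in[0,T]$ define $F(t):\mathbb{W}^*\to\mathbb{W}$ by $$F(t)w^*=\int_0^t\mathscr{G}(t-s)\mathrm{B}\mathrm{B}^*\mathscr{G}(T-s)^*w^*\,\mathrm{d}s,$$ and assume there exists a constant $\tilde L\ge1$ such that $\|F(t)F(T)^{-1}\|_{\mathcal{L}(\mathcal{R}(F(T)),\mathbb{W})}\le\tilde L$ for all $t\in[0,T]$. Suppose that for every $\zeta,\zeta_1\in\mathbb{W}$ there exists $\tilde r>0$ such that $$N\|\zeta\|_{\mathbb{W}}+N\|\gamma_{\tilde r}\|_{\mathrm{L}^1([0,T];\mathbb{R}^+)}+2\tilde L\left[\|\zeta_1\|_{\mathbb{W}}+N\|\zeta\|_{\mathbb{W}}+N\|\gamma_{\tilde r}\|_{\mathrm{L}^1([0,T];\mathbb{R}^+)}\right]\le\tilde r.$$ Then the semilinear system $$w'(t)=\mathrm{A}w(t)+\int_0^t\kappa(t-s)\mathrm{A}w(s)\,\mathrm{d}s+\mathrm{B}u(t)+f(t,w(t)),\quad t\in(0,T],\qquad w(0)=\zeta,$$ is approximately controllable on $[0,T]$.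
   Context: Range and inverse: $\mathcal{R}(F(T))\subseteq\mathbb{W}$ is the range of $F(T)$, with the norm of $\mathbb{W}$. Approximate controllability of the linear system implies that $F(T)$ is injective, so $F(T)^{-1}:\mathcal{R}(F(T))\to\mathbb{W}^*$ and $F(t)F(T)^{-1}:\mathcal{R}(F(T))\to\mathbb{W}$ are well defined. Mild solution: given $\zeta\in\mathbb{W}$ and $u\in\mathrm{L}^2([0,T];\mathbb{U})$, a mild solution of the semilinear system is a function $w\in C([0,T];\mathbb{W})$ with $w(t)=\mathscr{G}(t)\zeta+\int_0^t\mathscr{G}(t-s)[\mathrm{B}u(s)+f(s,w(s))]\,\mathrm{d}s$ for $t\in[0,T]$; for the linear system take $f=0$. Approximate controllability: the (linear or semilinear) system is approximately controllable on $[0,T]$ if for every initial value $\zeta\in\mathbb{W}$, every desired state $\zeta_1\in\mathbb{W}$ and every $\epsilon>0$ there exist a control $u\in\mathrm{L}^2([0,T];\mathbb{U})$ and a corresponding mild solution $w$ such that $\|w(T)-\zeta_1\|_{\mathbb{W}}<\epsilon$. Super-reflexive: every Banach space finitely representable in $\mathbb{W}$ is reflexive; such a space admits an equivalent norm that is both uniformly smooth and strictly convex. Sectorial operator: $\mathrm{A}$ is sectorial of angle $\theta\in(0,\frac{\pi}{2}]$ if $\Sigma_\theta:=\{\lambda\in\mathbb{C}\setminus\{0\}:|\arg(\lambda)|<\theta+\frac{\pi}{2}\}\subset\rho(\mathrm{A})$ and for each $\omega\in(0,\theta)$ there exists $K_\omega\ge1$ such that $\|(\lambda\mathrm{I}-\mathrm{A})^{-1}\|\le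 K_\omega/|\lambda|$ for all $0\ne\lambda\in\overline{\Sigma}_{\theta-\omega}$. (If the scalar field is real, resolvent set and resolvents are understood in the complexification.) $(\alpha,\beta,\nu)$-resolvent family: the family $(\mathscr{G}(t))_{t\ge0}=(\mathscr{G}_{\alpha,\beta}^{\nu}(t))_{t\ge 0}$ of bounded linear operators on $\mathbb{W}$ such that (a) $\mathscr{G}(\cdot)$ is strongly continuous on $[0,\infty)$ and $\mathscr{G}(0)=\mathrm{I}$; (b) $\mathscr{G}(t)z\in D(\mathrm{A})$ and $\mathscr{G}(t)\mathrm{A}z=\mathrm{A}\mathscr{G}(t)z$ for all $z\in D(\mathrm{A})$, $t\ge0$; (c) $\mathscr{G}(t)z=z+\int_0^t(1+1*\kappa)(t-s)\mathrm{A}\mathscr{G}(s)z\,\mathrm{d}s$ for all $z\in D(\mathrm{A})$, $t\ge0$, where $(1*\kappa)(t)=\int_0^t\kappa(s)\,\mathrm{d}s$. If $\mathrm{A}$ is sectorial of angle $\frac{\nu\pi}{2}$, such a family exists and is unique. *)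

theory Defs
  imports "HOL-Analysis.Analysis" "HOL-Library.Function_Algebras"
begin

section \<open>Scalars\<close>

text \<open>The scalar field is real or complex. The range of \<open>to_cplx\<close> is a subfield of the complex
  numbers that contains the reals, so up to isomorphism these two are the only members of the
  class.\<close>

class rc_field = real_normed_field +
  fixes to_cplx :: "'a \<Rightarrow> complex"
  assumes to_cplx_add: "to_cplx (x + y) = to_cplx x + to_cplx y"
    and to_cplx_mult: "to_cplx (x * y) = to_cplx x * to_cplx y"
    and to_cplx_real_scale: "to_cplx (r *\<^sub>R 1) = of_real r"
    and norm_to_cplx: "norm (to_cplx x) = norm x"

instantiation real :: rc_field
begin
definition to_cplx_real :: "real \<Rightarrow> complex" where "to_cplx_real = complex_of_real"
instance by standard (simp_all only: to_cplx_real_def of_real_add of_real_mult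
      real_scaleR_def mult_1_right norm_of_real real_norm_def)
end

instantiation complex :: rc_field
begin
definition to_cplx_complex :: "complex \<Rightarrow> complex" where "to_cplx_complex z = z"
instance by standard (simp_all only: to_cplx_complex_def of_real_def)
end

text \<open>A normed space over the scalar field \<open>'k\<close>: the type class provides the norm and the
  multiplication by real scalars, which \<open>scale\<close> extends.\<close>

locale normed_space_over = vector_space scale
  for scale :: "'k::rc_field \<Rightarrow> 'x::real_normed_vector \<Rightarrow> 'x" +
  assumes scale_of_real: "scale (of_real r) x = r *\<^sub>R x"
    and norm_scale: "norm (scale c x) = norm c * norm x"

definition linear_on ::
  "('k \<Rightarrow> 'x::plus \<Rightarrow> 'x) \<Rightarrow> ('k \<Rightarrow> 'y::plus \<Rightarrow> 'y) \<Rightarrow> 'x set \<Rightarrow> ('x \<Rightarrow> 'y) \<Rightarrow> bool" where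
  "linear_on s1 s2 V f \<longleftrightarrow>
     (\<forall>x\<in>V. \<forall>y\<in>V. f (x + y) = f x + f y) \<and> (\<forall>c. \<forall>x\<in>V. f (s1 c x) = s2 c (f x))"

definition bounded_linear_over ::
  "('k \<Rightarrow> 'x::real_normed_vector \<Rightarrow> 'x) \<Rightarrow> ('k \<Rightarrow> 'y::real_normed_vector \<Rightarrow> 'y) \<Rightarrow>
   ('x \<Rightarrow> 'y) \<Rightarrow> bool" where
  "bounded_linear_over s1 s2 f \<longleftrightarrow> bounded_linear f \<and> linear_on s1 s2 UNIV f"

definition hilbert_space_over ::
  "('k::rc_field \<Rightarrow> 'u::banach \<Rightarrow> 'u) \<Rightarrow> ('u \<Rightarrow> 'u \<Rightarrow> 'k) \<Rightarrow> bool" where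
  "hilbert_space_over s ip \<longleftrightarrow> normed_space_over s \<and>
     (\<forall>x y z. ip (x + y) z = ip x z + ip y z) \<and>
     (\<forall>c x y. ip (s c x) y = c * ip x y) \<and>
     (\<forall>x y. to_cplx (ip y x) = cnj (to_cplx (ip x y))) \<and>
     (\<forall>x. ip x x = of_real ((norm x)\<^sup>2))"


section \<open>Duals, reflexivity and super-reflexivity\<close>

text \<open>A normed space is here a linear subspace \<open>V\<close> of a vector space together with a norm \<open>p\<close>
  on \<open>V\<close>. Functionals on \<open>V\<close> are represented by functions vanishing outside \<open>V\<close>, so that they are
  determined by their values on \<open>V\<close>.\<close>

definition dual ::
  "('k::real_normed_field \<Rightarrow> 'x::ab_group_add \<Rightarrow> 'x) \<Rightarrow> 'x set \<Rightarrow> ('x \<Rightarrow> real) \<Rightarrow> ('x \<Rightarrow> 'k) set" where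
  "dual s V p = {\<phi>. linear_on s (*) V \<phi> \<and> (\<exists>M. \<forall>x\<in>V. norm (\<phi> x) \<le> M * p x) \<and> (\<forall>x. x \<notin> V \<longrightarrow> \<phi> x = 0)}"

definition dual_norm :: "'x set \<Rightarrow> ('x \<Rightarrow> real) \<Rightarrow> ('x \<Rightarrow> 'k::real_normed_field) \<Rightarrow> real" where
  "dual_norm V p \<phi> = (SUP x\<in>{x\<in>V. p x \<le> 1}. norm (\<phi> x))"

definition fun_scale :: "'k::times \<Rightarrow> ('i \<Rightarrow> 'k) \<Rightarrow> 'i \<Rightarrow> 'k" where
  "fun_scale c x = (\<lambda>i. c * x i)"

definition reflexive ::
  "('k::real_normed_field \<Rightarrow> 'x::ab_group_add \<Rightarrow> 'x) \<Rightarrow> 'x set \<Rightarrow> ('x \<Rightarrow> real) \<Rightarrow> bool" where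
  "reflexive s V p \<longleftrightarrow>
     (\<forall>\<Phi>\<in>dual fun_scale (dual s V p) (dual_norm V p). \<exists>x\<in>V. \<forall>\<phi>\<in>dual s V p. \<Phi> \<phi> = \<phi> x)"

definition banach_on ::
  "('k::real_normed_field \<Rightarrow> 'x::ab_group_add \<Rightarrow> 'x) \<Rightarrow> 'x set \<Rightarrow> ('x \<Rightarrow> real) \<Rightarrow> bool" where
  "banach_on s V p \<longleftrightarrow> module.subspace s V \<and>
     (\<forall>x\<in>V. 0 \<le> p x \<and> (p x = 0 \<longleftrightarrow> x = 0)) \<and>
     (\<forall>c. \<forall>x\<in>V. p (s c x) = norm c * p x) \<and>
     (\<forall>x\<in>V. \<forall>y\<in>V. p (x + y) \<le> p x + p y) \<and>
     (\<forall>X. (\<forall>n. X n \<in> V) \<and> (\<forall>e>0. \<exists>n0. \<forall>m\<ge>n0. \<forall>n\<ge>n0. p (X m - X n) < e) \<longrightarrow>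
        (\<exists>x\<in>V. (\<lambda>n. p (X n - x)) \<longlonglongrightarrow> 0))"

definition finitely_representable ::
  "('k::real_normed_field \<Rightarrow> 'x::ab_group_add \<Rightarrow> 'x) \<Rightarrow> 'x set \<Rightarrow> ('x \<Rightarrow> real) \<Rightarrow>
   ('k \<Rightarrow> 'w::real_normed_vector \<Rightarrow> 'w) \<Rightarrow> bool" where
  "finitely_representable s V p sW \<longleftrightarrow>
     (\<forall>S \<epsilon>. finite S \<and> S \<subseteq> V \<and> \<epsilon> > 0 \<longrightarrow>
        (\<exists>L. linear_on s sW (module.span s S) L \<and>
             (\<forall>x\<in>module.span s S. p x \<le> norm (L x) \<and> norm (L x) \<le> (1 + \<epsilon>) * p x)))"

text \<open>HOL cannot quantify over all types, so the Banach spaces are taken to be linear subspaces of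
  the space of scalar sequences with an arbitrary complete norm. Up to isometry these include
  every separable Banach space: the functionals of a countable norming family are jointly
  injective. This loses nothing, because a Banach space is reflexive iff its closed separable
  subspaces are, and finite representability passes to subspaces.\<close>

definition super_reflexive :: "('k::rc_field \<Rightarrow> 'w::banach \<Rightarrow> 'w) \<Rightarrow> bool" where
  "super_reflexive sW \<longleftrightarrow>
     (\<forall>(V :: (nat \<Rightarrow> 'k) set) p. banach_on fun_scale V p \<and> finitely_representable fun_scale V p sW
        \<longrightarrow> reflexive fun_scale V p)"

definition uniformly_smooth :: "'w::real_normed_vector itself \<Rightarrow> bool" where
  "uniformly_smooth _ \<longleftrightarrow>
     (\<forall>\<epsilon>>0. \<exists>\<delta>>0. \<forall>x y :: 'w. norm x = 1 \<and> norm y \<le> \<delta> \<longrightarrow>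
        norm (x + y) + norm (x - y) \<le> 2 + \<epsilon> * norm y)"

definition strictly_convex :: "'w::real_normed_vector itself \<Rightarrow> bool" where
  "strictly_convex _ \<longleftrightarrow>
     (\<forall>x y :: 'w. norm x = 1 \<and> norm y = 1 \<and> x \<noteq> y \<longrightarrow> norm (x + y) < 2)"


section \<open>Sectorial operators\<close>

text \<open>An unbounded operator is given by its domain \<open>D\<close> and a function \<open>A\<close>, whose values outside
  \<open>D\<close> are irrelevant.\<close>

definition closed_op :: "'w::topological_space set \<Rightarrow> ('w \<Rightarrow> 'w) \<Rightarrow> bool" where
  "closed_op D A \<longleftrightarrow> closed {(x, A x) | x. x \<in> D}"

definition resolvent_set ::
  "(complex \<Rightarrow> 'x::ab_group_add \<Rightarrow> 'x) \<Rightarrow> ('x \<Rightarrow> real) \<Rightarrow> 'x set \<Rightarrow> ('x \<Rightarrow> 'x) \<Rightarrow> complex set" where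
  "resolvent_set s p D A =
     {z. bij_betw (\<lambda>x. s z x - A x) D UNIV \<and> (\<exists>M. \<forall>x\<in>D. p x \<le> M * p (s z x - A x))}"

definition resolvent ::
  "(complex \<Rightarrow> 'x::ab_group_add \<Rightarrow> 'x) \<Rightarrow> 'x set \<Rightarrow> ('x \<Rightarrow> 'x) \<Rightarrow> complex \<Rightarrow> 'x \<Rightarrow> 'x" where
  "resolvent s D A z = inv_into D (\<lambda>x. s z x - A x)"

definition sector :: "real \<Rightarrow> complex set" where
  "sector \<theta> = {z. z \<noteq> 0 \<and> \<bar>Arg z\<bar> < \<theta> + pi / 2}"

definition complex_sectorial ::
  "(complex \<Rightarrow> 'x::ab_group_add \<Rightarrow> 'x) \<Rightarrow> ('x \<Rightarrow> real) \<Rightarrow> 'x set \<Rightarrow> ('x \<Rightarrow> 'x) \<Rightarrow> real \<Rightarrow> bool" where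
  "complex_sectorial s p D A \<theta> \<longleftrightarrow>
     0 < \<theta> \<and> \<theta> \<le> pi / 2 \<and> sector \<theta> \<subseteq> resolvent_set s p D A \<and>
     (\<forall>\<omega>\<in>{0<..<\<theta>}. \<exists>K\<ge>1. \<forall>z\<in>closure (sector (\<theta> - \<omega>)). z \<noteq> 0 \<longrightarrow>
        (\<forall>y. p (resolvent s D A z y) \<le> K / cmod z * p y))"

definition complex_compact_resolvent ::
  "(complex \<Rightarrow> 'x::{ab_group_add,topological_space} \<Rightarrow> 'x) \<Rightarrow> ('x \<Rightarrow> real) \<Rightarrow> 'x set \<Rightarrow>
   ('x \<Rightarrow> 'x) \<Rightarrow> bool" where
  "complex_compact_resolvent s p D A \<longleftrightarrow>
     (\<exists>z\<in>resolvent_set s p D A. compact (closure (resolvent s D A z ` {y. p y \<le> 1})))"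

text \<open>The complexification of a real space: \<open>(x, y)\<close> stands for \<open>x + iy\<close>, and the norm is
  Taylor's, which is complex-homogeneous and induces the product topology.\<close>

definition cx_scale :: "complex \<Rightarrow> 'w::real_vector \<times> 'w \<Rightarrow> 'w \<times> 'w" where
  "cx_scale z v = (Re z *\<^sub>R fst v - Im z *\<^sub>R snd v, Re z *\<^sub>R snd v + Im z *\<^sub>R fst v)"

definition cx_norm :: "'w::real_normed_vector \<times> 'w \<Rightarrow> real" where
  "cx_norm v = (SUP t::real. norm (cos t *\<^sub>R fst v + sin t *\<^sub>R snd v))"

text \<open>In the following two definitions the first case is that of complex scalars, the second that
  of real scalars.\<close>

definition sectorial ::
  "('k::rc_field \<Rightarrow> 'w::real_normed_vector \<Rightarrow> 'w) \<Rightarrow> 'w set \<Rightarrow> ('w \<Rightarrow> 'w) \<Rightarrow> real \<Rightarrow> bool" where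
  "sectorial s D A \<theta> \<longleftrightarrow>
     (if surj (to_cplx :: 'k \<Rightarrow> complex)
      then complex_sectorial (\<lambda>z. s (inv to_cplx z)) norm D A \<theta>
      else complex_sectorial cx_scale cx_norm (D \<times> D) (map_prod A A) \<theta>)"

definition compact_resolvent ::
  "('k::rc_field \<Rightarrow> 'w::real_normed_vector \<Rightarrow> 'w) \<Rightarrow> 'w set \<Rightarrow> ('w \<Rightarrow> 'w) \<Rightarrow> bool" where
  "compact_resolvent s D A \<longleftrightarrow>
     (if surj (to_cplx :: 'k \<Rightarrow> complex)
      then complex_compact_resolvent (\<lambda>z. s (inv to_cplx z)) norm D A
      else complex_compact_resolvent cx_scale cx_norm (D \<times> D) (map_prod A A))"


section \<open>Resolvent families, mild solutions and controllability\<close>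

text \<open>The library's Bochner integral requires its values in a separable Banach space (sort
  \<open>second_countable_topology\<close>). For the state space this is no restriction: a
  densely defined operator with compact resolvent exists only on a separable space, see
  \<open>compact_resolvent_imp_separable\<close> at the end of this theory. For functions with values in a
  separable space strong measurability is \<open>borel_measurable\<close>.\<close>

definition memory_kernel :: "real \<Rightarrow> real \<Rightarrow> real \<Rightarrow> real \<Rightarrow> real" where
  "memory_kernel \<alpha> \<beta> \<nu> t = \<alpha> * exp (- \<beta> * t) * (t powr (\<nu> - 1) / Gamma \<nu>)"

definition resolvent_family ::
  "('k \<Rightarrow> 'w::{banach,second_countable_topology} \<Rightarrow> 'w) \<Rightarrow> 'w set \<Rightarrow> ('w \<Rightarrow> 'w) \<Rightarrow>
   (real \<Rightarrow> real) \<Rightarrow> (real \<Rightarrow> 'w \<Rightarrow> 'w) \<Rightarrow> bool" where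
  "resolvent_family s D A \<kappa> G \<longleftrightarrow>
     (\<forall>t\<ge>0. bounded_linear_over s s (G t)) \<and>
     (\<forall>z. continuous_on {0..} (\<lambda>t. G t z)) \<and> (\<forall>z. G 0 z = z) \<and>
     (\<forall>t\<ge>0. \<forall>z\<in>D. G t z \<in> D \<and> G t (A z) = A (G t z)) \<and>
     (\<forall>t\<ge>0. \<forall>z\<in>D. G t z = z +
        (LINT s|lebesgue_on {0..t}. (1 + (LINT r|lebesgue_on {0..t - s}. \<kappa> r)) *\<^sub>R A (G s z)))"

definition L2_controls :: "real \<Rightarrow> (real \<Rightarrow> 'u::{banach,second_countable_topology}) set" where
  "L2_controls T = {u. u \<in> borel_measurable (lebesgue_on {0..T}) \<and>
     integrable (lebesgue_on {0..T}) (\<lambda>t. (norm (u t))\<^sup>2)}"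

definition mild_solution ::
  "(real \<Rightarrow> 'w::{banach,second_countable_topology} \<Rightarrow> 'w) \<Rightarrow> ('u \<Rightarrow> 'w) \<Rightarrow> (real \<Rightarrow> 'w \<Rightarrow> 'w) \<Rightarrow>
   real \<Rightarrow> 'w \<Rightarrow> (real \<Rightarrow> 'u) \<Rightarrow> (real \<Rightarrow> 'w) \<Rightarrow> bool" where
  "mild_solution G B f T \<zeta> u w \<longleftrightarrow> continuous_on {0..T} w \<and>
     (\<forall>t\<in>{0..T}.
        integrable (lebesgue_on {0..t}) (\<lambda>s. G (t - s) (B (u s) + f s (w s))) \<and>
        w t = G t \<zeta> + (LINT s|lebesgue_on {0..t}. G (t - s) (B (u s) + f s (w s))))"

definition approximately_controllable ::
  "(real \<Rightarrow> 'w::{banach,second_countable_topology} \<Rightarrow> 'w) \<Rightarrow>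
   ('u::{banach,second_countable_topology} \<Rightarrow> 'w) \<Rightarrow> (real \<Rightarrow> 'w \<Rightarrow> 'w) \<Rightarrow> real \<Rightarrow> bool" where
  "approximately_controllable G B f T \<longleftrightarrow>
     (\<forall>\<zeta> \<zeta>1. \<forall>\<epsilon>>0. \<exists>u\<in>L2_controls T. \<exists>w. mild_solution G B f T \<zeta> u w \<and> norm (w T - \<zeta>1) < \<epsilon>)"

text \<open>The adjoint of \<open>B\<close>, with \<open>U\<close> identified with its dual by the Riesz representation theorem.
  With complex scalars this identification, and hence the adjoint, is conjugate-linear.\<close>

definition adjoint_to_hilbert :: "('u \<Rightarrow> 'u \<Rightarrow> 'k) \<Rightarrow> ('u \<Rightarrow> 'w) \<Rightarrow> ('w \<Rightarrow> 'k) \<Rightarrow> 'u" where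
  "adjoint_to_hilbert ip B \<psi> = (THE v. \<forall>u. ip u v = \<psi> (B u))"

text \<open>The Banach space adjoint of \<open>G (T - s)\<close> maps \<open>\<phi>\<close> to \<open>\<phi> \<circ> G (T - s)\<close>.\<close>

definition control_operator ::
  "(real \<Rightarrow> 'w::{banach,second_countable_topology} \<Rightarrow> 'w) \<Rightarrow> ('u \<Rightarrow> 'u \<Rightarrow> 'k) \<Rightarrow> ('u \<Rightarrow> 'w) \<Rightarrow>
   real \<Rightarrow> real \<Rightarrow> ('w \<Rightarrow> 'k) \<Rightarrow> 'w" where
  "control_operator G ip B T t \<phi> =
     (LINT s|lebesgue_on {0..t}. G (t - s) (B (adjoint_to_hilbert ip B (\<phi> \<circ> G (T - s)))))"


section \<open>Separability of the state space\<close>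

lemma complex_compact_resolvent_separable:
  fixes s :: "complex \<Rightarrow> 'x::real_normed_vector \<Rightarrow> 'x"
  assumes cr: "complex_compact_resolvent s p D A"
    and D: "\<And>x r. x \<in> D \<Longrightarrow> r *\<^sub>R x \<in> D"
    and hom: "\<And>z x r. x \<in> D \<Longrightarrow> s z (r *\<^sub>R x) - A (r *\<^sub>R x) = r *\<^sub>R (s z x - A x)"
    and p: "\<And>y r. r \<ge> 0 \<Longrightarrow> p (r *\<^sub>R y) \<le> r * p y"
  shows "\<exists>C. countable C \<and> D \<subseteq> closure C"
proof -
  obtain z where z: "z \<in> resolvent_set s p D A"
    and comp: "compact (closure (resolvent s D A z ` {y. p y \<le> 1}))"
    using cr unfolding complex_compact_resolvent_def by blast
  define K where "K = closure (resolvent s D A z ` {y. p y \<le> 1})"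
  have tb: "\<forall>e>0. \<exists>k. finite k \<and> K \<subseteq> (\<Union>x\<in>k. ball x e)"
    using comp unfolding K_def[symmetric] compact_eq_totally_bounded by (elim conjE)
  have "\<exists>k. finite k \<and> K \<subseteq> (\<Union>x\<in>k. ball x (1 / real (Suc m)))" for m
    by (rule tb[rule_format]) simp
  then have "\<exists>k. \<forall>m. finite (k m) \<and> K \<subseteq> (\<Union>x\<in>k m. ball x (1 / real (Suc m)))"
    by (intro choice allI)
  then obtain k where "\<forall>m. finite (k m) \<and> K \<subseteq> (\<Union>x\<in>k m. ball x (1 / real (Suc m)))"
    by (elim exE)
  then have k: "finite (k m)" "K \<subseteq> (\<Union>x\<in>k m. ball x (1 / real (Suc m)))" for m
    by blast+
  define C where "C = (\<Union>n::nat. \<Union>m. (\<lambda>x. real n *\<^sub>R x) ` k m)"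
  have "countable C"
    unfolding C_def by (simp add: countable_finite[OF k(1)])
  moreover have "D \<subseteq> closure C"
  proof
    fix x assume x: "x \<in> D"
    obtain n0 :: nat where "p (s z x - A x) \<le> real n0" using real_arch_simple by blast
    then obtain n :: nat where n: "n > 0" "p (s z x - A x) \<le> real n"
      using that[of "Suc n0"] by simp
    define x' where "x' = (1 / real n) *\<^sub>R x"
    have x': "x' \<in> D" "x = real n *\<^sub>R x'" using D x n unfolding x'_def by auto
    have "s z x' - A x' = (1 / real n) *\<^sub>R (s z x - A x)" using hom[OF x] unfolding x'_def by blast
    then have p1: "p (s z x' - A x') \<le> 1"
      using p[of "1 / real n" "s z x - A x"] n by (simp add: divide_le_eq order_trans)
    have R: "resolvent s D A z (s z x' - A x') = x'"
      using z x' unfolding resolvent_set_def resolvent_def bij_betw_def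
      by (auto intro: inv_into_f_f)
    have "x' \<in> resolvent s D A z ` {y. p y \<le> 1}"
      by (rule image_eqI[where x = "s z x' - A x'"]) (use R p1 in simp_all)
    then have xK: "x' \<in> K"
      unfolding K_def by (rule closure_subset[THEN subsetD])
    show "x \<in> closure C"
      unfolding closure_approachable
    proof (intro allI impI)
      fix e :: real assume e: "e > 0"
      obtain m where m: "inverse (real (Suc m)) < e / real n"
        using reals_Archimedean[of "e / real n"] e n by auto
      obtain y where y: "y \<in> k m" "dist y x' < 1 / real (Suc m)"
        using k(2)[of m] xK by auto
      have "dist (real n *\<^sub>R y) x = real n * dist y x'"
        by (simp add: x'(2) dist_norm flip: scaleR_right_diff_distrib)
      also have "\<dots> < real n * (e / real n)"
        using y(2) m n by (intro mult_strict_left_mono) (auto simp: inverse_eq_divide)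
      also have "\<dots> = e" using n by simp
      finally show "\<exists>y\<in>C. dist y x < e" using y(1) unfolding C_def by blast
    qed
  qed
  ultimately show ?thesis by blast
qed

lemma compact_resolvent_imp_separable:
  fixes s :: "'k::rc_field \<Rightarrow> 'w::banach \<Rightarrow> 'w"
  assumes s: "normed_space_over s" and D: "module.subspace s D" and A: "linear_on s s D A"
    and dense: "closure D = UNIV" and cr: "compact_resolvent s D A"
  shows "\<exists>C::'w set. countable C \<and> closure C = UNIV"
proof -
  interpret normed_space_over s by fact
  have scR: "r *\<^sub>R x = s (of_real r) x" for r x by (simp add: scale_of_real)
  have DR: "r *\<^sub>R x \<in> D" if "x \<in> D" for r x
    using D that unfolding scR subspace_def by blast
  have AR: "A (r *\<^sub>R x) = r *\<^sub>R A x" if "x \<in> D" for r x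
    using A that unfolding scR linear_on_def by blast
  have "\<exists>C::'w set. countable C \<and> D \<subseteq> closure C"
  proof (cases "surj (to_cplx :: 'k \<Rightarrow> complex)")
    case True
    have "s c (r *\<^sub>R x) = r *\<^sub>R s c x" for c r x
      unfolding scR by (simp add: mult.commute)
    moreover have "complex_compact_resolvent (\<lambda>z. s (inv to_cplx z)) norm D A"
      using True cr unfolding compact_resolvent_def by simp
    ultimately show ?thesis
      by (intro complex_compact_resolvent_separable[where s = "\<lambda>z. s (inv to_cplx z)" and p = norm
            and A = A]) (simp_all add: DR AR scaleR_right_diff_distrib)
  next
    case False
    have nn: "cx_norm (r *\<^sub>R v) \<le> r * cx_norm v" if "r \<ge> 0" for r and v :: "'w \<times> 'w"
    proof -
      have bd: "bdd_above (range (\<lambda>t. norm (cos t *\<^sub>R fst v + sin t *\<^sub>R snd v)))"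
      proof (rule bdd_aboveI2)
        fix t :: real
        have "norm (cos t *\<^sub>R fst v + sin t *\<^sub>R snd v)
            \<le> \<bar>cos t\<bar> * norm (fst v) + \<bar>sin t\<bar> * norm (snd v)"
          by (metis norm_scaleR norm_triangle_ineq)
        also have "\<dots> \<le> 1 * norm (fst v) + 1 * norm (snd v)"
          by (intro add_mono mult_right_mono) auto
        finally show "norm (cos t *\<^sub>R fst v + sin t *\<^sub>R snd v) \<le> norm (fst v) + norm (snd v)" by simp
      qed
      have "norm (cos t *\<^sub>R fst (r *\<^sub>R v) + sin t *\<^sub>R snd (r *\<^sub>R v))
          = r * norm (cos t *\<^sub>R fst v + sin t *\<^sub>R snd v)" for t
      proof -
        have "cos t *\<^sub>R fst (r *\<^sub>R v) + sin t *\<^sub>R snd (r *\<^sub>R v)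
            = r *\<^sub>R (cos t *\<^sub>R fst v + sin t *\<^sub>R snd v)"
          by (simp add: scaleR_right_distrib mult.commute)
        then show ?thesis using that by simp
      qed
      moreover have "norm (cos t *\<^sub>R fst v + sin t *\<^sub>R snd v) \<le> cx_norm v" for t
        unfolding cx_norm_def by (rule cSUP_upper[OF UNIV_I bd])
      ultimately have "norm (cos t *\<^sub>R fst (r *\<^sub>R v) + sin t *\<^sub>R snd (r *\<^sub>R v)) \<le> r * cx_norm v" for t
        using that by (simp add: mult_left_mono)
      then show ?thesis
        unfolding cx_norm_def[of "r *\<^sub>R v"] by (rule cSUP_least[OF UNIV_not_empty])
    qed
    from False cr have "complex_compact_resolvent cx_scale cx_norm (D \<times> D) (map_prod A A)"
      unfolding compact_resolvent_def by simp
    then have "\<exists>C. countable C \<and> D \<times> D \<subseteq> closure C"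
    proof (rule complex_compact_resolvent_separable)
      fix z r and v :: "'w \<times> 'w"
      assume v: "v \<in> D \<times> D"
      then show "r *\<^sub>R v \<in> D \<times> D" by (auto simp: DR)
      show "cx_scale z (r *\<^sub>R v) - map_prod A A (r *\<^sub>R v) = r *\<^sub>R (cx_scale z v - map_prod A A v)"
        using v by (auto simp: AR cx_scale_def prod_eq_iff scaleR_right_diff_distrib
            scaleR_right_distrib mult.commute)
    qed (rule nn)
    then obtain C where C: "countable C" "D \<times> D \<subseteq> closure C" by (elim exE conjE)
    have "D \<subseteq> closure (fst ` C)"
    proof
      fix x assume "x \<in> D"
      then have "x \<in> fst ` closure C" using C(2) by force
      also have "\<dots> \<subseteq> closure (fst ` C)"
        by (rule image_closure_subset[where S=C])
           (auto intro!: continuous_on_fst continuous_on_id closure_subset[THEN subsetD])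
      finally show "x \<in> closure (fst ` C)" .
    qed
    then show ?thesis using C(1) by blast
  qed
  then obtain C where "countable C" "D \<subseteq> closure C" by blast
  moreover from this have "closure C = UNIV"
    using dense closure_minimal[of D "closure C"] by auto
  ultimately show ?thesis by blast
qed

end

theory Submission
  imports Defs "HOL-Complex_Analysis.Complex_Analysis" "HOL-Real_Asymp.Real_Asymp"
begin

text \<open>Smoothing makes \<open>G t\<close> compact for \<open>t > 0\<close>. Tested against a functional, \<open>t\<^sup>2 G t (A x)\<close> is an
  inverse Laplace integral whose integrand, differentiated twice, is \<open>O(1/|\<lambda>|\<^sup>2)\<close> by Cauchy's
  estimate in the sector, so \<open>t\<^sup>2 |G t (A x)| \<le> C |x|\<close>. With \<open>P = \<mu> R(\<mu>)\<close>, where \<open>R(\<mu>)\<close> is the compact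
  resolvent, this gives \<open>|G t x - G t (P x)| \<le> C |x| / (t\<^sup>2 \<mu>)\<close>, and therefore convolution with \<open>G\<close>
  maps integrably dominated families of functions to precompact subsets of \<open>C([0, T])\<close>.

  Since \<open>\<langle>\<phi>, F(T) \<phi>\<rangle> = \<integral> |B\<^sup>* G(T - s)\<^sup>* \<phi>|\<^sup>2 ds\<close>, approximate controllability of the linear system and
  the Hahn-Banach theorem show that \<open>F(T)\<close> is injective with dense range. The targets
  \<open>\<zeta>\<^sub>1 - G T \<zeta> - \<integral> G(T - s) f(s, w(s)) ds\<close> for \<open>w\<close> in a ball form a precompact set, so finitely many
  functionals \<open>\<phi>\<^sub>j\<close>, blended by a partition of unity, steer the linear system to within \<open>\<epsilon>\<close> of every
  target. The bound on \<open>F(t) F(T)\<^sup>-\<^sup>1\<close> keeps the resulting trajectories in the ball, and Schauder's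
  theorem yields a fixed point.\<close>

section \<open>Functionals with prescribed properties\<close>

definition sublinear :: "('a::real_vector \<Rightarrow> real) \<Rightarrow> bool" where
  "sublinear p \<longleftrightarrow> (\<forall>x y. p (x + y) \<le> p x + p y) \<and> (\<forall>r\<ge>0. \<forall>x. p (r *\<^sub>R x) = r * p x)"

lemma sublinear_add: "sublinear p \<Longrightarrow> p (x + y) \<le> p x + p y"
  and sublinear_scaleR: "sublinear p \<Longrightarrow> 0 \<le> r \<Longrightarrow> p (r *\<^sub>R x) = r * p x"
  by (simp_all add: sublinear_def)

lemma sublinear_0: "sublinear p \<Longrightarrow> p 0 = 0"
  using sublinear_scaleR[of p 0 0] by simp

lemma sublinear_lower: "sublinear p \<Longrightarrow> - p (- x) \<le> p x"
  using sublinear_add[of p x "- x"] sublinear_0[of p] by simp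

lemma sublinear_tilt:
  fixes x0 :: "'a::real_vector"
  assumes p: "sublinear p"
  defines "q \<equiv> \<lambda>x. INF t\<in>{0::real..}. p (x + t *\<^sub>R x0) - t * p x0"
  shows "sublinear q" and "\<And>t x. 0 \<le> t \<Longrightarrow> q x \<le> p (x + t *\<^sub>R x0) - t * p x0"
proof -
  have bd: "bdd_below ((\<lambda>t. p (x + t *\<^sub>R x0) - t * p x0) ` {0..})" for x
  proof (rule bdd_belowI2)
    fix t :: real assume t: "t \<in> {0..}"
    have "t * p x0 = p ((x + t *\<^sub>R x0) + (- x))" using t by (simp add: sublinear_scaleR[OF p])
    also have "\<dots> \<le> p (x + t *\<^sub>R x0) + p (- x)" by (rule sublinear_add[OF p])
    finally show "- p (- x) \<le> p (x + t *\<^sub>R x0) - t * p x0" by simp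
  qed
  show le: "q x \<le> p (x + t *\<^sub>R x0) - t * p x0" if "0 \<le> t" for t x
    unfolding q_def using bd that by (intro cINF_lower) auto
  have ge: "c \<le> q x" if "\<And>t. 0 \<le> t \<Longrightarrow> c \<le> p (x + t *\<^sub>R x0) - t * p x0" for c x
    unfolding q_def using that by (intro cINF_greatest) auto
  have sub: "q (x + y) \<le> q x + q y" for x y
  proof -
    have "q (x + y) - q x \<le> q y"
    proof (rule ge)
      fix t :: real assume t: "0 \<le> t"
      have "q (x + y) - (p (y + t *\<^sub>R x0) - t * p x0) \<le> q x"
      proof (rule ge)
        fix s :: real assume s: "0 \<le> s"
        have "q (x + y) \<le> p (x + y + (s + t) *\<^sub>R x0) - (s + t) * p x0"
          using s t by (intro le) simp
        also have "x + y + (s + t) *\<^sub>R x0 = (x + s *\<^sub>R x0) + (y + t *\<^sub>R x0)"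
          by (simp add: algebra_simps)
        also have "p \<dots> \<le> p (x + s *\<^sub>R x0) + p (y + t *\<^sub>R x0)" by (rule sublinear_add[OF p])
        finally show "q (x + y) - (p (y + t *\<^sub>R x0) - t * p x0) \<le> p (x + s *\<^sub>R x0) - s * p x0"
          by (simp add: algebra_simps)
      qed
      then show "q (x + y) - q x \<le> p (y + t *\<^sub>R x0) - t * p x0" by simp
    qed
    then show ?thesis by simp
  qed
  have hom_le: "q (r *\<^sub>R x) \<le> r * q x" if "r > 0" for r x
  proof -
    have "q (r *\<^sub>R x) / r \<le> q x"
    proof (rule ge)
      fix t :: real assume t: "0 \<le> t"
      have "q (r *\<^sub>R x) \<le> p (r *\<^sub>R x + (r * t) *\<^sub>R x0) - (r * t) * p x0"
        using that t by (intro le) simp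
      also have "r *\<^sub>R x + (r * t) *\<^sub>R x0 = r *\<^sub>R (x + t *\<^sub>R x0)" by (simp add: algebra_simps)
      also have "p \<dots> = r * p (x + t *\<^sub>R x0)" using that by (simp add: sublinear_scaleR[OF p])
      finally show "q (r *\<^sub>R x) / r \<le> p (x + t *\<^sub>R x0) - t * p x0"
        using that by (simp add: field_simps)
    qed
    then show ?thesis using that by (simp add: divide_le_eq mult.commute)
  qed
  have hom: "q (r *\<^sub>R x) = r * q x" if "r > 0" for r x
  proof (rule antisym)
    have "q ((1 / r) *\<^sub>R (r *\<^sub>R x)) \<le> (1 / r) * q (r *\<^sub>R x)" using that by (intro hom_le) simp
    then show "r * q x \<le> q (r *\<^sub>R x)" using that by (simp add: field_simps)
  qed (rule hom_le[OF that])
  have "q 0 = 0"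
  proof (rule antisym)
    show "q 0 \<le> 0" using le[of 0 0] by (simp add: sublinear_0[OF p])
    show "0 \<le> q 0" by (rule ge) (simp add: sublinear_scaleR[OF p])
  qed
  then show "sublinear q"
    unfolding sublinear_def using sub hom by (auto simp: order_le_less)
qed

lemma ex_minimal_sublinear:
  fixes p :: "'a::real_vector \<Rightarrow> real"
  assumes p: "sublinear p"
  shows "\<exists>q. sublinear q \<and> q \<le> p \<and> (\<forall>q'. sublinear q' \<and> q' \<le> q \<longrightarrow> q' = q)"
proof -
  define A where "A = {q. sublinear q \<and> q \<le> p}"
  define P where "P = (\<lambda>a b :: 'a \<Rightarrow> real. b \<le> a)"
  have "\<exists>m\<in>A. \<forall>a\<in>A. P m a \<longrightarrow> a = m"
  proof (rule predicate_Zorn)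
    show "partial_order_on A (relation_of P A)"
      unfolding P_def by (rule partial_order_on_relation_ofI) (auto intro: order_trans)
  next
    fix C assume C: "C \<in> Chains (relation_of P A)"
    show "\<exists>u\<in>A. \<forall>a\<in>C. P a u"
    proof (cases "C = {}")
      case True
      then show ?thesis using p by (auto simp: A_def)
    next
      case False
      have CA: "sublinear q" "q \<le> p" if "q \<in> C" for q
        using C that unfolding Chains_def relation_of_def A_def by auto
      have chain: "q1 \<le> q2 \<or> q2 \<le> q1" if "q1 \<in> C" "q2 \<in> C" for q1 q2
        using C that unfolding Chains_def relation_of_def P_def by auto
      define u where "u = (\<lambda>x. INF q\<in>C. q x)"
      have bd: "bdd_below ((\<lambda>q. q x) ` C)" for x
      proof (rule bdd_belowI2)
        fix q assume q: "q \<in> C"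
        have "- p (- x) \<le> - q (- x)" using CA(2)[OF q] by (simp add: le_fun_def)
        also have "\<dots> \<le> q x" by (rule sublinear_lower[OF CA(1)[OF q]])
        finally show "- p (- x) \<le> q x" .
      qed
      have le: "u x \<le> q x" if "q \<in> C" for q x
        unfolding u_def using that bd by (intro cINF_lower)
      have ge: "c \<le> u x" if "\<And>q. q \<in> C \<Longrightarrow> c \<le> q x" for c x
        unfolding u_def using that False by (intro cINF_greatest)
      have "u (x + y) \<le> u x + u y" for x y
      proof -
        have "u (x + y) - u x \<le> u y"
        proof (rule ge)
          fix q2 assume q2: "q2 \<in> C"
          have "u (x + y) - q2 y \<le> u x"
          proof (rule ge)
            fix q1 assume q1: "q1 \<in> C"
            obtain q where q: "q \<in> C" "q \<le> q1" "q \<le> q2" using chain[OF q1 q2] q1 q2 by blast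
            have "u (x + y) \<le> q x + q y"
              using le[OF q(1)] sublinear_add[OF CA(1)[OF q(1)]] order_trans by blast
            also have "\<dots> \<le> q1 x + q2 y" using q(2,3) by (intro add_mono) (auto simp: le_fun_def)
            finally show "u (x + y) - q2 y \<le> q1 x" by simp
          qed
          then show "u (x + y) - u x \<le> q2 y" by simp
        qed
        then show ?thesis by simp
      qed
      moreover have "u (r *\<^sub>R x) = r * u x" if "r \<ge> 0" for r x
      proof (cases "r = 0")
        case True
        have "u 0 = 0" unfolding u_def using False by (simp add: sublinear_0[OF CA(1)] cong: INF_cong)
        then show ?thesis using True by simp
      next
        case False
        then have r: "r > 0" using that by simp
        show ?thesis
        proof (rule antisym)
          have "u (r *\<^sub>R x) / r \<le> u x"
          proof (rule ge)
            fix q assume q: "q \<in> C"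
            show "u (r *\<^sub>R x) / r \<le> q x"
              using le[OF q, of "r *\<^sub>R x"] r sublinear_scaleR[OF CA(1)[OF q], of r x]
              by (simp add: divide_le_eq mult.commute)
          qed
          then show "u (r *\<^sub>R x) \<le> r * u x" using r by (simp add: divide_le_eq mult.commute)
          show "r * u x \<le> u (r *\<^sub>R x)"
            using r le by (intro ge) (simp add: sublinear_scaleR[OF CA(1)])
        qed
      qed
      ultimately have "sublinear u" by (simp add: sublinear_def)
      moreover have "u \<le> p"
      proof -
        obtain q where "q \<in> C" using False by blast
        then show ?thesis using le CA(2) order_trans[of _ q p] by (auto simp: le_fun_def)
      qed
      ultimately show ?thesis using le by (auto simp: A_def P_def le_fun_def)
    qed
  qed
  then obtain m where m: "sublinear m" "m \<le> p" "\<forall>a\<in>A. a \<le> m \<longrightarrow> a = m"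
    unfolding A_def P_def by blast
  have "q' = m" if "sublinear q'" "q' \<le> m" for q'
  proof -
    have "q' \<le> p" using that(2) m(2) by (rule order_trans)
    then show ?thesis using m(3) that by (simp add: A_def)
  qed
  then show ?thesis using m by blast
qed

theorem hahn_banach_sublinear:
  fixes p :: "'a::real_vector \<Rightarrow> real"
  assumes p: "sublinear p"
  obtains \<psi> where "linear \<psi>" and "\<And>x. \<psi> x \<le> p x" and "\<psi> x0 = p x0"
proof -
  define p' where "p' = (\<lambda>x. INF t\<in>{0::real..}. p (x + t *\<^sub>R x0) - t * p x0)"
  have p': "sublinear p'" "\<And>t x. 0 \<le> t \<Longrightarrow> p' x \<le> p (x + t *\<^sub>R x0) - t * p x0"
    unfolding p'_def using sublinear_tilt[OF p] by blast+
  obtain q where q: "sublinear q" "q \<le> p'" and min: "\<And>q'. sublinear q' \<Longrightarrow> q' \<le> q \<Longrightarrow> q' = q"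
    using ex_minimal_sublinear[OF p'(1)] by blast
  have qp: "q x \<le> p x" for x
    using q(2) p'(2)[of 0 x] by (auto simp: le_fun_def intro: order_trans)
  \<comment> \<open>Tilting a minimal sublinear functional cannot change it, which makes it additive.\<close>
  have sup: "q x + q y \<le> q (x + y)" for x y
  proof -
    define q' where "q' = (\<lambda>x. INF t\<in>{0::real..}. q (x + t *\<^sub>R y) - t * q y)"
    have q': "sublinear q'" "\<And>t x. 0 \<le> t \<Longrightarrow> q' x \<le> q (x + t *\<^sub>R y) - t * q y"
      unfolding q'_def using sublinear_tilt[OF q(1)] by blast+
    have "q' = q" by (rule min[OF q'(1)]) (use q'(2)[of 0] in \<open>auto simp: le_fun_def\<close>)
    then show ?thesis using q'(2)[of 1 x] by simp
  qed
  have add: "q (x + y) = q x + q y" for x y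
    using sup sublinear_add[OF q(1)] by (simp add: antisym)
  have neg: "q (- x) = - q x" for x
    using add[of x "- x"] sublinear_0[OF q(1)] by simp
  have "linear q"
  proof (rule linearI)
    fix r x
    show "q (r *\<^sub>R x) = r *\<^sub>R q x"
      using sublinear_scaleR[OF q(1), of r x] sublinear_scaleR[OF q(1), of "- r" x] neg[of "r *\<^sub>R x"]
      by (cases "r \<ge> 0") auto
  qed (rule add)
  moreover have "q x0 = p x0"
  proof (rule antisym[OF qp])
    have "- q x0 \<le> p' (- x0)" using q(2) neg[of x0] by (auto simp: le_fun_def dest: spec[of _ "- x0"])
    also have "\<dots> \<le> - p x0" using p'(2)[of 1 "- x0"] by (simp add: sublinear_0[OF p])
    finally show "p x0 \<le> q x0" by simp
  qed
  ultimately show thesis using that qp by blast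
qed

lemma ex_norming_functional:
  fixes x0 :: "'a::real_normed_vector"
  obtains \<psi> :: "'a \<Rightarrow> real" where "linear \<psi>" and "\<And>x. \<bar>\<psi> x\<bar> \<le> norm x" and "\<psi> x0 = norm x0"
proof -
  have "sublinear (norm :: 'a \<Rightarrow> real)" by (simp add: sublinear_def norm_triangle_ineq)
  then obtain \<psi> :: "'a \<Rightarrow> real" where \<psi>: "linear \<psi>" "\<And>x. \<psi> x \<le> norm x" "\<psi> x0 = norm x0"
    by (rule hahn_banach_sublinear[where ?x0.0 = x0]) blast
  have "\<bar>\<psi> x\<bar> \<le> norm x" for x
    using \<psi>(2)[of x] \<psi>(2)[of "- x"] linear_neg[OF \<psi>(1), of x] by simp
  then show thesis using that \<psi> by blast
qed

lemma ex_annihilating_functional: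
  fixes M :: "'a::real_normed_vector set"
  assumes M: "subspace M" and x0: "x0 \<notin> closure M"
  obtains \<psi> :: "'a \<Rightarrow> real" where "bounded_linear \<psi>" and "\<And>x. x \<in> M \<Longrightarrow> \<psi> x = 0" and "\<psi> x0 \<noteq> 0"
proof -
  have M0: "M \<noteq> {}" using M subspace_0 by blast
  let ?p = "\<lambda>x. infdist x M"
  have appr: "\<exists>m\<in>M. norm (x - m) < ?p x + e" if "e > 0" for x e
  proof -
    have "(INF a\<in>M. dist x a) < ?p x + e" using that M0 by (simp add: infdist_notempty)
    then obtain m where "m \<in> M" "dist x m < ?p x + e"
      using M0 by (subst (asm) cINF_less_iff) auto
    then show ?thesis by (auto simp: dist_norm)
  qed
  have up: "?p x \<le> norm (x - m)" if "m \<in> M" for x m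
    using infdist_le[OF that, of x] by (simp add: dist_norm)
  have "sublinear ?p"
    unfolding sublinear_def
  proof (intro conjI allI impI)
    fix x y
    show "?p (x + y) \<le> ?p x + ?p y"
    proof (rule field_le_epsilon)
      fix e :: real assume e: "e > 0"
      obtain m n where m: "m \<in> M" "norm (x - m) < ?p x + e / 2"
        and n: "n \<in> M" "norm (y - n) < ?p y + e / 2"
        using appr[of "e / 2"] e by (meson half_gt_zero)
      have "?p (x + y) \<le> norm ((x + y) - (m + n))" using m n M by (intro up subspace_add)
      also have "\<dots> = norm ((x - m) + (y - n))" by (simp add: algebra_simps)
      also have "\<dots> \<le> norm (x - m) + norm (y - n)" by (rule norm_triangle_ineq)
      finally show "?p (x + y) \<le> ?p x + ?p y + e" using m n by simp
    qed
  next
    fix r :: real and x assume r: "0 \<le> r"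
    have le: "?p (r *\<^sub>R x) \<le> r * ?p x" if r: "r > 0" for r x
    proof (rule field_le_epsilon)
      fix e :: real assume e: "e > 0"
      obtain m where m: "m \<in> M" "norm (x - m) < ?p x + e / r"
        using appr[of "e / r"] e r by auto
      have "?p (r *\<^sub>R x) \<le> norm (r *\<^sub>R x - r *\<^sub>R m)" using m M by (intro up subspace_scale)
      also have "\<dots> = r * norm (x - m)" using r by (simp flip: scaleR_right_diff_distrib)
      also have "\<dots> \<le> r * (?p x + e / r)" using m r by (intro mult_left_mono) auto
      finally show "?p (r *\<^sub>R x) \<le> r * ?p x + e" using r by (simp add: algebra_simps)
    qed
    show "?p (r *\<^sub>R x) = r * ?p x"
    proof (cases "r = 0")
      case True
      then show ?thesis using subspace_0[OF M] by simp
    next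
      case False
      then have r: "r > 0" using \<open>0 \<le> r\<close> by simp
      show ?thesis using le[OF r, of x] le[of "1 / r" "r *\<^sub>R x"] r by (simp add: field_simps)
    qed
  qed
  then obtain \<psi> where \<psi>: "linear \<psi>" "\<And>x. \<psi> x \<le> ?p x" "\<psi> x0 = ?p x0"
    by (rule hahn_banach_sublinear[where ?x0.0 = x0]) blast
  have pn: "?p x \<le> norm x" for x using up[OF subspace_0[OF M], of x] by simp
  have "\<bar>\<psi> x\<bar> \<le> norm x" for x
    using \<psi>(2)[of x] \<psi>(2)[of "- x"] pn[of x] pn[of "- x"] linear_neg[OF \<psi>(1), of x] by simp
  then have "bounded_linear \<psi>"
    by (intro bounded_linear_intro[where K = 1]) (use \<psi>(1) in \<open>auto simp: linear_add linear_scale\<close>)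
  moreover have "\<psi> x = 0" if "x \<in> M" for x
    using \<psi>(2)[of x] \<psi>(2)[of "- x"] that subspace_neg[OF M that] linear_neg[OF \<psi>(1), of x] by simp
  moreover have "\<psi> x0 \<noteq> 0"
    using \<psi>(3) x0 M0 in_closure_iff_infdist_zero[of M x0] by simp
  ultimately show thesis using that by blast
qed

section \<open>Precompact sets and Schauder's fixed point theorem\<close>

definition unit_cube :: "nat \<Rightarrow> (nat \<Rightarrow> real) set" where
  "unit_cube m = {x. (\<forall>i. 0 \<le> x i \<and> x i \<le> 1) \<and> (\<forall>i\<ge>m. x i = 0)}"

lemma unit_cube_convergent_subsequence:
  assumes "\<And>k. X k \<in> unit_cube m"
  obtains x r where "x \<in> unit_cube m" and "strict_mono (r :: nat \<Rightarrow> nat)"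
    and "\<And>i. (\<lambda>k. X (r k) i) \<longlonglongrightarrow> x i"
proof -
  have eq: "unit_cube m = PiE UNIV (\<lambda>i. if i < m then {0..1} else {0})"
  proof (rule set_eqI)
    fix x :: "nat \<Rightarrow> real"
    have "(x i \<in> (if i < m then {0..1} else {0})) \<longleftrightarrow> 0 \<le> x i \<and> x i \<le> 1 \<and> (m \<le> i \<longrightarrow> x i = 0)" for i
      by auto
    then show "x \<in> unit_cube m \<longleftrightarrow> x \<in> PiE UNIV (\<lambda>i. if i < m then {0..1} else {0})"
      unfolding unit_cube_def PiE_UNIV_domain Pi_iff by blast
  qed
  have "compactin (product_topology (\<lambda>_. euclidean) UNIV) (unit_cube m)"
    unfolding eq by (subst compactin_PiE) auto
  then have "compact (unit_cube m)" by (simp add: euclidean_product_topology)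
  then have "seq_compact (unit_cube m)" by (simp add: compact_imp_seq_compact)
  then obtain x r where x: "x \<in> unit_cube m" "strict_mono r" "(X \<circ> r) \<longlonglongrightarrow> x"
    using assms unfolding seq_compact_def by blast
  have "(\<lambda>k. X (r k) i) \<longlonglongrightarrow> x i" for i
  proof -
    have "continuous_on UNIV (\<lambda>f :: nat \<Rightarrow> real. f i)" by (rule continuous_on_product_coordinates)
    then have "isCont (\<lambda>f :: nat \<Rightarrow> real. f i) x" by (metis UNIV_I continuous_on_eq_continuous_at open_UNIV)
    from isCont_tendsto_compose[OF this x(3)] show ?thesis by (simp add: o_def)
  qed
  then show thesis using that x by blast
qed

theorem brouwer_unit_cube:
  assumes maps: "\<And>x. x \<in> unit_cube m \<Longrightarrow> g x \<in> unit_cube m"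
    and cont: "\<And>X x i. (\<And>k. X k \<in> unit_cube m) \<Longrightarrow> x \<in> unit_cube m \<Longrightarrow>
      (\<And>j. (\<lambda>k. X k j) \<longlonglongrightarrow> x j) \<Longrightarrow> (\<lambda>k::nat. g (X k) i) \<longlonglongrightarrow> g x i"
  obtains x where "x \<in> unit_cube m" and "g x = x"
proof -
  define pt where "pt = (\<lambda>k (v :: nat \<Rightarrow> nat) j. if j < m then real (v j) / real (Suc k) else 0)"
  define label where "label = (\<lambda>k v i. if v i = 0 \<or> (v i < Suc k \<and> pt k v i \<le> g (pt k v) i)
      then 0 else (1::nat))"
  have pt: "pt k v \<in> unit_cube m" if "\<And>j. j < m \<Longrightarrow> v j \<le> Suc k" for k v
  proof -
    have "real (v j) \<le> 1 + real k" if "j < m" for j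
      using \<open>\<And>j. j < m \<Longrightarrow> v j \<le> Suc k\<close>[OF that] by simp
    then show ?thesis by (auto simp: unit_cube_def pt_def)
  qed
  define KP where "KP = (\<lambda>k q. (\<forall>i<m. q i < Suc k) \<and> (\<forall>i<m. \<exists>r s.
      (\<forall>j<m. q j \<le> r j \<and> r j \<le> q j + 1) \<and> (\<forall>j<m. q j \<le> s j \<and> s j \<le> q j + 1) \<and>
      label k r i \<noteq> label k s i))"
  have "\<exists>q. KP k q" for k
  proof -
    have "\<forall>x. (\<forall>i<m. x i \<le> Suc k) \<longrightarrow> (\<forall>i<m. label k x i = 0 \<or> label k x i = 1)"
      "\<forall>x. (\<forall>i<m. x i \<le> Suc k) \<longrightarrow> (\<forall>i<m. x i = 0 \<longrightarrow> label k x i = 0)"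
      "\<forall>x. (\<forall>i<m. x i \<le> Suc k) \<longrightarrow> (\<forall>i<m. x i = Suc k \<longrightarrow> label k x i = 1)"
      by (auto simp: label_def)
    from kuhn_lemma[OF zero_less_Suc this] obtain q where "\<forall>i<m. q i < Suc k"
      "\<forall>i<m. \<exists>r s. (\<forall>j<m. q j \<le> r j \<and> r j \<le> q j + 1) \<and>
        (\<forall>j<m. q j \<le> s j \<and> s j \<le> q j + 1) \<and> label k r i \<noteq> label k s i" .
    then have "KP k q" unfolding KP_def by (rule conjI)
    then show ?thesis by (rule exI[of _ q])
  qed
  then obtain q where KP: "\<And>k. KP k (q k)" by metis
  have q: "q k i < Suc k"
    "\<exists>r s. (\<forall>j<m. q k j \<le> r j \<and> r j \<le> q k j + 1) \<and>
      (\<forall>j<m. q k j \<le> s j \<and> s j \<le> q k j + 1) \<and> label k r i \<noteq> label k s i" if "i < m" for k i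
    using KP[of k, unfolded KP_def, THEN conjunct1] KP[of k, unfolded KP_def, THEN conjunct2] that
    by simp_all
  have lab: "\<exists>v. (\<forall>j<m. q k j \<le> v j \<and> v j \<le> q k j + 1) \<and> label k v i = l"
    if im: "i < m" and l01: "l = 0 \<or> l = 1" for k i l
  proof -
    obtain r s where rs: "\<forall>j<m. q k j \<le> r j \<and> r j \<le> q k j + 1"
      "\<forall>j<m. q k j \<le> s j \<and> s j \<le> q k j + 1" "label k r i \<noteq> label k s i"
      using q(2)[OF im, of k] by blast
    have "label k v i = 0 \<or> label k v i = 1" for v by (simp add: label_def)
    then have "label k r i = l \<or> label k s i = l" using rs(3) l01 by metis
    then show ?thesis using rs by blast
  qed
  have qc: "pt k (q k) \<in> unit_cube m" for k using q(1)[of _ k] by (intro pt) (auto simp: less_imp_le)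
  obtain x r where x: "x \<in> unit_cube m" and r: "strict_mono (r :: nat \<Rightarrow> nat)"
    and lim: "\<And>i. (\<lambda>k. pt (r k) (q (r k)) i) \<longlonglongrightarrow> x i"
    using unit_cube_convergent_subsequence[of "\<lambda>k. pt k (q k)", OF qc] by blast
  have near: "\<exists>Y. (\<forall>k. Y k \<in> unit_cube m) \<and> (\<forall>j. (\<lambda>k. Y k j) \<longlonglongrightarrow> x j) \<and>
      (\<forall>k. if l = 0 then Y k i \<le> g (Y k) i else g (Y k) i \<le> Y k i)"
    if i: "i < m" and l: "l = (0::nat) \<or> l = 1" for i l
  proof -
    obtain v where v: "\<And>k j. j < m \<Longrightarrow> q k j \<le> v k j \<and> v k j \<le> q k j + 1"
      and vl: "\<And>k. label k (v k) i = l" using lab[OF i l] by metis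
    have vle: "v k j \<le> Suc k" if "j < m" for k j using v[OF that, of k] q(1)[OF that, of k] by linarith
    define Y where "Y = (\<lambda>k. pt (r k) (v (r k)))"
    have Yc: "Y k \<in> unit_cube m" for k unfolding Y_def by (intro pt vle)
    have "(\<lambda>k. Y k j) \<longlonglongrightarrow> x j" for j
    proof -
      have "(\<lambda>k. Y k j - pt (r k) (q (r k)) j) \<longlonglongrightarrow> 0"
      proof (rule Lim_null_comparison)
        show "\<forall>\<^sub>F k in sequentially. norm (Y k j - pt (r k) (q (r k)) j) \<le> inverse (real (Suc (r k)))"
        proof (rule always_eventually, rule allI)
          fix k
          have "\<bar>real (v (r k) j) - real (q (r k) j)\<bar> \<le> 1" if "j < m" using v[OF that, of "r k"] by linarith
          then show "norm (Y k j - pt (r k) (q (r k)) j) \<le> inverse (real (Suc (r k)))"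
            by (simp add: Y_def pt_def inverse_eq_divide divide_right_mono flip: diff_divide_distrib)
        qed
        show "(\<lambda>k. inverse (real (Suc (r k)))) \<longlonglongrightarrow> 0"
          using LIMSEQ_subseq_LIMSEQ[OF LIMSEQ_inverse_real_of_nat r] by (simp add: o_def)
      qed
      from tendsto_add[OF this lim[of j]] show ?thesis by simp
    qed
    moreover have "if l = 0 then Y k i \<le> g (Y k) i else g (Y k) i \<le> Y k i" for k
    proof -
      have g01: "0 \<le> g (Y k) i" "g (Y k) i \<le> 1" using maps[OF Yc] by (auto simp: unit_cube_def)
      have Y: "Y k i = real (v (r k) i) / real (Suc (r k))" using i by (simp add: Y_def pt_def)
      show ?thesis
      proof (cases "l = 0")
        case True
        then have "v (r k) i = 0 \<or> Y k i \<le> g (Y k) i"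
          using vl[of "r k"] by (auto simp: label_def Y_def split: if_splits)
        then show ?thesis using True Y g01 by auto
      next
        case False
        then have "\<not> v (r k) i < Suc (r k) \<or> g (Y k) i \<le> Y k i"
          using vl[of "r k"] by (auto simp: label_def Y_def split: if_splits)
        moreover have "Y k i = 1" if "\<not> v (r k) i < Suc (r k)"
          using that vle[OF i, of "r k"] by (simp add: Y)
        ultimately show ?thesis using False g01 by auto
      qed
    qed
    ultimately show ?thesis using Yc by blast
  qed
  have "g x i = x i" for i
  proof (cases "i < m")
    case True
    obtain Y where Y: "\<And>k. Y k \<in> unit_cube m" "\<And>j. (\<lambda>k. Y k j) \<longlonglongrightarrow> x j"
      "\<And>k. Y k i \<le> g (Y k) i" using near[OF True, of 0] by auto
    obtain Z where Z: "\<And>k. Z k \<in> unit_cube m" "\<And>j. (\<lambda>k. Z k j) \<longlonglongrightarrow> x j"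
      "\<And>k. g (Z k) i \<le> Z k i" using near[OF True, of 1] by auto
    have "x i \<le> g x i"
      by (rule LIMSEQ_le[OF Y(2) cont[OF Y(1) x Y(2)]]) (use Y(3) in blast)
    moreover have "g x i \<le> x i"
      by (rule LIMSEQ_le[OF cont[OF Z(1) x Z(2)] Z(2)]) (use Z(3) in blast)
    ultimately show ?thesis by simp
  next
    case False
    then show ?thesis using x maps[OF x] by (simp add: unit_cube_def)
  qed
  then show thesis using that x by blast
qed

definition precompact :: "'a::metric_space set \<Rightarrow> bool" where
  "precompact S \<longleftrightarrow> (\<forall>e>0. \<exists>k. finite k \<and> S \<subseteq> (\<Union>x\<in>k. ball x e))"

lemma precompact_subset:
  assumes "precompact S" "S' \<subseteq> S"
  shows "precompact S'"
  unfolding precompact_def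
proof (intro allI impI)
  fix e :: real assume "e > 0"
  then obtain k where "finite k" "S \<subseteq> (\<Union>x\<in>k. ball x e)"
    using assms(1) unfolding precompact_def by blast
  then show "\<exists>k. finite k \<and> S' \<subseteq> (\<Union>x\<in>k. ball x e)" using assms(2) by (intro exI[of _ k]) auto
qed

lemma compact_imp_precompact: "compact S \<Longrightarrow> precompact S"
  unfolding precompact_def compact_eq_totally_bounded by (rule conjunct2)

lemma precompact_centers:
  assumes "precompact S" "e > 0"
  obtains k where "finite k" "k \<subseteq> S" "S \<subseteq> (\<Union>x\<in>k. ball x e)"
proof -
  obtain k where k: "finite k" "S \<subseteq> (\<Union>x\<in>k. ball x (e / 2))"
    using assms unfolding precompact_def by (meson half_gt_zero)
  define c where "c = (\<lambda>x. SOME y. y \<in> S \<inter> ball x (e / 2))"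
  define k' where "k' = {x \<in> k. S \<inter> ball x (e / 2) \<noteq> {}}"
  have c: "c x \<in> S \<inter> ball x (e / 2)" if "x \<in> k'" for x
    using that unfolding c_def k'_def by (metis (mono_tags, lifting) ex_in_conv mem_Collect_eq someI)
  have "S \<subseteq> (\<Union>x\<in>c ` k'. ball x e)"
  proof
    fix y assume y: "y \<in> S"
    then obtain x where x: "x \<in> k" "dist x y < e / 2" using k(2) by auto
    then have xk: "x \<in> k'" using y by (auto simp: k'_def)
    have "dist (c x) y < e"
      using c[OF xk] x(2) dist_triangle_half_r[of x "c x" e y] by auto
    then show "y \<in> (\<Union>x\<in>c ` k'. ball x e)" using xk by auto
  qed
  moreover have "finite (c ` k')" using k(1) by (simp add: k'_def)
  moreover have "c ` k' \<subseteq> S" using c by blast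
  ultimately show thesis using that by blast
qed

lemma precompact_approx:
  assumes "\<And>e. e > 0 \<Longrightarrow> \<exists>S'. precompact S' \<and> (\<forall>x\<in>S. \<exists>y\<in>S'. dist x y \<le> e)"
  shows "precompact S"
  unfolding precompact_def
proof (intro allI impI)
  fix e :: real assume e: "e > 0"
  obtain S' where S': "precompact S'" "\<And>x. x \<in> S \<Longrightarrow> \<exists>y\<in>S'. dist x y \<le> e / 2"
    using assms[of "e / 2"] e by auto
  obtain k where k: "finite k" "S' \<subseteq> (\<Union>x\<in>k. ball x (e / 2))"
    using S'(1) e unfolding precompact_def by (meson half_gt_zero)
  have "S \<subseteq> (\<Union>x\<in>k. ball x e)"
  proof
    fix x assume "x \<in> S"
    then obtain y where y: "y \<in> S'" "dist x y \<le> e / 2" using S'(2) by blast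
    then obtain z where z: "z \<in> k" "dist z y < e / 2" using k(2) by auto
    have "dist z x \<le> dist z y + dist x y" by (metis dist_commute dist_triangle)
    then show "x \<in> (\<Union>x\<in>k. ball x e)" using y z by (intro UN_I[of z]) auto
  qed
  then show "\<exists>k. finite k \<and> S \<subseteq> (\<Union>x\<in>k. ball x e)" using k(1) by blast
qed

lemma precompact_compact_closure:
  fixes S :: "'a::complete_space set"
  assumes "precompact S"
  shows "compact (closure S)"
proof -
  have "precompact (closure S)"
  proof (rule precompact_approx)
    fix e :: real assume "e > 0"
    then have "\<forall>x\<in>closure S. \<exists>y\<in>S. dist x y \<le> e"
      by (metis closure_approachable dist_commute less_imp_le)
    then show "\<exists>S'. precompact S' \<and> (\<forall>x\<in>closure S. \<exists>y\<in>S'. dist x y \<le> e)"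
      using assms by blast
  qed
  then show ?thesis
    unfolding compact_eq_totally_bounded precompact_def by (simp add: complete_eq_closed)
qed

lemma precompact_plus:
  fixes S S' :: "'a::real_normed_vector set"
  assumes "precompact S" "precompact S'"
  shows "precompact {x + y | x y. x \<in> S \<and> y \<in> S'}"
  unfolding precompact_def
proof (intro allI impI)
  fix e :: real assume e: "e > 0"
  obtain k where k: "finite k" "S \<subseteq> (\<Union>x\<in>k. ball x (e / 2))"
    using assms(1) e unfolding precompact_def by (meson half_gt_zero)
  obtain k' where k': "finite k'" "S' \<subseteq> (\<Union>x\<in>k'. ball x (e / 2))"
    using assms(2) e unfolding precompact_def by (meson half_gt_zero)
  let ?K = "(\<lambda>(a, b). a + b) ` (k \<times> k')"
  have "{x + y | x y. x \<in> S \<and> y \<in> S'} \<subseteq> (\<Union>x\<in>?K. ball x e)"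
  proof clarify
    fix x y assume "x \<in> S" "y \<in> S'"
    then have "x \<in> (\<Union>x\<in>k. ball x (e / 2))" "y \<in> (\<Union>x\<in>k'. ball x (e / 2))" using k(2) k'(2) by (blast intro: subsetD)+
    then obtain a b where ab: "a \<in> k" "dist a x < e / 2" "b \<in> k'" "dist b y < e / 2"
      by auto
    have "dist (a + b) (x + y) < e" using dist_triangle_add[of a b x y] ab by simp
    then show "x + y \<in> (\<Union>x\<in>?K. ball x e)" using ab by force
  qed
  then show "\<exists>k. finite k \<and> {x + y | x y. x \<in> S \<and> y \<in> S'} \<subseteq> (\<Union>x\<in>k. ball x e)"
    by (rule exI[of _ ?K, OF conjI[rotated]]) (simp add: k(1) k'(1))
qed

lemma precompact_combinations:
  fixes c :: "nat \<Rightarrow> 'a::real_normed_vector"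
  shows "precompact {\<Sum>j<m. a j *\<^sub>R c j | a. \<forall>j<m. \<bar>a j\<bar> \<le> M}"
proof (induction m)
  case 0
  have "precompact {0 :: 'a}" by (intro compact_imp_precompact) simp
  then show ?case by (rule precompact_subset) auto
next
  case (Suc m)
  have "compact ((\<lambda>r. r *\<^sub>R c m) ` {- M..M})"
    by (intro compact_continuous_image continuous_intros) auto
  from precompact_plus[OF Suc.IH compact_imp_precompact[OF this]]
  show ?case by (rule precompact_subset) (fastforce simp: abs_le_iff)
qed

lemma precompact_partition:
  fixes S :: "'a::real_normed_vector set"
  assumes S: "precompact S" and e: "e > 0"
  obtains m :: nat and c \<theta> where "\<And>j. j < m \<Longrightarrow> c j \<in> S" and "\<And>j. continuous_on S (\<theta> j)"
    and "\<And>j. \<theta> j \<in> borel_measurable borel"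
    and "\<And>j x. 0 \<le> \<theta> j x" and "\<And>j x. j < m \<Longrightarrow> \<theta> j x \<le> 1" and "\<And>x. x \<in> S \<Longrightarrow> (\<Sum>j<m. \<theta> j x) = 1"
    and "\<And>x y. x \<in> S \<Longrightarrow> (\<And>j. j < m \<Longrightarrow> dist (c j) x \<le> e \<Longrightarrow> dist (y j) (c j) \<le> d)
          \<Longrightarrow> norm (x - (\<Sum>j<m. \<theta> j x *\<^sub>R (y j :: 'a))) \<le> e + d"
proof -
  obtain k where k: "finite k" "k \<subseteq> S" "S \<subseteq> (\<Union>x\<in>k. ball x e)"
    using precompact_centers[OF S e] by blast
  define m where "m = card k"
  obtain c where c: "bij_betw c {..<m} k"
    using ex_bij_betw_nat_finite[OF k(1)] by (auto simp: m_def atLeast0LessThan)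
  define \<eta> where "\<eta> = (\<lambda>j x. max 0 (e - dist (c j) x))"
  define \<theta> where "\<theta> = (\<lambda>j x. \<eta> j x / (\<Sum>i<m. \<eta> i x))"
  have \<eta>0: "0 \<le> \<eta> j x" for j x by (simp add: \<eta>_def)
  have pos: "(\<Sum>i<m. \<eta> i x) > 0" if x: "x \<in> S" for x
  proof -
    obtain y where y: "y \<in> k" "dist y x < e" using k(3) x by auto
    then obtain i where i: "i < m" "c i = y" using c by (auto simp: bij_betw_def)
    have "0 < \<eta> i x" using y i by (simp add: \<eta>_def)
    also have "\<dots> \<le> (\<Sum>i<m. \<eta> i x)" using i \<eta>0 by (intro member_le_sum) auto
    finally show ?thesis .
  qed
  show thesis
  proof (rule that[of m c \<theta>])
    show "c j \<in> S" if "j < m" for j using that c k(2) by (auto simp: bij_betw_def)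
    show "continuous_on S (\<theta> j)" for j
    proof -
      have "continuous_on S (\<eta> i)" for i unfolding \<eta>_def by (intro continuous_intros)
      then show ?thesis
        unfolding \<theta>_def using pos by (intro continuous_intros) (auto dest: pos)
    qed
    show "\<theta> j \<in> borel_measurable borel" for j
    proof -
      have "continuous_on UNIV (\<eta> i)" for i unfolding \<eta>_def by (intro continuous_intros)
      then have "\<eta> i \<in> borel_measurable borel" for i by (rule borel_measurable_continuous_onI)
      then show ?thesis unfolding \<theta>_def by measurable
    qed
    show "0 \<le> \<theta> j x" for j x unfolding \<theta>_def using \<eta>0 by (intro divide_nonneg_nonneg sum_nonneg)
    show "\<theta> j x \<le> 1" if "j < m" for j x
    proof -
      have "\<eta> j x \<le> (\<Sum>i<m. \<eta> i x)" using that \<eta>0 by (intro member_le_sum) auto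
      then show ?thesis unfolding \<theta>_def using \<eta>0[of j x]
        by (cases "(\<Sum>i<m. \<eta> i x) = 0") (auto simp: divide_le_eq)
    qed
    show sum1: "(\<Sum>j<m. \<theta> j x) = 1" if "x \<in> S" for x
      using pos[OF that] by (simp add: \<theta>_def flip: sum_divide_distrib)
    show "norm (x - (\<Sum>j<m. \<theta> j x *\<^sub>R y j)) \<le> e + d"
      if x: "x \<in> S" and y: "\<And>j. j < m \<Longrightarrow> dist (c j) x \<le> e \<Longrightarrow> dist (y j) (c j) \<le> d" for x y
    proof -
      have "x - (\<Sum>j<m. \<theta> j x *\<^sub>R y j) = (\<Sum>j<m. \<theta> j x *\<^sub>R (x - y j))"
        using sum1[OF x] by (simp add: scaleR_right_diff_distrib sum_subtractf flip: scaleR_sum_left)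
      also have "norm \<dots> \<le> (\<Sum>j<m. \<theta> j x * (e + d))"
      proof (rule sum_norm_le)
        fix j assume j: "j \<in> {..<m}"
        show "norm (\<theta> j x *\<^sub>R (x - y j)) \<le> \<theta> j x * (e + d)"
        proof (cases "\<theta> j x = 0")
          case False
          then have "\<eta> j x \<noteq> 0" by (auto simp: \<theta>_def)
          then have "dist (c j) x \<le> e" by (auto simp: \<eta>_def max_def split: if_splits)
          then have "norm (x - y j) \<le> e + d"
            using y[of j] j dist_triangle[of x "y j" "c j"] by (simp add: dist_norm norm_minus_commute)
          moreover have "\<theta> j x \<ge> 0" unfolding \<theta>_def using \<eta>0 by (intro divide_nonneg_nonneg sum_nonneg)
          ultimately show ?thesis by (simp add: mult_left_mono)
        qed simp
      qed
      also have "\<dots> = e + d" using sum1[OF x] by (simp flip: sum_distrib_right)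
      finally show ?thesis .
    qed
  qed
qed

lemma approximate_fixed_point:
  fixes C :: "'a::real_normed_vector set"
  assumes C: "convex C" "C \<noteq> {}" and maps: "\<Phi> ` C \<subseteq> C" and cont: "continuous_on C \<Phi>"
    and tb: "precompact (\<Phi> ` C)" and e: "e > 0"
  obtains x where "x \<in> C" and "norm (\<Phi> x - x) \<le> e"
proof -
  obtain m :: nat and c \<theta> where c: "\<And>j. j < m \<Longrightarrow> c j \<in> \<Phi> ` C"
    and \<theta>: "\<And>j. continuous_on (\<Phi> ` C) (\<theta> j)" "\<And>j x. 0 \<le> \<theta> j x" "\<And>j x. j < m \<Longrightarrow> \<theta> j x \<le> 1"
      "\<And>x. x \<in> \<Phi> ` C \<Longrightarrow> (\<Sum>j<m. \<theta> j x) = 1"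
    and near: "\<And>x y. x \<in> \<Phi> ` C \<Longrightarrow> (\<And>j. j < m \<Longrightarrow> dist (c j) x \<le> e \<Longrightarrow> dist (y j) (c j) \<le> 0)
          \<Longrightarrow> norm (x - (\<Sum>j<m. \<theta> j x *\<^sub>R (y j :: 'a))) \<le> e + 0"
    by (rule precompact_partition[OF tb e, where d = 0]) blast
  have m: "m > 0"
  proof (rule ccontr)
    assume "\<not> m > 0"
    moreover obtain x where "x \<in> C" using C(2) by blast
    ultimately show False using \<theta>(4)[of "\<Phi> x"] by simp
  qed
  \<comment> \<open>\<open>\<rho>\<close> retracts the cube onto the standard simplex.\<close>
  define s where "s = (\<lambda>a :: nat \<Rightarrow> real. \<Sum>j<m. a j)"
  define \<rho> where "\<rho> = (\<lambda>a j. (a j + max 0 (1 - s a) / real m) / max 1 (s a))"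
  define pt where "pt = (\<lambda>a. \<Sum>j<m. \<rho> a j *\<^sub>R c j)"
  define g where "g = (\<lambda>a j. if j < m then \<theta> j (\<Phi> (pt a)) else 0)"
  have \<rho>1: "(\<Sum>j<m. \<rho> a j) = 1" for a
  proof -
    have "(\<Sum>j<m. \<rho> a j) = (s a + max 0 (1 - s a)) / max 1 (s a)"
      using m by (simp add: \<rho>_def s_def sum.distrib flip: sum_divide_distrib)
    also have "s a + max 0 (1 - s a) = max 1 (s a)" by (simp add: max_def)
    finally show ?thesis by (simp add: max_def split: if_splits)
  qed
  have pt: "pt a \<in> C" if "a \<in> unit_cube m" for a
    unfolding pt_def
  proof (rule convex_sum[OF _ C(1) \<rho>1])
    fix j assume "j \<in> {..<m}"
    then show "c j \<in> C" using c maps by blast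
    show "0 \<le> \<rho> a j" using that unfolding \<rho>_def unit_cube_def by auto
  qed auto
  obtain a where a: "a \<in> unit_cube m" "g a = a"
  proof (rule brouwer_unit_cube[of m g])
    fix a assume "a \<in> unit_cube m"
    then show "g a \<in> unit_cube m" using \<theta> by (auto simp: unit_cube_def g_def)
  next
    fix X :: "nat \<Rightarrow> nat \<Rightarrow> real" and x i
    assume X: "\<And>k. X k \<in> unit_cube m" and x: "x \<in> unit_cube m"
      and lim: "\<And>j. (\<lambda>k. X k j) \<longlonglongrightarrow> x j"
    have "(\<lambda>k. s (X k)) \<longlonglongrightarrow> s x" unfolding s_def by (intro tendsto_intros lim)
    then have "(\<lambda>k. \<rho> (X k) j) \<longlonglongrightarrow> \<rho> x j" for j
      unfolding \<rho>_def using m by (intro tendsto_intros lim) (auto simp: max_def)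
    then have "(\<lambda>k. pt (X k)) \<longlonglongrightarrow> pt x" unfolding pt_def by (intro tendsto_intros)
    then have *: "(\<lambda>k. \<Phi> (pt (X k))) \<longlonglongrightarrow> \<Phi> (pt x)"
      by (rule continuous_on_tendsto_compose[OF cont]) (use pt[OF X] pt[OF x] in auto)
    have "(\<lambda>k. \<theta> i (\<Phi> (pt (X k)))) \<longlonglongrightarrow> \<theta> i (\<Phi> (pt x))"
      by (rule continuous_on_tendsto_compose[OF \<theta>(1) *]) (use pt[OF X] pt[OF x] in auto)
    then show "(\<lambda>k. g (X k) i) \<longlonglongrightarrow> g x i" unfolding g_def by simp
  qed
  have pC: "pt a \<in> C" by (rule pt[OF a(1)])
  have ga: "a j = \<theta> j (\<Phi> (pt a))" if "j < m" for j using fun_cong[OF a(2), of j] that by (simp add: g_def)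
  then have "s a = 1" unfolding s_def using \<theta>(4)[of "\<Phi> (pt a)"] pC by simp
  then have "pt a = (\<Sum>j<m. \<theta> j (\<Phi> (pt a)) *\<^sub>R c j)"
    using ga by (subst pt_def) (simp add: \<rho>_def)
  then have "norm (\<Phi> (pt a) - pt a) \<le> e"
    using near[of "\<Phi> (pt a)" c] pC by simp
  then show thesis using that pC by blast
qed

theorem schauder_fixed_point:
  fixes C :: "'a::banach set"
  assumes C: "convex C" "C \<noteq> {}" "closed C" and maps: "\<Phi> ` C \<subseteq> C" and cont: "continuous_on C \<Phi>"
    and tb: "precompact (\<Phi> ` C)"
  obtains x where "x \<in> C" and "\<Phi> x = x"
proof -
  have "\<exists>x. x \<in> C \<and> norm (\<Phi> x - x) \<le> inverse (real (Suc n))" for n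
    by (rule approximate_fixed_point[OF C(1,2) maps cont tb, of "inverse (real (Suc n))"]) auto
  then obtain X where X: "\<And>n. X n \<in> C" "\<And>n. norm (\<Phi> (X n) - X n) \<le> inverse (real (Suc n))"
    by metis
  have "seq_compact (closure (\<Phi> ` C))"
    using precompact_compact_closure[OF tb] by (rule compact_imp_seq_compact)
  from this[unfolded seq_compact_def, rule_format, of "\<lambda>n. \<Phi> (X n)"]
  have "\<exists>y\<in>closure (\<Phi> ` C). \<exists>r. strict_mono r \<and> ((\<lambda>n. \<Phi> (X n)) \<circ> r) \<longlonglongrightarrow> y"
    using X(1) closure_subset by blast
  then obtain y r where r: "strict_mono (r :: nat \<Rightarrow> nat)" and "((\<lambda>n. \<Phi> (X n)) \<circ> r) \<longlonglongrightarrow> y"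
    by blast
  then have y: "(\<lambda>n. \<Phi> (X (r n))) \<longlonglongrightarrow> y" by (simp add: o_def)
  have "(\<lambda>n. \<Phi> (X n) - X n) \<longlonglongrightarrow> 0"
    by (rule Lim_null_comparison[OF _ LIMSEQ_inverse_real_of_nat]) (use X(2) in auto)
  from LIMSEQ_subseq_LIMSEQ[OF this r] have "(\<lambda>n. \<Phi> (X (r n)) - X (r n)) \<longlonglongrightarrow> 0" by (simp add: o_def)
  from tendsto_diff[OF y this] have Xy: "(\<lambda>n. X (r n)) \<longlonglongrightarrow> y" by simp
  have yC: "y \<in> C" by (rule closed_sequentially[OF C(3) _ Xy]) (rule X(1))
  have "(\<lambda>n. \<Phi> (X (r n))) \<longlonglongrightarrow> \<Phi> y"
    by (rule continuous_on_tendsto_compose[OF cont Xy yC]) (use X(1) in auto)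
  then have "\<Phi> y = y" using y LIMSEQ_unique by blast
  then show thesis using that yC by blast
qed

section \<open>Inverse Laplace integrals in a sector\<close>

lemma
  shows integrable_inverse_1_plus_square: "integrable lborel (\<lambda>x::real. 1 / (1 + x\<^sup>2))"
    and integral_inverse_1_plus_square: "(\<integral>x. 1 / (1 + x\<^sup>2) \<partial>(lborel :: real measure)) = pi"
proof -
  have lim: "((arctan \<circ> real_of_ereal) \<longlongrightarrow> - (pi / 2)) (at_right (- \<infinity>))"
    "((arctan \<circ> real_of_ereal) \<longlongrightarrow> pi / 2) (at_left \<infinity>)"
    using tendsto_arctan_at_bot tendsto_arctan_at_top
    by (simp_all add: ereal_tendsto_simps)
  have deriv: "(arctan has_real_derivative 1 / (1 + x\<^sup>2)) (at x)" for x
    using DERIV_arctan[of x] by (simp add: inverse_eq_divide)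
  have cont: "isCont (\<lambda>x. 1 / (1 + x\<^sup>2)) x" for x :: real
  proof -
    have "1 + x\<^sup>2 \<noteq> 0" by (metis add_pos_nonneg less_irrefl zero_le_power2 zero_less_one)
    then show ?thesis by (intro continuous_intros)
  qed
  have "AE x in lborel. - \<infinity> < ereal x \<longrightarrow> ereal x < \<infinity> \<longrightarrow> 0 \<le> 1 / (1 + x\<^sup>2)" by simp
  note * = interval_integral_FTC_nonneg[OF _ deriv cont this lim]
  show "integrable lborel (\<lambda>x::real. 1 / (1 + x\<^sup>2))"
    using *(1) by (simp add: set_integrable_def einterval_eq_UNIV)
  show "(\<integral>x. 1 / (1 + x\<^sup>2) \<partial>(lborel :: real measure)) = pi"
    using *(2) by (simp add: interval_lebesgue_integral_def set_lebesgue_integral_def einterval_eq_UNIV)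
qed

lemma
  fixes w :: real assumes w: "w > 0"
  shows integrable_inverse_plus_square: "integrable lborel (\<lambda>x. 1 / (w\<^sup>2 + x\<^sup>2))"
    and integral_inverse_plus_square: "(\<integral>x. 1 / (w\<^sup>2 + x\<^sup>2) \<partial>lborel) = pi / w"
proof -
  have eq: "1 / (w\<^sup>2 + (0 + w * x)\<^sup>2) = (1 / w\<^sup>2) * (1 / (1 + x\<^sup>2))" for x
    using w by (simp add: power_mult_distrib field_simps)
  show "integrable lborel (\<lambda>x. 1 / (w\<^sup>2 + x\<^sup>2))"
  proof -
    have "integrable lborel (\<lambda>x. 1 / (w\<^sup>2 + (0 + w * x)\<^sup>2))"
      unfolding eq using integrable_inverse_1_plus_square by (rule integrable_mult_right)
    then show ?thesis
      by (subst (asm) lborel_integrable_real_affine_iff[where f = "\<lambda>x. 1 / (w\<^sup>2 + x\<^sup>2)"]) (use w in auto)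
  qed
  show "(\<integral>x. 1 / (w\<^sup>2 + x\<^sup>2) \<partial>lborel) = pi / w"
  proof -
    have "(\<integral>x. 1 / (w\<^sup>2 + x\<^sup>2) \<partial>lborel) = \<bar>w\<bar> *\<^sub>R (\<integral>x. 1 / (w\<^sup>2 + (0 + w * x)\<^sup>2) \<partial>lborel)"
      using w by (intro lborel_integral_real_affine) simp
    also have "\<dots> = w * ((1 / w\<^sup>2) * pi)"
      unfolding eq integral_mult_right_zero integral_inverse_1_plus_square using w by simp
    finally show ?thesis using w by (simp add: power2_eq_square)
  qed
qed

lemma cmod_Complex_square: "(cmod (Complex w x))\<^sup>2 = w\<^sup>2 + x\<^sup>2"
  by (simp add: cmod_power2)

lemma continuous_on_Complex_line: "continuous_on A (\<lambda>x. Complex w x)"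
  by (simp add: Complex_eq, intro continuous_intros)

lemma has_vector_derivative_Complex_line: "((\<lambda>x. Complex w x) has_vector_derivative \<i>) (at x within A)"
  unfolding Complex_eq by (auto intro!: derivative_eq_intros)

lemma vertical_integrable:
  assumes w: "w > 0" and cont: "continuous_on UNIV (\<lambda>x. f (Complex w x))"
    and bd: "\<And>x. cmod (f (Complex w x)) \<le> C / (cmod (Complex w x))\<^sup>2"
  shows "integrable lborel (\<lambda>x. f (Complex w x))"
proof (rule Bochner_Integration.integrable_bound)
  show "integrable lborel (\<lambda>x. C * (1 / (w\<^sup>2 + x\<^sup>2)))"
    using integrable_inverse_plus_square[OF w] by (rule integrable_mult_right)
  show "(\<lambda>x. f (Complex w x)) \<in> borel_measurable lborel"
    using borel_measurable_continuous_onI[OF cont] by simp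
  show "AE x in lborel. norm (f (Complex w x)) \<le> norm (C * (1 / (w\<^sup>2 + x\<^sup>2)))"
    using bd by (intro AE_I2 order_trans[OF bd]) (simp add: cmod_Complex_square divide_right_mono)
qed

lemma integral_symmetric_limit:
  fixes f :: "real \<Rightarrow> complex"
  assumes f: "integrable lborel f"
  shows "(\<lambda>n. \<integral>x. indicator {- real n..real n} x *\<^sub>R f x \<partial>lborel) \<longlonglongrightarrow> (\<integral>x. f x \<partial>lborel)"
proof (rule integral_dominated_convergence[where w = "\<lambda>x. norm (f x)"])
  show "AE x in lborel. (\<lambda>n. indicator {- real n..real n} x *\<^sub>R f x) \<longlonglongrightarrow> f x"
  proof (intro AE_I2 tendsto_eventually)
    fix x :: real
    show "\<forall>\<^sub>F n in sequentially. indicator {- real n..real n} x *\<^sub>R f x = f x"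
      using eventually_ge_at_top[of "nat \<lceil>\<bar>x\<bar>\<rceil>"]
    proof eventually_elim
      case (elim n)
      then have "\<bar>x\<bar> \<le> real n" by linarith
      then have "x \<in> {- real n..real n}" by auto
      then show ?case by simp
    qed
  qed
qed (use f in \<open>auto simp: indicator_def\<close>)

lemma vertical_integrals_eq:
  assumes holo: "f holomorphic_on {z. \<rho> < Re z}" and w: "\<rho> < w1" "w1 \<le> w2" "0 < w1"
    and bd: "\<And>z. w1 \<le> Re z \<Longrightarrow> Re z \<le> w2 \<Longrightarrow> cmod (f z) \<le> C / (cmod z)\<^sup>2"
  shows "(\<integral>x. f (Complex w1 x) \<partial>lborel) = (\<integral>x. f (Complex w2 x) \<partial>lborel)"
proof -
  let ?S = "{z. \<rho> < Re z}"
  have S: "open ?S" "convex ?S" by (simp_all add: open_halfspace_Re_gt convex_halfspace_Re_gt)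
  obtain g where gS: "\<And>z. z \<in> ?S \<Longrightarrow> (g has_field_derivative f z) (at z within ?S)"
    using holomorphic_convex_primitive'[OF S(2,1) holo] by blast
  then have g: "(g has_field_derivative f z) (at z)" if "\<rho> < Re z" for z
  proof -
    have z: "z \<in> ?S" using that by simp
    show ?thesis using gS[OF z] at_within_open[OF z S(1)] by simp
  qed
  have C: "C \<ge> 0"
  proof -
    have "0 \<le> cmod (f (of_real w1))" by simp
    also have "\<dots> \<le> C / (cmod (of_real w1))\<^sup>2" using w by (intro bd) auto
    finally have "0 \<le> C / (cmod (of_real w1))\<^sup>2" .
    then show ?thesis using w by (simp add: zero_le_divide_iff)
  qed
  have cont: "continuous_on A (\<lambda>x. f (Complex w x))" if "w1 \<le> w" for w A
    using w that
    by (intro continuous_on_compose2[OF holomorphic_on_imp_continuous_on[OF holo] continuous_on_Complex_line]) auto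
  have int: "integrable lborel (\<lambda>x. f (Complex w x))" if "w1 \<le> w" "w \<le> w2" for w
    using w that by (intro vertical_integrable[where C = C] cont bd) auto
  define I where "I = (\<lambda>w n. \<integral>x. indicator {- real n..real n} x *\<^sub>R f (Complex w x) \<partial>lborel)"
  have lim: "(\<lambda>n. I w n) \<longlonglongrightarrow> (\<integral>x. f (Complex w x) \<partial>lborel)" if "w1 \<le> w" "w \<le> w2" for w
    unfolding I_def by (rule integral_symmetric_limit[OF int[OF that]])
  have I: "I w n = - \<i> * (g (Complex w (real n)) - g (Complex w (- real n)))" if "w1 \<le> w" for w n
  proof -
    have "I w n = - \<i> * g (Complex w (real n)) - (- \<i> * g (Complex w (- real n)))"
      unfolding I_def
    proof (rule integral_FTC_atLeastAtMost)
      fix x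
      have "((\<lambda>x. g (Complex w x)) has_vector_derivative \<i> * f (Complex w x)) (at x within {- real n..real n})"
        using field_vector_diff_chain_within[OF has_vector_derivative_Complex_line
            has_field_derivative_at_within[OF g], of w x] w that
        by (simp add: o_def)
      then show "((\<lambda>x. - \<i> * g (Complex w x)) has_vector_derivative f (Complex w x)) (at x within {- real n..real n})"
        by (auto intro!: derivative_eq_intros)
    qed (use cont[OF that] in auto)
    then show ?thesis by (simp add: algebra_simps)
  qed
  have edge: "cmod (g (Complex w1 y) - g (Complex w2 y)) \<le> C / y\<^sup>2 * (w2 - w1)" if "y \<noteq> 0" for y
  proof -
    define E where "E = {z. w1 \<le> Re z \<and> Re z \<le> w2 \<and> Im z = y}"
    have "E = {z. Re z \<ge> w1} \<inter> {z. Re z \<le> w2} \<inter> {z. Im z = y}" by (auto simp: E_def)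
    moreover have "convex {z. Im z = y}"
      by (rule convexI) (simp flip: distrib_right)
    ultimately have "convex E"
      using convex_halfspace_Re_ge convex_halfspace_Re_le by (simp add: convex_Int)
    then have "cmod (g (Complex w1 y) - g (Complex w2 y)) \<le> C / y\<^sup>2 * cmod (Complex w1 y - Complex w2 y)"
    proof (rule field_differentiable_bound)
      fix z assume z: "z \<in> E"
      then show "(g has_field_derivative f z) (at z within E)"
        using w by (intro has_field_derivative_at_within[OF g]) (auto simp: E_def)
      have "cmod (f z) \<le> C / (cmod z)\<^sup>2" using z by (intro bd) (auto simp: E_def)
      also have "\<dots> \<le> C / y\<^sup>2"
        using z C that by (intro divide_left_mono) (auto simp: E_def cmod_power2 intro!: mult_pos_pos add_nonneg_pos)
      finally show "cmod (f z) \<le> C / y\<^sup>2" .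
    qed (use w in \<open>auto simp: E_def\<close>)
    also have "Complex w1 y - Complex w2 y = of_real (w1 - w2)" by (simp add: complex_eq_iff)
    finally show ?thesis using w by (simp only: norm_of_real) simp
  qed
  have "(\<lambda>n. I w1 n - I w2 n) \<longlonglongrightarrow> 0"
  proof (rule Lim_null_comparison)
    show "\<forall>\<^sub>F n in sequentially. norm (I w1 n - I w2 n) \<le> 2 * C * (w2 - w1) * (1 / (real n)\<^sup>2)"
      using eventually_gt_at_top[of 0]
    proof eventually_elim
      case (elim n)
      have "I w1 n - I w2 n = - \<i> * ((g (Complex w1 (real n)) - g (Complex w2 (real n))) -
          (g (Complex w1 (- real n)) - g (Complex w2 (- real n))))"
        unfolding I[OF order_refl] I[OF w(2)] by (simp add: algebra_simps)
      also have "cmod \<dots> \<le> cmod (g (Complex w1 (real n)) - g (Complex w2 (real n))) +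
          cmod (g (Complex w1 (- real n)) - g (Complex w2 (- real n)))"
        by (simp add: norm_mult norm_triangle_ineq4)
      also have "\<dots> \<le> C / (real n)\<^sup>2 * (w2 - w1) + C / (- real n)\<^sup>2 * (w2 - w1)"
        using elim by (intro add_mono edge) auto
      finally show ?case by (simp add: field_simps)
    qed
    show "(\<lambda>n. 2 * C * (w2 - w1) * (1 / (real n)\<^sup>2)) \<longlonglongrightarrow> 0"
      by real_asymp
  qed
  moreover have "(\<lambda>n. I w1 n - I w2 n) \<longlonglongrightarrow> (\<integral>x. f (Complex w1 x) \<partial>lborel) - (\<integral>x. f (Complex w2 x) \<partial>lborel)"
    using w by (intro tendsto_diff lim) auto
  ultimately show ?thesis using LIMSEQ_unique by fastforce
qed

lemma vertical_integral_zero: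
  assumes holo: "f holomorphic_on {z. \<rho> < Re z}" and w: "\<rho> < w" "0 < w"
    and bd: "\<And>z. w \<le> Re z \<Longrightarrow> cmod (f z) \<le> C / (cmod z)\<^sup>2"
  shows "(\<integral>x. f (Complex w x) \<partial>lborel) = 0"
proof -
  let ?I = "\<integral>x. f (Complex w x) \<partial>lborel"
  have "norm ?I \<le> C * (pi / w')" if w': "w' \<ge> w" for w'
  proof -
    have eq: "?I = (\<integral>x. f (Complex w' x) \<partial>lborel)"
      using w' by (intro vertical_integrals_eq[OF holo w(1) _ w(2), where C = C] bd)
    have "norm (\<integral>x. f (Complex w' x) \<partial>lborel) \<le> (\<integral>x. C * (1 / (w'\<^sup>2 + x\<^sup>2)) \<partial>lborel)"
    proof (rule Bochner_Integration.integral_norm_bound_integral)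
      have cont: "continuous_on UNIV (\<lambda>x. f (Complex w' x))"
        using w w'
        by (intro continuous_on_compose2[OF holomorphic_on_imp_continuous_on[OF holo] continuous_on_Complex_line]) auto
      show "integrable lborel (\<lambda>x. f (Complex w' x))"
        using w w' by (intro vertical_integrable[where C = C] cont bd) auto
      show "integrable lborel (\<lambda>x. C * (1 / (w'\<^sup>2 + x\<^sup>2)))"
        using w w' by (intro integrable_mult_right integrable_inverse_plus_square) auto
      show "norm (f (Complex w' x)) \<le> C * (1 / (w'\<^sup>2 + x\<^sup>2))" for x
        using bd[of "Complex w' x"] w' by (simp add: cmod_Complex_square)
    qed
    also have "\<dots> = C * (pi / w')" using w w' by (subst integral_mult_right_zero) (simp add: integral_inverse_plus_square)
    finally show ?thesis by (simp add: eq)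
  qed
  then have "\<forall>\<^sub>F w' in at_top. norm ?I \<le> C * (pi / w')"
    by (rule eventually_mono[OF eventually_ge_at_top[of w]])
  moreover have "((\<lambda>w'. C * (pi / w')) \<longlongrightarrow> 0) at_top" by real_asymp
  ultimately have "norm ?I \<le> 0" by (intro tendsto_lowerbound[where F = at_top]) auto
  then show ?thesis by simp
qed

lemma lborel_swap_dominated:
  fixes f :: "real \<Rightarrow> real \<Rightarrow> complex"
  assumes f [measurable]: "case_prod f \<in> borel_measurable (lborel \<Otimes>\<^sub>M lborel)"
    and g: "integrable lborel (g :: real \<Rightarrow> real)" and h: "integrable lborel (h :: real \<Rightarrow> real)"
    and bd: "\<And>x y. cmod (f x y) \<le> g x * h y"
  shows "(\<integral>y. (\<integral>x. f x y \<partial>lborel) \<partial>lborel) = (\<integral>x. (\<integral>y. f x y \<partial>lborel) \<partial>lborel)"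
proof (rule lborel_pair.Fubini_integral)
  have "integrable (lborel \<Otimes>\<^sub>M lborel) (\<lambda>(x, y). g x * h y)"
  proof (rule lborel_pair.Fubini_integrable)
    show "(\<lambda>(x, y). g x * h y) \<in> borel_measurable (lborel \<Otimes>\<^sub>M lborel)"
      using borel_measurable_integrable[OF g] borel_measurable_integrable[OF h] by measurable
    have "(\<lambda>x. \<integral>y. norm (g x * h y) \<partial>lborel) = (\<lambda>x. \<bar>g x\<bar> * (\<integral>y. \<bar>h y\<bar> \<partial>lborel))"
      by (simp add: abs_mult)
    then show "integrable lborel (\<lambda>x. \<integral>y. norm (case (x, y) of (x, y) \<Rightarrow> g x * h y) \<partial>lborel)"
      using g by simp
    show "AE x in lborel. integrable lborel (\<lambda>y. case (x, y) of (x, y) \<Rightarrow> g x * h y)"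
      using h by simp
  qed
  then show "integrable (lborel \<Otimes>\<^sub>M lborel) (case_prod f)"
    by (rule Bochner_Integration.integrable_bound)
       (use bd in \<open>auto intro!: AE_I2 order_trans[OF bd]\<close>)
qed

lemma integrable_exp_decay: "integrable lborel (\<lambda>s::real. indicator {0<..} s * exp (- s))"
  and integrable_square_exp_decay: "integrable lborel (\<lambda>s::real. indicator {0<..} s * (s\<^sup>2 * exp (- s)))"
  and integral_square_exp_decay: "(\<integral>s. indicator {0<..} s * (s\<^sup>2 * exp (- s)) \<partial>(lborel :: real measure)) = 2"
proof -
  have lim1: "(((\<lambda>s. - exp (- s)) \<circ> real_of_ereal) \<longlongrightarrow> - 1) (at_right 0)"
    "(((\<lambda>s. - exp (- s)) \<circ> real_of_ereal) \<longlongrightarrow> 0) (at_left \<infinity>)"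
    unfolding zero_ereal_def ereal_tendsto_simps by real_asymp+
  have lim2: "(((\<lambda>s. - (s\<^sup>2 + 2 * s + 2) * exp (- s)) \<circ> real_of_ereal) \<longlongrightarrow> - 2) (at_right 0)"
    "(((\<lambda>s. - (s\<^sup>2 + 2 * s + 2) * exp (- s)) \<circ> real_of_ereal) \<longlongrightarrow> 0) (at_left \<infinity>)"
    unfolding zero_ereal_def ereal_tendsto_simps by real_asymp+
  have d1: "((\<lambda>s. - exp (- s)) has_real_derivative exp (- s)) (at s)" for s :: real
    by (auto intro!: derivative_eq_intros)
  have d2: "((\<lambda>s. - (s\<^sup>2 + 2 * s + 2) * exp (- s)) has_real_derivative s\<^sup>2 * exp (- s)) (at s)" for s :: real
    by (auto intro!: derivative_eq_intros simp: algebra_simps)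
  have c: "isCont (\<lambda>s::real. exp (- s)) s" "isCont (\<lambda>s::real. s\<^sup>2 * exp (- s)) s" for s
    by (auto intro!: continuous_intros)
  have ae: "AE s in lborel. 0 < ereal s \<longrightarrow> ereal s < \<infinity> \<longrightarrow> 0 \<le> exp (- s)"
    "AE s in lborel. 0 < ereal s \<longrightarrow> ereal s < \<infinity> \<longrightarrow> 0 \<le> s\<^sup>2 * exp (- s)" by auto
  have ein: "einterval 0 \<infinity> = {0::real<..}" by (auto simp: einterval_def)
  note F1 = interval_integral_FTC_nonneg[OF _ d1 c(1) ae(1) lim1]
    and F2 = interval_integral_FTC_nonneg[OF _ d2 c(2) ae(2) lim2]
  show "integrable lborel (\<lambda>s::real. indicator {0<..} s * exp (- s))"
    using F1(1) by (simp add: set_integrable_def ein)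
  show "integrable lborel (\<lambda>s::real. indicator {0<..} s * (s\<^sup>2 * exp (- s)))"
    using F2(1) by (simp add: set_integrable_def ein)
  show "(\<integral>s. indicator {0<..} s * (s\<^sup>2 * exp (- s)) \<partial>(lborel :: real measure)) = 2"
    using F2(2) by (simp add: interval_lebesgue_integral_def set_lebesgue_integral_def ein)
qed

lemma integrable_exp_decay_rate:
  assumes "a > 0"
  shows "integrable lborel (\<lambda>s::real. indicator {0<..} s * exp (- (a * s)))"
proof -
  have "(\<lambda>s. indicator {0<..} (0 + a * s) * exp (- (0 + a * s))) = (\<lambda>s. indicator {0<..} s * exp (- (a * s)))"
    using assms by (auto simp: indicator_def fun_eq_iff zero_less_mult_iff)
  then show ?thesis
    using lborel_integrable_real_affine[OF integrable_exp_decay, of a 0] assms by simp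
qed

lemma cmod_exp_neg: "cmod (exp (- (z * of_real s))) = exp (- (Re z * s))"
  by (simp add: norm_exp_eq_Re)

lemma
  assumes z: "Re z > 0"
  shows integrable_exp_decay_complex: "integrable lborel (\<lambda>s. indicator {0<..} s *\<^sub>R exp (- (z * of_real s)))"
    and integral_exp_decay_complex: "(\<integral>s. indicator {0<..} s *\<^sub>R exp (- (z * of_real s)) \<partial>lborel) = 1 / z"
proof -
  let ?f = "\<lambda>s. indicator {0<..} s *\<^sub>R exp (- (z * of_real s))"
  show int: "integrable lborel ?f"
    by (rule Bochner_Integration.integrable_bound[OF integrable_exp_decay_rate[OF z]])
       (auto simp: cmod_exp_neg indicator_def)
  have "(\<lambda>n. \<integral>s. indicator {- real n..real n} s *\<^sub>R ?f s \<partial>lborel) \<longlonglongrightarrow> (\<integral>s. ?f s \<partial>lborel)"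
    by (rule integral_symmetric_limit[OF int])
  moreover have "(\<integral>s. indicator {- real n..real n} s *\<^sub>R ?f s \<partial>lborel) = (1 - exp (- (z * of_real (real n)))) / z" for n
  proof -
    have "(\<integral>s. indicator {- real n..real n} s *\<^sub>R ?f s \<partial>lborel) =
        (\<integral>s. indicator {0..real n} s *\<^sub>R exp (- (z * of_real s)) \<partial>lborel)"
    proof (rule integral_cong_AE)
      show "AE s in lborel. indicator {- real n..real n} s *\<^sub>R ?f s =
          indicator {0..real n} s *\<^sub>R exp (- (z * of_real s))"
        using AE_lborel_singleton[of "0::real"] by eventually_elim (auto simp: indicator_def)
    qed auto
    also have "\<dots> = - exp (- (z * of_real (real n))) / z - (- exp (- (z * of_real 0)) / z)"
    proof (rule integral_FTC_atLeastAtMost)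
      show "continuous_on {0..real n} (\<lambda>s. exp (- (z * of_real s)))" by (intro continuous_intros)
      show "((\<lambda>s. - exp (- (z * of_real s)) / z) has_vector_derivative exp (- (z * of_real s))) (at s within {0..real n})" for s
      proof -
        have "((\<lambda>u. - exp (- (z * u)) / z) has_field_derivative exp (- (z * of_real s))) (at (of_real s))"
          using z by (auto intro!: derivative_eq_intros simp: field_simps)
        from field_vector_diff_chain_at[OF has_vector_derivative_of_real[OF DERIV_ident] this]
        show ?thesis by (simp add: o_def has_vector_derivative_at_within)
      qed
    qed auto
    finally show ?thesis by (simp add: diff_divide_distrib)
  qed
  moreover have "(\<lambda>n. (1 - exp (- (z * of_real (real n)))) / z) \<longlonglongrightarrow> (1 - 0) / z"
  proof (intro tendsto_intros)
    show "(\<lambda>n. exp (- (z * of_real (real n)))) \<longlonglongrightarrow> 0"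
    proof (rule Lim_null_comparison)
      show "\<forall>\<^sub>F n in sequentially. norm (exp (- (z * of_real (real n)))) \<le> exp (- (Re z * real n))"
        by (simp add: cmod_exp_neg)
      show "(\<lambda>n. exp (- (Re z * real n))) \<longlonglongrightarrow> 0" using z by real_asymp
    qed
  qed (use z in auto)
  ultimately show "(\<integral>s. ?f s \<partial>lborel) = 1 / z" using LIMSEQ_unique by fastforce
qed

lemma cmod_Complex_ge: "\<bar>w\<bar> \<le> cmod (Complex w x)" "\<bar>x\<bar> \<le> cmod (Complex w x)"
  using abs_Re_le_cmod[of "Complex w x"] abs_Im_le_cmod[of "Complex w x"] by auto

lemma exp_over_cube_bound:
  assumes "0 < w1" "w1 \<le> Re z" "Re z \<le> w2" "0 \<le> \<tau>"
  shows "cmod (exp (of_real \<tau> * z) / z ^ 3) \<le> (exp (\<tau> * w2) / w1) / (cmod z)\<^sup>2"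
proof -
  have z: "w1 \<le> cmod z" using complex_Re_le_cmod[of z] assms by simp
  have "cmod (exp (of_real \<tau> * z) / z ^ 3) = exp (\<tau> * Re z) / (cmod z * (cmod z)\<^sup>2)"
    by (simp add: norm_divide norm_mult norm_exp_eq_Re power3_eq_cube power2_eq_square)
  also have "\<dots> \<le> exp (\<tau> * w2) / (w1 * (cmod z)\<^sup>2)"
  proof (rule frac_le)
    have "z \<noteq> 0" using z assms by auto
    then show "0 < w1 * (cmod z)\<^sup>2" using assms by simp
    show "exp (\<tau> * Re z) \<le> exp (\<tau> * w2)" using assms by (simp add: mult_left_mono)
    show "w1 * (cmod z)\<^sup>2 \<le> cmod z * (cmod z)\<^sup>2" using z by (intro mult_right_mono) auto
  qed simp
  finally show ?thesis by simp
qed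

lemma exp_over_cube_holomorphic: "(\<lambda>z. exp (of_real \<tau> * z) / z ^ 3) holomorphic_on {z. 0 < Re z}"
  by (intro holomorphic_intros) auto

lemma exp_over_cube_integral_scaling:
  assumes w: "w > 0" and \<tau>: "\<tau> \<ge> 0"
  shows "(\<integral>x. exp (of_real \<tau> * Complex w x) / Complex w x ^ 3 \<partial>lborel) =
    of_real (\<tau>\<^sup>2) * (\<integral>x. exp (Complex 1 x) / Complex 1 x ^ 3 \<partial>lborel)"
proof -
  define J where "J = (\<lambda>w \<tau>. \<integral>x. exp (of_real \<tau> * Complex w x) / Complex w x ^ 3 \<partial>lborel)"
  have le: "J w1 \<tau> = J w2 \<tau>" if "0 < w1" "w1 \<le> w2" for w1 w2
    unfolding J_def
  proof (rule vertical_integrals_eq[OF exp_over_cube_holomorphic[of \<tau>]])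
    fix z assume "w1 \<le> Re z" "Re z \<le> w2"
    then show "cmod (exp (of_real \<tau> * z) / z ^ 3) \<le> exp (\<tau> * w2) / w1 / (cmod z)\<^sup>2"
      using that \<tau> by (intro exp_over_cube_bound)
  qed (use that in auto)
  have indep: "J w1 \<tau> = J w2 \<tau>" if "0 < w1" "0 < w2" for w1 w2
  proof (cases "w1 \<le> w2")
    case True
    then show ?thesis using that by (intro le)
  next
    case False
    then show ?thesis using that by (intro le[symmetric]) auto
  qed
  have "J w \<tau> = of_real (\<tau>\<^sup>2) * J 1 1"
  proof (cases "\<tau> = 0")
    case True
    have "J w 0 = 0"
      unfolding J_def
    proof (rule vertical_integral_zero[OF exp_over_cube_holomorphic[of 0] w w, where C = "1 / w"])
      fix z assume "w \<le> Re z"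
      then show "cmod (exp (of_real 0 * z) / z ^ 3) \<le> 1 / w / (cmod z)\<^sup>2"
        using exp_over_cube_bound[of w z "Re z" 0] w by simp
    qed
    then show ?thesis using True by simp
  next
    case False
    then have t: "\<tau> > 0" using \<tau> by simp
    have C: "Complex (1 / \<tau>) (0 + 1 / \<tau> * x) = Complex 1 x / of_real \<tau>" for x
      using t by (simp add: complex_eq_iff)
    have "J w \<tau> = J (1 / \<tau>) \<tau>" using w t by (intro indep) auto
    also have "\<dots> = \<bar>1 / \<tau>\<bar> *\<^sub>R (\<integral>x. exp (of_real \<tau> * Complex (1 / \<tau>) (0 + 1 / \<tau> * x)) /
        Complex (1 / \<tau>) (0 + 1 / \<tau> * x) ^ 3 \<partial>lborel)"
      unfolding J_def using t by (intro lborel_integral_real_affine) simp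
    also have "(\<lambda>x. exp (of_real \<tau> * Complex (1 / \<tau>) (0 + 1 / \<tau> * x)) / Complex (1 / \<tau>) (0 + 1 / \<tau> * x) ^ 3) =
        (\<lambda>x. of_real (\<tau> ^ 3) * (exp (of_real 1 * Complex 1 x) / Complex 1 x ^ 3))"
      unfolding C using t by (simp add: power_divide mult.commute)
    also have "\<bar>1 / \<tau>\<bar> *\<^sub>R (\<integral>x. of_real (\<tau> ^ 3) * (exp (of_real 1 * Complex 1 x) / Complex 1 x ^ 3) \<partial>lborel) =
        of_real (1 / \<tau>) * (of_real (\<tau> ^ 3) * J 1 1)"
      unfolding J_def integral_mult_right_zero using t by (simp add: scaleR_conv_of_real)
    also have "\<dots> = of_real (\<tau>\<^sup>2) * J 1 1"
      using t by (simp add: power3_eq_cube power2_eq_square)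
    finally show ?thesis .
  qed
  then show ?thesis by (simp add: J_def)
qed

lemma exp_over_cube_integral_nonzero: "(\<integral>x. exp (Complex 1 x) / Complex 1 x ^ 3 \<partial>lborel) \<noteq> 0"
proof
  assume zero: "(\<integral>x. exp (Complex 1 x) / Complex 1 x ^ 3 \<partial>lborel) = 0"
  define f where "f = (\<lambda>x \<tau>. indicator {0<..} \<tau> *\<^sub>R (exp (- (2 * of_real \<tau>)) * (exp (of_real \<tau> * Complex 1 x) / Complex 1 x ^ 3)))"
  have Cm: "Complex 1 = (\<lambda>x. 1 + \<i> * of_real x)" by (simp add: Complex_eq fun_eq_iff)
  have nz: "Complex 1 x \<noteq> 0" for x by (simp add: complex_eq_iff)
  have "(\<integral>\<tau>. (\<integral>x. f x \<tau> \<partial>lborel) \<partial>lborel) = (\<integral>x. (\<integral>\<tau>. f x \<tau> \<partial>lborel) \<partial>lborel)"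
  proof (rule lborel_swap_dominated)
    show "case_prod f \<in> borel_measurable (lborel \<Otimes>\<^sub>M lborel)"
      unfolding f_def Cm by measurable
    show "integrable lborel (\<lambda>x::real. 1 / (1 + x\<^sup>2))" by (rule integrable_inverse_1_plus_square)
    show "integrable lborel (\<lambda>\<tau>::real. indicator {0<..} \<tau> * exp (- \<tau>))" by (rule integrable_exp_decay)
    fix x \<tau> :: real
    have "exp (- (2 * \<tau>)) * (exp \<tau> / cmod (Complex 1 x) ^ 3) \<le> exp (- (2 * \<tau>)) * (exp \<tau> / (1 + x\<^sup>2))"
    proof (intro mult_left_mono divide_left_mono)
      have "1 + x\<^sup>2 = (cmod (Complex 1 x))\<^sup>2" by (simp add: cmod_Complex_square)
      also have "\<dots> \<le> cmod (Complex 1 x) ^ 3"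
        using cmod_Complex_ge(1)[of 1 x] by (intro power_increasing) auto
      finally show "1 + x\<^sup>2 \<le> cmod (Complex 1 x) ^ 3" .
      show "0 < cmod (Complex 1 x) ^ 3 * (1 + x\<^sup>2)"
        using nz[of x] by (intro mult_pos_pos) (auto intro: add_pos_nonneg)
    qed auto
    also have "\<dots> = 1 / (1 + x\<^sup>2) * exp (- \<tau>)" by (simp flip: exp_add)
    finally show "cmod (f x \<tau>) \<le> 1 / (1 + x\<^sup>2) * (indicator {0<..} \<tau> * exp (- \<tau>))"
      by (auto simp: f_def norm_mult norm_divide norm_power norm_exp_eq_Re indicator_def)
  qed
  moreover have "(\<integral>x. f x \<tau> \<partial>lborel) = 0" for \<tau>
  proof (cases "\<tau> > 0")
    case True
    have "(\<integral>x. f x \<tau> \<partial>lborel) = exp (- (2 * of_real \<tau>)) * (\<integral>x. exp (of_real \<tau> * Complex 1 x) / Complex 1 x ^ 3 \<partial>lborel)"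
    proof -
      have "(\<lambda>x. f x \<tau>) = (\<lambda>x. exp (- (2 * of_real \<tau>)) * (exp (of_real \<tau> * Complex 1 x) / Complex 1 x ^ 3))"
        using True by (simp add: f_def fun_eq_iff)
      then show ?thesis by (simp only: integral_mult_right_zero)
    qed
    then show ?thesis using exp_over_cube_integral_scaling[of 1 \<tau>] True zero by simp
  qed (simp add: f_def)
  moreover have "(\<integral>\<tau>. f x \<tau> \<partial>lborel) =
      1 / 2 * (1 / Complex 1 x ^ 3) + 1 / 4 * (1 / (Complex 1 x)\<^sup>2) + of_real (1 / 4 * (1 / (1 + x\<^sup>2)))" for x
  proof -
    have "f x \<tau> = 1 / Complex 1 x ^ 3 * (indicator {0<..} \<tau> *\<^sub>R exp (- ((2 - Complex 1 x) * of_real \<tau>)))" for \<tau>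
      unfolding f_def by (simp add: algebra_simps scaleR_conv_of_real flip: exp_add)
    moreover have "0 < Re (2 - Complex 1 x)" by simp
    ultimately have int: "(\<integral>\<tau>. f x \<tau> \<partial>lborel) = 1 / Complex 1 x ^ 3 * (1 / (2 - Complex 1 x))"
      by (simp only: integral_mult_right_zero integral_exp_decay_complex)
    have pf: "1 / z ^ 3 * (1 / (2 - z)) = 1 / 2 * (1 / z ^ 3) + 1 / 4 * (1 / z\<^sup>2) + 1 / 4 * (1 / (z * (2 - z)))"
      if "z \<noteq> 0" "z \<noteq> 2" for z :: complex
    proof -
      have "2 - z \<noteq> 0" using that by auto
      then show ?thesis using that by (simp add: divide_simps) (simp add: algebra_simps eval_nat_numeral)
    qed
    have "Complex 1 x * (2 - Complex 1 x) = of_real (1 + x\<^sup>2)"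
      by (simp add: complex_eq_iff power2_eq_square)
    then have "1 / 4 * (1 / (Complex 1 x * (2 - Complex 1 x))) = of_real (1 / 4 * (1 / (1 + x\<^sup>2)))"
      by simp
    moreover have "Complex 1 x \<noteq> 2" by (simp add: complex_eq_iff)
    ultimately show ?thesis unfolding int using pf[OF nz[of x]] by simp
  qed
  ultimately have "(\<integral>x. 1 / 2 * (1 / Complex 1 x ^ 3) + 1 / 4 * (1 / (Complex 1 x)\<^sup>2) +
      of_real (1 / 4 * (1 / (1 + x\<^sup>2))) \<partial>lborel) = (0 :: complex)" by simp
  moreover have pw: "cmod (1 / z ^ 3) \<le> 1 / (cmod z)\<^sup>2" "cmod (1 / z\<^sup>2) \<le> 1 / (cmod z)\<^sup>2" if "1 \<le> Re z" for z
    using exp_over_cube_bound[of 1 z "Re z" 0] that by (auto simp: norm_divide norm_power)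
  moreover have hol: "(\<lambda>z. 1 / z ^ k) holomorphic_on {z. 0 < Re z}" for k :: nat
    by (intro holomorphic_intros) auto
  moreover have z3: "(\<integral>x. 1 / Complex 1 x ^ 3 \<partial>lborel) = 0"
    by (rule vertical_integral_zero[OF hol, where C = 1]) (auto intro: pw)
  moreover have z2: "(\<integral>x. 1 / (Complex 1 x)\<^sup>2 \<partial>lborel) = 0"
    by (rule vertical_integral_zero[OF hol, where C = 1]) (auto intro: pw)
  moreover have i3: "integrable lborel (\<lambda>x. 1 / Complex 1 x ^ k)" if "k = 3 \<or> k = 2" for k :: nat
    using that nz
    by (intro vertical_integrable[of 1 "\<lambda>z. 1 / z ^ k" 1])
       (auto intro!: pw continuous_intros continuous_on_Complex_line)
  moreover have id: "integrable lborel (\<lambda>x. complex_of_real (1 / 4 * (1 / (1 + x\<^sup>2))))"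
    using integrable_inverse_1_plus_square by (intro integrable_of_real integrable_mult_right)
  moreover have ia: "integrable lborel (\<lambda>x. 1 / 2 * (1 / Complex 1 x ^ 3))"
    and ib: "integrable lborel (\<lambda>x. 1 / 4 * (1 / (Complex 1 x)\<^sup>2))"
    by (intro integrable_mult_right i3; simp)+
  ultimately have "(\<integral>x. 1 / 2 * (1 / Complex 1 x ^ 3) \<partial>lborel) + (\<integral>x. 1 / 4 * (1 / (Complex 1 x)\<^sup>2) \<partial>lborel) +
      (\<integral>x. complex_of_real (1 / 4 * (1 / (1 + x\<^sup>2))) \<partial>lborel) = 0"
    by (simp only: Bochner_Integration.integral_add Bochner_Integration.integrable_add)
  then have "(\<integral>x. complex_of_real (1 / 4 * (1 / (1 + x\<^sup>2))) \<partial>lborel) = 0"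
    by (simp only: integral_mult_right_zero z3 z2) simp
  then have "complex_of_real (\<integral>x. 1 / 4 * (1 / (1 + x\<^sup>2)) \<partial>lborel) = 0" by (simp only: integral_complex_of_real)
  then have "1 / 4 * (\<integral>x. 1 / (1 + x\<^sup>2) \<partial>(lborel :: real measure)) = 0"
    unfolding integral_mult_right_zero by simp
  then show False by (simp add: integral_inverse_1_plus_square)
qed

lemma holomorphic_derivative_bounds:
  assumes holo: "V holomorphic_on \<Omega>" and \<Omega>: "open \<Omega>" and r: "r > 0" "cball z r \<subseteq> \<Omega>"
    and B: "\<And>u. u \<in> \<Omega> \<Longrightarrow> cmod (V u) \<le> B"
  shows "cmod (deriv V z) \<le> B / r" and "cmod (deriv (deriv V) z) \<le> 2 * B / r\<^sup>2"
proof -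
  have *: "V holomorphic_on ball z r" "continuous_on (cball z r) V"
    using holo r ball_subset_cball
    by (meson holomorphic_on_subset holomorphic_on_imp_continuous_on order_trans)+
  have "cmod ((deriv ^^ n) V z) \<le> fact n * B / r ^ n" for n
    by (rule Cauchy_inequality[OF * r(1)]) (use r(2) B in \<open>auto simp: dist_norm subset_iff\<close>)
  from this[of 1] this[of 2] show "cmod (deriv V z) \<le> B / r" "cmod (deriv (deriv V) z) \<le> 2 * B / r\<^sup>2"
    by (simp_all add: numeral_2_eq_2)
qed

definition tilted_region :: "real \<Rightarrow> real \<Rightarrow> complex set" where
  "tilted_region \<rho> c = {z. \<rho> < cmod z \<and> - c * cmod z < Re z}"

lemma open_tilted_region: "open (tilted_region \<rho> c)"
  unfolding tilted_region_def
  by (intro open_Collect_conj open_Collect_less continuous_intros)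

lemma cball_subset_tilted_region:
  assumes c: "0 < c" "c < 1" and \<rho>: "\<rho> > 0" and z: "2 * \<rho> \<le> Re z"
  shows "cball z (c / 2 * cmod z) \<subseteq> tilted_region \<rho> c"
proof
  fix u assume "u \<in> cball z (c / 2 * cmod z)"
  then have u: "cmod (u - z) \<le> c / 2 * cmod z" by (simp add: dist_norm norm_minus_commute)
  have zr: "2 * \<rho> \<le> cmod z" using z complex_Re_le_cmod[of z] by linarith
  have uz: "(1 - c / 2) * cmod z \<le> cmod u"
    using norm_triangle_ineq2[of z "z - u"] u by (simp add: norm_minus_commute algebra_simps)
  have "\<rho> < (1 - c / 2) * (2 * \<rho>)" using c \<rho> by (simp add: field_simps)
  also have "\<dots> \<le> (1 - c / 2) * cmod z" using zr c by (intro mult_left_mono) auto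
  finally have "\<rho> < cmod u" using uz by linarith
  moreover have "- c * cmod u < Re u"
  proof -
    have cc: "c / 2 \<le> c * (1 - c / 2)"
      using mult_left_mono[of "1 / 2" "1 - c / 2" c] c by simp
    have "Re u \<ge> Re z - c / 2 * cmod z" using u abs_Re_le_cmod[of "u - z"] by simp
    then have "Re u > - (c / 2 * cmod z)" using z \<rho> by linarith
    moreover have "c / 2 * cmod z \<le> c * ((1 - c / 2) * cmod z)"
      using mult_right_mono[OF cc norm_ge_zero[of z]] by (simp add: algebra_simps)
    moreover have "\<dots> \<le> c * cmod u" using uz c by (intro mult_left_mono) auto
    ultimately show ?thesis by linarith
  qed
  ultimately show "u \<in> tilted_region \<rho> c" by (simp add: tilted_region_def)
qed

text \<open>Two integrations by parts along the vertical line turn the factor \<open>t\<^sup>2\<close> into a second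
  derivative, which decays quadratically by Cauchy's estimates on discs of radius
  proportional to \<open>cmod z\<close>.\<close>

lemma vertical_exp_integral_bound:
  assumes c: "0 < c" "c < 1" and \<rho>: "\<rho> > 0" and w: "2 * \<rho> \<le> w"
    and holo: "V holomorphic_on tilted_region \<rho> c"
    and B: "\<And>z. z \<in> tilted_region \<rho> c \<Longrightarrow> cmod (V z) \<le> B"
    and B': "\<And>z. z \<in> tilted_region \<rho> c \<Longrightarrow> cmod (V z) \<le> B' / (cmod z)\<^sup>2"
  shows "cmod (of_real (t\<^sup>2) * (\<integral>x. exp (of_real t * Complex w x) * V (Complex w x) \<partial>lborel))
      \<le> exp (t * w) * (8 * B / c\<^sup>2) * (pi / w)"
proof -
  let ?\<Omega> = "tilted_region \<rho> c"
  define V1 where "V1 = deriv V"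
  define V2 where "V2 = deriv V1"
  have w0: "w > 0" using w \<rho> by linarith
  have hol1: "V1 holomorphic_on ?\<Omega>" unfolding V1_def by (rule holomorphic_deriv[OF holo open_tilted_region])
  have hol2: "V2 holomorphic_on ?\<Omega>" unfolding V2_def by (rule holomorphic_deriv[OF hol1 open_tilted_region])
  have line: "Complex w x \<in> ?\<Omega>" for x
    using cball_subset_tilted_region[OF c \<rho>, of "Complex w x"] w c by (auto simp: subset_iff)
  have D1: "(V has_field_derivative V1 (Complex w x)) (at (Complex w x))" for x
    unfolding V1_def by (rule holomorphic_derivI[OF holo open_tilted_region line])
  have D2: "(V1 has_field_derivative V2 (Complex w x)) (at (Complex w x))" for x
    unfolding V2_def by (rule holomorphic_derivI[OF hol1 open_tilted_region line])
  have Cw: "w \<le> cmod (Complex w x)" "\<bar>x\<bar> \<le> cmod (Complex w x)" for x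
    using complex_Re_le_cmod[of "Complex w x"] abs_Im_le_cmod[of "Complex w x"] by auto
  then have Cpos: "cmod (Complex w x) > 0" for x using w0 by (meson less_le_trans)
  have B0: "B \<ge> 0" using B[OF line[of 0]] norm_ge_zero order_trans by blast
  have b1: "cmod (V1 (Complex w x)) \<le> 2 * B / c * (1 / cmod (Complex w x))"
    and b2: "cmod (V2 (Complex w x)) \<le> 8 * B / c\<^sup>2 / (cmod (Complex w x))\<^sup>2" for x
  proof -
    have r: "c / 2 * cmod (Complex w x) > 0" using c Cpos[of x] by simp
    have sub: "cball (Complex w x) (c / 2 * cmod (Complex w x)) \<subseteq> ?\<Omega>"
      by (rule cball_subset_tilted_region[OF c \<rho>]) (use w in simp)
    note * = holomorphic_derivative_bounds[OF holo open_tilted_region r sub B]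
    show "cmod (V1 (Complex w x)) \<le> 2 * B / c * (1 / cmod (Complex w x))"
      using *(1) by (simp add: V1_def field_simps)
    show "cmod (V2 (Complex w x)) \<le> 8 * B / c\<^sup>2 / (cmod (Complex w x))\<^sup>2"
      using *(2) by (simp add: V1_def V2_def power_mult_distrib power_divide)
  qed
  define e where "e = (\<lambda>x. exp (of_real t * Complex w x))"
  have e: "cmod (e x) = exp (t * w)" for x by (simp add: e_def norm_exp_eq_Re)
  have conte: "continuous_on A e" for A
    unfolding e_def by (intro continuous_intros continuous_on_Complex_line)
  have cont: "continuous_on A (\<lambda>x. F (Complex w x))" if "F holomorphic_on ?\<Omega>" for F A
    using line by (intro continuous_on_compose2[OF holomorphic_on_imp_continuous_on[OF that] continuous_on_Complex_line]) auto
  have intV: "integrable lborel (\<lambda>x. e x * V (Complex w x))"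
  proof (rule Bochner_Integration.integrable_bound)
    show "integrable lborel (\<lambda>x. exp (t * w) * (B' * (1 / (w\<^sup>2 + x\<^sup>2))))"
      by (intro integrable_mult_right integrable_inverse_plus_square w0)
    show "(\<lambda>x. e x * V (Complex w x)) \<in> borel_measurable lborel"
      using borel_measurable_continuous_onI[OF continuous_on_mult[OF conte cont[OF holo]]] by simp
    show "AE x in lborel. norm (e x * V (Complex w x)) \<le> norm (exp (t * w) * (B' * (1 / (w\<^sup>2 + x\<^sup>2))))"
    proof (rule AE_I2)
      fix x
      have "norm (e x * V (Complex w x)) \<le> exp (t * w) * (B' * (1 / (w\<^sup>2 + x\<^sup>2)))"
        using mult_left_mono[OF B'[OF line[of x]] exp_ge_zero[of "t * w"]]
        by (simp add: norm_mult e cmod_Complex_square)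
      then show "norm (e x * V (Complex w x)) \<le> norm (exp (t * w) * (B' * (1 / (w\<^sup>2 + x\<^sup>2))))"
        by (rule order_trans) (simp only: real_norm_def abs_ge_self)
    qed
  qed
  have bV2: "norm (e x * V2 (Complex w x)) \<le> exp (t * w) * (8 * B / c\<^sup>2) * (1 / (w\<^sup>2 + x\<^sup>2))" for x
    using mult_left_mono[OF b2[of x] exp_ge_zero[of "t * w"]]
    by (simp add: norm_mult e cmod_Complex_square)
  have intb: "integrable lborel (\<lambda>x. exp (t * w) * (8 * B / c\<^sup>2) * (1 / (w\<^sup>2 + x\<^sup>2)))"
    by (intro integrable_mult_right integrable_inverse_plus_square w0)
  have intV2: "integrable lborel (\<lambda>x. e x * V2 (Complex w x))"
  proof (rule Bochner_Integration.integrable_bound[OF intb])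
    show "(\<lambda>x. e x * V2 (Complex w x)) \<in> borel_measurable lborel"
      using borel_measurable_continuous_onI[OF continuous_on_mult[OF conte cont[OF hol2]]] by simp
    show "AE x in lborel. norm (e x * V2 (Complex w x)) \<le> norm (exp (t * w) * (8 * B / c\<^sup>2) * (1 / (w\<^sup>2 + x\<^sup>2)))"
      by (rule AE_I2, rule order_trans[OF bV2]) (simp only: real_norm_def abs_ge_self)
  qed
  define \<Phi> where "\<Phi> = (\<lambda>x. - \<i> * (e x * (of_real t * V (Complex w x) - V1 (Complex w x))))"
  define g where "g = (\<lambda>x. of_real (t\<^sup>2) * (e x * V (Complex w x)) - e x * V2 (Complex w x))"
  have intg: "integrable lborel g"
    unfolding g_def by (intro Bochner_Integration.integrable_diff integrable_mult_right intV intV2)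
  have "(\<integral>x. indicator {- real n..real n} x *\<^sub>R g x \<partial>lborel) = \<Phi> (real n) - \<Phi> (- real n)" for n
  proof (rule integral_FTC_atLeastAtMost)
    fix x
    let ?z = "Complex w x"
    have "((\<lambda>z. exp (of_real t * z) * (of_real t * V z - V1 z)) has_field_derivative
        (exp (of_real t * ?z) * of_real t * (of_real t * V ?z - V1 ?z) +
          exp (of_real t * ?z) * (of_real t * V1 ?z - V2 ?z))) (at ?z)"
      by (auto intro!: derivative_eq_intros D1 D2 simp: algebra_simps)
    moreover have "exp (of_real t * ?z) * of_real t * (of_real t * V ?z - V1 ?z) +
          exp (of_real t * ?z) * (of_real t * V1 ?z - V2 ?z) = g x"
      by (simp add: g_def e_def algebra_simps power2_eq_square)
    ultimately have "((\<lambda>z. exp (of_real t * z) * (of_real t * V z - V1 z)) has_field_derivative g x) (at ?z)"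
      by simp
    from field_vector_diff_chain_within[OF has_vector_derivative_Complex_line has_field_derivative_at_within[OF this]]
    have "((\<lambda>x. e x * (of_real t * V (Complex w x) - V1 (Complex w x))) has_vector_derivative \<i> * g x)
        (at x within {- real n..real n})"
      by (simp add: o_def e_def)
    from has_vector_derivative_mult_right[OF this, of "- \<i>"]
    show "(\<Phi> has_vector_derivative g x) (at x within {- real n..real n})"
      by (simp add: \<Phi>_def)
  next
    show "continuous_on {- real n..real n} g"
      unfolding g_def by (intro continuous_intros conte cont holo hol2)
  qed auto
  moreover have "(\<lambda>n. \<integral>x. indicator {- real n..real n} x *\<^sub>R g x \<partial>lborel) \<longlonglongrightarrow> (\<integral>x. g x \<partial>lborel)"
    by (rule integral_symmetric_limit[OF intg])
  moreover have "(\<lambda>n. \<Phi> (real n) - \<Phi> (- real n)) \<longlonglongrightarrow> 0"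
  proof -
    have b: "cmod (\<Phi> x) \<le> exp (t * w) * (\<bar>t\<bar> * \<bar>B'\<bar> / x\<^sup>2 + 2 * B / c * (1 / \<bar>x\<bar>))" if x: "x \<noteq> 0" for x
    proof -
      have "cmod (V (Complex w x)) \<le> \<bar>B'\<bar> / (cmod (Complex w x))\<^sup>2"
        using B'[OF line[of x]] by (rule order_trans) (intro divide_right_mono, auto)
      also have "\<dots> \<le> \<bar>B'\<bar> / x\<^sup>2"
        using x by (intro divide_left_mono) (auto simp: cmod_Complex_square intro!: mult_pos_pos add_nonneg_pos)
      finally have v: "cmod (V (Complex w x)) \<le> \<bar>B'\<bar> / x\<^sup>2" .
      have "cmod (V1 (Complex w x)) \<le> 2 * B / c * (1 / cmod (Complex w x))" by (rule b1)
      also have "\<dots> \<le> 2 * B / c * (1 / \<bar>x\<bar>)"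
        using x Cw(2)[of x] Cpos[of x] B0 c by (intro mult_left_mono divide_left_mono) auto
      finally have v1: "cmod (V1 (Complex w x)) \<le> 2 * B / c * (1 / \<bar>x\<bar>)" .
      have "cmod (\<Phi> x) = exp (t * w) * cmod (of_real t * V (Complex w x) - V1 (Complex w x))"
        by (simp add: \<Phi>_def norm_mult e)
      also have "\<dots> \<le> exp (t * w) * (\<bar>t\<bar> * (\<bar>B'\<bar> / x\<^sup>2) + 2 * B / c * (1 / \<bar>x\<bar>))"
      proof (rule mult_left_mono)
        have "cmod (of_real t * V (Complex w x) - V1 (Complex w x)) \<le>
            \<bar>t\<bar> * cmod (V (Complex w x)) + cmod (V1 (Complex w x))"
          using norm_triangle_ineq4[of "of_real t * V (Complex w x)"] by (simp add: norm_mult)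
        also have "\<dots> \<le> \<bar>t\<bar> * (\<bar>B'\<bar> / x\<^sup>2) + 2 * B / c * (1 / \<bar>x\<bar>)"
          using v v1 by (intro add_mono mult_left_mono) auto
        finally show "cmod (of_real t * V (Complex w x) - V1 (Complex w x)) \<le>
            \<bar>t\<bar> * (\<bar>B'\<bar> / x\<^sup>2) + 2 * B / c * (1 / \<bar>x\<bar>)" .
      qed simp
      finally show ?thesis by simp
    qed
    show ?thesis
    proof (rule Lim_null_comparison)
      show "\<forall>\<^sub>F n in sequentially. norm (\<Phi> (real n) - \<Phi> (- real n)) \<le>
          2 * (exp (t * w) * (\<bar>t\<bar> * \<bar>B'\<bar> / (real n)\<^sup>2 + 2 * B / c * (1 / real n)))"
        using eventually_gt_at_top[of 0]
      proof eventually_elim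
        case (elim n)
        define K where "K = exp (t * w) * (\<bar>t\<bar> * \<bar>B'\<bar> / (real n)\<^sup>2 + 2 * B / c * (1 / real n))"
        have "cmod (\<Phi> (real n)) \<le> K" "cmod (\<Phi> (- real n)) \<le> K"
          using b[of "real n"] b[of "- real n"] elim by (simp_all add: K_def)
        then show ?case
          using norm_triangle_ineq4[of "\<Phi> (real n)" "\<Phi> (- real n)"] unfolding K_def[symmetric] by linarith
      qed
      show "(\<lambda>n. 2 * (exp (t * w) * (\<bar>t\<bar> * \<bar>B'\<bar> / (real n)\<^sup>2 + 2 * B / c * (1 / real n)))) \<longlonglongrightarrow> 0"
        by real_asymp
    qed
  qed
  ultimately have "(\<integral>x. g x \<partial>lborel) = 0" using LIMSEQ_unique by fastforce
  then have "of_real (t\<^sup>2) * (\<integral>x. e x * V (Complex w x) \<partial>lborel) = (\<integral>x. e x * V2 (Complex w x) \<partial>lborel)"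
    unfolding g_def
    by (subst (asm) Bochner_Integration.integral_diff) (auto intro: intV intV2)
  also have "cmod \<dots> \<le> (\<integral>x. exp (t * w) * (8 * B / c\<^sup>2) * (1 / (w\<^sup>2 + x\<^sup>2)) \<partial>lborel)"
    by (rule Bochner_Integration.integral_norm_bound_integral[OF intV2 intb bV2])
  also have "\<dots> = exp (t * w) * (8 * B / c\<^sup>2) * (pi / w)"
    unfolding integral_mult_right_zero integral_inverse_plus_square[OF w0] ..
  finally show ?thesis by (simp add: e_def)
qed

lemma erlang_approximate_identity:
  fixes y :: "real \<Rightarrow> complex"
  assumes t: "t > 0" and y: "continuous_on {0..t} y"
  shows "(\<lambda>n. \<integral>s. indicator {0..t} s *\<^sub>R
      (of_real (real (Suc n) ^ 3 * (t - s)\<^sup>2 * exp (- (real (Suc n) * (t - s)))) * y s) \<partial>lborel)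
    \<longlonglongrightarrow> 2 * y t"
proof -
  have "bounded (y ` {0..t})" by (intro compact_imp_bounded compact_continuous_image y) simp
  then obtain Y where "\<forall>v\<in>y ` {0..t}. cmod v \<le> Y" unfolding bounded_iff by blast
  then have Y: "cmod (y s) \<le> Y" if "s \<in> {0..t}" for s using that by blast
  define F where "F = (\<lambda>n s. indicator {0..t} s *\<^sub>R
      (of_real (real (Suc n) ^ 3 * (t - s)\<^sup>2 * exp (- (real (Suc n) * (t - s)))) * y s))"
  define H where "H = (\<lambda>n s. indicator {0..t} (t - s / real (Suc n)) *\<^sub>R
      (of_real (s\<^sup>2 * exp (- s)) * y (t - s / real (Suc n))))"
  have "(\<lambda>n. \<integral>s. H n s \<partial>lborel) \<longlonglongrightarrow> (\<integral>s. of_real (indicator {0<..} s * (s\<^sup>2 * exp (- s))) * y t \<partial>lborel)"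
  proof (rule integral_dominated_convergence)
    show "integrable lborel (\<lambda>s. Y * (indicator {0<..} s * (s\<^sup>2 * exp (- s))))"
      by (intro integrable_mult_right integrable_square_exp_decay)
    show "AE s in lborel. norm (H n s) \<le> Y * (indicator {0<..} s * (s\<^sup>2 * exp (- s)))" for n
    proof (rule AE_I2)
      fix s :: real
      show "norm (H n s) \<le> Y * (indicator {0<..} s * (s\<^sup>2 * exp (- s)))"
      proof (cases "t - s / real (Suc n) \<in> {0..t}")
        case True
        then have "0 \<le> s / real (Suc n)" by simp
        then have s: "s \<ge> 0" by (simp add: zero_le_divide_iff)
        have "norm (H n s) = s\<^sup>2 * exp (- s) * cmod (y (t - s / real (Suc n)))"
          using True unfolding H_def by (simp add: norm_mult norm_power)
        also have "\<dots> \<le> s\<^sup>2 * exp (- s) * Y" by (intro mult_left_mono Y True) auto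
        also have "\<dots> = Y * (indicator {0<..} s * (s\<^sup>2 * exp (- s)))" using s by (cases "s = 0") auto
        finally show ?thesis .
      next
        case False
        have "0 \<le> Y" using order_trans[OF norm_ge_zero Y[of t]] t by simp
        then show ?thesis using False by (simp add: H_def)
      qed
    qed
    show "AE s in lborel. (\<lambda>n. H n s) \<longlonglongrightarrow> of_real (indicator {0<..} s * (s\<^sup>2 * exp (- s))) * y t"
    proof (rule AE_I2)
      fix s :: real
      show "(\<lambda>n. H n s) \<longlonglongrightarrow> of_real (indicator {0<..} s * (s\<^sup>2 * exp (- s))) * y t"
      proof (cases "s > 0")
        case True
        have l: "(\<lambda>n. t - s / real (Suc n)) \<longlonglongrightarrow> t" by real_asymp
        have ev: "\<forall>\<^sub>F n in sequentially. t - s / real (Suc n) \<in> {0..t}"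
          using order_tendstoD(1)[OF l t] by eventually_elim (use True in auto)
        have "(\<lambda>n. y (t - s / real (Suc n))) \<longlonglongrightarrow> y t"
          by (rule continuous_on_tendsto_compose[OF y l _ ev]) (use t in simp)
        then have "(\<lambda>n. of_real (s\<^sup>2 * exp (- s)) * y (t - s / real (Suc n))) \<longlonglongrightarrow> of_real (s\<^sup>2 * exp (- s)) * y t"
          by (intro tendsto_intros)
        moreover have "\<forall>\<^sub>F n in sequentially. of_real (s\<^sup>2 * exp (- s)) * y (t - s / real (Suc n)) = H n s"
          using ev by eventually_elim (simp add: H_def)
        ultimately have "(\<lambda>n. H n s) \<longlonglongrightarrow> of_real (s\<^sup>2 * exp (- s)) * y t"
          by (rule Lim_transform_eventually)
        then show ?thesis using True by simp
      next
        case False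
        have "H n s = 0" for n
        proof (cases "s = 0")
          case True then show ?thesis by (simp add: H_def)
        next
          case False
          then have "s / real (Suc n) < 0" using \<open>\<not> s > 0\<close> by (simp add: divide_less_0_iff)
          then show ?thesis by (simp add: H_def)
        qed
        then show ?thesis using False by simp
      qed
    qed
    show "H n \<in> borel_measurable lborel" for n
    proof -
      have m: "(\<lambda>s. indicator {0..t} s *\<^sub>R y s) \<in> borel_measurable borel"
        using borel_measurable_continuous_on_indicator[OF _ y] by simp
      have "(\<lambda>s. indicator {0..t} (t - s / real (Suc n)) *\<^sub>R y (t - s / real (Suc n))) \<in> borel_measurable borel"
        by (rule measurable_compose[OF _ m]) simp
      then have "(\<lambda>s. of_real (s\<^sup>2 * exp (- s)) * (indicator {0..t} (t - s / real (Suc n)) *\<^sub>R y (t - s / real (Suc n)))) \<in> borel_measurable borel"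
        by (intro borel_measurable_times) simp_all
      then show ?thesis unfolding H_def by simp
    qed
  qed auto
  moreover have "(\<integral>s. of_real (indicator {0<..} s * (s\<^sup>2 * exp (- s))) * y t \<partial>lborel) = 2 * y t"
    unfolding integral_mult_left_zero integral_complex_of_real integral_square_exp_decay by simp
  moreover have "(\<integral>s. H n s \<partial>lborel) = (\<integral>s. F n s \<partial>lborel)" for n
  proof -
    have "F n (t + (- 1 / real (Suc n)) * s) = of_real (real (Suc n)) * H n s" for s
      unfolding F_def H_def by (simp add: power2_eq_square power3_eq_cube scaleR_conv_of_real del: of_nat_Suc)
    then have "(\<integral>s. F n s \<partial>lborel) = \<bar>- 1 / real (Suc n)\<bar> *\<^sub>R (\<integral>s. of_real (real (Suc n)) * H n s \<partial>lborel)"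
      by (subst lborel_integral_real_affine[of "- 1 / real (Suc n)" _ t]) auto
    also have "\<dots> = (\<integral>s. H n s \<partial>lborel)"
      unfolding integral_mult_right_zero by (simp add: scaleR_conv_of_real del: of_nat_Suc)
    finally show ?thesis ..
  qed
  ultimately show ?thesis unfolding F_def by (simp only:)
qed

lemma
  fixes \<nu> x :: real
  assumes \<nu>: "\<nu> > 0" and x: "x > 0"
  shows integrable_powr_exp: "integrable lborel (\<lambda>s. indicator {0<..} s * (s powr (\<nu> - 1) * exp (- (x * s))))"
    and integral_powr_exp: "(\<integral>s. indicator {0<..} s * (s powr (\<nu> - 1) * exp (- (x * s))) \<partial>lborel) = Gamma \<nu> * x powr (- \<nu>)"
proof -
  define g where "g = (\<lambda>s::real. (indicator {0..} s :: real) * s powr (\<nu> - 1) / exp s)"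
  have g0: "g s \<ge> 0" for s by (simp add: g_def)
  have nn: "(\<integral>\<^sup>+s. ennreal (g s) \<partial>lborel) = ennreal (Gamma \<nu>)"
    using Gamma_conv_nn_integral_real[OF \<nu>] by (simp add: g_def)
  have gm: "g \<in> borel_measurable lborel" unfolding g_def by measurable
  have gi: "integrable lborel g"
    by (rule integrableI_nonneg[OF gm]) (use g0 nn in auto)
  have gv: "(\<integral>s. g s \<partial>lborel) = Gamma \<nu>"
    by (rule integral_eq_nn_integral[OF gm, THEN trans]) (use g0 nn \<nu> in \<open>auto intro: less_imp_le\<close>)
  have eq: "indicator {0<..} s * (s powr (\<nu> - 1) * exp (- (x * s))) = x powr (1 - \<nu>) * g (0 + x * s)" for s
  proof (cases "s > 0")
    case True
    have "x powr (1 - \<nu>) * (x * s) powr (\<nu> - 1) = s powr (\<nu> - 1)"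
      using x True by (simp add: powr_mult flip: powr_add mult.assoc)
    then show ?thesis using x True by (simp add: g_def exp_minus divide_inverse flip: mult.assoc)
  next
    case False
    then show ?thesis using x by (cases "s = 0") (auto simp: g_def mult_less_0_iff indicator_def not_less zero_le_mult_iff)
  qed
  show "integrable lborel (\<lambda>s. indicator {0<..} s * (s powr (\<nu> - 1) * exp (- (x * s))))"
    unfolding eq using lborel_integrable_real_affine[OF gi, of x 0] x by (intro integrable_mult_right) auto
  have "(\<integral>s. g s \<partial>lborel) = \<bar>x\<bar> *\<^sub>R (\<integral>s. g (0 + x * s) \<partial>lborel)"
    using x by (intro lborel_integral_real_affine) simp
  then have "(\<integral>s. g (0 + x * s) \<partial>lborel) = Gamma \<nu> / x" using x by (simp add: gv)
  then have "(\<integral>s. indicator {0<..} s * (s powr (\<nu> - 1) * exp (- (x * s))) \<partial>lborel) = x powr (1 - \<nu>) * (Gamma \<nu> / x)"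
    unfolding eq integral_mult_right_zero by simp
  also have "\<dots> = Gamma \<nu> * x powr (- \<nu>)"
    using x by (simp add: powr_diff powr_minus field_simps)
  finally show "(\<integral>s. indicator {0<..} s * (s powr (\<nu> - 1) * exp (- (x * s))) \<partial>lborel) = Gamma \<nu> * x powr (- \<nu>)" .
qed

lemma laplace_transform_holomorphic:
  fixes k :: "real \<Rightarrow> real"
  assumes k: "k \<in> borel_measurable borel" "\<And>s. k s \<ge> 0"
    and int: "\<And>x. x > 0 \<Longrightarrow> integrable lborel (\<lambda>s. indicator {0<..} s * (k s * exp (- (x * s))))"
  shows "(\<lambda>z. \<integral>s. indicator {0<..} s *\<^sub>R (of_real (k s) * exp (- (z * of_real s))) \<partial>lborel)
    holomorphic_on {z. 0 < Re z}"
proof -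
  define L where "L = (\<lambda>x. \<integral>s. indicator {0<..} s * (k s * exp (- (x * s))) \<partial>lborel)"
  define f where "f = (\<lambda>(z :: complex) s. indicator {0<..} s *\<^sub>R (of_real (k s) * exp (- (z * of_real s))))"
  define d where "d = (\<lambda>z s. of_real (- s) * f z s)"
  have m [measurable]: "f z \<in> borel_measurable lborel" for z using k(1) unfolding f_def by measurable
  have md [measurable]: "d z \<in> borel_measurable lborel" for z unfolding d_def by measurable
  have nf: "cmod (f z s) = indicator {0<..} s * (k s * exp (- (Re z * s)))" for z s
    using k(2)[of s] by (simp add: f_def norm_mult cmod_exp_neg)
  have fint: "integrable lborel (f z)" if "Re z > 0" for z
    by (rule Bochner_Integration.integrable_bound[OF int[OF that]]) (auto simp: nf)
  have lin: "s \<le> exp (a * s) / a" if "a > 0" for a s :: real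
  proof -
    have "a * s \<le> exp (a * s)" using exp_ge_add_one_self[of "a * s"] by linarith
    then show ?thesis using that by (simp add: field_simps)
  qed
  have "\<exists>l. ((\<lambda>z. \<integral>s. f z s \<partial>lborel) has_field_derivative l) (at z)" if z: "Re z > 0" for z
  proof -
    define x where "x = Re z"
    have x: "x > 0" using z by (simp add: x_def)
    have dint: "integrable lborel (d z)"
    proof (rule Bochner_Integration.integrable_bound)
      show "integrable lborel (\<lambda>s. (2 / x) * (indicator {0<..} s * (k s * exp (- (x / 2 * s)))))"
        using x by (intro integrable_mult_right int) simp
      show "AE s in lborel. norm (d z s) \<le> norm ((2 / x) * (indicator {0<..} s * (k s * exp (- (x / 2 * s)))))"
      proof (rule AE_I2)
        fix s :: real
        show "norm (d z s) \<le> norm ((2 / x) * (indicator {0<..} s * (k s * exp (- (x / 2 * s)))))"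
        proof (cases "s > 0")
          case True
          have "norm (d z s) = k s * (s * exp (- (x * s)))"
            using True by (simp add: d_def norm_mult nf x_def)
          also have "\<dots> \<le> k s * ((exp (x / 2 * s) / (x / 2)) * exp (- (x * s)))"
            using lin[of "x / 2" s] x k(2)[of s] by (intro mult_left_mono mult_right_mono) auto
          also have "\<dots> = (2 / x) * (k s * exp (- (x / 2 * s)))"
            by (simp add: field_simps flip: exp_add)
          finally show ?thesis using True x k(2)[of s] by simp
        qed (simp add: d_def f_def)
      qed
    qed simp
    define C where "C = 64 / x\<^sup>2 * L (x / 2)"
    have est: "cmod (((\<integral>s. f (z + h) s \<partial>lborel) - (\<integral>s. f z s \<partial>lborel)) / h - (\<integral>s. d z s \<partial>lborel)) \<le> C * cmod h"
      if h: "h \<noteq> 0" "cmod h < x / 4" for h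
    proof -
      have "Re (z + h) > 0" using h abs_Re_le_cmod[of h] x by (simp add: x_def)
      note i = fint[OF this] fint[OF z] dint
      have "(\<integral>s. f (z + h) s \<partial>lborel) - (\<integral>s. f z s \<partial>lborel) - h * (\<integral>s. d z s \<partial>lborel)
          = (\<integral>s. f (z + h) s - f z s - h * d z s \<partial>lborel)"
        using i by simp
      also have "cmod \<dots> \<le> (\<integral>s. (64 / x\<^sup>2 * (cmod h)\<^sup>2) * (indicator {0<..} s * (k s * exp (- (x / 2 * s)))) \<partial>lborel)"
      proof (rule Bochner_Integration.integral_norm_bound_integral)
        show "integrable lborel (\<lambda>s. f (z + h) s - f z s - h * d z s)" using i by simp
        show "integrable lborel (\<lambda>s. (64 / x\<^sup>2 * (cmod h)\<^sup>2) * (indicator {0<..} s * (k s * exp (- (x / 2 * s)))))"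
          using x by (intro integrable_mult_right int) simp
        fix s :: real
        show "cmod (f (z + h) s - f z s - h * d z s) \<le> (64 / x\<^sup>2 * (cmod h)\<^sup>2) * (indicator {0<..} s * (k s * exp (- (x / 2 * s))))"
        proof (cases "s > 0")
          case True
          have fh: "f (z + h) s = f z s * exp (- (h * of_real s))"
            using True by (simp add: f_def algebra_simps flip: exp_add)
          have "f (z + h) s - f z s - h * d z s = f z s * (exp (- (h * of_real s)) - (1 + - (h * of_real s)))"
            unfolding fh d_def by (simp add: algebra_simps)
          also have "cmod \<dots> \<le> (k s * exp (- (x * s))) * (exp (cmod h * s) * (cmod h * s)\<^sup>2)"
          proof -
            have "cmod (exp (- (h * of_real s)) - (\<Sum>i\<le>1. (- (h * of_real s)) ^ i / fact i)) \<le>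
                exp \<bar>Re (- (h * of_real s))\<bar> * cmod (- (h * of_real s)) ^ Suc 1 / fact 1"
              by (rule Taylor_exp)
            moreover have "\<bar>Re (- (h * of_real s))\<bar> \<le> cmod h * s"
              using abs_Re_le_cmod[of h] True by (simp add: abs_mult mult_right_mono)
            ultimately have "cmod (exp (- (h * of_real s)) - (1 + - (h * of_real s))) \<le> exp (cmod h * s) * (cmod h * s)\<^sup>2"
              using True mult_right_mono[of "exp \<bar>Re h * s\<bar>" "exp (cmod h * s)" "cmod h * s * (cmod h * s)"]
              by (simp add: norm_mult power2_eq_square)
            then show ?thesis using True k(2)[of s] by (simp add: norm_mult nf x_def mult_left_mono)
          qed
          also have "\<dots> \<le> (k s * exp (- (x * s))) * (exp (x / 4 * s) * ((cmod h)\<^sup>2 * (64 / x\<^sup>2 * exp (x / 4 * s))))"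
          proof (intro mult_left_mono mult_mono)
            show "exp (cmod h * s) \<le> exp (x / 4 * s)" using h True by (simp add: mult_right_mono)
            have "s\<^sup>2 \<le> (exp (x / 8 * s) / (x / 8))\<^sup>2"
              using lin[of "x / 8" s] x True by (intro power_mono) auto
            also have "\<dots> = 64 / x\<^sup>2 * exp (x / 4 * s)"
              by (simp add: power_divide power2_eq_square flip: exp_add)
            finally show "(cmod h * s)\<^sup>2 \<le> (cmod h)\<^sup>2 * (64 / x\<^sup>2 * exp (x / 4 * s))"
              unfolding power_mult_distrib by (intro mult_left_mono) auto
          qed (use k(2)[of s] in auto)
          also have "\<dots> = (64 / x\<^sup>2 * (cmod h)\<^sup>2) * (k s * (exp (- (x * s)) * (exp (x / 4 * s) * exp (x / 4 * s))))"
            by simp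
          also have "exp (- (x * s)) * (exp (x / 4 * s) * exp (x / 4 * s)) = exp (- (x / 2 * s))"
            by (simp flip: exp_add)
          finally show ?thesis using True by simp
        qed (simp add: d_def f_def)
      qed
      also have "\<dots> = C * cmod h * cmod h"
        unfolding integral_mult_right_zero C_def L_def by (simp add: power2_eq_square)
      finally have "cmod ((\<integral>s. f (z + h) s \<partial>lborel) - (\<integral>s. f z s \<partial>lborel) - h * (\<integral>s. d z s \<partial>lborel)) / cmod h \<le> C * cmod h"
        using h by (simp add: divide_le_eq)
      then show ?thesis using h by (simp add: norm_divide[symmetric] diff_divide_distrib)
    qed
    have "((\<lambda>h. ((\<integral>s. f (z + h) s \<partial>lborel) - (\<integral>s. f z s \<partial>lborel)) / h - (\<integral>s. d z s \<partial>lborel)) \<longlongrightarrow> 0) (at 0)"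
    proof (rule Lim_null_comparison)
      show "\<forall>\<^sub>F h in at 0. norm (((\<integral>s. f (z + h) s \<partial>lborel) - (\<integral>s. f z s \<partial>lborel)) / h - (\<integral>s. d z s \<partial>lborel)) \<le> C * cmod h"
        unfolding eventually_at using est x by (intro exI[of _ "x / 4"]) auto
      show "((\<lambda>h. C * cmod h) \<longlongrightarrow> 0) (at 0)" by (auto intro!: tendsto_eq_intros)
    qed
    then have "((\<lambda>z. \<integral>s. f z s \<partial>lborel) has_field_derivative (\<integral>s. d z s \<partial>lborel)) (at z)"
      unfolding DERIV_def LIM_zero_iff .
    then show ?thesis by blast
  qed
  then show ?thesis
    unfolding holomorphic_on_def field_differentiable_def f_def
    by (blast intro: has_field_derivative_at_within)
qed

lemma powr_laplace_transform:
  fixes \<nu> :: real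
  assumes \<nu>: "\<nu> > 0" and z: "Re z > 0"
  shows "(\<integral>s. indicator {0<..} s *\<^sub>R (of_real (s powr (\<nu> - 1)) * exp (- (z * of_real s))) \<partial>lborel)
    = of_real (Gamma \<nu>) * z powr (of_real (- \<nu>))"
proof -
  define f where "f = (\<lambda>z :: complex. (\<integral>s. indicator {0<..} s *\<^sub>R (of_real (s powr (\<nu> - 1)) * exp (- (z * of_real s))) \<partial>lborel)
    - of_real (Gamma \<nu>) * z powr (of_real (- \<nu>)))"
  let ?S = "{z. 0 < Re z}"
  have "f z = 0"
  proof (rule analytic_continuation[where f = f and S = ?S and U = "complex_of_real ` {0<..}" and \<xi> = 1])
    have "z \<in> ?S \<Longrightarrow> z \<notin> \<real>\<^sub>\<le>\<^sub>0" for z by (auto simp: complex_nonpos_Reals_iff)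
    then show "f holomorphic_on ?S"
      unfolding f_def using integrable_powr_exp[OF \<nu>]
      by (intro holomorphic_intros laplace_transform_holomorphic) auto
    show "open ?S" by (rule open_halfspace_Re_gt)
    show "connected ?S" by (intro convex_connected convex_halfspace_Re_gt)
    show "1 islimpt complex_of_real ` {0<..}"
      unfolding islimpt_approachable
    proof (intro allI impI)
      fix e :: real assume e: "e > 0"
      have "dist (complex_of_real (1 + e / 2)) (complex_of_real 1) = e / 2"
        using e by (simp only: dist_of_real) (simp add: dist_real_def)
      then have "dist (complex_of_real (1 + e / 2)) 1 < e" "complex_of_real (1 + e / 2) \<noteq> 1" using e by auto
      moreover have "complex_of_real (1 + e / 2) \<in> complex_of_real ` {0<..}"
        using e by (intro imageI) simp
      ultimately show "\<exists>x'\<in>complex_of_real ` {0<..}. x' \<noteq> 1 \<and> dist x' 1 < e" by blast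
    qed
    fix u assume "u \<in> complex_of_real ` {0<..}"
    then obtain x where x: "u = of_real x" "x > 0" by auto
    have "indicator {0<..} s *\<^sub>R (of_real (s powr (\<nu> - 1)) * exp (- (u * of_real s))) =
        complex_of_real (indicator {0<..} s * (s powr (\<nu> - 1) * exp (- (x * s))))" for s
      unfolding x(1) scaleR_conv_of_real by (simp flip: exp_of_real)
    then have "(\<integral>s. indicator {0<..} s *\<^sub>R (of_real (s powr (\<nu> - 1)) * exp (- (u * of_real s))) \<partial>lborel)
        = of_real (Gamma \<nu> * x powr (- \<nu>))"
      by (simp only: integral_complex_of_real integral_powr_exp[OF \<nu> x(2)])
    then show "f u = 0" using x(2) unfolding f_def x(1) by (simp add: powr_of_real flip: of_real_minus)
  qed (use z in auto)
  then show ?thesis by (simp add: f_def)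
qed

lemma integrable_continuous_indicator:
  fixes f :: "real \<Rightarrow> complex"
  assumes "continuous_on {a..b} f"
  shows "integrable lborel (\<lambda>x. indicator {a..b} x *\<^sub>R f x)"
  using borel_integrable_atLeastAtMost'[OF assms] by (simp add: set_integrable_def)

lemma norm_integral_le_dominating:
  fixes f :: "'a \<Rightarrow> 'b::{banach,second_countable_topology}"
  assumes "integrable M w" "\<And>x. norm (f x) \<le> w x"
  shows "norm (\<integral>x. f x \<partial>M) \<le> (\<integral>x. w x \<partial>M)"
proof -
  have "norm (\<integral>x. f x \<partial>M) \<le> (\<integral>x. norm (f x) \<partial>M)" by (rule integral_norm_bound)
  also have "\<dots> \<le> (\<integral>x. w x \<partial>M)"
    using assms(2) norm_ge_zero order_trans by (intro integral_mono'[OF assms(1)]) blast+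
  finally show ?thesis .
qed

lemma volterra_exponential_convolution:
  fixes a :: "real \<Rightarrow> real" and v y :: "real \<Rightarrow> complex" and z q p :: complex and t :: real
  defines "b \<equiv> \<lambda>u. \<integral>s. indicator {0..u} s *\<^sub>R (exp (z * of_real (u - s)) * of_real (a s)) \<partial>lborel"
  assumes t: "t > 0" and z: "z \<noteq> 0" and q: "q \<noteq> 0"
    and a: "a \<in> borel_measurable borel" "\<And>s. s \<in> {0..t} \<Longrightarrow> \<bar>a s\<bar> \<le> Ca"
    and v: "continuous_on {0..t} v" and y: "continuous_on {0..t} y"
    and eq: "\<And>\<tau>. \<tau> \<in> {0..t} \<Longrightarrow>
      (v \<tau> + y \<tau>) / q = p + (\<integral>s. indicator {0..\<tau>} s *\<^sub>R (of_real (a (\<tau> - s)) * v s) \<partial>lborel)"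
  shows "integrable lborel (\<lambda>s. indicator {0..t} s *\<^sub>R ((exp (z * of_real (t - s)) / q - b (t - s)) * v s))"
    and "(\<integral>s. indicator {0..t} s *\<^sub>R (exp (z * of_real (t - s)) * y s) \<partial>lborel) =
      q / z * p * (exp (z * of_real t) - 1)
      - q * (\<integral>s. indicator {0..t} s *\<^sub>R ((exp (z * of_real (t - s)) / q - b (t - s)) * v s) \<partial>lborel)"
proof -
  have am [measurable]: "a \<in> borel_measurable borel" by (rule a(1))
  define vv where "vv = (\<lambda>s. indicator {0..t} s *\<^sub>R v s)"
  have vm [measurable]: "vv \<in> borel_measurable borel"
    unfolding vv_def using borel_measurable_continuous_on_indicator[OF _ v] by simp
  have "bounded (v ` {0..t})" by (intro compact_imp_bounded compact_continuous_image v) simp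
  then obtain Mv where "\<forall>u\<in>v ` {0..t}. cmod u \<le> Mv" unfolding bounded_iff by blast
  then have Mv: "cmod (v s) \<le> Mv" if "s \<in> {0..t}" for s using that by blast
  have Mv0: "Mv \<ge> 0" and Ca0: "Ca \<ge> 0"
    using order_trans[OF norm_ge_zero Mv[of 0]] order_trans[OF abs_ge_zero a(2)[of 0]] t by auto
  define K where "K = exp (\<bar>Re z\<bar> * t)"
  have K: "cmod (exp (z * of_real r)) \<le> K" if "0 \<le> r" "r \<le> t" for r
  proof -
    have "Re z * r \<le> \<bar>Re z\<bar> * t" using that by (intro mult_mono) auto
    then show ?thesis by (simp add: norm_exp_eq_Re K_def)
  qed
  define f where "f = (\<lambda>s \<tau>. (if s \<le> \<tau> \<and> \<tau> \<le> t then 1 else 0) *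
      (exp (z * of_real (t - \<tau>)) * of_real (a (\<tau> - s)) * vv s))"
  have fm: "case_prod f \<in> borel_measurable (lborel \<Otimes>\<^sub>M lborel)"
    unfolding f_def by measurable
  have fb: "cmod (f s \<tau>) \<le> indicator {0..t} s * (Mv * Ca * K) * indicator {0..t} \<tau>" for s \<tau>
  proof (cases "0 \<le> s \<and> s \<le> \<tau> \<and> \<tau> \<le> t")
    case True
    have "cmod (f s \<tau>) = cmod (exp (z * of_real (t - \<tau>))) * \<bar>a (\<tau> - s)\<bar> * cmod (v s)"
      using True by (simp add: f_def vv_def norm_mult)
    also have "\<dots> \<le> K * Ca * Mv"
      using True Ca0 Mv0 by (intro mult_mono K a(2) Mv mult_nonneg_nonneg) (auto simp: K_def)
    finally show ?thesis using True by (simp add: mult.commute mult.left_commute)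
  next
    case False
    then have "f s \<tau> = 0" by (auto simp: f_def vv_def)
    then show ?thesis using Mv0 Ca0 by (simp add: K_def)
  qed
  have iz: "integrable lborel (\<lambda>s. indicator {0..t} s * r :: real)" for r
    using t by (intro integrable_mult_left integrable_real_indicator) auto
  have i1: "integrable lborel (\<lambda>\<tau>. indicator {0..t} \<tau> :: real)" using iz[of 1] by simp
  have fub: "(\<integral>\<tau>. (\<integral>s. f s \<tau> \<partial>lborel) \<partial>lborel) = (\<integral>s. (\<integral>\<tau>. f s \<tau> \<partial>lborel) \<partial>lborel)"
    by (rule lborel_swap_dominated[OF fm iz i1 fb])
  have inner: "(\<integral>\<tau>. f s \<tau> \<partial>lborel) = b (t - s) * vv s" for s
  proof -
    have "(\<integral>\<tau>. f s \<tau> \<partial>lborel) = (\<integral>\<sigma>. f s (s + 1 * \<sigma>) \<partial>lborel)"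
      by (subst lborel_integral_real_affine[of 1 _ s]) auto
    also have "(\<lambda>\<sigma>. f s (s + 1 * \<sigma>)) = (\<lambda>\<sigma>. indicator {0..t - s} \<sigma> *\<^sub>R (exp (z * of_real (t - s - \<sigma>)) * of_real (a \<sigma>)) * vv s)"
      by (auto simp: f_def fun_eq_iff indicator_def algebra_simps)
    finally show ?thesis unfolding b_def integral_mult_left_zero .
  qed
  have bm [measurable]: "b \<in> borel_measurable borel"
    unfolding b_def indicator_def atLeastAtMost_iff by measurable
  have bb: "cmod (b u) \<le> t * (K * Ca)" if u: "u \<in> {0..t}" for u
  proof -
    have "cmod (b u) \<le> (\<integral>s. indicator {0..t} s * (K * Ca) \<partial>lborel)"
      unfolding b_def
    proof (rule norm_integral_le_dominating[OF iz])
      fix s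
      show "norm (indicator {0..u} s *\<^sub>R (exp (z * of_real (u - s)) * of_real (a s))) \<le> indicator {0..t} s * (K * Ca)"
      proof (cases "s \<in> {0..u}")
        case True
        then have "cmod (exp (z * of_real (u - s))) * \<bar>a s\<bar> \<le> K * Ca"
          using u by (intro mult_mono K a(2)) (auto simp: K_def)
        then show ?thesis using True u by (simp add: norm_mult)
      qed (use Ca0 in \<open>auto simp: K_def\<close>)
    qed
    also have "\<dots> = t * (K * Ca)" using t by simp
    finally show ?thesis .
  qed
  have ib: "integrable lborel (\<lambda>s. indicator {0..t} s *\<^sub>R (b (t - s) * v s))"
  proof (rule Bochner_Integration.integrable_bound[OF iz[of "t * (K * Ca) * Mv"]])
    have "(\<lambda>s. indicator {0..t} s *\<^sub>R (b (t - s) * v s)) = (\<lambda>s. b (t - s) * vv s)"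
      by (auto simp: vv_def fun_eq_iff indicator_def)
    then show "(\<lambda>s. indicator {0..t} s *\<^sub>R (b (t - s) * v s)) \<in> borel_measurable lborel"
      by simp
    show "AE s in lborel. norm (indicator {0..t} s *\<^sub>R (b (t - s) * v s)) \<le> norm (indicator {0..t} s * (t * (K * Ca) * Mv))"
    proof (rule AE_I2)
      fix s
      show "norm (indicator {0..t} s *\<^sub>R (b (t - s) * v s)) \<le> norm (indicator {0..t} s * (t * (K * Ca) * Mv))"
      proof (cases "s \<in> {0..t}")
        case True
        then have "cmod (b (t - s)) * cmod (v s) \<le> t * (K * Ca) * Mv"
          using t Ca0 by (intro mult_mono bb Mv) (auto simp: K_def)
        then show ?thesis using True by (simp add: norm_mult)
      qed simp
    qed
  qed
  have ce: "continuous_on {0..t} (\<lambda>s. exp (z * of_real (t - s)))" by (intro continuous_intros)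
  have iv: "integrable lborel (\<lambda>s. indicator {0..t} s *\<^sub>R (exp (z * of_real (t - s)) * v s))"
    and iy: "integrable lborel (\<lambda>s. indicator {0..t} s *\<^sub>R (exp (z * of_real (t - s)) * y s))"
    and ie: "integrable lborel (\<lambda>s. indicator {0..t} s *\<^sub>R exp (z * of_real (t - s)))"
    by (intro integrable_continuous_indicator continuous_on_mult ce v y)+
  have Req: "(\<lambda>s. indicator {0..t} s *\<^sub>R ((exp (z * of_real (t - s)) / q - b (t - s)) * v s)) =
      (\<lambda>s. 1 / q * (indicator {0..t} s *\<^sub>R (exp (z * of_real (t - s)) * v s)) - indicator {0..t} s *\<^sub>R (b (t - s) * v s))"
    by (auto simp: fun_eq_iff indicator_def algebra_simps)
  show "integrable lborel (\<lambda>s. indicator {0..t} s *\<^sub>R ((exp (z * of_real (t - s)) / q - b (t - s)) * v s))"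
    unfolding Req by (intro Bochner_Integration.integrable_diff integrable_mult_right iv ib)
  define Ev where "Ev = (\<integral>s. indicator {0..t} s *\<^sub>R (exp (z * of_real (t - s)) * v s) \<partial>lborel)"
  define Ey where "Ey = (\<integral>s. indicator {0..t} s *\<^sub>R (exp (z * of_real (t - s)) * y s) \<partial>lborel)"
  define E1 where "E1 = (\<integral>s. indicator {0..t} s *\<^sub>R exp (z * of_real (t - s)) \<partial>lborel)"
  define Eb where "Eb = (\<integral>s. indicator {0..t} s *\<^sub>R (b (t - s) * v s) \<partial>lborel)"
  have "Eb = (\<integral>s. (\<integral>\<tau>. f s \<tau> \<partial>lborel) \<partial>lborel)"
    unfolding Eb_def inner by (rule Bochner_Integration.integral_cong) (auto simp: vv_def)
  also have "\<dots> = (\<integral>\<tau>. (\<integral>s. f s \<tau> \<partial>lborel) \<partial>lborel)" by (rule fub[symmetric])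
  also have "\<dots> = (\<integral>\<tau>. 1 / q * (indicator {0..t} \<tau> *\<^sub>R (exp (z * of_real (t - \<tau>)) * v \<tau>)) +
      1 / q * (indicator {0..t} \<tau> *\<^sub>R (exp (z * of_real (t - \<tau>)) * y \<tau>)) -
      p * (indicator {0..t} \<tau> *\<^sub>R exp (z * of_real (t - \<tau>))) \<partial>lborel)"
  proof (rule Bochner_Integration.integral_cong[OF refl])
    fix \<tau> :: real
    show "(\<integral>s. f s \<tau> \<partial>lborel) = 1 / q * (indicator {0..t} \<tau> *\<^sub>R (exp (z * of_real (t - \<tau>)) * v \<tau>)) +
      1 / q * (indicator {0..t} \<tau> *\<^sub>R (exp (z * of_real (t - \<tau>)) * y \<tau>)) -
      p * (indicator {0..t} \<tau> *\<^sub>R exp (z * of_real (t - \<tau>)))"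
    proof (cases "\<tau> \<in> {0..t}")
      case True
      have "(\<lambda>s. f s \<tau>) = (\<lambda>s. exp (z * of_real (t - \<tau>)) * (indicator {0..\<tau>} s *\<^sub>R (of_real (a (\<tau> - s)) * v s)))"
        using True by (auto simp: f_def vv_def fun_eq_iff indicator_def)
      then have "(\<integral>s. f s \<tau> \<partial>lborel) = exp (z * of_real (t - \<tau>)) * ((v \<tau> + y \<tau>) / q - p)"
        using eq[OF True] by (simp only: integral_mult_right_zero) simp
      then show ?thesis using True by (simp add: algebra_simps add_divide_distrib)
    next
      case False
      then have "(\<lambda>s. f s \<tau>) = (\<lambda>s. 0)" by (auto simp: f_def vv_def fun_eq_iff)
      then show ?thesis using False by simp
    qed
  qed
  also have "\<dots> = 1 / q * Ev + 1 / q * Ey - p * E1"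
    unfolding Ev_def Ey_def E1_def
    by (simp only: Bochner_Integration.integral_add Bochner_Integration.integral_diff Bochner_Integration.integrable_add
        integrable_mult_right integral_mult_right_zero iv iy ie)
  finally have main: "Eb = 1 / q * Ev + 1 / q * Ey - p * E1" .
  have E1v: "E1 = (exp (z * of_real t) - 1) / z"
  proof -
    have "E1 = - exp (z * of_real (t - t)) / z - (- exp (z * of_real (t - 0)) / z)"
      unfolding E1_def
    proof (rule integral_FTC_atLeastAtMost)
      fix s :: real
      have "((\<lambda>u. - exp (z * (of_real t - u)) / z) has_field_derivative exp (z * of_real (t - s))) (at (of_real s))"
        using z by (auto intro!: derivative_eq_intros simp: field_simps)
      from field_vector_diff_chain_at[OF has_vector_derivative_of_real[OF DERIV_ident] this]
      show "((\<lambda>s. - exp (z * of_real (t - s)) / z) has_vector_derivative exp (z * of_real (t - s))) (at s within {0..t})"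
        by (simp add: o_def has_vector_derivative_at_within)
    qed (use t ce in auto)
    then show ?thesis by (simp add: diff_divide_distrib)
  qed
  define R where "R = (\<integral>s. indicator {0..t} s *\<^sub>R ((exp (z * of_real (t - s)) / q - b (t - s)) * v s) \<partial>lborel)"
  have Rv: "R = 1 / q * Ev - Eb"
    unfolding R_def Req Ev_def Eb_def
    by (simp only: Bochner_Integration.integral_diff integrable_mult_right integral_mult_right_zero iv ib)
  have "q / z * p * (exp (z * of_real t) - 1) - q * R = q * (p * E1) - q * (1 / q * Ev - Eb)"
    by (simp add: E1v Rv)
  also have "\<dots> = Ey" unfolding main using q by (simp add: field_simps)
  finally show "(\<integral>s. indicator {0..t} s *\<^sub>R (exp (z * of_real (t - s)) * y s) \<partial>lborel) =
      q / z * p * (exp (z * of_real t) - 1)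
      - q * (\<integral>s. indicator {0..t} s *\<^sub>R ((exp (z * of_real (t - s)) / q - b (t - s)) * v s) \<partial>lborel)"
    by (simp add: Ey_def R_def)
qed

lemma exponential_convolution_entire:
  assumes y: "continuous_on {0..t} y"
  shows "(\<lambda>z. \<integral>s. indicator {0..t} s *\<^sub>R (exp (z * of_real (t - s)) * y s) \<partial>lborel) holomorphic_on S"
proof -
  have "(\<lambda>z. integral (cbox 0 t) (\<lambda>s. exp (z * of_real (t - s)) * y s)) holomorphic_on UNIV"
  proof (rule leibniz_rule_holomorphic)
    fix z :: complex and s
    show "((\<lambda>z. exp (z * of_real (t - s)) * y s) has_field_derivative
        of_real (t - s) * exp (z * of_real (t - s)) * y s) (at z within UNIV)"
      by (auto intro!: derivative_eq_intros)
    show "(\<lambda>s. exp (z * of_real (t - s)) * y s) integrable_on cbox 0 t"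
      using y by (intro integrable_continuous continuous_intros) (auto simp: cbox_interval)
  next
    have "continuous_on (UNIV \<times> cbox 0 t) (\<lambda>x. y (snd x))"
      by (rule continuous_on_compose2[OF y continuous_on_snd[OF continuous_on_id]]) (auto simp: cbox_interval)
    then show "continuous_on (UNIV \<times> cbox 0 t) (\<lambda>(z, s). of_real (t - s) * exp (z * of_real (t - s)) * y s)"
      unfolding case_prod_unfold by (intro continuous_intros)
  qed auto
  moreover have "integral (cbox 0 t) (\<lambda>s. exp (z * of_real (t - s)) * y s) =
      (\<integral>s. indicator {0..t} s *\<^sub>R (exp (z * of_real (t - s)) * y s) \<partial>lborel)" for z
  proof -
    have "set_integrable lborel {0..t} (\<lambda>s. exp (z * of_real (t - s)) * y s)"
      by (intro borel_integrable_atLeastAtMost' continuous_intros y)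
    from set_borel_integral_eq_integral(2)[OF this] show ?thesis
      by (simp add: set_lebesgue_integral_def cbox_interval)
  qed
  ultimately have "(\<lambda>z. \<integral>s. indicator {0..t} s *\<^sub>R (exp (z * of_real (t - s)) * y s) \<partial>lborel) holomorphic_on UNIV"
    by (simp only:)
  then show ?thesis by (rule holomorphic_on_subset) simp
qed

lemma cmod_add_of_nat_lower:
  assumes c: "0 < c" "c \<le> 1 / 4" and z: "- c * cmod z < Re z" and n: "n \<ge> 0"
  shows "n / 2 \<le> cmod (of_real n + z)" and "cmod z / 2 \<le> cmod (of_real n + z)"
proof -
  have "(cmod (of_real n + z))\<^sup>2 = n\<^sup>2 + 2 * n * Re z + (cmod z)\<^sup>2"
    unfolding cmod_power2 by (simp add: power2_eq_square algebra_simps)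
  moreover have "2 * n * Re z \<ge> 2 * n * (- (1 / 4) * cmod z)"
  proof (rule mult_left_mono)
    have "c * cmod z \<le> 1 / 4 * cmod z" using c by (intro mult_right_mono) auto
    then show "- (1 / 4) * cmod z \<le> Re z" using z by linarith
  qed (use n in auto)
  moreover have "2 * (n * cmod z) \<le> n\<^sup>2 + (cmod z)\<^sup>2"
    using sum_squares_bound[of n "cmod z"] by simp
  ultimately have *: "(cmod (of_real n + z))\<^sup>2 \<ge> (n\<^sup>2 + (cmod z)\<^sup>2) * (3 / 4)" by (simp add: algebra_simps)
  have "p / 4 \<le> r \<and> q / 4 \<le> r" if "(p + q) * (3 / 4) \<le> r" "0 \<le> p" "0 \<le> q" for p q r :: real
    using that by auto
  from this[OF * zero_le_power2 zero_le_power2]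
  have "(n / 2)\<^sup>2 \<le> (cmod (of_real n + z))\<^sup>2" "(cmod z / 2)\<^sup>2 \<le> (cmod (of_real n + z))\<^sup>2"
    by (auto simp: power_divide)
  then show "n / 2 \<le> cmod (of_real n + z)" "cmod z / 2 \<le> cmod (of_real n + z)"
    using power2_le_imp_le[of "n / 2"] power2_le_imp_le[of "cmod z / 2"] by simp_all
qed

definition erlang_symbol :: "real \<Rightarrow> complex \<Rightarrow> complex" where
  "erlang_symbol n z = of_real (n ^ 3) / (of_real n + z) ^ 3"

lemma erlang_symbol:
  assumes c: "0 < c" "c \<le> 1 / 4" and z: "- c * cmod z < Re z" and n: "n > 0"
  shows "of_real n + z \<noteq> 0" and "cmod (erlang_symbol n z) \<le> 8"
    and "z \<noteq> 0 \<Longrightarrow> cmod (erlang_symbol n z) \<le> 8 * n ^ 3 / cmod z ^ 3"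
proof -
  note lo = cmod_add_of_nat_lower[OF c z less_imp_le[OF n]]
  show nz: "of_real n + z \<noteq> 0" using lo(1) n by auto
  have eq: "cmod (erlang_symbol n z) = n ^ 3 / cmod (of_real n + z) ^ 3"
    using n by (simp add: erlang_symbol_def norm_divide norm_power)
  have "n ^ 3 / cmod (of_real n + z) ^ 3 \<le> n ^ 3 / (n / 2) ^ 3"
    using lo(1) n nz by (intro divide_left_mono power_mono) auto
  then show "cmod (erlang_symbol n z) \<le> 8" using n by (simp add: eq power_divide)
  assume z0: "z \<noteq> 0"
  have "n ^ 3 / cmod (of_real n + z) ^ 3 \<le> n ^ 3 / (cmod z / 2) ^ 3"
    using lo(2) n nz z0 by (intro divide_left_mono power_mono) auto
  then show "cmod (erlang_symbol n z) \<le> 8 * n ^ 3 / cmod z ^ 3" by (simp add: eq power_divide mult.commute)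
qed

definition kernel_constant :: complex where
  "kernel_constant = (\<integral>x. exp (Complex 1 x) / Complex 1 x ^ 3 \<partial>lborel)"

lemma erlang_symbol_integral:
  assumes w: "w > 0" and n: "n > 0" and \<tau>: "\<tau> \<ge> 0"
  shows "(\<integral>x. erlang_symbol n (Complex w x) * exp (Complex w x * of_real \<tau>) \<partial>lborel) =
    kernel_constant * of_real (n ^ 3 * \<tau>\<^sup>2 * exp (- (n * \<tau>)))"
proof -
  have "erlang_symbol n (Complex w x) * exp (Complex w x * of_real \<tau>) =
    of_real (n ^ 3 * exp (- (n * \<tau>))) * (exp (of_real \<tau> * Complex (w + n) x) / Complex (w + n) x ^ 3)" for x
  proof -
    have eq: "Complex (w + n) x = of_real n + Complex w x" by (simp add: complex_eq_iff)
    have "exp (of_real \<tau> * Complex (w + n) x) = exp (Complex w x * of_real \<tau>) * of_real (exp (n * \<tau>))"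
      unfolding eq by (simp add: algebra_simps exp_add flip: exp_of_real)
    then show ?thesis
      unfolding erlang_symbol_def eq by (simp add: exp_minus)
  qed
  then have "(\<integral>x. erlang_symbol n (Complex w x) * exp (Complex w x * of_real \<tau>) \<partial>lborel) =
      of_real (n ^ 3 * exp (- (n * \<tau>))) * (\<integral>x. exp (of_real \<tau> * Complex (w + n) x) / Complex (w + n) x ^ 3 \<partial>lborel)"
    by (simp only: integral_mult_right_zero)
  also have "\<dots> = of_real (n ^ 3 * exp (- (n * \<tau>))) * (of_real (\<tau>\<^sup>2) * kernel_constant)"
    using w n \<tau> by (subst exp_over_cube_integral_scaling) (auto simp: kernel_constant_def)
  finally show ?thesis by (simp add: mult.commute mult.left_commute)
qed

lemma smoothing_estimate:
  fixes q p :: "complex \<Rightarrow> complex" and a :: "real \<Rightarrow> real"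
  assumes c: "0 < c" "c \<le> 1 / 4" and \<rho>: "\<rho> > 0" and t: "t > 0"
    and q: "q holomorphic_on tilted_region \<rho> c" "\<And>z. z \<in> tilted_region \<rho> c \<Longrightarrow> q z \<in> \<Sigma>"
      "\<And>z. z \<in> tilted_region \<rho> c \<Longrightarrow> cmod (q z) \<le> 2 * cmod z" "0 \<notin> \<Sigma>"
    and p: "p holomorphic_on \<Sigma>" "\<And>z. z \<in> \<Sigma> \<Longrightarrow> cmod (p z) \<le> M"
    and y: "continuous_on {0..t} y"
    and a: "a \<in> borel_measurable borel" "\<And>s. s \<in> {0..t} \<Longrightarrow> \<bar>a s\<bar> \<le> Ca"
    and b: "\<And>z u. 2 * \<rho> < Re z \<Longrightarrow> u \<in> {0..t} \<Longrightarrow> cmod (exp (z * of_real u) / q z -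
      (\<integral>s. indicator {0..u} s *\<^sub>R (exp (z * of_real (u - s)) * of_real (a s)) \<partial>lborel)) \<le> Cb / cmod z"
    and v: "\<And>z. 2 * \<rho> < Re z \<Longrightarrow> \<exists>v. continuous_on {0..t} v \<and> (\<forall>s\<in>{0..t}. cmod (v s) \<le> M2) \<and>
      (\<forall>\<tau>\<in>{0..t}. (v \<tau> + y \<tau>) / q z =
        p (q z) + (\<integral>s. indicator {0..\<tau>} s *\<^sub>R (of_real (a (\<tau> - s)) * v s) \<partial>lborel))"
  shows "t\<^sup>2 * cmod (y t) \<le> exp (3 * \<rho> * t) * (64 / c\<^sup>2) * (pi / (3 * \<rho>)) / cmod kernel_constant * M"
proof -
  let ?\<Omega> = "tilted_region \<rho> c"
  define w where "w = 3 * \<rho>"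
  have w: "2 * \<rho> < w" "2 * \<rho> \<le> w" "w > 0" using \<rho> by (auto simp: w_def)
  have half: "z \<in> ?\<Omega>" if "2 * \<rho> < Re z" for z
    using cball_subset_tilted_region[OF c(1) _ \<rho>, of z] that c by (auto simp: subset_iff)
  have \<Omega>: "\<rho> < cmod z" "- c * cmod z < Re z" "z \<noteq> 0" if "z \<in> ?\<Omega>" for z
    using that \<rho> by (auto simp: tilted_region_def)
  define U where "U = (\<lambda>z. q z / z * p (q z))"
  have U: "U holomorphic_on ?\<Omega>"
  proof -
    have "(p \<circ> q) holomorphic_on ?\<Omega>"
      by (rule holomorphic_on_compose_gen[OF q(1) p(1)]) (use q(2) in auto)
    then show ?thesis unfolding U_def o_def by (intro holomorphic_intros q(1)) (use \<Omega> in auto)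
  qed
  have M0: "M \<ge> 0" using order_trans[OF norm_ge_zero p(2)[OF q(2)[OF half[of "of_real w"]]]] w by simp
  have Ub: "cmod (U z) \<le> 2 * M" if "z \<in> ?\<Omega>" for z
  proof -
    have "cmod (q z) / cmod z \<le> 2" using q(3)[OF that] \<Omega>[OF that] by (simp add: divide_le_eq)
    then show ?thesis unfolding U_def norm_mult norm_divide
      using p(2)[OF q(2)[OF that]] M0 by (intro mult_mono) auto
  qed
  define E where "E = (\<lambda>z. \<integral>s. indicator {0..t} s *\<^sub>R (exp (z * of_real (t - s)) * y s) \<partial>lborel)"
  define r where "r = (\<lambda>z. U z * exp (z * of_real t) - E z)"
  define Cr where "Cr = 2 * M + 2 * (t * \<bar>Cb * M2\<bar>)"
  have rb: "cmod (r z) \<le> Cr" if z: "2 * \<rho> < Re z" for z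
  proof -
    have z\<Omega>: "z \<in> ?\<Omega>" by (rule half[OF z])
    obtain v where v: "continuous_on {0..t} v" "\<And>s. s \<in> {0..t} \<Longrightarrow> cmod (v s) \<le> M2"
      "\<And>\<tau>. \<tau> \<in> {0..t} \<Longrightarrow> (v \<tau> + y \<tau>) / q z =
        p (q z) + (\<integral>s. indicator {0..\<tau>} s *\<^sub>R (of_real (a (\<tau> - s)) * v s) \<partial>lborel)"
      using assms(15)[OF z] by blast
    have q0: "q z \<noteq> 0" using q(2)[OF z\<Omega>] q(4) by auto
    define b where "b = (\<lambda>u. \<integral>s. indicator {0..u} s *\<^sub>R (exp (z * of_real (u - s)) * of_real (a s)) \<partial>lborel)"
    define R where "R = (\<integral>s. indicator {0..t} s *\<^sub>R ((exp (z * of_real (t - s)) / q z - b (t - s)) * v s) \<partial>lborel)"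
    have "E z = U z * (exp (z * of_real t) - 1) - q z * R"
      unfolding E_def R_def b_def U_def
      using volterra_exponential_convolution(2)[OF t \<Omega>(3)[OF z\<Omega>] q0 a v(1) y v(3)] by simp
    then have "r z = U z + q z * R" by (simp add: r_def algebra_simps)
    then have "cmod (r z) \<le> cmod (U z) + cmod (q z) * cmod R"
      using norm_triangle_ineq[of "U z" "q z * R"] by (simp add: norm_mult)
    also have "\<dots> \<le> 2 * M + (2 * cmod z) * (t * (\<bar>Cb * M2\<bar> / cmod z))"
    proof (intro add_mono mult_mono Ub z\<Omega> q(3))
      have "cmod R \<le> (\<integral>s. indicator {0..t} s * (\<bar>Cb * M2\<bar> / cmod z) \<partial>lborel)"
        unfolding R_def
      proof (rule norm_integral_le_dominating)
        show "integrable lborel (\<lambda>s. indicator {0..t} s * (\<bar>Cb * M2\<bar> / cmod z))"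
          using t by (intro integrable_mult_left integrable_real_indicator) auto
        fix s
        show "norm (indicator {0..t} s *\<^sub>R ((exp (z * of_real (t - s)) / q z - b (t - s)) * v s))
            \<le> indicator {0..t} s * (\<bar>Cb * M2\<bar> / cmod z)"
        proof (cases "s \<in> {0..t}")
          case True
          then have "cmod (exp (z * of_real (t - s)) / q z - b (t - s)) \<le> Cb / cmod z"
            unfolding b_def by (intro assms(14) z) auto
          then have "cmod (exp (z * of_real (t - s)) / q z - b (t - s)) * cmod (v s) \<le> Cb / cmod z * M2"
            using v(2)[OF True] by (intro mult_mono order_trans[OF norm_ge_zero]) auto
          also have "\<dots> \<le> \<bar>Cb * M2\<bar> / cmod z" by (simp add: divide_right_mono)
          finally show ?thesis using True by (simp add: norm_mult)
        qed simp
      qed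
      also have "\<dots> = t * (\<bar>Cb * M2\<bar> / cmod z)" using t by simp
      finally show "cmod R \<le> t * (\<bar>Cb * M2\<bar> / cmod z)" .
    qed auto
    also have "\<dots> = Cr" using \<Omega>(3)[OF z\<Omega>] by (simp add: Cr_def)
    finally show ?thesis .
  qed
  have bound: "cmod (of_real (t\<^sup>2) * (kernel_constant *
      (\<integral>s. indicator {0..t} s *\<^sub>R (of_real (n ^ 3 * (t - s)\<^sup>2 * exp (- (n * (t - s)))) * y s) \<partial>lborel)))
      \<le> exp (t * w) * (8 * (16 * M) / c\<^sup>2) * (pi / w)" if n: "n > 0" for n
  proof -
    define m where "m = erlang_symbol n"
    have m1: "of_real n + z \<noteq> 0" and m2: "cmod (m z) \<le> 8" and m3: "cmod (m z) \<le> 8 * n ^ 3 / cmod z ^ 3"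
      if "z \<in> ?\<Omega>" for z
      using erlang_symbol[OF c \<Omega>(2)[OF that] n] \<Omega>(3)[OF that] by (auto simp: m_def)
    have mh: "m holomorphic_on ?\<Omega>"
      unfolding m_def erlang_symbol_def by (intro holomorphic_intros) (use m1 in auto)
    have m4: "cmod (m z) \<le> 8 * n ^ 3 / \<rho> / (cmod z)\<^sup>2" if "z \<in> ?\<Omega>" for z
    proof -
      have "cmod (m z) \<le> 8 * n ^ 3 / (cmod z * (cmod z)\<^sup>2)"
        using m3[OF that] by (simp add: power3_eq_cube power2_eq_square)
      also have "\<dots> \<le> 8 * n ^ 3 / (\<rho> * (cmod z)\<^sup>2)"
        using \<Omega>[OF that] \<rho> n by (intro divide_left_mono mult_right_mono) auto
      finally show ?thesis by simp
    qed
    have Eh: "E holomorphic_on S" for S unfolding E_def by (rule exponential_convolution_entire[OF y])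
    have sub: "{z. 2 * \<rho> < Re z} \<subseteq> ?\<Omega>" using half by auto
    have zero: "(\<integral>x. m (Complex w x) * r (Complex w x) \<partial>lborel) = 0"
    proof (rule vertical_integral_zero[OF _ w(1,3)])
      show "(\<lambda>z. m z * r z) holomorphic_on {z. 2 * \<rho> < Re z}"
        unfolding r_def
        by (intro holomorphic_intros holomorphic_on_subset[OF mh sub] holomorphic_on_subset[OF U sub] Eh)
      fix z assume "w \<le> Re z"
      then have z: "2 * \<rho> < Re z" using w by linarith
      have "cmod (m z * r z) \<le> 8 * n ^ 3 / \<rho> / (cmod z)\<^sup>2 * Cr"
        unfolding norm_mult using m4[OF half[OF z]] rb[OF z] order_trans[OF norm_ge_zero m4[OF half[OF z]]]
        by (intro mult_mono) auto
      then show "cmod (m z * r z) \<le> (8 * n ^ 3 / \<rho> * Cr) / (cmod z)\<^sup>2" by simp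
    qed
    have line: "Complex w x \<in> ?\<Omega>" for x using half[of "Complex w x"] w by simp
    define V where "V = (\<lambda>z. m z * U z)"
    have Vh: "V holomorphic_on ?\<Omega>" unfolding V_def by (intro holomorphic_intros mh U)
    have Vb: "cmod (V z) \<le> 16 * M" if "z \<in> ?\<Omega>" for z
    proof -
      have "cmod (m z) * cmod (U z) \<le> 8 * (2 * M)" by (intro mult_mono m2 Ub that) auto
      then show ?thesis by (simp add: V_def norm_mult)
    qed
    have Vb': "cmod (V z) \<le> (8 * n ^ 3 / \<rho> * (2 * M)) / (cmod z)\<^sup>2" if "z \<in> ?\<Omega>" for z
    proof -
      have "cmod (m z) * cmod (U z) \<le> 8 * n ^ 3 / \<rho> / (cmod z)\<^sup>2 * (2 * M)"
        using n \<rho> by (intro mult_mono m4 Ub that) auto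
      then show ?thesis by (simp add: V_def norm_mult)
    qed
    have cont: "continuous_on UNIV (\<lambda>x. F (Complex w x))" if "F holomorphic_on ?\<Omega>" for F
      using line by (intro continuous_on_compose2[OF holomorphic_on_imp_continuous_on[OF that] continuous_on_Complex_line]) auto
    have i1: "integrable lborel (\<lambda>x. m (Complex w x) * r (Complex w x))"
    proof (rule vertical_integrable[where C = "8 * n ^ 3 / \<rho> * Cr" and f = "\<lambda>z. m z * r z", OF w(3)])
      show "continuous_on UNIV (\<lambda>x. m (Complex w x) * r (Complex w x))"
        unfolding r_def by (intro continuous_intros cont[of m] cont[of U] cont[of E] mh U Eh continuous_on_Complex_line)
      fix x
      have z: "2 * \<rho> < Re (Complex w x)" using w by simp
      have "cmod (m (Complex w x) * r (Complex w x)) \<le> 8 * n ^ 3 / \<rho> / (cmod (Complex w x))\<^sup>2 * Cr"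
        unfolding norm_mult using m4[OF line] rb[OF z] order_trans[OF norm_ge_zero m4[OF line]]
        by (intro mult_mono) auto
      then show "cmod (m (Complex w x) * r (Complex w x)) \<le> 8 * n ^ 3 / \<rho> * Cr / (cmod (Complex w x))\<^sup>2" by simp
    qed
    have mint: "integrable lborel (\<lambda>x. cmod (m (Complex w x)))"
      by (intro integrable_norm vertical_integrable[where C = "8 * n ^ 3 / \<rho>" and f = m, OF w(3)] cont mh m4 line)
    have "bounded (y ` {0..t})" by (intro compact_imp_bounded compact_continuous_image y) simp
    then obtain Y where "\<forall>u\<in>y ` {0..t}. cmod u \<le> Y" unfolding bounded_iff by blast
    then have Y: "cmod (y s) \<le> Y" if "s \<in> {0..t}" for s using that by blast
    define yy where "yy = (\<lambda>s. indicator {0..t} s *\<^sub>R y s)"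
    have ym [measurable]: "yy \<in> borel_measurable borel"
      unfolding yy_def using borel_measurable_continuous_on_indicator[OF _ y] by simp
    have mm [measurable]: "(\<lambda>x. m (Complex w x)) \<in> borel_measurable borel"
      by (rule borel_measurable_continuous_onI[OF cont[OF mh]])
    define g where "g = (\<lambda>x s. m (Complex w x) * exp (Complex w x * of_real (t - s)) * yy s)"
    have "(\<integral>s. (\<integral>x. g x s \<partial>lborel) \<partial>lborel) = (\<integral>x. (\<integral>s. g x s \<partial>lborel) \<partial>lborel)"
    proof (rule lborel_swap_dominated[OF _ mint])
      show "case_prod g \<in> borel_measurable (lborel \<Otimes>\<^sub>M lborel)"
        unfolding g_def Complex_eq using mm[unfolded Complex_eq] by measurable
      show "integrable lborel (\<lambda>s. indicator {0..t} s * (exp (w * t) * Y))"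
        using t by (intro integrable_mult_left integrable_real_indicator) auto
      fix x s
      show "cmod (g x s) \<le> cmod (m (Complex w x)) * (indicator {0..t} s * (exp (w * t) * Y))"
      proof (cases "s \<in> {0..t}")
        case True
        then have "exp (w * (t - s)) * cmod (y s) \<le> exp (w * t) * Y"
          using w by (intro mult_mono Y) (auto intro: mult_left_mono)
        then show ?thesis using True by (simp add: g_def yy_def norm_mult norm_exp_eq_Re mult.assoc mult_left_mono)
      qed (simp add: g_def yy_def)
    qed
    moreover have "(\<integral>x. g x s \<partial>lborel) = kernel_constant * (indicator {0..t} s *\<^sub>R (of_real (n ^ 3 * (t - s)\<^sup>2 * exp (- (n * (t - s)))) * y s))" for s
    proof (cases "s \<in> {0..t}")
      case True
      then have "(\<integral>x. g x s \<partial>lborel) = kernel_constant * of_real (n ^ 3 * (t - s)\<^sup>2 * exp (- (n * (t - s)))) * y s"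
        unfolding g_def integral_mult_left_zero m_def using erlang_symbol_integral[OF w(3) n, of "t - s"] by (simp add: yy_def)
      then show ?thesis using True by simp
    qed (simp add: g_def yy_def)
    moreover have "(\<integral>s. g x s \<partial>lborel) = m (Complex w x) * E (Complex w x)" for x
    proof -
      have "g x = (\<lambda>s. m (Complex w x) * (indicator {0..t} s *\<^sub>R (exp (Complex w x * of_real (t - s)) * y s)))"
        by (auto simp: g_def yy_def fun_eq_iff indicator_def)
      then show ?thesis unfolding E_def by (simp only: integral_mult_right_zero)
    qed
    ultimately have "kernel_constant * (\<integral>s. indicator {0..t} s *\<^sub>R (of_real (n ^ 3 * (t - s)\<^sup>2 * exp (- (n * (t - s)))) * y s) \<partial>lborel) =
        (\<integral>x. m (Complex w x) * E (Complex w x) \<partial>lborel)"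
      by (simp only: integral_mult_right_zero)
    also have "(\<lambda>x. m (Complex w x) * E (Complex w x)) =
        (\<lambda>x. exp (of_real t * Complex w x) * V (Complex w x) - m (Complex w x) * r (Complex w x))"
      by (simp add: fun_eq_iff r_def V_def algebra_simps)
    also have "(\<integral>x. exp (of_real t * Complex w x) * V (Complex w x) - m (Complex w x) * r (Complex w x) \<partial>lborel) =
        (\<integral>x. exp (of_real t * Complex w x) * V (Complex w x) \<partial>lborel) - 0"
    proof (subst Bochner_Integration.integral_diff)
      show "integrable lborel (\<lambda>x. exp (of_real t * Complex w x) * V (Complex w x))"
      proof (rule vertical_integrable[where C = "exp (t * w) * (8 * n ^ 3 / \<rho> * (2 * M))" and f = "\<lambda>z. exp (of_real t * z) * V z", OF w(3)])
        show "continuous_on UNIV (\<lambda>x. exp (of_real t * Complex w x) * V (Complex w x))"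
          by (intro continuous_intros cont Vh continuous_on_Complex_line)
        show "cmod (exp (of_real t * Complex w x) * V (Complex w x)) \<le> exp (t * w) * (8 * n ^ 3 / \<rho> * (2 * M)) / (cmod (Complex w x))\<^sup>2" for x
          using mult_left_mono[OF Vb'[OF line[of x]] exp_ge_zero[of "t * w"]] by (simp add: norm_mult norm_exp_eq_Re)
      qed
    qed (use i1 zero in auto)
    finally show ?thesis
      using vertical_exp_integral_bound[OF c(1) _ \<rho> w(2) Vh Vb Vb', of t] c by simp
  qed
  have "(\<lambda>n. cmod (of_real (t\<^sup>2) * (kernel_constant *
      (\<integral>s. indicator {0..t} s *\<^sub>R (of_real (real (Suc n) ^ 3 * (t - s)\<^sup>2 * exp (- (real (Suc n) * (t - s)))) * y s) \<partial>lborel))))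
     \<longlonglongrightarrow> cmod (of_real (t\<^sup>2) * (kernel_constant * (2 * y t)))"
    by (intro tendsto_intros erlang_approximate_identity t y)
  then have "cmod (of_real (t\<^sup>2) * (kernel_constant * (2 * y t))) \<le> exp (t * w) * (8 * (16 * M) / c\<^sup>2) * (pi / w)"
    by (rule LIMSEQ_le_const2) (intro exI[of _ 0] allI impI bound, simp)
  then have kc: "2 * cmod kernel_constant * (t\<^sup>2 * cmod (y t)) \<le> exp (t * w) * (8 * (16 * M) / c\<^sup>2) * (pi / w)"
    by (simp add: norm_mult norm_power mult.commute mult.left_commute)
  have "cmod kernel_constant > 0"
    using exp_over_cube_integral_nonzero by (simp add: kernel_constant_def)
  then have "t\<^sup>2 * cmod (y t) \<le> (exp (t * w) * (8 * (16 * M) / c\<^sup>2) * (pi / w)) / (2 * cmod kernel_constant)"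
  proof -
    have "x \<le> m / (2 * k)" if "2 * k * x \<le> m" "0 < k" for x m k :: real
      using that by (simp add: field_simps)
    then show ?thesis using kc \<open>0 < cmod kernel_constant\<close> by blast
  qed
  also have "\<dots> = exp (3 * \<rho> * t) * (64 / c\<^sup>2) * (pi / (3 * \<rho>)) / cmod kernel_constant * M"
    by (simp add: w_def mult.commute mult.left_commute)
  finally show ?thesis .
qed

section \<open>The memory kernel and its resolvent family\<close>

definition kernel_primitive :: "real \<Rightarrow> real \<Rightarrow> real \<Rightarrow> real \<Rightarrow> real" where
  "kernel_primitive \<alpha> \<beta> \<nu> u = 1 + (\<integral>s. indicator {0..u} s * (indicator {0<..} s * memory_kernel \<alpha> \<beta> \<nu> s) \<partial>lborel)"

definition kernel_transform :: "real \<Rightarrow> real \<Rightarrow> real \<Rightarrow> complex \<Rightarrow> complex" where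
  "kernel_transform \<alpha> \<beta> \<nu> z = of_real \<alpha> * (z + of_real \<beta>) powr (of_real (- \<nu>))"

lemma memory_kernel_measurable [measurable]: "memory_kernel \<alpha> \<beta> \<nu> \<in> borel_measurable borel"
  unfolding memory_kernel_def by measurable

lemma kernel_primitive_eq:
  "1 + (LINT r|lebesgue_on {0..u}. memory_kernel \<alpha> \<beta> \<nu> r) = kernel_primitive \<alpha> \<beta> \<nu> u"
proof -
  have "(LINT r|lebesgue_on {0..u}. memory_kernel \<alpha> \<beta> \<nu> r) =
      (\<integral>s. indicator {0..u} s *\<^sub>R memory_kernel \<alpha> \<beta> \<nu> s \<partial>lebesgue)"
    by (rule integral_restrict_space) simp
  also have "\<dots> = (\<integral>s. indicator {0..u} s *\<^sub>R memory_kernel \<alpha> \<beta> \<nu> s \<partial>lborel)"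
    by (rule integral_completion) simp
  also have "(\<lambda>s. indicator {0..u} s *\<^sub>R memory_kernel \<alpha> \<beta> \<nu> s) =
      (\<lambda>s. indicator {0..u} s * (indicator {0<..} s * memory_kernel \<alpha> \<beta> \<nu> s))"
    by (auto simp: fun_eq_iff indicator_def memory_kernel_def)
  finally show ?thesis by (simp add: kernel_primitive_def)
qed

context
  fixes \<alpha> \<beta> \<nu> :: real
  assumes par: "\<alpha> > 0" "\<beta> \<ge> 0" "0 < \<nu>"
begin

private lemma kernel_powr:
  "indicator {0<..} s * memory_kernel \<alpha> \<beta> \<nu> s * exp (- (x * s)) =
    \<alpha> / Gamma \<nu> * (indicator {0<..} s * (s powr (\<nu> - 1) * exp (- ((x + \<beta>) * s))))"
  by (simp add: memory_kernel_def algebra_simps exp_add exp_diff exp_minus field_simps)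

lemma memory_kernel_nonneg: "0 \<le> indicator {0<..} s * memory_kernel \<alpha> \<beta> \<nu> s"
  using par Gamma_real_pos[OF par(3)] by (auto simp: memory_kernel_def indicator_def)

lemma integrable_memory_kernel:
  assumes "x > 0"
  shows "integrable lborel (\<lambda>s. indicator {0<..} s * memory_kernel \<alpha> \<beta> \<nu> s * exp (- (x * s)))"
  unfolding kernel_powr using par assms
  by (intro integrable_mult_right integrable_powr_exp) auto

lemma kernel_transform_eq:
  assumes z: "Re z > 0"
  shows "(\<integral>s. of_real (indicator {0<..} s * memory_kernel \<alpha> \<beta> \<nu> s) * exp (- (z * of_real s)) \<partial>lborel)
    = kernel_transform \<alpha> \<beta> \<nu> z"
proof -
  have G: "Gamma \<nu> \<noteq> 0" using Gamma_real_pos[OF par(3)] by simp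
  have "complex_of_real (indicator {0<..} s * memory_kernel \<alpha> \<beta> \<nu> s) * exp (- (z * of_real s)) =
      of_real (\<alpha> / Gamma \<nu>) * (indicator {0<..} s *\<^sub>R (of_real (s powr (\<nu> - 1)) * exp (- ((z + of_real \<beta>) * of_real s))))" for s
  proof -
    have "exp (- ((z + of_real \<beta>) * of_real s)) = of_real (exp (- \<beta> * s)) * exp (- (z * of_real s))"
      by (simp add: algebra_simps exp_diff exp_minus flip: exp_of_real)
        (simp add: exp_minus exp_add exp_diff field_simps)
    then show ?thesis by (simp add: memory_kernel_def scaleR_conv_of_real)
  qed
  then have "(\<integral>s. of_real (indicator {0<..} s * memory_kernel \<alpha> \<beta> \<nu> s) * exp (- (z * of_real s)) \<partial>lborel) =
      of_real (\<alpha> / Gamma \<nu>) * (of_real (Gamma \<nu>) * (z + of_real \<beta>) powr (of_real (- \<nu>)))"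
    using powr_laplace_transform[OF par(3), of "z + of_real \<beta>"] z par by (simp only: integral_mult_right_zero) simp
  also have "\<dots> = kernel_transform \<alpha> \<beta> \<nu> z" using G by (simp add: kernel_transform_def)
  finally show ?thesis .
qed

lemma kernel_primitive_bounds:
  defines "K1 \<equiv> \<integral>s. indicator {0<..} s * memory_kernel \<alpha> \<beta> \<nu> s * exp (- (1 * s)) \<partial>lborel"
  assumes "u \<in> {0..t}"
  shows "\<bar>kernel_primitive \<alpha> \<beta> \<nu> u\<bar> \<le> 1 + exp t * K1"
proof -
  have "norm (\<integral>s. indicator {0..u} s * (indicator {0<..} s * memory_kernel \<alpha> \<beta> \<nu> s) \<partial>lborel) \<le>
      (\<integral>s. exp t * (indicator {0<..} s * memory_kernel \<alpha> \<beta> \<nu> s * exp (- (1 * s))) \<partial>lborel)"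
  proof (rule norm_integral_le_dominating)
    show "integrable lborel (\<lambda>s. exp t * (indicator {0<..} s * memory_kernel \<alpha> \<beta> \<nu> s * exp (- (1 * s))))"
      by (intro integrable_mult_right integrable_memory_kernel) simp
    fix s
    let ?k = "indicator {0<..} s * memory_kernel \<alpha> \<beta> \<nu> s"
    show "norm (indicator {0..u} s * ?k) \<le> exp t * (?k * exp (- (1 * s)))"
    proof (cases "s \<in> {0..u}")
      case True
      have "?k * 1 \<le> ?k * exp (t - s)" using memory_kernel_nonneg[of s] True assms by (intro mult_left_mono) auto
      then show ?thesis using True memory_kernel_nonneg[of s] by (simp add: exp_diff exp_minus field_simps)
    next
      case False
      then show ?thesis using memory_kernel_nonneg[of s] by (auto intro!: mult_nonneg_nonneg)
    qed
  qed
  also have "\<dots> = exp t * K1" by (simp add: K1_def)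
  finally show ?thesis unfolding kernel_primitive_def by (simp only: real_norm_def)
qed

lemma kernel_primitive_measurable: "kernel_primitive \<alpha> \<beta> \<nu> \<in> borel_measurable borel"
proof -
  have "(\<lambda>u. \<integral>s. indicator {0..u} s * (indicator {0<..} s * memory_kernel \<alpha> \<beta> \<nu> s) \<partial>lborel) \<in> borel_measurable borel"
    unfolding indicator_def atLeastAtMost_iff by measurable
  then show ?thesis unfolding kernel_primitive_def[abs_def] by measurable
qed

lemma kernel_primitive_exponential_convolution:
  defines "K1 \<equiv> \<integral>s. indicator {0<..} s * memory_kernel \<alpha> \<beta> \<nu> s * exp (- (1 * s)) \<partial>lborel"
  assumes z: "Re z \<ge> 1" and u: "u \<in> {0..t}"
  shows "cmod (exp (z * of_real u) * (1 + kernel_transform \<alpha> \<beta> \<nu> z) / z -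
      (\<integral>s. indicator {0..u} s *\<^sub>R (exp (z * of_real (u - s)) * of_real (kernel_primitive \<alpha> \<beta> \<nu> s)) \<partial>lborel))
    \<le> (1 + 2 * (exp t * K1)) / cmod z"
proof -
  define k where "k = (\<lambda>s. indicator {0<..} s * memory_kernel \<alpha> \<beta> \<nu> s)"
  have km [measurable]: "k \<in> borel_measurable borel" unfolding k_def by measurable
  have k0: "k s \<ge> 0" for s unfolding k_def by (rule memory_kernel_nonneg)
  have kint: "integrable lborel (\<lambda>s. k s * exp (- (x * s)))" if "x > 0" for x
    unfolding k_def by (rule integrable_memory_kernel[OF that])
  have z0: "z \<noteq> 0" using z by auto
  have u0: "0 \<le> u" "u \<le> t" using u by auto
  have kloc: "integrable lborel (\<lambda>s. indicator {0..u} s * k s)"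
  proof (rule Bochner_Integration.integrable_bound)
    show "integrable lborel (\<lambda>s. exp u * (k s * exp (- (1 * s))))" by (intro integrable_mult_right kint) simp
    show "AE s in lborel. norm (indicator {0..u} s * k s) \<le> norm (exp u * (k s * exp (- (1 * s))))"
    proof (rule AE_I2)
      fix s
      have "k s * 1 \<le> k s * exp (u - s)" if "s \<le> u" using k0[of s] that by (intro mult_left_mono) auto
      then show "norm (indicator {0..u} s * k s) \<le> norm (exp u * (k s * exp (- (1 * s))))"
        using k0[of s] by (auto simp: indicator_def exp_diff exp_minus field_simps)
    qed
  qed measurable
  have kz: "integrable lborel (\<lambda>s. of_real (k s) * exp (- (z * of_real s)))"
    by (rule Bochner_Integration.integrable_bound[OF kint[of "Re z"]])
      (use z k0 in \<open>auto simp: norm_mult cmod_exp_neg\<close>)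
  define Kh where "Kh = (\<integral>s. indicator {0..u} s *\<^sub>R (of_real (k s) * exp (- (z * of_real s))) \<partial>lborel)"
  define Kt where "Kt = (\<integral>s. indicator {u<..} s *\<^sub>R (of_real (k s) * exp (- (z * of_real s))) \<partial>lborel)"
  define A where "A = (\<integral>s. indicator {0..u} s * k s \<partial>lborel)"
  have ih: "integrable lborel (\<lambda>s. indicator {0..u} s *\<^sub>R (of_real (k s) * exp (- (z * of_real s))))"
    and it: "integrable lborel (\<lambda>s. indicator {u<..} s *\<^sub>R (of_real (k s) * exp (- (z * of_real s))))"
    by (rule integrable_mult_indicator[OF _ kz]; simp)+
  have "Kh + Kt = (\<integral>s. of_real (k s) * exp (- (z * of_real s)) \<partial>lborel)"
    unfolding Kh_def Kt_def Bochner_Integration.integral_add[OF ih it, symmetric]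
    by (rule Bochner_Integration.integral_cong) (auto simp: k_def indicator_def u0)
  also have "\<dots> = kernel_transform \<alpha> \<beta> \<nu> z" unfolding k_def using z by (intro kernel_transform_eq) simp
  finally have split: "Kh = kernel_transform \<alpha> \<beta> \<nu> z - Kt" by (simp add: algebra_simps)
  have FTC: "(\<integral>s. indicator {r..u} s *\<^sub>R exp (z * of_real (u - s)) \<partial>lborel) = (exp (z * of_real (u - r)) - 1) / z" if "r \<le> u" for r
  proof -
    have "(\<integral>s. indicator {r..u} s *\<^sub>R exp (z * of_real (u - s)) \<partial>lborel) = - exp (z * of_real (u - u)) / z - (- exp (z * of_real (u - r)) / z)"
    proof (rule integral_FTC_atLeastAtMost[OF that])
      fix s :: real
      have "((\<lambda>v. - exp (z * (of_real u - v)) / z) has_field_derivative exp (z * of_real (u - s))) (at (of_real s))"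
        using z0 by (auto intro!: derivative_eq_intros simp: field_simps)
      from field_vector_diff_chain_at[OF has_vector_derivative_of_real[OF DERIV_ident] this]
      show "((\<lambda>s. - exp (z * of_real (u - s)) / z) has_vector_derivative exp (z * of_real (u - s))) (at s within {r..u})"
        by (simp add: o_def has_vector_derivative_at_within)
    qed (intro continuous_intros)
    then show ?thesis by (simp add: diff_divide_distrib)
  qed
  define f where "f = (\<lambda>r s. (if r \<le> s \<and> s \<le> u then 1 else 0) * (of_real (indicator {0..u} r * k r) * exp (z * of_real (u - s))))"
  have "(\<integral>s. (\<integral>r. f r s \<partial>lborel) \<partial>lborel) = (\<integral>r. (\<integral>s. f r s \<partial>lborel) \<partial>lborel)"
  proof (rule lborel_swap_dominated)
    show "case_prod f \<in> borel_measurable (lborel \<Otimes>\<^sub>M lborel)" unfolding f_def by measurable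
    show "integrable lborel (\<lambda>r. indicator {0..u} r * k r)" by (rule kloc)
    show "integrable lborel (\<lambda>s. indicator {0..u} s * exp (Re z * u))"
      using u0 by (intro integrable_mult_left integrable_real_indicator) auto
    fix r s
    show "cmod (f r s) \<le> indicator {0..u} r * k r * (indicator {0..u} s * exp (Re z * u))"
    proof (cases "0 \<le> r \<and> r \<le> s \<and> s \<le> u")
      case True
      then have "exp (Re z * (u - s)) \<le> exp (Re z * u)" using z by (auto intro!: mult_left_mono)
      then show ?thesis using True k0[of r] by (simp add: f_def norm_mult norm_exp_eq_Re mult_left_mono)
    next
      case False
      then have "f r s = 0" by (auto simp: f_def)
      then show ?thesis using k0[of r] by simp
    qed
  qed
  moreover have "(\<integral>r. f r s \<partial>lborel) = indicator {0..u} s *\<^sub>R (exp (z * of_real (u - s)) * of_real (kernel_primitive \<alpha> \<beta> \<nu> s - 1))" for s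
  proof (cases "s \<in> {0..u}")
    case True
    have "(\<lambda>r. f r s) = (\<lambda>r. exp (z * of_real (u - s)) * of_real (indicator {0..s} r * k r))"
      using True by (auto simp: f_def fun_eq_iff indicator_def)
    then have "(\<integral>r. f r s \<partial>lborel) = exp (z * of_real (u - s)) * of_real (\<integral>r. indicator {0..s} r * k r \<partial>lborel)"
      by (simp only: integral_mult_right_zero integral_complex_of_real)
    then show ?thesis using True by (simp add: kernel_primitive_def k_def)
  next
    case False
    have "k r = 0" if "r \<le> 0" for r using that by (simp add: k_def)
    then have "(\<lambda>r. f r s) = (\<lambda>r. 0)" using False by (auto simp: f_def fun_eq_iff indicator_def)
    then show ?thesis using False by simp
  qed
  moreover have "(\<integral>s. f r s \<partial>lborel) =
      1 / z * (exp (z * of_real u) * (indicator {0..u} r *\<^sub>R (of_real (k r) * exp (- (z * of_real r)))) - of_real (indicator {0..u} r * k r))" for r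
  proof (cases "r \<in> {0..u}")
    case True
    have "f r = (\<lambda>s. of_real (k r) * (indicator {r..u} s *\<^sub>R exp (z * of_real (u - s))))"
      using True by (auto simp: f_def fun_eq_iff indicator_def)
    then have "(\<integral>s. f r s \<partial>lborel) = of_real (k r) * ((exp (z * of_real (u - r)) - 1) / z)"
      using True by (simp only: integral_mult_right_zero FTC atLeastAtMost_iff)
    also have "exp (z * of_real (u - r)) = exp (z * of_real u) * exp (- (z * of_real r))"
      by (simp add: algebra_simps flip: exp_add)
    finally show ?thesis using True by (simp add: algebra_simps diff_divide_distrib)
  next
    case False
    then have "f r = (\<lambda>s. 0)" by (auto simp: f_def fun_eq_iff)
    then show ?thesis using False by simp
  qed
  ultimately have swap: "(\<integral>s. indicator {0..u} s *\<^sub>R (exp (z * of_real (u - s)) * of_real (kernel_primitive \<alpha> \<beta> \<nu> s - 1)) \<partial>lborel) =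
      (\<integral>r. 1 / z * (exp (z * of_real u) * (indicator {0..u} r *\<^sub>R (of_real (k r) * exp (- (z * of_real r)))) - of_real (indicator {0..u} r * k r)) \<partial>lborel)"
    by (simp only:)
  also have "\<dots> = 1 / z * (exp (z * of_real u) * Kh - of_real A)"
    unfolding Kh_def A_def
    by (simp only: integral_mult_right_zero Bochner_Integration.integral_diff integrable_mult_right ih integrable_of_real[OF kloc] integral_complex_of_real)
  finally have part: "(\<integral>s. indicator {0..u} s *\<^sub>R (exp (z * of_real (u - s)) * of_real (kernel_primitive \<alpha> \<beta> \<nu> s - 1)) \<partial>lborel) =
      1 / z * (exp (z * of_real u) * Kh - of_real A)" .
  have ie: "integrable lborel (\<lambda>s. indicator {0..u} s *\<^sub>R exp (z * of_real (u - s)))"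
    by (intro integrable_continuous_indicator continuous_intros)
  have ip: "integrable lborel (\<lambda>s. indicator {0..u} s *\<^sub>R (exp (z * of_real (u - s)) * of_real (kernel_primitive \<alpha> \<beta> \<nu> s - 1)))"
  proof (rule Bochner_Integration.integrable_bound)
    show "integrable lborel (\<lambda>s. indicator {0..u} s * (exp (Re z * u) * (2 + exp t * K1)))"
      using u0 by (intro integrable_mult_left integrable_real_indicator) auto
    show "(\<lambda>s. indicator {0..u} s *\<^sub>R (exp (z * of_real (u - s)) * of_real (kernel_primitive \<alpha> \<beta> \<nu> s - 1))) \<in> borel_measurable lborel"
      using kernel_primitive_measurable by measurable
    show "AE s in lborel. norm (indicator {0..u} s *\<^sub>R (exp (z * of_real (u - s)) * of_real (kernel_primitive \<alpha> \<beta> \<nu> s - 1)))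
        \<le> norm (indicator {0..u} s * (exp (Re z * u) * (2 + exp t * K1)))"
    proof (rule AE_I2)
      fix s
      show "norm (indicator {0..u} s *\<^sub>R (exp (z * of_real (u - s)) * of_real (kernel_primitive \<alpha> \<beta> \<nu> s - 1)))
        \<le> norm (indicator {0..u} s * (exp (Re z * u) * (2 + exp t * K1)))"
      proof (cases "s \<in> {0..u}")
        case True
        have "\<bar>kernel_primitive \<alpha> \<beta> \<nu> s - 1\<bar> \<le> 2 + exp t * K1"
          using kernel_primitive_bounds[of s t] True u0 by (simp add: K1_def)
        moreover from this have nn: "\<bar>2 + exp t * K1\<bar> = 2 + exp t * K1" by linarith
        moreover have "exp (Re z * (u - s)) \<le> exp (Re z * u)" using z True by (auto intro!: mult_left_mono)
        ultimately have "exp (Re z * (u - s)) * \<bar>kernel_primitive \<alpha> \<beta> \<nu> s - 1\<bar> \<le> exp (Re z * u) * (2 + exp t * K1)"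
          by (intro mult_mono) auto
        then show ?thesis using True
          by (simp only: norm_scaleR norm_mult norm_of_real norm_exp_eq_Re) (simp add: abs_mult nn)
      qed simp
    qed
  qed
  have "(\<integral>s. indicator {0..u} s *\<^sub>R (exp (z * of_real (u - s)) * of_real (kernel_primitive \<alpha> \<beta> \<nu> s)) \<partial>lborel) =
      (\<integral>s. indicator {0..u} s *\<^sub>R exp (z * of_real (u - s)) +
        indicator {0..u} s *\<^sub>R (exp (z * of_real (u - s)) * of_real (kernel_primitive \<alpha> \<beta> \<nu> s - 1)) \<partial>lborel)"
    by (rule Bochner_Integration.integral_cong) (auto simp: algebra_simps)
  also have "\<dots> = (exp (z * of_real u) - 1) / z + 1 / z * (exp (z * of_real u) * Kh - of_real A)"
    using FTC[of 0] u0 by (simp only: Bochner_Integration.integral_add[OF ie ip] part) simp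
  finally have val: "(\<integral>s. indicator {0..u} s *\<^sub>R (exp (z * of_real (u - s)) * of_real (kernel_primitive \<alpha> \<beta> \<nu> s)) \<partial>lborel) =
      (exp (z * of_real u) - 1) / z + 1 / z * (exp (z * of_real u) * Kh - of_real A)" .
  have "exp (z * of_real u) * (1 + kernel_transform \<alpha> \<beta> \<nu> z) / z -
      (\<integral>s. indicator {0..u} s *\<^sub>R (exp (z * of_real (u - s)) * of_real (kernel_primitive \<alpha> \<beta> \<nu> s)) \<partial>lborel)
      = (of_real (1 + A) + exp (z * of_real u) * Kt) / z"
    unfolding val split by (simp add: add_divide_distrib diff_divide_distrib algebra_simps)
  then have "cmod (exp (z * of_real u) * (1 + kernel_transform \<alpha> \<beta> \<nu> z) / z -
      (\<integral>s. indicator {0..u} s *\<^sub>R (exp (z * of_real (u - s)) * of_real (kernel_primitive \<alpha> \<beta> \<nu> s)) \<partial>lborel))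
      = cmod (of_real (1 + A) + exp (z * of_real u) * Kt) / cmod z"
    by (simp only: norm_divide)
  also have "\<dots> \<le> (1 + 2 * (exp t * K1)) / cmod z"
  proof (rule divide_right_mono)
    have "\<bar>1 + A\<bar> \<le> 1 + exp t * K1"
      using kernel_primitive_bounds[OF u] by (simp add: A_def kernel_primitive_def k_def K1_def)
    moreover have "cmod (exp (z * of_real u) * Kt) \<le> exp t * K1"
    proof -
      have "exp (z * of_real u) * Kt = (\<integral>s. exp (z * of_real u) * (indicator {u<..} s *\<^sub>R (of_real (k s) * exp (- (z * of_real s)))) \<partial>lborel)"
        by (simp only: Kt_def integral_mult_right_zero)
      also have "cmod \<dots> \<le> (\<integral>s. exp t * (k s * exp (- (1 * s))) \<partial>lborel)"
      proof (rule norm_integral_le_dominating)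
        show "integrable lborel (\<lambda>s. exp t * (k s * exp (- (1 * s))))" by (intro integrable_mult_right kint) simp
        fix s
        show "cmod (exp (z * of_real u) * (indicator {u<..} s *\<^sub>R (of_real (k s) * exp (- (z * of_real s))))) \<le> exp t * (k s * exp (- (1 * s)))"
        proof (cases "s > u")
          case True
          have "Re z * u + - (Re z * s) \<le> t + - (1 * s)"
          proof -
            have "Re z * (u - s) \<le> 1 * (u - s)" using z True by (intro mult_right_mono_neg) auto
            then show ?thesis using u0 by (simp add: algebra_simps)
          qed
          then have "exp (Re z * u) * exp (- (Re z * s)) \<le> exp t * exp (- (1 * s))"
            by (simp flip: exp_add)
          then have "k s * (exp (Re z * u) * exp (- (Re z * s))) \<le> k s * (exp t * exp (- (1 * s)))"
            using k0[of s] by (intro mult_left_mono)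
          then show ?thesis using True k0[of s]
            by (simp add: norm_mult norm_exp_eq_Re mult.commute mult.left_commute)
        next
          case False
          then show ?thesis using k0[of s] by simp
        qed
      qed
      also have "\<dots> = exp t * K1" by (simp add: K1_def k_def)
      finally show ?thesis .
    qed
    ultimately show "cmod (of_real (1 + A) + exp (z * of_real u) * Kt) \<le> 1 + 2 * (exp t * K1)"
      using norm_triangle_ineq[of "of_real (1 + A)" "exp (z * of_real u) * Kt"] by (simp only: norm_of_real)
  qed simp
  finally show ?thesis .
qed

end

definition open_sector :: "real \<Rightarrow> complex set" where
  "open_sector c = {\<mu>. \<mu> \<noteq> 0 \<and> - c * cmod \<mu> < Re \<mu>}"

lemma volterra_symbol:
  fixes \<alpha> \<beta> \<nu> c :: real
  assumes par: "\<alpha> > 0" "\<beta> \<ge> 0" "0 < \<nu>" and c: "0 < c" "c < 1"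
  obtains \<rho> where "\<rho> \<ge> 1"
    and "(\<lambda>z. z / (1 + kernel_transform \<alpha> \<beta> \<nu> z)) holomorphic_on tilted_region \<rho> (c / 4)"
    and "\<And>z. z \<in> tilted_region \<rho> (c / 4) \<Longrightarrow> 1 + kernel_transform \<alpha> \<beta> \<nu> z \<noteq> 0"
    and "\<And>z. z \<in> tilted_region \<rho> (c / 4) \<Longrightarrow> z / (1 + kernel_transform \<alpha> \<beta> \<nu> z) \<in> open_sector c"
    and "\<And>z. z \<in> tilted_region \<rho> (c / 4) \<Longrightarrow> cmod (z / (1 + kernel_transform \<alpha> \<beta> \<nu> z)) \<le> 2 * cmod z"
proof -
  have "((\<lambda>r. \<alpha> * (r / 2) powr (- \<nu>)) \<longlongrightarrow> 0) at_top" using par by real_asymp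
  then have "\<forall>\<^sub>F r in at_top. \<alpha> * (r / 2) powr (- \<nu>) < c / 4"
    by (rule order_tendstoD(2)) (use c in simp)
  then have "\<forall>\<^sub>F r in at_top. \<alpha> * (r / 2) powr (- \<nu>) < c / 4 \<and> 1 \<le> r"
    using eventually_ge_at_top[of 1] by (rule eventually_conj)
  then obtain \<rho> where \<rho>: "\<alpha> * (\<rho> / 2) powr (- \<nu>) < c / 4" "1 \<le> \<rho>"
    by (auto simp: eventually_at_top_linorder)
  let ?\<Omega> = "tilted_region \<rho> (c / 4)" and ?K = "kernel_transform \<alpha> \<beta> \<nu>"
  have \<Omega>: "\<rho> < cmod z" "- (c / 4) * cmod z < Re z" if "z \<in> ?\<Omega>" for z
    using that by (auto simp: tilted_region_def)
  have K: "cmod (?K z) < c / 4" if z: "z \<in> ?\<Omega>" for z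
  proof -
    have lo: "cmod z / 2 \<le> cmod (z + of_real \<beta>)"
      using cmod_add_of_nat_lower(2)[OF _ _ \<Omega>(2)[OF z] par(2)] c by (simp add: add.commute)
    then have "\<rho> / 2 \<le> cmod (z + of_real \<beta>)" using \<Omega>(1)[OF z] by simp
    have "cmod (?K z) = \<alpha> * cmod (z + of_real \<beta>) powr (- \<nu>)"
      using par by (simp add: kernel_transform_def norm_mult norm_powr_real_powr' flip: of_real_minus)
    also have "\<dots> \<le> \<alpha> * (\<rho> / 2) powr (- \<nu>)"
      using par \<rho> \<open>\<rho> / 2 \<le> _\<close> by (intro mult_left_mono powr_mono2') auto
    finally show ?thesis using \<rho>(1) by simp
  qed
  have K1: "1 - c / 4 \<le> cmod (1 + ?K z)" "cmod (1 + ?K z) \<le> 1 + c / 4" if "z \<in> ?\<Omega>" for z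
    using K[OF that] norm_triangle_ineq2[of 1 "- ?K z"] norm_triangle_ineq[of 1 "?K z"] by auto
  have nz: "1 + ?K z \<noteq> 0" if "z \<in> ?\<Omega>" for z using K1(1)[OF that] c by auto
  show thesis
  proof (rule that[OF \<rho>(2) _ nz])
    have "z + of_real \<beta> \<notin> \<real>\<^sub>\<le>\<^sub>0" if "z \<in> ?\<Omega>" for z
    proof
      assume "z + of_real \<beta> \<in> \<real>\<^sub>\<le>\<^sub>0"
      then have "Re z \<le> 0" "Im z = 0" using par by (auto simp: complex_nonpos_Reals_iff)
      then have "Re z = - cmod z" by (simp add: cmod_eq_Re)
      then have "c / 4 * cmod z > cmod z" using \<Omega>(2)[OF that] by simp
      moreover have "c / 4 * cmod z \<le> 1 * cmod z" using c by (intro mult_right_mono) auto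
      ultimately show False by simp
    qed
    then show "(\<lambda>z. z / (1 + ?K z)) holomorphic_on ?\<Omega>"
      using nz unfolding kernel_transform_def by (intro holomorphic_intros) auto
    fix z assume z: "z \<in> ?\<Omega>"
    have cz: "cmod z > 0" using \<Omega>(1)[OF z] \<rho> by linarith
    have h: "cmod (1 / (1 + ?K z) - 1) \<le> c / 3"
    proof -
      have "1 / (1 + ?K z) - 1 = - ?K z / (1 + ?K z)" using nz[OF z] by (simp add: field_simps)
      then have "cmod (1 / (1 + ?K z) - 1) = cmod (?K z) / cmod (1 + ?K z)" by (simp add: norm_divide)
      also have "\<dots> \<le> (c / 4) / (3 / 4)"
        using K[OF z] K1(1)[OF z] c by (intro frac_le) auto
      finally show ?thesis by simp
    qed
    show "cmod (z / (1 + ?K z)) \<le> 2 * cmod z"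
    proof -
      have "cmod z / cmod (1 + ?K z) \<le> cmod z / (1 / 2)"
        using K1(1)[OF z] c by (intro divide_left_mono) auto
      then show ?thesis by (simp add: norm_divide)
    qed
    show "z / (1 + ?K z) \<in> open_sector c"
    proof -
      have "z / (1 + ?K z) = z + z * (1 / (1 + ?K z) - 1)" by (simp add: algebra_simps)
      then have "Re (z / (1 + ?K z)) = Re z + Re (z * (1 / (1 + ?K z) - 1))" by simp
      have "\<bar>Re (z * (1 / (1 + ?K z) - 1))\<bar> \<le> cmod z * (c / 3)"
        using abs_Re_le_cmod[of "z * (1 / (1 + ?K z) - 1)"] mult_left_mono[OF h, of "cmod z"]
        by (simp add: norm_mult)
      have "Re (z / (1 + ?K z)) > - (c / 4 + c / 3) * cmod z"
      proof -
        have "- (c / 4 + c / 3) * cmod z = - (c / 4) * cmod z - cmod z * (c / 3)" by (simp add: algebra_simps)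
        then show ?thesis
          using \<Omega>(2)[OF z] \<open>Re (z / (1 + ?K z)) = _\<close> \<open>\<bar>Re (z * (1 / (1 + ?K z) - 1))\<bar> \<le> _\<close> by linarith
      qed
      moreover have "c * (4 / 5 * cmod z) \<le> c * cmod (z / (1 + ?K z))"
      proof (rule mult_left_mono)
        have "cmod z / (5 / 4) \<le> cmod z / cmod (1 + ?K z)"
          using K1[OF z] c by (intro divide_left_mono) auto
        then show "4 / 5 * cmod z \<le> cmod (z / (1 + ?K z))" by (simp add: norm_divide)
      qed (use c in auto)
      moreover have "(c / 4 + c / 3) * cmod z \<le> c * (4 / 5 * cmod z)"
        using c cz by (simp add: field_simps)
      ultimately have "- c * cmod (z / (1 + ?K z)) < Re (z / (1 + ?K z))" by linarith
      moreover have "z / (1 + ?K z) \<noteq> 0" using nz[OF z] cz by auto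
      ultimately show ?thesis by (simp add: open_sector_def)
    qed
  qed
qed

locale sectorial_volterra_family =
  fixes s :: "complex \<Rightarrow> 'x::{banach,second_countable_topology} \<Rightarrow> 'x"
    and D :: "'x set" and A :: "'x \<Rightarrow> 'x" and R :: "complex \<Rightarrow> 'x \<Rightarrow> 'x"
    and G :: "real \<Rightarrow> 'x \<Rightarrow> 'x" and c S K N T \<alpha> \<beta> \<nu> :: real
  assumes par: "\<alpha> > 0" "\<beta> \<ge> 0" "0 < \<nu>" and c: "0 < c" "c < 1" and nonneg: "0 \<le> S" "0 \<le> K" "0 \<le> N"
    and s_add: "s z (x + y) = s z x + s z y" and s_add_left: "s (z + z') x = s z x + s z' x"
    and s_mult: "s (z * z') x = s z (s z' x)" and s_of_real: "s (of_real r) x = r *\<^sub>R x"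
    and s_norm: "norm (s z x) \<le> S * cmod z * norm x"
    and D_add: "x \<in> D \<Longrightarrow> y \<in> D \<Longrightarrow> x + y \<in> D" and D_scale: "x \<in> D \<Longrightarrow> s z x \<in> D"
    and A_add: "x \<in> D \<Longrightarrow> y \<in> D \<Longrightarrow> A (x + y) = A x + A y" and A_scale: "x \<in> D \<Longrightarrow> A (s z x) = s z (A x)"
    and R_in: "\<mu> \<in> open_sector c \<Longrightarrow> R \<mu> x \<in> D"
    and R_right: "\<mu> \<in> open_sector c \<Longrightarrow> s \<mu> (R \<mu> x) - A (R \<mu> x) = x"
    and R_left: "\<mu> \<in> open_sector c \<Longrightarrow> x \<in> D \<Longrightarrow> R \<mu> (s \<mu> x - A x) = x"
    and R_norm: "\<mu> \<in> open_sector c \<Longrightarrow> norm (R \<mu> x) \<le> K / cmod \<mu> * norm x"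
    and G_lin: "0 \<le> t \<Longrightarrow> G t (x + y) = G t x + G t y" and G_scale: "0 \<le> t \<Longrightarrow> G t (s z x) = s z (G t x)"
    and G_norm: "t \<in> {0..T} \<Longrightarrow> norm (G t x) \<le> N * norm x"
    and G_cont: "continuous_on {0..} (\<lambda>t. G t x)"
    and G_D: "0 \<le> t \<Longrightarrow> x \<in> D \<Longrightarrow> G t x \<in> D" and G_A: "0 \<le> t \<Longrightarrow> x \<in> D \<Longrightarrow> G t (A x) = A (G t x)"
    and G_volterra: "0 \<le> t \<Longrightarrow> x \<in> D \<Longrightarrow> G t x = x +
      (LINT \<tau>|lebesgue_on {0..t}. kernel_primitive \<alpha> \<beta> \<nu> (t - \<tau>) *\<^sub>R A (G \<tau> x))"
begin

lemma s_minus: "s z (- x) = - s z x" and s_0: "s z 0 = 0" and s_diff: "s z (x - y) = s z x - s z y"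
proof -
  show s0: "s z 0 = 0" using s_add[of z 0 0] by simp
  show sm: "s z (- x) = - s z x" for x using s_add[of z x "- x"] s0 by (simp add: eq_neg_iff_add_eq_0 add.commute)
  show "s z (x - y) = s z x - s z y" using s_add[of z x "- y"] sm by simp
qed

lemma s_diff_left: "s (z - z') x = s z x - s z' x"
  using s_add_left[of "z - z'" z' x] by simp

lemma D_diff: "x \<in> D \<Longrightarrow> y \<in> D \<Longrightarrow> x - y \<in> D"
  using D_add[of x "s (of_real (- 1)) y"] D_scale[of y "of_real (- 1)"] s_of_real[of "- 1" y] by simp

lemma A_diff: "x \<in> D \<Longrightarrow> y \<in> D \<Longrightarrow> A (x - y) = A x - A y"
  using A_add[of "x - y" y] D_diff by simp

lemma R_unique:
  assumes "\<mu> \<in> open_sector c" "x \<in> D" "s \<mu> x - A x = y"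
  shows "x = R \<mu> y"
  using R_left[OF assms(1,2)] assms(3) by simp

lemma R_diff:
  assumes \<mu>: "\<mu> \<in> open_sector c"
  shows "R \<mu> (x - y) = R \<mu> x - R \<mu> y"
proof (rule R_unique[symmetric, OF \<mu>])
  show "R \<mu> x - R \<mu> y \<in> D" by (intro D_diff R_in \<mu>)
  have "s \<mu> (R \<mu> x - R \<mu> y) - A (R \<mu> x - R \<mu> y) = (s \<mu> (R \<mu> x) - A (R \<mu> x)) - (s \<mu> (R \<mu> y) - A (R \<mu> y))"
    using A_diff[OF R_in[OF \<mu>, of x] R_in[OF \<mu>, of y]] by (simp add: s_diff)
  then show "s \<mu> (R \<mu> x - R \<mu> y) - A (R \<mu> x - R \<mu> y) = x - y" by (simp add: R_right[OF \<mu>])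
qed

lemma R_scale: "\<mu> \<in> open_sector c \<Longrightarrow> R \<mu> (s z x) = s z (R \<mu> x)"
proof (rule R_unique[symmetric])
  assume \<mu>: "\<mu> \<in> open_sector c"
  show "s z (R \<mu> x) \<in> D" by (intro D_scale R_in \<mu>)
  have "s \<mu> (s z (R \<mu> x)) = s z (s \<mu> (R \<mu> x))" by (simp flip: s_mult add: mult.commute)
  then show "s \<mu> (s z (R \<mu> x)) - A (s z (R \<mu> x)) = s z x"
    using R_right[OF \<mu>, of x] by (simp add: A_scale R_in \<mu> flip: s_diff)
qed

lemma R_bound: "\<mu> \<in> open_sector c \<Longrightarrow> norm (s \<mu> (R \<mu> x)) \<le> S * K * norm x"
proof -
  assume \<mu>: "\<mu> \<in> open_sector c"
  have "norm (s \<mu> (R \<mu> x)) \<le> S * cmod \<mu> * norm (R \<mu> x)" by (rule s_norm)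
  also have "\<dots> \<le> S * cmod \<mu> * (K / cmod \<mu> * norm x)" using nonneg by (intro mult_left_mono R_norm \<mu>) auto
  finally show ?thesis using \<mu> by (simp add: open_sector_def)
qed

lemma resolvent_identity:
  assumes "\<xi> \<in> open_sector c" "\<mu> \<in> open_sector c"
  shows "R \<xi> x - R \<mu> x = s (\<mu> - \<xi>) (R \<xi> (R \<mu> x))"
proof -
  have "R \<mu> x = R \<xi> (s \<xi> (R \<mu> x) - A (R \<mu> x))" using assms by (simp add: R_left R_in)
  also have "s \<xi> (R \<mu> x) - A (R \<mu> x) = x - s (\<mu> - \<xi>) (R \<mu> x)"
    using R_right[OF assms(2), of x] by (simp add: s_diff_left algebra_simps)
  finally have "R \<mu> x = R \<xi> x - s (\<mu> - \<xi>) (R \<xi> (R \<mu> x))" using assms(1) by (simp add: R_diff R_scale)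
  moreover have "a - r = b" if "r = a - b" for a b r :: 'x using that by simp
  ultimately show ?thesis by blast
qed

lemma open_sector_open: "open (open_sector c)"
  unfolding open_sector_def by (intro open_Collect_conj open_Collect_less open_Collect_neq continuous_intros)

definition cfun :: "('x \<Rightarrow> real) \<Rightarrow> 'x \<Rightarrow> complex" where
  "cfun \<psi> x = Complex (\<psi> x) (- \<psi> (s \<i> x))"

context
  fixes \<psi> :: "'x \<Rightarrow> real"
  assumes \<psi>: "linear \<psi>" "\<And>x. \<bar>\<psi> x\<bar> \<le> norm x"
begin

lemma cfun_add: "cfun \<psi> (x + y) = cfun \<psi> x + cfun \<psi> y"
  by (simp add: cfun_def s_add linear_add[OF \<psi>(1)] complex_eq_iff)

lemma cfun_diff: "cfun \<psi> (x - y) = cfun \<psi> x - cfun \<psi> y"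
  by (simp add: cfun_def s_diff linear_diff[OF \<psi>(1)] complex_eq_iff)

lemma cfun_scale: "cfun \<psi> (s z x) = z * cfun \<psi> x"
proof -
  have r: "\<psi> (s (of_real r) x) = r * \<psi> x" for r x
    using linear_scale[OF \<psi>(1), of r x] by (simp add: s_of_real)
  have z: "s z x = s (of_real (Re z)) x + s (of_real (Im z)) (s \<i> x)" for x
    by (metis complex_eq mult.commute s_add_left s_mult)
  have m1: "s (- 1) x = - x" using s_of_real[of "- 1" x] by simp
  have "s \<i> (s z x) = s z (s \<i> x)" by (metis mult.commute s_mult)
  then have iz: "s \<i> (s z x) = s (of_real (Re z)) (s \<i> x) + s (of_real (- Im z)) x"
    using z[of "s \<i> x"] s_mult[of \<i> \<i> x, symmetric] s_of_real
    by (simp add: m1 del: of_real_minus)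
  show ?thesis
  proof -
    have "\<psi> (s z x) = Re z * \<psi> x + Im z * \<psi> (s \<i> x)" by (subst z) (simp only: linear_add[OF \<psi>(1)] r)
    moreover have "\<psi> (s \<i> (s z x)) = Re z * \<psi> (s \<i> x) + - Im z * \<psi> x"
      by (simp only: iz linear_add[OF \<psi>(1)] r)
    ultimately show ?thesis by (simp add: cfun_def complex_eq_iff)
  qed
qed

lemma cfun_norm: "cmod (cfun \<psi> x) \<le> (1 + S) * norm x"
proof -
  have "cmod (cfun \<psi> x) \<le> \<bar>\<psi> x\<bar> + \<bar>\<psi> (s \<i> x)\<bar>"
    using cmod_le[of "cfun \<psi> x"] by (simp add: cfun_def)
  also have "\<dots> \<le> norm x + S * norm x"
    using \<psi>(2)[of x] \<psi>(2)[of "s \<i> x"] s_norm[of \<i> x] by simp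
  finally show ?thesis by (simp add: algebra_simps)
qed

lemma cfun_bounded_linear: "bounded_linear (cfun \<psi>)"
proof (rule bounded_linear_intro[where K = "1 + S"])
  show "cfun \<psi> (r *\<^sub>R x) = r *\<^sub>R cfun \<psi> x" for r x
    using cfun_scale[of "of_real r" x] by (simp add: s_of_real scaleR_conv_of_real)
qed (use cfun_add cfun_norm in \<open>auto simp: mult.commute\<close>)

lemma cfun_resolvent_holomorphic: "(\<lambda>\<mu>. cfun \<psi> (R \<mu> x)) holomorphic_on open_sector c"
proof -
  have "((\<lambda>\<mu>. cfun \<psi> (R \<mu> x)) has_field_derivative - cfun \<psi> (R \<mu> (R \<mu> x))) (at \<mu>)"
    if \<mu>: "\<mu> \<in> open_sector c" for \<mu>
  proof -
    have \<mu>0: "cmod \<mu> > 0" using \<mu> by (simp add: open_sector_def)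
    define C where "C = (1 + S) * (2 * K / cmod \<mu> * norm (R \<mu> (R \<mu> x)))"
    obtain e where e: "e > 0" "ball \<mu> e \<subseteq> open_sector c"
      using open_sector_open \<mu> by (auto simp: open_contains_ball)
    have "((\<lambda>h. (cfun \<psi> (R (\<mu> + h) x) - cfun \<psi> (R \<mu> x)) / h - (- cfun \<psi> (R \<mu> (R \<mu> x)))) \<longlongrightarrow> 0) (at 0)"
    proof (rule Lim_null_comparison)
      show "\<forall>\<^sub>F h in at 0. norm ((cfun \<psi> (R (\<mu> + h) x) - cfun \<psi> (R \<mu> x)) / h - (- cfun \<psi> (R \<mu> (R \<mu> x)))) \<le> C * cmod h"
        unfolding eventually_at
      proof (intro exI[of _ "min e (cmod \<mu> / 2)"] conjI ballI impI)
        show "0 < min e (cmod \<mu> / 2)" using e \<mu>0 by simp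
        fix h :: complex assume "h \<noteq> 0 \<and> dist h 0 < min e (cmod \<mu> / 2)"
        then have h: "h \<noteq> 0" "cmod h < e" "cmod h < cmod \<mu> / 2" by auto
        have l: "\<mu> + h \<in> open_sector c" using e(2) h(2) by (auto simp: subset_iff dist_norm)
        have lb: "cmod \<mu> / 2 \<le> cmod (\<mu> + h)"
          using norm_triangle_ineq2[of \<mu> "- h"] h(3) by simp
        have "R (\<mu> + h) x - R \<mu> x = s (- h) (R (\<mu> + h) (R \<mu> x))"
          using resolvent_identity[OF l \<mu>, of x] by simp
        then have 1: "cfun \<psi> (R (\<mu> + h) x) - cfun \<psi> (R \<mu> x) = - h * cfun \<psi> (R (\<mu> + h) (R \<mu> x))"
          using cfun_scale[of "- h"] by (metis cfun_diff)
        have "R \<mu> (R \<mu> x) - R (\<mu> + h) (R \<mu> x) = s h (R (\<mu> + h) (R \<mu> (R \<mu> x)))"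
          using resolvent_identity[OF l \<mu>, of "R \<mu> x"] s_minus s_mult[of "-1" h] by (metis add_diff_cancel_left' diff_add_cancel
              minus_diff_eq s_add_left s_diff_left)
        then have 2: "cfun \<psi> (R \<mu> (R \<mu> x)) - cfun \<psi> (R (\<mu> + h) (R \<mu> x)) = h * cfun \<psi> (R (\<mu> + h) (R \<mu> (R \<mu> x)))"
          by (metis cfun_diff cfun_scale)
        have "(cfun \<psi> (R (\<mu> + h) x) - cfun \<psi> (R \<mu> x)) / h - (- cfun \<psi> (R \<mu> (R \<mu> x))) =
            h * cfun \<psi> (R (\<mu> + h) (R \<mu> (R \<mu> x)))"
          using h(1) 2 unfolding 1 by simp
        also have "cmod \<dots> \<le> cmod h * ((1 + S) * norm (R (\<mu> + h) (R \<mu> (R \<mu> x))))"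
          unfolding norm_mult by (intro mult_left_mono cfun_norm) auto
        also have "\<dots> \<le> cmod h * ((1 + S) * (2 * K / cmod \<mu> * norm (R \<mu> (R \<mu> x))))"
        proof (intro mult_left_mono)
          have "norm (R (\<mu> + h) (R \<mu> (R \<mu> x))) \<le> K / cmod (\<mu> + h) * norm (R \<mu> (R \<mu> x))" by (rule R_norm[OF l])
          also have "\<dots> \<le> K / (cmod \<mu> / 2) * norm (R \<mu> (R \<mu> x))"
            using lb \<mu>0 nonneg by (intro mult_right_mono divide_left_mono mult_pos_pos) auto
          finally show "norm (R (\<mu> + h) (R \<mu> (R \<mu> x))) \<le> 2 * K / cmod \<mu> * norm (R \<mu> (R \<mu> x))"
            by (simp add: mult.commute)
        qed (use nonneg in auto)
        finally show "norm ((cfun \<psi> (R (\<mu> + h) x) - cfun \<psi> (R \<mu> x)) / h - (- cfun \<psi> (R \<mu> (R \<mu> x)))) \<le> C * cmod h"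
          by (simp add: C_def mult.commute mult.left_commute)
      qed
      show "((\<lambda>h. C * cmod h) \<longlongrightarrow> 0) (at 0)" by (auto intro!: tendsto_eq_intros)
    qed
    then show ?thesis unfolding DERIV_def LIM_zero_iff .
  qed
  then show ?thesis
    unfolding holomorphic_on_def field_differentiable_def by (blast intro: has_field_derivative_at_within)
qed

end

theorem analytic_smoothing:
  assumes T: "T > 0"
  shows "\<exists>C\<ge>0. \<forall>t\<in>{0<..T}. \<forall>z\<in>D. t\<^sup>2 * norm (G t (A z)) \<le> C * norm z"
proof -
  obtain \<rho> where \<rho>: "\<rho> \<ge> 1"
    and q: "(\<lambda>z. z / (1 + kernel_transform \<alpha> \<beta> \<nu> z)) holomorphic_on tilted_region \<rho> (c / 4)"
      "\<And>z. z \<in> tilted_region \<rho> (c / 4) \<Longrightarrow> 1 + kernel_transform \<alpha> \<beta> \<nu> z \<noteq> 0"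
      "\<And>z. z \<in> tilted_region \<rho> (c / 4) \<Longrightarrow> z / (1 + kernel_transform \<alpha> \<beta> \<nu> z) \<in> open_sector c"
      "\<And>z. z \<in> tilted_region \<rho> (c / 4) \<Longrightarrow> cmod (z / (1 + kernel_transform \<alpha> \<beta> \<nu> z)) \<le> 2 * cmod z"
    by (rule volterra_symbol[OF par c]) blast
  define q where "q = (\<lambda>z. z / (1 + kernel_transform \<alpha> \<beta> \<nu> z))"
  note q' = q[folded q_def]
  define Cm where "Cm = (1 + S) * (S * K + 1)"
  define C where "C = exp (3 * \<rho> * T) * (64 / (c / 4)\<^sup>2) * (pi / (3 * \<rho>)) / cmod kernel_constant * Cm"
  have C0: "C \<ge> 0" using nonneg \<rho> by (simp add: C_def Cm_def)
  have "t\<^sup>2 * norm (G t (A z)) \<le> C * norm z" if t: "t \<in> {0<..T}" and z: "z \<in> D" for t z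
  proof -
    have t0: "t > 0" "0 \<le> t" "t \<le> T" using t by auto
    obtain \<psi> :: "'x \<Rightarrow> real" where \<psi>: "linear \<psi>" "\<And>x. \<bar>\<psi> x\<bar> \<le> norm x" "\<psi> (G t (A z)) = norm (G t (A z))"
      by (rule ex_norming_functional[of "G t (A z)"]) blast
    define \<phi> where "\<phi> = cfun \<psi>"
    note \<phi>_diff = cfun_diff[OF \<psi>(1,2), folded \<phi>_def] and \<phi>_scale = cfun_scale[OF \<psi>(1,2), folded \<phi>_def]
      and \<phi>_norm = cfun_norm[OF \<psi>(1,2), folded \<phi>_def] and \<phi>_bl = cfun_bounded_linear[OF \<psi>(1,2), folded \<phi>_def]
      and \<phi>_add = cfun_add[OF \<psi>(1,2), folded \<phi>_def]
    define x where "x = A z"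
    define y where "y = (\<lambda>\<tau>. \<phi> (G \<tau> x))"
    define p where "p = (\<lambda>\<mu>. \<phi> (R \<mu> x))"
    define a where "a = kernel_primitive \<alpha> \<beta> \<nu>"
    have Gc: "continuous_on {0..t} (\<lambda>\<tau>. G \<tau> w)" for w
      using G_cont by (rule continuous_on_subset) auto
    have \<phi>c: "continuous_on {0..t} (\<lambda>\<tau>. \<phi> (G \<tau> w))" for w
      using bounded_linear.continuous_on[OF \<phi>_bl Gc] .
    have Gn: "norm (G \<tau> w) \<le> N * norm w" if "\<tau> \<in> {0..t}" for \<tau> w
      using that t0 by (intro G_norm) auto
    have Rx: "R \<mu> x = s \<mu> (R \<mu> z) - z" if \<mu>: "\<mu> \<in> open_sector c" for \<mu>
    proof -
      have "R \<mu> (s \<mu> z - x) = z" unfolding x_def by (rule R_left[OF \<mu> z])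
      then show ?thesis by (simp add: R_diff[OF \<mu>] R_scale[OF \<mu>] algebra_simps)
    qed
    have "t\<^sup>2 * cmod (y t) \<le> exp (3 * \<rho> * t) * (64 / (c / 4)\<^sup>2) * (pi / (3 * \<rho>)) / cmod kernel_constant * (Cm * norm z)"
    proof (rule smoothing_estimate[where q = q and p = p and \<Sigma> = "open_sector c" and a = a
          and Ca = "1 + exp t * (\<integral>s. indicator {0<..} s * memory_kernel \<alpha> \<beta> \<nu> s * exp (- (1 * s)) \<partial>lborel)"
          and Cb = "1 + 2 * (exp t * (\<integral>s. indicator {0<..} s * memory_kernel \<alpha> \<beta> \<nu> s * exp (- (1 * s)) \<partial>lborel))"
          and ?M2.0 = "(1 + S) * (S * K * (N * norm x) + N * norm x)"])
      show "0 < c / 4" "c / 4 \<le> 1 / 4" "0 < \<rho>" "0 < t" using c \<rho> t0 by auto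
      show "q holomorphic_on tilted_region \<rho> (c / 4)" by (rule q'(1))
      show "q u \<in> open_sector c" if "u \<in> tilted_region \<rho> (c / 4)" for u using q(3)[OF that] by (simp add: q_def)
      show "cmod (q u) \<le> 2 * cmod u" if "u \<in> tilted_region \<rho> (c / 4)" for u using q(4)[OF that] by (simp add: q_def)
      show "0 \<notin> open_sector c" by (simp add: open_sector_def)
      show "p holomorphic_on open_sector c"
        unfolding p_def \<phi>_def by (rule cfun_resolvent_holomorphic[OF \<psi>(1,2)])
      show "cmod (p \<mu>) \<le> Cm * norm z" if \<mu>: "\<mu> \<in> open_sector c" for \<mu>
      proof -
        have "norm (R \<mu> x) \<le> norm (s \<mu> (R \<mu> z)) + norm z" unfolding Rx[OF \<mu>] by (rule norm_triangle_ineq4)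
        also have "\<dots> \<le> (S * K + 1) * norm z" using R_bound[OF \<mu>, of z] by (simp add: algebra_simps)
        finally have "(1 + S) * norm (R \<mu> x) \<le> (1 + S) * ((S * K + 1) * norm z)"
          using nonneg by (intro mult_left_mono) auto
        then show ?thesis using \<phi>_norm[of "R \<mu> x"] by (simp add: p_def Cm_def mult.assoc)
      qed
      show "continuous_on {0..t} y" unfolding y_def by (rule \<phi>c)
      show "a \<in> borel_measurable borel" unfolding a_def by (rule kernel_primitive_measurable[OF par])
      show "\<bar>a \<tau>\<bar> \<le> 1 + exp t * (\<integral>s. indicator {0<..} s * memory_kernel \<alpha> \<beta> \<nu> s * exp (- (1 * s)) \<partial>lborel)" if "\<tau> \<in> {0..t}" for \<tau>
        unfolding a_def by (rule kernel_primitive_bounds[OF par that])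
      fix l :: complex assume l: "2 * \<rho> < Re l"
      have l\<Omega>: "l \<in> tilted_region \<rho> (c / 4)"
        using cball_subset_tilted_region[of "c / 4" \<rho> l] c \<rho> l by (auto simp: subset_iff)
      show "cmod (exp (l * of_real u) / q l - (\<integral>s. indicator {0..u} s *\<^sub>R (exp (l * of_real (u - s)) * of_real (a s)) \<partial>lborel))
          \<le> (1 + 2 * (exp t * (\<integral>s. indicator {0<..} s * memory_kernel \<alpha> \<beta> \<nu> s * exp (- (1 * s)) \<partial>lborel))) / cmod l"
        if "u \<in> {0..t}" for u
        using kernel_primitive_exponential_convolution[OF par _ that, of l] l \<rho> by (simp add: q_def a_def)
      define \<mu> where "\<mu> = q l"
      have \<mu>: "\<mu> \<in> open_sector c" unfolding \<mu>_def q_def by (rule q(3)[OF l\<Omega>])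
      then have \<mu>0: "\<mu> \<noteq> 0" by (simp add: open_sector_def)
      define v where "v = (\<lambda>\<tau>. \<mu> * \<phi> (G \<tau> (R \<mu> x)) - y \<tau>)"
      have vG: "v \<tau> = \<phi> (G \<tau> (s \<mu> (R \<mu> x) - x))" if "0 \<le> \<tau>" for \<tau>
      proof -
        have "G \<tau> (s \<mu> (R \<mu> x) - x) = s \<mu> (G \<tau> (R \<mu> x)) - G \<tau> x"
          using G_lin[OF that, of "s \<mu> (R \<mu> x) - x" x] by (simp add: G_scale[OF that] algebra_simps)
        then show ?thesis by (simp add: v_def y_def \<phi>_diff \<phi>_scale)
      qed
      have vc: "continuous_on {0..t} v" unfolding v_def y_def by (intro continuous_intros \<phi>c)
      have vb: "cmod (v \<tau>) \<le> (1 + S) * (S * K * (N * norm x) + N * norm x)" if "\<tau> \<in> {0..t}" for \<tau>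
      proof -
        have "norm (s \<mu> (R \<mu> x) - x) \<le> S * K * norm x + norm x"
          using norm_triangle_ineq4[of "s \<mu> (R \<mu> x)" x] R_bound[OF \<mu>, of x] by simp
        then have "N * norm (s \<mu> (R \<mu> x) - x) \<le> N * (S * K * norm x + norm x)"
          using nonneg by (intro mult_left_mono) auto
        then have "norm (G \<tau> (s \<mu> (R \<mu> x) - x)) \<le> N * (S * K * norm x + norm x)"
          using Gn[OF that, of "s \<mu> (R \<mu> x) - x"] by linarith
        then have "(1 + S) * norm (G \<tau> (s \<mu> (R \<mu> x) - x)) \<le> (1 + S) * (N * (S * K * norm x + norm x))"
          using nonneg by (intro mult_left_mono) auto
        then show ?thesis using \<phi>_norm[of "G \<tau> (s \<mu> (R \<mu> x) - x)"] vG[of \<tau>] that by (simp add: algebra_simps)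
      qed
      have veq: "(v \<tau> + y \<tau>) / q l = p (q l) + (\<integral>s. indicator {0..\<tau>} s *\<^sub>R (of_real (a (\<tau> - s)) * v s) \<partial>lborel)"
        if \<tau>: "\<tau> \<in> {0..t}" for \<tau>
      proof -
        have \<tau>0: "0 \<le> \<tau>" using \<tau> by simp
        define w where "w = s \<mu> (R \<mu> x) - x"
        have AG: "A (G r (R \<mu> x)) = G r w" if "0 \<le> r" for r
          using G_A[OF that R_in[OF \<mu>, of x]] R_right[OF \<mu>, of x] by (simp add: w_def algebra_simps)
        define h where "h = (\<lambda>r. indicator {0..\<tau>} r *\<^sub>R (a (\<tau> - r) *\<^sub>R G r w))"
        have hm: "h \<in> borel_measurable borel"
        proof -
          have "(\<lambda>r. indicator {0..\<tau>} r *\<^sub>R G r w) \<in> borel_measurable borel"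
            by (rule borel_measurable_continuous_on_indicator) (use continuous_on_subset[OF Gc[of w]] \<tau> in auto)
          moreover have [measurable]: "a \<in> borel_measurable borel" unfolding a_def by (rule kernel_primitive_measurable[OF par])
          ultimately have "(\<lambda>r. a (\<tau> - r) *\<^sub>R (indicator {0..\<tau>} r *\<^sub>R G r w)) \<in> borel_measurable borel" by measurable
          then show ?thesis by (simp add: h_def mult.commute)
        qed
        have hi: "integrable lborel h"
        proof (rule Bochner_Integration.integrable_bound)
          define Ca where "Ca = 1 + exp t * (\<integral>s. indicator {0<..} s * memory_kernel \<alpha> \<beta> \<nu> s * exp (- (1 * s)) \<partial>lborel)"
          show "integrable lborel (\<lambda>r. indicator {0..\<tau>} r * (Ca * (N * norm w)))"
            using \<tau>0 by (intro integrable_mult_left integrable_real_indicator) auto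
          show "h \<in> borel_measurable lborel" using hm by simp
          show "AE r in lborel. norm (h r) \<le> norm (indicator {0..\<tau>} r * (Ca * (N * norm w)))"
          proof (rule AE_I2)
            fix r
            show "norm (h r) \<le> norm (indicator {0..\<tau>} r * (Ca * (N * norm w)))"
            proof (cases "r \<in> {0..\<tau>}")
              case True
              have "\<bar>a (\<tau> - r)\<bar> \<le> Ca"
                unfolding a_def Ca_def by (rule kernel_primitive_bounds[OF par]) (use True \<tau> in auto)
              then have "\<bar>a (\<tau> - r)\<bar> * norm (G r w) \<le> Ca * (N * norm w)"
                using True \<tau> by (intro mult_mono Gn) auto
              then show ?thesis using True by (simp add: h_def)
            qed (simp add: h_def)
          qed
        qed
        have "(LINT r|lebesgue_on {0..\<tau>}. a (\<tau> - r) *\<^sub>R A (G r (R \<mu> x))) =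
            (\<integral>r. indicator {0..\<tau>} r *\<^sub>R (a (\<tau> - r) *\<^sub>R A (G r (R \<mu> x))) \<partial>lebesgue)"
          by (rule integral_restrict_space) simp
        also have "(\<lambda>r. indicator {0..\<tau>} r *\<^sub>R (a (\<tau> - r) *\<^sub>R A (G r (R \<mu> x)))) = h"
          by (auto simp: fun_eq_iff h_def indicator_def AG)
        also have "(\<integral>r. h r \<partial>lebesgue) = (\<integral>r. h r \<partial>lborel)" using hm by (intro integral_completion) simp
        finally have "G \<tau> (R \<mu> x) = R \<mu> x + (\<integral>r. h r \<partial>lborel)"
          using G_volterra[OF \<tau>0 R_in[OF \<mu>, of x]] by (simp add: a_def)
        then have "\<phi> (G \<tau> (R \<mu> x)) = p \<mu> + (\<integral>r. \<phi> (h r) \<partial>lborel)"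
          by (simp add: \<phi>_add p_def integral_bounded_linear[OF \<phi>_bl hi])
        also have "(\<lambda>r. \<phi> (h r)) = (\<lambda>r. indicator {0..\<tau>} r *\<^sub>R (of_real (a (\<tau> - r)) * v r))"
          using linear_scale[OF bounded_linear.linear[OF \<phi>_bl]] linear_0[OF bounded_linear.linear[OF \<phi>_bl]]
          by (auto simp: fun_eq_iff h_def indicator_def vG w_def scaleR_conv_of_real)
        finally show ?thesis using \<mu>0 by (simp add: v_def flip: \<mu>_def)
      qed
      show "\<exists>v. continuous_on {0..t} v \<and>
          (\<forall>s\<in>{0..t}. cmod (v s) \<le> (1 + S) * (S * K * (N * norm x) + N * norm x)) \<and>
          (\<forall>\<tau>\<in>{0..t}. (v \<tau> + y \<tau>) / q l = p (q l) + (\<integral>s. indicator {0..\<tau>} s *\<^sub>R (of_real (a (\<tau> - s)) * v s) \<partial>lborel))"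
        using vc vb veq by blast
    qed
    also have "\<dots> \<le> C * norm z"
    proof -
      have "exp (3 * \<rho> * t) \<le> exp (3 * \<rho> * T)" using t0 \<rho> by simp
      then have "exp (3 * \<rho> * t) * ((64 / (c / 4)\<^sup>2) * (pi / (3 * \<rho>)) / cmod kernel_constant * (Cm * norm z)) \<le>
          exp (3 * \<rho> * T) * ((64 / (c / 4)\<^sup>2) * (pi / (3 * \<rho>)) / cmod kernel_constant * (Cm * norm z))"
        using \<rho> nonneg by (intro mult_right_mono) (auto simp: Cm_def)
      then show ?thesis by (simp add: C_def mult.assoc)
    qed
    finally have "t\<^sup>2 * cmod (y t) \<le> C * norm z" .
    moreover have "norm (G t (A z)) \<le> cmod (y t)"
      using abs_Re_le_cmod[of "y t"] \<psi>(3) by (simp add: y_def \<phi>_def cfun_def x_def)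
    then have "t\<^sup>2 * norm (G t (A z)) \<le> t\<^sup>2 * cmod (y t)" by (intro mult_left_mono) auto
    ultimately show ?thesis by linarith
  qed
  then show ?thesis using C0 by blast
qed

end

section \<open>Compact approximation of the resolvent family\<close>

lemma precompact_scaleR:
  fixes X :: "'a::real_normed_vector set"
  assumes "precompact X"
  shows "precompact ((*\<^sub>R) r ` X)"
proof (rule precompact_approx)
  fix e :: real assume e: "e > 0"
  obtain k where k: "finite k" "X \<subseteq> (\<Union>x\<in>k. ball x (e / (\<bar>r\<bar> + 1)))"
    using assms e unfolding precompact_def by (metis abs_ge_zero add_nonneg_pos divide_pos_pos zero_less_one)
  have "\<exists>y\<in>(*\<^sub>R) r ` k. dist x y \<le> e" if "x \<in> (*\<^sub>R) r ` X" for x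
  proof -
    obtain x' where x': "x = r *\<^sub>R x'" "x' \<in> X" using \<open>x \<in> _\<close> by blast
    then obtain y where y: "y \<in> k" "dist y x' < e / (\<bar>r\<bar> + 1)" using k(2) by auto
    have "dist x (r *\<^sub>R y) = \<bar>r\<bar> * dist y x'"
      by (simp add: x'(1) dist_norm norm_minus_commute flip: scaleR_right_diff_distrib)
    also have "\<dots> \<le> (\<bar>r\<bar> + 1) * (e / (\<bar>r\<bar> + 1))" using y(2) by (intro mult_mono) auto
    finally show ?thesis using y(1) by auto
  qed
  then show "\<exists>S'. precompact S' \<and> (\<forall>x\<in>(*\<^sub>R) r ` X. \<exists>y\<in>S'. dist x y \<le> e)"
    using compact_imp_precompact[OF finite_imp_compact[OF finite_imageI[OF k(1)]]] by blast
qed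

context sectorial_volterra_family
begin

lemma s_commute: "s a (s b x) = s b (s a x)"
  using s_mult[of a b x] s_mult[of b a x] by (simp only: mult.commute[of b a])

theorem compact_approximation:
  assumes T: "T > 0" and \<delta>: "\<delta> > 0"
    and R0: "\<And>x. R0 x \<in> D" "\<And>x. s z0 (R0 x) - A (R0 x) = x" "\<And>x. x \<in> D \<Longrightarrow> R0 (s z0 x - A x) = x"
    and comp: "precompact (R0 ` cball 0 \<delta>)"
  shows "\<exists>C\<ge>0. \<forall>\<mu>>0. \<exists>P. bounded_linear P \<and> (\<forall>x. norm (P x) \<le> S * K * norm x) \<and>
    precompact (P ` cball 0 1) \<and> (\<forall>t\<in>{0<..T}. \<forall>x. norm (G t x - G t (P x)) \<le> C / (t\<^sup>2 * \<mu>) * norm x)"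
proof -
  obtain C where C: "C \<ge> 0" "\<And>t z. t \<in> {0<..T} \<Longrightarrow> z \<in> D \<Longrightarrow> t\<^sup>2 * norm (G t (A z)) \<le> C * norm z"
    using analytic_smoothing[OF T] by blast
  have "\<exists>P. bounded_linear P \<and> (\<forall>x. norm (P x) \<le> S * K * norm x) \<and>
    precompact (P ` cball 0 1) \<and> (\<forall>t\<in>{0<..T}. \<forall>x. norm (G t x - G t (P x)) \<le> (C * K) / (t\<^sup>2 * m) * norm x)"
    if m: "m > 0" for m :: real
  proof -
    define \<mu> where "\<mu> = complex_of_real m"
    have \<mu>: "\<mu> \<in> open_sector c" using m mult_pos_pos[OF c(1) m] by (simp add: \<mu>_def open_sector_def)
    have cm: "cmod \<mu> = m" using m by (simp add: \<mu>_def)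
    define P where "P = (\<lambda>x. s \<mu> (R \<mu> x))"
    have Pd: "P (x - y) = P x - P y" for x y by (simp add: P_def R_diff[OF \<mu>] s_diff)
    have Ps: "P (r *\<^sub>R x) = r *\<^sub>R P x" for r x
    proof -
      have "P (s (of_real r) x) = s (of_real r) (P x)"
        unfolding P_def R_scale[OF \<mu>] by (rule s_commute)
      then show ?thesis by (simp add: s_of_real)
    qed
    have Pn: "norm (P x) \<le> S * K * norm x" for x unfolding P_def by (rule R_bound[OF \<mu>])
    have Pa: "P (x + y) = P x + P y" for x y using Pd[of "x + y" y] by simp
    have bl: "bounded_linear P"
      by (rule bounded_linear_intro[where K = "S * K"]) (use Pa Ps Pn in \<open>auto simp: mult.commute\<close>)
    have R0_scale: "R0 (r *\<^sub>R x) = r *\<^sub>R R0 x" for r x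
    proof -
      have "s z0 (r *\<^sub>R R0 x) - A (r *\<^sub>R R0 x) = r *\<^sub>R x"
      proof -
        have "s z0 (s (of_real r) (R0 x)) = s (of_real r) (s z0 (R0 x))" by (rule s_commute)
        then show ?thesis
          using A_scale[OF R0(1), of "of_real r" x] R0(2)[of x] by (simp add: s_of_real flip: scaleR_right_diff_distrib)
      qed
      then show ?thesis using R0(3)[of "r *\<^sub>R R0 x"] D_scale[OF R0(1), of "of_real r" x] by (simp add: s_of_real)
    qed
    define r where "r = 1 + S * cmod (z0 - \<mu>) * (K / m)"
    have r: "r \<ge> 1" using nonneg m by (simp add: r_def)
    have "P ` cball 0 1 \<subseteq> (*\<^sub>R) (m * (r / \<delta>)) ` (R0 ` cball 0 \<delta>)"
    proof
      fix y assume "y \<in> P ` cball 0 1"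
      then obtain x where x: "y = P x" "norm x \<le> 1" by auto
      define w where "w = x + s (z0 - \<mu>) (R \<mu> x)"
      have "s z0 (R \<mu> x) - A (R \<mu> x) = w"
        using R_right[OF \<mu>, of x] by (simp add: w_def s_diff_left algebra_simps)
      then have "R0 w = R \<mu> x" using R0(3)[OF R_in[OF \<mu>, of x]] by simp
      have "norm (s (z0 - \<mu>) (R \<mu> x)) \<le> S * cmod (z0 - \<mu>) * (K / m)"
      proof -
        have "norm (R \<mu> x) \<le> K / m * norm x" using R_norm[OF \<mu>, of x] by (simp add: cm)
        also have "\<dots> \<le> K / m * 1" using x(2) nonneg m by (intro mult_left_mono) auto
        finally have "S * cmod (z0 - \<mu>) * norm (R \<mu> x) \<le> S * cmod (z0 - \<mu>) * (K / m)"
          using nonneg by (intro mult_left_mono) auto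
        then show ?thesis using s_norm[of "z0 - \<mu>" "R \<mu> x"] by linarith
      qed
      then have w: "norm w \<le> r" using norm_triangle_ineq[of x "s (z0 - \<mu>) (R \<mu> x)"] x(2) by (simp add: w_def r_def)
      have "norm ((\<delta> / r) *\<^sub>R w) \<le> \<delta>" using w r \<delta> by (simp add: field_simps mult_left_mono)
      moreover have "y = (m * (r / \<delta>)) *\<^sub>R R0 ((\<delta> / r) *\<^sub>R w)"
        using r \<delta> by (simp add: R0_scale \<open>R0 w = R \<mu> x\<close> x(1) P_def \<mu>_def s_of_real)
      ultimately show "y \<in> (*\<^sub>R) (m * (r / \<delta>)) ` (R0 ` cball 0 \<delta>)" by auto
    qed
    then have pc: "precompact (P ` cball 0 1)"
      using precompact_scaleR[OF comp] by (rule precompact_subset[rotated])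
    have "norm (G t x - G t (P x)) \<le> (C * K) / (t\<^sup>2 * m) * norm x" if t: "t \<in> {0<..T}" for t x
    proof -
      have t0: "0 \<le> t" "t > 0" using t by auto
      have "G t x - G t (P x) = - G t (A (R \<mu> x))"
        using G_lin[OF t0(1), of "A (R \<mu> x)" x] R_right[OF \<mu>, of x] by (simp add: P_def algebra_simps)
      then have "t\<^sup>2 * norm (G t x - G t (P x)) \<le> C * norm (R \<mu> x)"
        using C(2)[OF t R_in[OF \<mu>, of x]] by simp
      also have "\<dots> \<le> C * (K / m * norm x)"
        using R_norm[OF \<mu>, of x] C(1) by (intro mult_left_mono) (auto simp: cm)
      finally have "t\<^sup>2 * norm (G t x - G t (P x)) \<le> C * (K / m * norm x)" .
      moreover have "n \<le> q / r" if "r * n \<le> q" "0 < r" for n q r :: real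
        using that by (simp add: field_simps)
      ultimately have "norm (G t x - G t (P x)) \<le> (C * (K / m * norm x)) / t\<^sup>2"
        using zero_less_power[OF t0(2)] by blast
      then show ?thesis by (simp add: mult.commute mult.left_commute)
    qed
    then show ?thesis using bl Pn pc by blast
  qed
  then show ?thesis using C(1) nonneg by (intro exI[of _ "C * K"]) auto
qed

end

lemma sin_open_sector_subset_sector:
  assumes \<theta>: "0 < \<theta>" "\<theta> \<le> pi / 2"
  shows "open_sector (sin \<theta>) \<subseteq> sector \<theta>"
proof
  fix z assume z: "z \<in> open_sector (sin \<theta>)"
  then have z0: "z \<noteq> 0" "- sin \<theta> * cmod z < Re z" by (auto simp: open_sector_def)
  have "Re z = cmod z * cos \<bar>Arg z\<bar>"
    using cos_Arg[of z] z0(1) by (simp add: abs_if)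
  then have "cmod z * - sin \<theta> < cmod z * cos \<bar>Arg z\<bar>" using z0 by (simp add: mult.commute)
  then have "- sin \<theta> < cos \<bar>Arg z\<bar>"
    using mult_less_cancel_left_pos[OF iffD2[OF zero_less_norm_iff z0(1)]] by blast
  then have "cos (\<theta> + pi / 2) < cos \<bar>Arg z\<bar>"
    by (simp add: cos_add)
  then have "\<bar>Arg z\<bar> < \<theta> + pi / 2"
  proof (rule contrapos_pp)
    assume "\<not> \<bar>Arg z\<bar> < \<theta> + pi / 2"
    then have "cos \<bar>Arg z\<bar> \<le> cos (\<theta> + pi / 2)"
      using \<theta> Arg_bounded[of z] by (intro cos_monotone_0_pi_le) auto
    then show "\<not> cos (\<theta> + pi / 2) < cos \<bar>Arg z\<bar>" by simp
  qed
  then show "z \<in> sector \<theta>" using z0 by (simp add: sector_def)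
qed

lemma complex_sectorial_resolvent:
  assumes sec: "complex_sectorial s p D A \<theta>"
    and p: "\<And>v. norm v \<le> 2 * p v" "\<And>v. p v \<le> 2 * norm (v :: 'x::real_normed_vector)"
  obtains K where "0 \<le> K"
    and "\<And>\<mu> x. \<mu> \<in> open_sector (sin (\<theta> / 2)) \<Longrightarrow> resolvent s D A \<mu> x \<in> D"
    and "\<And>\<mu> x. \<mu> \<in> open_sector (sin (\<theta> / 2)) \<Longrightarrow> s \<mu> (resolvent s D A \<mu> x) - A (resolvent s D A \<mu> x) = x"
    and "\<And>\<mu> x. \<mu> \<in> open_sector (sin (\<theta> / 2)) \<Longrightarrow> x \<in> D \<Longrightarrow> resolvent s D A \<mu> (s \<mu> x - A x) = x"
    and "\<And>\<mu> x. \<mu> \<in> open_sector (sin (\<theta> / 2)) \<Longrightarrow> norm (resolvent s D A \<mu> x) \<le> K / cmod \<mu> * norm x"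
proof -
  have \<theta>: "0 < \<theta>" "\<theta> \<le> pi / 2" and sub: "sector \<theta> \<subseteq> resolvent_set s p D A"
    and est: "\<forall>\<omega>\<in>{0<..<\<theta>}. \<exists>K\<ge>1. \<forall>z\<in>closure (sector (\<theta> - \<omega>)). z \<noteq> 0 \<longrightarrow>
        (\<forall>y. p (resolvent s D A z y) \<le> K / cmod z * p y)"
    using sec by (auto simp: complex_sectorial_def)
  have "\<theta> / 2 \<in> {0<..<\<theta>}" using \<theta> by auto
  from bspec[OF est this] obtain K where K: "K \<ge> 1" "\<forall>z\<in>closure (sector (\<theta> - \<theta> / 2)). z \<noteq> 0 \<longrightarrow>
        (\<forall>y. p (resolvent s D A z y) \<le> K / cmod z * p y)" by blast
  have sec2: "\<mu> \<in> sector (\<theta> / 2)" "\<mu> \<noteq> 0" if "\<mu> \<in> open_sector (sin (\<theta> / 2))" for \<mu>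
    using sin_open_sector_subset_sector[of "\<theta> / 2"] \<theta> that by (auto simp: open_sector_def)
  have bij: "bij_betw (\<lambda>x. s \<mu> x - A x) D UNIV" if "\<mu> \<in> open_sector (sin (\<theta> / 2))" for \<mu>
  proof -
    have "\<mu> \<in> sector \<theta>" using sec2[OF that] \<theta> by (auto simp: sector_def)
    then show ?thesis using sub by (auto simp: resolvent_set_def)
  qed
  show thesis
  proof (rule that[of "4 * K"])
    fix \<mu> x assume \<mu>: "\<mu> \<in> open_sector (sin (\<theta> / 2))"
    have surj: "x \<in> (\<lambda>x. s \<mu> x - A x) ` D" using bij[OF \<mu>] by (auto simp: bij_betw_def)
    show "resolvent s D A \<mu> x \<in> D" unfolding resolvent_def by (rule inv_into_into[OF surj])
    show "s \<mu> (resolvent s D A \<mu> x) - A (resolvent s D A \<mu> x) = x"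
      unfolding resolvent_def by (rule f_inv_into_f[OF surj])
    show "resolvent s D A \<mu> (s \<mu> x - A x) = x" if "x \<in> D"
      unfolding resolvent_def using bij[OF \<mu>] that by (intro inv_into_f_f) (auto simp: bij_betw_def)
    have "p (resolvent s D A \<mu> x) \<le> K / cmod \<mu> * p x"
    proof -
      have "\<mu> \<in> closure (sector (\<theta> - \<theta> / 2))" using sec2(1)[OF \<mu>] closure_subset by auto
      then show ?thesis using K(2) sec2(2)[OF \<mu>] by blast
    qed
    also have "\<dots> \<le> K / cmod \<mu> * (2 * norm x)" using K(1) p(2) by (intro mult_left_mono) auto
    finally show "norm (resolvent s D A \<mu> x) \<le> 4 * K / cmod \<mu> * norm x"
      using p(1)[of "resolvent s D A \<mu> x"] by simp
  qed (use K in auto)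
qed

lemma compact_resolvent_precompact:
  assumes comp: "complex_compact_resolvent s p D A"
    and p: "\<And>v. p v \<le> 2 * norm (v :: 'x::real_normed_vector)"
  obtains z0 where "\<And>x. resolvent s D A z0 x \<in> D"
    and "\<And>x. s z0 (resolvent s D A z0 x) - A (resolvent s D A z0 x) = x"
    and "\<And>x. x \<in> D \<Longrightarrow> resolvent s D A z0 (s z0 x - A x) = x"
    and "precompact (resolvent s D A z0 ` cball 0 (1 / 2))"
proof -
  obtain z0 where z0: "z0 \<in> resolvent_set s p D A" "compact (closure (resolvent s D A z0 ` {y. p y \<le> 1}))"
    using comp unfolding complex_compact_resolvent_def by blast
  have bij: "bij_betw (\<lambda>x. s z0 x - A x) D UNIV" using z0(1) by (simp add: resolvent_set_def)
  show thesis
  proof (rule that[of z0])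
    fix x
    have surj: "x \<in> (\<lambda>x. s z0 x - A x) ` D" using bij by (auto simp: bij_betw_def)
    show "resolvent s D A z0 x \<in> D" unfolding resolvent_def by (rule inv_into_into[OF surj])
    show "s z0 (resolvent s D A z0 x) - A (resolvent s D A z0 x) = x"
      unfolding resolvent_def by (rule f_inv_into_f[OF surj])
    show "resolvent s D A z0 (s z0 x - A x) = x" if "x \<in> D"
      unfolding resolvent_def using bij that by (intro inv_into_f_f) (auto simp: bij_betw_def)
    have "cball 0 (1 / 2) \<subseteq> {y. p y \<le> 1}"
    proof
      fix y :: 'x assume "y \<in> cball 0 (1 / 2)"
      then show "y \<in> {y. p y \<le> 1}" using p[of y] by simp
    qed
    then have "resolvent s D A z0 ` cball 0 (1 / 2) \<subseteq> closure (resolvent s D A z0 ` {y. p y \<le> 1})"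
      by (rule order_trans[OF image_mono closure_subset])
    then show "precompact (resolvent s D A z0 ` cball 0 (1 / 2))"
      by (rule precompact_subset[OF compact_imp_precompact[OF z0(2)]])
  qed
qed

lemma to_cplx_diff: "to_cplx (x - y) = to_cplx x - to_cplx y"
  using to_cplx_add[of "x - y" y] by simp

lemma to_cplx_inj: "to_cplx x = to_cplx y \<Longrightarrow> x = y"
  using norm_to_cplx[of "x - y"] by (simp add: to_cplx_diff)

lemma to_cplx_of_real: "to_cplx (of_real r) = of_real r"
  using to_cplx_real_scale[of r] by (simp add: of_real_def)

lemma kernel_convolution_integrable:
  fixes g :: "real \<Rightarrow> 'x::{banach,second_countable_topology}"
  assumes par: "\<alpha> > 0" "\<beta> \<ge> 0" "0 < \<nu>" and g: "continuous_on {0..t} g"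
  shows "integrable (lebesgue_on {0..t}) (\<lambda>\<tau>. kernel_primitive \<alpha> \<beta> \<nu> (t - \<tau>) *\<^sub>R g \<tau>)"
proof -
  define a where "a = kernel_primitive \<alpha> \<beta> \<nu>"
  have [measurable]: "a \<in> borel_measurable borel" unfolding a_def by (rule kernel_primitive_measurable[OF par])
  define Ca where "Ca = 1 + exp t * (\<integral>s. indicator {0<..} s * memory_kernel \<alpha> \<beta> \<nu> s * exp (- (1 * s)) \<partial>lborel)"
  have "bounded (g ` {0..t})" by (intro compact_imp_bounded compact_continuous_image g) simp
  then obtain M where "\<forall>u\<in>g ` {0..t}. norm u \<le> M" unfolding bounded_iff by blast
  then have M: "norm (g \<tau>) \<le> M" if "\<tau> \<in> {0..t}" for \<tau> using that by blast
  show ?thesis unfolding a_def[symmetric]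
  proof (rule Bochner_Integration.integrable_bound)
    show "integrable (lebesgue_on {0..t}) (\<lambda>_. Ca * M)" by simp
    have "(\<lambda>\<tau>. a (t - \<tau>)) \<in> borel_measurable borel" by measurable
    then have "(\<lambda>\<tau>. a (t - \<tau>)) \<in> borel_measurable (lebesgue_on {0..t})"
      by (intro measurable_restrict_space1 measurable_completion) simp
    then show "(\<lambda>\<tau>. a (t - \<tau>) *\<^sub>R g \<tau>) \<in> borel_measurable (lebesgue_on {0..t})"
      using continuous_imp_measurable_on_sets_lebesgue[OF g] by simp
    show "AE \<tau> in lebesgue_on {0..t}. norm (a (t - \<tau>) *\<^sub>R g \<tau>) \<le> norm (Ca * M)"
    proof (rule AE_I2)
      fix \<tau> assume "\<tau> \<in> space (lebesgue_on {0..t})"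
      then have \<tau>: "\<tau> \<in> {0..t}" by simp
      have "\<bar>a (t - \<tau>)\<bar> \<le> Ca"
        unfolding a_def Ca_def by (rule kernel_primitive_bounds[OF par]) (use \<tau> in auto)
      then have "\<bar>a (t - \<tau>)\<bar> * norm (g \<tau>) \<le> Ca * M" using M[OF \<tau>] by (intro mult_mono) auto
      then show "norm (a (t - \<tau>) *\<^sub>R g \<tau>) \<le> norm (Ca * M)" by simp
    qed
  qed
qed

lemma norm_fst_component: "norm (fst v) \<le> norm v" and norm_snd_component: "norm (snd v) \<le> norm v"
  using norm_fst_le[of "fst v" "snd v"] norm_snd_le[of "snd v" "fst v"] by simp_all

lemma norm_cx_scale_le: "norm (cx_scale z v) \<le> 4 * cmod z * norm v"
proof -
  obtain x y where v: "v = (x, y)" by (cases v)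
  have n: "norm x \<le> norm v" "norm y \<le> norm v" using norm_fst_component[of v] norm_snd_component[of v] by (auto simp: v)
  have z: "\<bar>Re z\<bar> \<le> cmod z" "\<bar>Im z\<bar> \<le> cmod z" by (rule abs_Re_le_cmod, rule abs_Im_le_cmod)
  have b: "norm (r *\<^sub>R u) \<le> cmod z * norm v" if "\<bar>r\<bar> \<le> cmod z" "norm u \<le> norm v" for r and u :: 'a
    using mult_mono[OF that] by simp
  have "norm (cx_scale z v) \<le> norm (Re z *\<^sub>R x - Im z *\<^sub>R y) + norm (Re z *\<^sub>R y + Im z *\<^sub>R x)"
    using norm_Pair_le[of "Re z *\<^sub>R x - Im z *\<^sub>R y" "Re z *\<^sub>R y + Im z *\<^sub>R x"] by (simp add: cx_scale_def v)
  also have "\<dots> \<le> (norm (Re z *\<^sub>R x) + norm (Im z *\<^sub>R y)) + (norm (Re z *\<^sub>R y) + norm (Im z *\<^sub>R x))"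
    by (intro add_mono norm_triangle_ineq norm_triangle_ineq4)
  also have "\<dots> \<le> (cmod z * norm v + cmod z * norm v) + (cmod z * norm v + cmod z * norm v)"
    by (intro add_mono b z n)
  finally show ?thesis by simp
qed

lemma
  fixes v :: "'w::real_normed_vector \<times> 'w"
  shows cx_norm_le: "cx_norm v \<le> 2 * norm v" and norm_le_cx_norm: "norm v \<le> 2 * cx_norm v"
proof -
  have b: "norm (cos t *\<^sub>R fst v + sin t *\<^sub>R snd v) \<le> 2 * norm v" for t
  proof -
    have "norm (cos t *\<^sub>R fst v + sin t *\<^sub>R snd v) \<le> \<bar>cos t\<bar> * norm (fst v) + \<bar>sin t\<bar> * norm (snd v)"
      by (metis norm_scaleR norm_triangle_ineq)
    also have "\<dots> \<le> 1 * norm v + 1 * norm v"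
      using norm_fst_component[of v] norm_snd_component[of v] by (intro add_mono mult_mono) auto
    finally show ?thesis by simp
  qed
  show "cx_norm v \<le> 2 * norm v" unfolding cx_norm_def by (rule cSUP_least) (auto intro: b)
  have up: "norm (cos t *\<^sub>R fst v + sin t *\<^sub>R snd v) \<le> cx_norm v" for t
    unfolding cx_norm_def by (rule cSUP_upper) (auto intro!: bdd_aboveI2 b)
  show "norm v \<le> 2 * cx_norm v"
    using up[of 0] up[of "pi / 2"] norm_Pair_le[of "fst v" "snd v"] by simp
qed

theorem resolvent_family_compact_approximation:
  fixes sW :: "'k::rc_field \<Rightarrow> 'w::{banach,second_countable_topology} \<Rightarrow> 'w"
  assumes sW: "normed_space_over sW" and hyp: "T > 0" "\<alpha> > 0" "\<beta> \<ge> 0" "0 < \<nu>" "\<nu> < 1"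
    and D: "module.subspace sW D" and A: "linear_on sW sW D A"
    and sec: "sectorial sW D A (\<nu> * pi / 2)" and comp: "compact_resolvent sW D A"
    and G: "resolvent_family sW D A (memory_kernel \<alpha> \<beta> \<nu>) G" and N: "\<forall>t\<in>{0..T}. onorm (G t) \<le> N"
  shows "\<exists>C\<ge>0. \<exists>K\<ge>0. \<forall>\<mu>>0. \<exists>P. bounded_linear P \<and> (\<forall>x. norm (P x) \<le> K * norm x) \<and>
    precompact (P ` cball 0 1) \<and> (\<forall>t\<in>{0<..T}. \<forall>x. norm (G t x - G t (P x)) \<le> C / (t\<^sup>2 * \<mu>) * norm x)"
proof -
  interpret normed_space_over sW by fact
  define \<theta> where "\<theta> = \<nu> * pi / 2"
  have \<theta>: "0 < \<theta>" "\<theta> < pi / 2" using hyp by (auto simp: \<theta>_def)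
  define c where "c = sin (\<theta> / 2)"
  have c: "0 < c" "c < 1"
  proof -
    show "0 < c" unfolding c_def using \<theta> by (intro sin_gt_zero) auto
    have "sin (\<theta> / 2) < sin (pi / 2)" using \<theta> by (intro sin_monotone_2pi) auto
    then show "c < 1" by (simp add: c_def)
  qed
  have Gbl: "bounded_linear (G t)" and Gs: "G t (sW k x) = sW k (G t x)" if "0 \<le> t" for t k x
    using G that by (auto simp: resolvent_family_def bounded_linear_over_def linear_on_def)
  have Gadd: "G t (x + y) = G t x + G t y" and GsR: "G t (r *\<^sub>R x) = r *\<^sub>R G t x" if "0 \<le> t" for t x y r
    using Gbl[OF that] by (simp_all add: linear_add linear_scale bounded_linear.linear)
  have Gn: "norm (G t x) \<le> N * norm x" if "t \<in> {0..T}" for t x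
  proof -
    have "norm (G t x) \<le> onorm (G t) * norm x" using that by (intro onorm Gbl) auto
    also have "\<dots> \<le> N * norm x" using N that by (intro mult_right_mono) auto
    finally show ?thesis .
  qed
  have N0: "0 \<le> N" 
  proof -
    have "0 \<le> onorm (G 0)" by (rule onorm_pos_le[OF Gbl]) simp
    also have "\<dots> \<le> N" using N hyp(1) by simp
    finally show ?thesis .
  qed
  have Gc: "continuous_on {0..} (\<lambda>t. G t x)" for x using G by (simp add: resolvent_family_def)
  have GD: "G t x \<in> D" "G t (A x) = A (G t x)" if "0 \<le> t" "x \<in> D" for t x
    using G that by (auto simp: resolvent_family_def)
  have GV: "G t x = x + (LINT \<tau>|lebesgue_on {0..t}. kernel_primitive \<alpha> \<beta> \<nu> (t - \<tau>) *\<^sub>R A (G \<tau> x))"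
    if "0 \<le> t" "x \<in> D" for t x
    using G that by (simp add: resolvent_family_def kernel_primitive_eq)
  have Dadd: "x + y \<in> D" if "x \<in> D" "y \<in> D" for x y using D that by (simp add: subspace_def)
  have Ds: "sW k x \<in> D" if "x \<in> D" for k x using D that by (simp add: subspace_def)
  have D0: "0 \<in> D" using D by (simp add: subspace_def)
  have Aadd: "A (x + y) = A x + A y" if "x \<in> D" "y \<in> D" for x y using A that by (simp add: linear_on_def)
  have As: "A (sW k x) = sW k (A x)" if "x \<in> D" for k x using A that by (simp add: linear_on_def)
  have sR: "r *\<^sub>R x = sW (of_real r) x" for r x by (simp add: scale_of_real)
  have DR: "r *\<^sub>R x \<in> D" and AR: "A (r *\<^sub>R x) = r *\<^sub>R A x" if "x \<in> D" for r x
    using that by (simp_all add: sR Ds As)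
  show ?thesis
  proof (cases "surj (to_cplx :: 'k \<Rightarrow> complex)")
    case True
    define i where "i = (inv to_cplx :: complex \<Rightarrow> 'k)"
    have ti: "to_cplx (i z) = z" for z unfolding i_def by (rule surj_f_inv_f[OF True])
    have i_add: "i (z + z') = i z + i z'" for z z' by (rule to_cplx_inj) (simp add: ti to_cplx_add)
    have i_mult: "i (z * z') = i z * i z'" for z z' by (rule to_cplx_inj) (simp add: ti to_cplx_mult)
    have i_real: "i (of_real r) = of_real r" for r by (rule to_cplx_inj) (simp add: ti to_cplx_of_real)
    have i_norm: "norm (i z) = cmod z" for z using norm_to_cplx[of "i z"] by (simp add: ti)
    define s where "s = (\<lambda>z. sW (i z))"
    have sec': "complex_sectorial s norm D A \<theta>" and comp': "complex_compact_resolvent s norm D A"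
      using sec comp True by (simp_all add: sectorial_def compact_resolvent_def s_def i_def \<theta>_def)
    obtain K where K: "0 \<le> K" "\<And>\<mu> x. \<mu> \<in> open_sector c \<Longrightarrow> resolvent s D A \<mu> x \<in> D"
      "\<And>\<mu> x. \<mu> \<in> open_sector c \<Longrightarrow> s \<mu> (resolvent s D A \<mu> x) - A (resolvent s D A \<mu> x) = x"
      "\<And>\<mu> x. \<mu> \<in> open_sector c \<Longrightarrow> x \<in> D \<Longrightarrow> resolvent s D A \<mu> (s \<mu> x - A x) = x"
      "\<And>\<mu> x. \<mu> \<in> open_sector c \<Longrightarrow> norm (resolvent s D A \<mu> x) \<le> K / cmod \<mu> * norm x"
      unfolding c_def by (rule complex_sectorial_resolvent[OF sec']) auto
    interpret sectorial_volterra_family s D A "resolvent s D A" G c 1 K N T \<alpha> \<beta> \<nu>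
      by unfold_locales
        (use hyp c K N0 Gs Gadd Gn Gc GD GV Dadd Ds Aadd As in
          \<open>auto simp: s_def i_add i_mult i_real scale_of_real i_norm norm_scale scale_right_distrib scale_left_distrib\<close>)
    obtain z0 where z0: "\<And>x. resolvent s D A z0 x \<in> D"
      "\<And>x. s z0 (resolvent s D A z0 x) - A (resolvent s D A z0 x) = x"
      "\<And>x. x \<in> D \<Longrightarrow> resolvent s D A z0 (s z0 x - A x) = x"
      "precompact (resolvent s D A z0 ` cball 0 (1 / 2))"
      by (rule compact_resolvent_precompact[OF comp']) auto
    have "\<exists>C\<ge>0. \<forall>\<mu>>0. \<exists>P. bounded_linear P \<and> (\<forall>x. norm (P x) \<le> 1 * K * norm x) \<and>
      precompact (P ` cball 0 1) \<and> (\<forall>t\<in>{0<..T}. \<forall>x. norm (G t x - G t (P x)) \<le> C / (t\<^sup>2 * \<mu>) * norm x)"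
      by (rule compact_approximation[OF hyp(1) _ z0]) auto
    then show ?thesis using K(1) by auto
  next
    case False
    define AA where "AA = map_prod A A"
    define GG where "GG = (\<lambda>t v. (G t (fst v), G t (snd v)))"
    have sec': "complex_sectorial cx_scale cx_norm (D \<times> D) AA \<theta>"
      and comp': "complex_compact_resolvent cx_scale cx_norm (D \<times> D) AA"
      using sec comp False by (simp_all add: sectorial_def compact_resolvent_def AA_def \<theta>_def)
    define R where "R = resolvent cx_scale (D \<times> D) AA"
    obtain K where K: "0 \<le> K" "\<And>\<mu> x. \<mu> \<in> open_sector c \<Longrightarrow> R \<mu> x \<in> D \<times> D"
      "\<And>\<mu> x. \<mu> \<in> open_sector c \<Longrightarrow> cx_scale \<mu> (R \<mu> x) - AA (R \<mu> x) = x"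
      "\<And>\<mu> x. \<mu> \<in> open_sector c \<Longrightarrow> x \<in> D \<times> D \<Longrightarrow> R \<mu> (cx_scale \<mu> x - AA x) = x"
      "\<And>\<mu> x. \<mu> \<in> open_sector c \<Longrightarrow> norm (R \<mu> x) \<le> K / cmod \<mu> * norm x"
      unfolding c_def R_def by (rule complex_sectorial_resolvent[OF sec' norm_le_cx_norm cx_norm_le]) blast
    interpret sectorial_volterra_family cx_scale "D \<times> D" AA R GG c 4 K "2 * N" T \<alpha> \<beta> \<nu>
    proof unfold_locales
      show "0 < \<alpha>" "0 \<le> \<beta>" "0 < \<nu>" "0 < c" "c < 1" "0 \<le> K" "0 \<le> 2 * N" "(0::real) \<le> 4" using hyp c K N0 by auto
      fix z z' :: complex and x y :: "'w \<times> 'w" and r t :: real and \<mu>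
      show "cx_scale z (x + y) = cx_scale z x + cx_scale z y"
        "cx_scale (z + z') x = cx_scale z x + cx_scale z' x"
        "cx_scale (z * z') x = cx_scale z (cx_scale z' x)"
        "cx_scale (of_real r) x = r *\<^sub>R x"
        by (simp_all add: cx_scale_def prod_eq_iff algebra_simps)
      show "norm (cx_scale z x) \<le> 4 * cmod z * norm x" by (rule norm_cx_scale_le)
      have Ddiff: "u - v \<in> D" and Adiff: "A (u - v) = A u - A v" if "u \<in> D" "v \<in> D" for u v
        using Dadd[of u "(- 1) *\<^sub>R v"] Aadd[of u "(- 1) *\<^sub>R v"] DR[of v "- 1"] AR[of v "- 1"] that by auto
      show "x \<in> D \<times> D \<Longrightarrow> y \<in> D \<times> D \<Longrightarrow> x + y \<in> D \<times> D" by (auto intro: Dadd)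
      show "x \<in> D \<times> D \<Longrightarrow> cx_scale z x \<in> D \<times> D" by (auto simp: cx_scale_def intro!: Dadd Ddiff DR)
      show "x \<in> D \<times> D \<Longrightarrow> y \<in> D \<times> D \<Longrightarrow> AA (x + y) = AA x + AA y" by (auto simp: AA_def Aadd)
      show "x \<in> D \<times> D \<Longrightarrow> AA (cx_scale z x) = cx_scale z (AA x)"
        by (auto simp: AA_def cx_scale_def Aadd Adiff AR DR)
      show "\<mu> \<in> open_sector c \<Longrightarrow> R \<mu> x \<in> D \<times> D" by (rule K(2))
      show "\<mu> \<in> open_sector c \<Longrightarrow> cx_scale \<mu> (R \<mu> x) - AA (R \<mu> x) = x" by (rule K(3))
      show "\<mu> \<in> open_sector c \<Longrightarrow> x \<in> D \<times> D \<Longrightarrow> R \<mu> (cx_scale \<mu> x - AA x) = x" by (rule K(4))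
      show "\<mu> \<in> open_sector c \<Longrightarrow> norm (R \<mu> x) \<le> K / cmod \<mu> * norm x" by (rule K(5))
      have Gdiff: "G t (u - v) = G t u - G t v" if "0 \<le> t" for u v
        using Gbl[OF that] by (simp add: linear_diff bounded_linear.linear)
      show "0 \<le> t \<Longrightarrow> GG t (x + y) = GG t x + GG t y" by (simp add: GG_def Gadd)
      show "0 \<le> t \<Longrightarrow> GG t (cx_scale z x) = cx_scale z (GG t x)"
        by (simp add: GG_def cx_scale_def Gadd Gdiff GsR)
      show "t \<in> {0..T} \<Longrightarrow> norm (GG t x) \<le> 2 * N * norm x"
      proof -
        assume t: "t \<in> {0..T}"
        have "norm (GG t x) \<le> norm (G t (fst x)) + norm (G t (snd x))" unfolding GG_def by (rule norm_Pair_le)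
        also have "\<dots> \<le> N * norm (fst x) + N * norm (snd x)" by (intro add_mono Gn t)
        also have "\<dots> \<le> N * norm x + N * norm x"
          using N0 norm_fst_component[of x] norm_snd_component[of x] by (intro add_mono mult_left_mono) auto
        finally show ?thesis by simp
      qed
      show "continuous_on {0..} (\<lambda>t. GG t x)" unfolding GG_def by (intro continuous_on_Pair Gc)
      show "0 \<le> t \<Longrightarrow> x \<in> D \<times> D \<Longrightarrow> GG t x \<in> D \<times> D" by (auto simp: GG_def GD)
      show "0 \<le> t \<Longrightarrow> x \<in> D \<times> D \<Longrightarrow> GG t (AA x) = AA (GG t x)" by (auto simp: GG_def AA_def GD)
      show "GG t x = x + (LINT \<tau>|lebesgue_on {0..t}. kernel_primitive \<alpha> \<beta> \<nu> (t - \<tau>) *\<^sub>R AA (GG \<tau> x))"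
        if t: "0 \<le> t" and x: "x \<in> D \<times> D"
      proof -
        let ?h = "\<lambda>\<tau>. kernel_primitive \<alpha> \<beta> \<nu> (t - \<tau>) *\<^sub>R (G \<tau> (A (fst x)), G \<tau> (A (snd x)))"
        have eq: "kernel_primitive \<alpha> \<beta> \<nu> (t - \<tau>) *\<^sub>R AA (GG \<tau> x) = ?h \<tau>" if "\<tau> \<in> space (lebesgue_on {0..t})" for \<tau>
          using that x by (auto simp: AA_def GG_def GD)
        have cont: "continuous_on {0..t} (\<lambda>\<tau>. (G \<tau> (A (fst x)), G \<tau> (A (snd x))))"
          by (intro continuous_on_Pair continuous_on_subset[OF Gc]) auto
        have int: "integrable (lebesgue_on {0..t}) ?h"
          by (rule kernel_convolution_integrable[OF hyp(2,3,4) cont])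
        have "fst (LINT \<tau>|lebesgue_on {0..t}. ?h \<tau>) = (LINT \<tau>|lebesgue_on {0..t}. kernel_primitive \<alpha> \<beta> \<nu> (t - \<tau>) *\<^sub>R G \<tau> (A (fst x)))"
          by (subst integral_bounded_linear[OF bounded_linear_fst int, symmetric]) simp
        moreover have "snd (LINT \<tau>|lebesgue_on {0..t}. ?h \<tau>) = (LINT \<tau>|lebesgue_on {0..t}. kernel_primitive \<alpha> \<beta> \<nu> (t - \<tau>) *\<^sub>R G \<tau> (A (snd x)))"
          by (subst integral_bounded_linear[OF bounded_linear_snd int, symmetric]) simp
        moreover have "G t u = u + (LINT \<tau>|lebesgue_on {0..t}. kernel_primitive \<alpha> \<beta> \<nu> (t - \<tau>) *\<^sub>R G \<tau> (A u))" if "u \<in> D" for u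
        proof -
          have "(LINT \<tau>|lebesgue_on {0..t}. kernel_primitive \<alpha> \<beta> \<nu> (t - \<tau>) *\<^sub>R A (G \<tau> u)) =
              (LINT \<tau>|lebesgue_on {0..t}. kernel_primitive \<alpha> \<beta> \<nu> (t - \<tau>) *\<^sub>R G \<tau> (A u))"
            by (rule Bochner_Integration.integral_cong) (use that in \<open>auto simp: GD\<close>)
          then show ?thesis using GV[OF t that] by simp
        qed
        ultimately have "GG t x = x + (LINT \<tau>|lebesgue_on {0..t}. ?h \<tau>)"
          using x by (auto simp: GG_def prod_eq_iff)
        also have "(LINT \<tau>|lebesgue_on {0..t}. ?h \<tau>) = (LINT \<tau>|lebesgue_on {0..t}. kernel_primitive \<alpha> \<beta> \<nu> (t - \<tau>) *\<^sub>R AA (GG \<tau> x))"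
          by (rule Bochner_Integration.integral_cong[OF refl]) (simp only: eq)
        finally show ?thesis .
      qed
    qed
    obtain z0 where z0: "\<And>x. resolvent cx_scale (D \<times> D) AA z0 x \<in> D \<times> D"
      "\<And>x. cx_scale z0 (resolvent cx_scale (D \<times> D) AA z0 x) - AA (resolvent cx_scale (D \<times> D) AA z0 x) = x"
      "\<And>x. x \<in> D \<times> D \<Longrightarrow> resolvent cx_scale (D \<times> D) AA z0 (cx_scale z0 x - AA x) = x"
      "precompact (resolvent cx_scale (D \<times> D) AA z0 ` cball 0 (1 / 2))"
      by (rule compact_resolvent_precompact[OF comp' cx_norm_le]) blast
    have "\<exists>C\<ge>0. \<forall>\<mu>>0. \<exists>P. bounded_linear P \<and> (\<forall>x. norm (P x) \<le> 4 * K * norm x) \<and>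
      precompact (P ` cball 0 1) \<and> (\<forall>t\<in>{0<..T}. \<forall>x. norm (GG t x - GG t (P x)) \<le> C / (t\<^sup>2 * \<mu>) * norm x)"
      by (rule compact_approximation[OF hyp(1) _ z0]) auto
    then obtain C where C: "C \<ge> 0" "\<And>\<mu>. \<mu> > 0 \<Longrightarrow> \<exists>P. bounded_linear P \<and> (\<forall>x. norm (P x) \<le> 4 * K * norm x) \<and>
      precompact (P ` cball 0 1) \<and> (\<forall>t\<in>{0<..T}. \<forall>x. norm (GG t x - GG t (P x)) \<le> C / (t\<^sup>2 * \<mu>) * norm x)"
      by blast
    have "\<exists>P. bounded_linear P \<and> (\<forall>x. norm (P x) \<le> 4 * K * norm x) \<and>
      precompact (P ` cball 0 1) \<and> (\<forall>t\<in>{0<..T}. \<forall>x. norm (G t x - G t (P x)) \<le> C / (t\<^sup>2 * \<mu>) * norm x)"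
      if \<mu>: "\<mu> > 0" for \<mu> :: real
    proof -
      obtain Q where Q: "bounded_linear Q" "\<And>x. norm (Q x) \<le> 4 * K * norm x" "precompact (Q ` cball 0 1)"
        "\<And>t x. t \<in> {0<..T} \<Longrightarrow> norm (GG t x - GG t (Q x)) \<le> C / (t\<^sup>2 * \<mu>) * norm x"
        using C(2)[OF \<mu>] by blast
      define P where "P = (\<lambda>x. fst (Q (x, 0)))"
      have "bounded_linear (\<lambda>x::'w. (x, 0::'w))"
        by (rule bounded_linear_Pair[OF bounded_linear_ident bounded_linear_zero])
      then have "bounded_linear P"
        unfolding P_def by (intro bounded_linear_fst_comp bounded_linear_compose[OF Q(1)])
      moreover have "norm (P x) \<le> 4 * K * norm x" for x
        using norm_fst_component[of "Q (x, 0)"] Q(2)[of "(x, 0)"] by (simp add: P_def)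
      moreover have "precompact (P ` cball 0 1)"
        unfolding precompact_def
      proof (intro allI impI)
        fix e :: real assume "e > 0"
        then obtain k where k: "finite k" "Q ` cball 0 1 \<subseteq> (\<Union>x\<in>k. ball x e)"
          using Q(3) unfolding precompact_def by blast
        have "P ` cball 0 1 \<subseteq> (\<Union>x\<in>fst ` k. ball x e)"
        proof
          fix y assume "y \<in> P ` cball 0 1"
          then obtain x where x: "y = fst (Q (x, 0))" "norm x \<le> 1" by (auto simp: P_def)
          then have "Q (x, 0) \<in> Q ` cball 0 1" by (intro imageI) simp
          then obtain u where u: "u \<in> k" "dist u (Q (x, 0)) < e" using k(2) by auto
          have "dist (fst u) y < e" using dist_fst_le[of u "Q (x, 0)"] u x by simp
          then show "y \<in> (\<Union>x\<in>fst ` k. ball x e)" using u(1) by auto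
        qed
        then show "\<exists>k. finite k \<and> P ` cball 0 1 \<subseteq> (\<Union>x\<in>k. ball x e)"
          by (rule exI[of _ "fst ` k", OF conjI[rotated]]) (use k(1) in simp)
      qed
      moreover have "norm (G t x - G t (P x)) \<le> C / (t\<^sup>2 * \<mu>) * norm x" if "t \<in> {0<..T}" for t x
        using norm_fst_component[of "GG t (x, 0) - GG t (Q (x, 0))"] Q(4)[OF that, of "(x, 0)"]
        by (simp add: P_def GG_def)
      ultimately show ?thesis by blast
    qed
    then show ?thesis using C(1) K(1) by (intro exI[of _ C] conjI exI[of _ "4 * K"]) auto
  qed
qed

section \<open>The Riesz representation and the adjoint\<close>

lemma bounded_linear_riesz:
  fixes rp :: "'u::banach \<Rightarrow> 'u \<Rightarrow> real" and l :: "'u \<Rightarrow> real"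
  assumes add: "\<And>x y z. rp (x + y) z = rp x z + rp y z" and scale: "\<And>r x y. rp (r *\<^sub>R x) y = r * rp x y"
    and sym: "\<And>x y. rp x y = rp y x" and self: "\<And>x. rp x x = (norm x)\<^sup>2" and l: "bounded_linear l"
  shows "\<exists>v. \<forall>u. rp u v = l u"
proof -
  define J where "J = (\<lambda>v. (norm v)\<^sup>2 - 2 * l v)"
  have add_r: "rp z (x + y) = rp z x + rp z y" for x y z using add sym by metis
  have scale_r: "rp x (r *\<^sub>R y) = r * rp x y" for r x y using scale sym by metis
  have l_add: "l (x + y) = l x + l y" and l_scale: "l (r *\<^sub>R x) = r * l x" for x y r
    using l by (simp_all add: linear_add linear_scale bounded_linear.linear)
  have J_add: "J (v + r *\<^sub>R u) = J v + 2 * r * (rp u v - l u) + r\<^sup>2 * (norm u)\<^sup>2" for v u r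
    unfolding J_def self[symmetric] add add_r scale scale_r l_add l_scale sym[of v u]
    by (simp add: algebra_simps power2_eq_square)
  obtain K where K: "\<And>x. norm (l x) \<le> norm x * K" "K > 0"
    using bounded_linear.pos_bounded[OF l] by blast
  have J_lower: "- (K\<^sup>2) \<le> J v" for v
  proof -
    have "2 * l v \<le> 2 * (norm v * K)" using K(1)[of v] by simp
    moreover have "0 \<le> (norm v - K)\<^sup>2" by simp
    ultimately show ?thesis unfolding J_def by (simp add: power2_eq_square algebra_simps)
  qed
  define m where "m = (INF v. J v)"
  have bdd: "bdd_below (range J)" using J_lower by (intro bdd_belowI2)
  have m_le: "m \<le> J v" for v unfolding m_def using bdd by (intro cINF_lower) auto
  have "\<exists>v. J v < m + inverse (real (Suc n))" for n
  proof -
    have "(INF v. J v) < m + inverse (real (Suc n))" by (simp add: m_def)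
    then show ?thesis by (simp add: cINF_less_iff[OF _ bdd])
  qed
  then obtain V where V: "\<And>n. J (V n) < m + inverse (real (Suc n))" by metis
  have par: "(norm (V a - V b))\<^sup>2 = 2 * J (V a) + 2 * J (V b) - 4 * J ((1 / 2) *\<^sub>R (V a + V b))" for a b
  proof -
    have d: "V a - V b = V a + (- 1) *\<^sub>R V b" by simp
    have "(norm (V a - V b))\<^sup>2 = rp (V a) (V a) + - 1 * rp (V b) (V a) + - 1 * (rp (V a) (V b) + - 1 * rp (V b) (V b))"
      by (simp only: d self[symmetric] add add_r scale scale_r)
    moreover have "(norm ((1 / 2) *\<^sub>R (V a + V b)))\<^sup>2 =
        1 / 2 * (1 / 2 * (rp (V a) (V a) + rp (V b) (V a) + (rp (V a) (V b) + rp (V b) (V b))))"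
      by (simp only: self[symmetric] add add_r scale scale_r) (simp add: algebra_simps)
    moreover have "l ((1 / 2) *\<^sub>R (V a + V b)) = 1 / 2 * (l (V a) + l (V b))" by (simp only: l_scale l_add)
    ultimately show ?thesis unfolding J_def self[of "V a", symmetric] self[of "V b", symmetric] by (simp only:) (simp add: algebra_simps)
  qed
  have sq: "(norm (V a - V b))\<^sup>2 \<le> 2 * inverse (real (Suc a)) + 2 * inverse (real (Suc b))" for a b
    using par[of a b] V[of a] V[of b] m_le[of "(1 / 2) *\<^sub>R (V a + V b)"] by linarith
  have "Cauchy V"
  proof (rule metric_CauchyI)
    fix e :: real assume e: "0 < e"
    have "(\<lambda>n. 4 * inverse (real (Suc n))) \<longlonglongrightarrow> 4 * 0" by (intro tendsto_intros LIMSEQ_inverse_real_of_nat)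
    then have "\<forall>\<^sub>F n in sequentially. 4 * inverse (real (Suc n)) < e\<^sup>2"
      by (rule order_tendstoD(2)) (use e in simp)
    then obtain n0 where n0: "\<And>n. n \<ge> n0 \<Longrightarrow> 4 * inverse (real (Suc n)) < e\<^sup>2"
      by (auto simp: eventually_sequentially)
    have "dist (V a) (V b) < e" if "a \<ge> n0" "b \<ge> n0" for a b
    proof -
      have "(norm (V a - V b))\<^sup>2 < e\<^sup>2" using sq[of a b] n0[OF that(1)] n0[OF that(2)] by linarith
      then show ?thesis using e by (auto simp: dist_norm intro: power_less_imp_less_base)
    qed
    then show "\<exists>M. \<forall>a\<ge>M. \<forall>b\<ge>M. dist (V a) (V b) < e" by blast
  qed
  then obtain v where v: "V \<longlonglongrightarrow> v" by (auto simp: Cauchy_convergent_iff convergent_def)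
  have "(\<lambda>n. J (V n)) \<longlonglongrightarrow> J v"
    unfolding J_def by (intro tendsto_intros v bounded_linear.tendsto[OF l])
  moreover have "(\<lambda>n. m + inverse (real (Suc n))) \<longlonglongrightarrow> m + 0" by (intro tendsto_intros LIMSEQ_inverse_real_of_nat)
  ultimately have "J v \<le> m + 0" by (rule LIMSEQ_le) (use V in \<open>auto intro: less_imp_le\<close>)
  then have min: "J v \<le> J w" for w using m_le[of w] by linarith
  have "rp u v = l u" for u
  proof (rule ccontr)
    assume ne: "rp u v \<noteq> l u"
    define d where "d = rp u v - l u"
    have d0: "d\<^sup>2 > 0" using ne by (simp add: d_def)
    have u0: "(norm u)\<^sup>2 + 1 > 0" by (simp add: add_nonneg_pos)
    define r where "r = - d / ((norm u)\<^sup>2 + 1)"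
    have "0 \<le> 2 * r * d + r\<^sup>2 * (norm u)\<^sup>2" using min[of "v + r *\<^sub>R u"] J_add[of v r u] by (simp add: d_def)
    also have "\<dots> \<le> 2 * r * d + r\<^sup>2 * ((norm u)\<^sup>2 + 1)" by (simp add: mult_left_mono)
    also have "\<dots> = - (d\<^sup>2) / ((norm u)\<^sup>2 + 1)"
    proof -
      define s where "s = (norm u)\<^sup>2 + 1"
      have "2 * (- d / s) * d + (- d / s)\<^sup>2 * s = - (d\<^sup>2) / s"
        using u0 unfolding s_def[symmetric] by (simp add: power2_eq_square field_simps)
      then show ?thesis by (simp add: r_def s_def)
    qed
    also have "\<dots> < 0" using d0 u0 by (simp add: divide_neg_pos)
    finally show False by simp
  qed
  then show ?thesis by blast
qed

lemma to_cplx_1: "to_cplx 1 = 1" and to_cplx_0: "to_cplx 0 = 0"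
  using to_cplx_of_real[of 1] to_cplx_of_real[of 0] by simp_all

context
  fixes sU :: "'k::rc_field \<Rightarrow> 'u::banach \<Rightarrow> 'u" and ip :: "'u \<Rightarrow> 'u \<Rightarrow> 'k"
  assumes H: "hilbert_space_over sU ip"
begin

interpretation normed_space_over sU using H unfolding hilbert_space_over_def by (elim conjE)

lemma ip_add_left: "ip (x + y) z = ip x z + ip y z" and ip_scale_left: "ip (sU c x) y = c * ip x y"
  and ip_conj: "to_cplx (ip y x) = cnj (to_cplx (ip x y))" and ip_self: "ip x x = of_real ((norm x)\<^sup>2)"
  using H unfolding hilbert_space_over_def by blast+

lemma ip_add_right: "ip z (x + y) = ip z x + ip z y"
  by (rule to_cplx_inj)
    (simp only: ip_conj[of z "x + y"] ip_conj[of z x] ip_conj[of z y] ip_add_left to_cplx_add complex_cnj_add)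

lemma ip_diff_left: "ip (x - y) z = ip x z - ip y z"
  using ip_add_left[of "x - y" y z] by simp

lemma ip_diff_right: "ip z (x - y) = ip z x - ip z y"
  using ip_add_right[of z "x - y" y] by simp

lemma ip_scaleR_left: "ip (r *\<^sub>R x) y = of_real r * ip x y"
  using ip_scale_left[of "of_real r" x y] by (simp only: scale_of_real)

lemma ip_scaleR_right: "ip x (r *\<^sub>R y) = of_real r * ip x y"
  by (rule to_cplx_inj)
    (simp only: ip_conj[of x "r *\<^sub>R y"] ip_conj[of x y] ip_scaleR_left to_cplx_mult to_cplx_of_real complex_cnj_mult complex_cnj_complex_of_real)

lemma ip_unique:
  assumes "\<And>u. ip u v = ip u v'"
  shows "v = v'"
proof -
  have "ip (v - v') (v - v') = 0" using assms[of "v - v'"] by (simp add: ip_diff_right)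
  then show ?thesis by (simp add: ip_self)
qed

lemma riesz_representation:
  assumes \<psi>: "\<And>x y. \<psi> (x + y) = \<psi> x + \<psi> y" "\<And>c x. \<psi> (sU c x) = c * \<psi> x" "\<And>x. norm (\<psi> x) \<le> M * norm x"
  shows "\<exists>!v. \<forall>u. ip u v = \<psi> u"
proof -
  define rp where "rp = (\<lambda>x y. Re (to_cplx (ip x y)))"
  have "bounded_linear (\<lambda>x. Re (to_cplx (\<psi> x)))"
  proof (rule bounded_linear_intro[where K = M])
    show "Re (to_cplx (\<psi> (r *\<^sub>R x))) = r *\<^sub>R Re (to_cplx (\<psi> x))" for r x
      using \<psi>(2)[of "of_real r" x] by (simp add: scale_of_real to_cplx_mult to_cplx_of_real)
    show "norm (Re (to_cplx (\<psi> x))) \<le> norm x * M" for x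
      using \<psi>(3)[of x] abs_Re_le_cmod[of "to_cplx (\<psi> x)"] by (simp add: norm_to_cplx mult.commute)
  qed (simp add: \<psi>(1) to_cplx_add)
  then have "\<exists>v. \<forall>u. rp u v = Re (to_cplx (\<psi> u))"
  proof (rule bounded_linear_riesz[rotated 4])
    show "rp (x + y) z = rp x z + rp y z" for x y z by (simp add: rp_def ip_add_left to_cplx_add)
    show "rp (r *\<^sub>R x) y = r * rp x y" for r x y
      by (simp add: rp_def ip_scaleR_left to_cplx_mult to_cplx_of_real)
    show "rp x y = rp y x" for x y by (simp add: rp_def ip_conj[of x y])
    show "rp x x = (norm x)\<^sup>2" for x by (simp add: rp_def ip_self to_cplx_of_real del: of_real_power)
  qed
  then obtain v where v: "\<And>u. Re (to_cplx (ip u v)) = Re (to_cplx (\<psi> u))" by (auto simp: rp_def)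
  have "ip u v = \<psi> u" for u
  proof (rule ccontr)
    assume ne: "ip u v \<noteq> \<psi> u"
    define k where "k = ip u v - \<psi> u"
    have "Re (to_cplx (inverse k * k)) = Re (to_cplx (ip (sU (inverse k) u) v)) - Re (to_cplx (\<psi> (sU (inverse k) u)))"
      by (simp add: k_def ip_scale_left \<psi>(2) right_diff_distrib to_cplx_diff)
    then have "Re (to_cplx (inverse k * k)) = 0" using v by simp
    moreover have "inverse k * k = 1" using ne by (simp add: k_def)
    ultimately show False by (simp add: to_cplx_1)
  qed
  then show ?thesis
  proof (intro ex1I[of _ v] allI)
    fix v' assume "\<forall>u. ip u v' = \<psi> u"
    then show "v' = v" using \<open>\<And>u. ip u v = \<psi> u\<close> by (intro ip_unique) simp
  qed
qed

lemma adjoint_to_hilbert: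
  assumes B: "bounded_linear_over sU sW B"
    and \<phi>: "linear_on sW (*) UNIV \<phi>" "\<And>x. norm (\<phi> x) \<le> M * norm x" "M \<ge> 0"
  shows "ip u (adjoint_to_hilbert ip B \<phi>) = \<phi> (B u)"
    and "norm (adjoint_to_hilbert ip B \<phi>) \<le> M * onorm B"
proof -
  have bl: "bounded_linear B" using B by (simp add: bounded_linear_over_def)
  have Bn: "norm (\<phi> (B u)) \<le> M * onorm B * norm u" for u
  proof -
    have "norm (\<phi> (B u)) \<le> M * norm (B u)" by (rule \<phi>(2))
    also have "\<dots> \<le> M * (onorm B * norm u)" using onorm[OF bl] \<phi>(3) by (intro mult_left_mono) auto
    finally show ?thesis by (simp add: mult.assoc)
  qed
  have "\<exists>!v. \<forall>u. ip u v = \<phi> (B u)"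
    by (rule riesz_representation[where M = "M * onorm B"])
      (use B \<phi>(1) Bn in \<open>auto simp: bounded_linear_over_def linear_on_def\<close>)
  from theI'[OF this] have *: "ip u (adjoint_to_hilbert ip B \<phi>) = \<phi> (B u)" for u
    unfolding adjoint_to_hilbert_def by blast
  then show "ip u (adjoint_to_hilbert ip B \<phi>) = \<phi> (B u)" .
  define v where "v = adjoint_to_hilbert ip B \<phi>"
  have "(norm v)\<^sup>2 = norm (ip v v)" by (simp add: ip_self norm_power)
  also have "\<dots> \<le> M * onorm B * norm v" using Bn[of v] * by (simp add: v_def)
  finally have "norm v * norm v \<le> (M * onorm B) * norm v" by (simp add: power2_eq_square)
  then show "norm (adjoint_to_hilbert ip B \<phi>) \<le> M * onorm B"
    unfolding v_def[symmetric] using \<phi>(3) onorm_pos_le[OF bl] by (cases "v = 0") auto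
qed

lemma adjoint_to_hilbert_unique:
  assumes "\<And>u. ip u v = \<phi> (B u)"
  shows "adjoint_to_hilbert ip B \<phi> = v"
  unfolding adjoint_to_hilbert_def
proof (rule the_equality)
  show "\<forall>u. ip u v = \<phi> (B u)" using assms by blast
  fix v' assume "\<forall>u. ip u v' = \<phi> (B u)"
  then show "v' = v" using assms by (intro ip_unique) simp
qed

lemma ip_cauchy_schwarz: "norm (ip x y) \<le> norm x * norm y"
  proof -
    have "norm (ip x y) \<le> norm y * norm x"
    proof (cases "ip x y = 0")
      case False
      define k where "k = norm (ip x y)"
      have k: "k > 0" using False by (simp add: k_def)
      define c where "c = of_real k / ip x y"
      have c: "c * ip x y = of_real k" "norm c = 1" using False by (simp_all add: c_def k_def norm_divide)
      have quad: "0 \<le> t\<^sup>2 * (norm y)\<^sup>2 - 2 * t * k + (norm x)\<^sup>2" for t :: real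
      proof -
        let ?z = "sU c x - t *\<^sub>R y"
        have e1: "to_cplx (ip (sU c x) (t *\<^sub>R y)) = of_real (t * k)"
          by (simp only: ip_scaleR_right ip_scale_left c(1) to_cplx_mult to_cplx_of_real of_real_mult)
        have e2: "to_cplx (ip (t *\<^sub>R y) (sU c x)) = of_real (t * k)" using ip_conj[of "t *\<^sub>R y" "sU c x"] e1 by simp
        have "ip ?z ?z = ip (sU c x) (sU c x) - ip (sU c x) (t *\<^sub>R y) - (ip (t *\<^sub>R y) (sU c x) - ip (t *\<^sub>R y) (t *\<^sub>R y))"
          by (simp add: ip_diff_left ip_diff_right)
        then have "to_cplx (ip ?z ?z) = of_real ((norm x)\<^sup>2 - t * k - (t * k - t\<^sup>2 * (norm y)\<^sup>2))"
          by (simp only: to_cplx_diff e1 e2 ip_self to_cplx_of_real) (simp add: norm_scale c(2) power_mult_distrib)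
        then have "complex_of_real ((norm ?z)\<^sup>2) = of_real ((norm x)\<^sup>2 - t * k - (t * k - t\<^sup>2 * (norm y)\<^sup>2))"
          by (simp only: ip_self to_cplx_of_real)
        then have eq: "(norm ?z)\<^sup>2 = (norm x)\<^sup>2 - t * k - (t * k - t\<^sup>2 * (norm y)\<^sup>2)" by (simp only: of_real_eq_iff)
        show ?thesis using zero_le_power2[of "norm ?z"] unfolding eq by (simp add: algebra_simps)
      qed
      have y0: "norm y > 0"
      proof (rule ccontr)
        assume "\<not> norm y > 0"
        then have "y = 0" by simp
        then have "(norm x)\<^sup>2 + 2 \<le> 0" using quad[of "((norm x)\<^sup>2 + 1) / k"] k by simp
        then show False using zero_le_power2[of "norm x"] by linarith
      qed
      have "0 \<le> (k / (norm y)\<^sup>2)\<^sup>2 * (norm y)\<^sup>2 - 2 * (k / (norm y)\<^sup>2) * k + (norm x)\<^sup>2" by (rule quad)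
      also have "\<dots> = (norm x)\<^sup>2 - k\<^sup>2 / (norm y)\<^sup>2" using y0 by (simp add: power2_eq_square field_simps)
      finally have "k\<^sup>2 \<le> (norm y * norm x)\<^sup>2" using y0 by (simp add: field_simps power_mult_distrib)
      then show ?thesis unfolding k_def by (rule power2_le_imp_le) simp
    qed simp
    then show ?thesis by (simp add: mult.commute)
  qed

end

text \<open>Weak measurability and separability give measurability, because balls can be described by
  countably many functionals.\<close>

lemma weakly_measurable_imp_measurable:
  fixes sU :: "'k::rc_field \<Rightarrow> 'u::{banach,second_countable_topology} \<Rightarrow> 'u"
  assumes H: "hilbert_space_over sU ip" and meas: "\<And>u. (\<lambda>x. ip u (v x)) \<in> borel_measurable M"
  shows "v \<in> borel_measurable M"
proof -
  obtain X :: "'u set" where X: "countable X" and dense: "\<And>S. open S \<Longrightarrow> S \<noteq> {} \<Longrightarrow> \<exists>d\<in>X. d \<in> S"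
    using countable_dense_exists[where 'a = 'u] by blast
  have iff: "norm w \<le> r \<longleftrightarrow> (\<forall>u\<in>X. norm (ip u w) \<le> r * norm u)" if r: "r \<ge> 0" for w r
  proof
    assume "norm w \<le> r"
    show "\<forall>u\<in>X. norm (ip u w) \<le> r * norm u"
    proof
      fix u
      have "norm (ip u w) \<le> norm u * norm w" by (rule ip_cauchy_schwarz[OF H])
      also have "\<dots> \<le> norm u * r" using \<open>norm w \<le> r\<close> by (intro mult_left_mono) auto
      finally show "norm (ip u w) \<le> r * norm u" by (simp add: mult.commute)
    qed
  next
    assume *: "\<forall>u\<in>X. norm (ip u w) \<le> r * norm u"
    have "(norm w)\<^sup>2 \<le> r * norm w + (norm w + r) * e" if e: "e > 0" for e
    proof -
      obtain u where u: "u \<in> X" "dist w u < e" using dense[of "ball w e"] e by auto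
      have "(norm w)\<^sup>2 = norm (ip w w)" by (simp add: ip_self[OF H] norm_power)
      also have "ip w w = ip u w + ip (w - u) w" by (simp add: ip_diff_left[OF H])
      also have "norm \<dots> \<le> norm (ip u w) + norm (ip (w - u) w)" by (rule norm_triangle_ineq)
      also have "\<dots> \<le> r * norm u + e * norm w"
      proof (intro add_mono)
        show "norm (ip u w) \<le> r * norm u" using * u(1) by blast
        have "norm (ip (w - u) w) \<le> norm (w - u) * norm w" by (rule ip_cauchy_schwarz[OF H])
        also have "\<dots> \<le> e * norm w" using u(2) by (intro mult_right_mono) (auto simp: dist_norm)
        finally show "norm (ip (w - u) w) \<le> e * norm w" .
      qed
      also have "r * norm u \<le> r * (norm w + e)"
        using u(2) norm_triangle_ineq2[of u w] r by (intro mult_left_mono) (auto simp: dist_norm norm_minus_commute)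
      finally show ?thesis by (simp add: algebra_simps)
    qed
    moreover have "((\<lambda>e. r * norm w + (norm w + r) * e) \<longlongrightarrow> r * norm w + (norm w + r) * 0) (at_right 0)"
      by (intro tendsto_intros)
    ultimately have "(norm w)\<^sup>2 \<le> r * norm w + (norm w + r) * 0"
      by (intro tendsto_lowerbound[where F = "at_right 0"]) (auto simp: eventually_at_right_less eventually_at_filter)
    then have "norm w * norm w \<le> r * norm w" by (simp add: power2_eq_square)
    then show "norm w \<le> r" using r by (cases "w = 0") auto
  qed
  have cball: "{x \<in> space M. norm (v x - a) \<le> r} \<in> sets M" if r: "r \<ge> 0" for a r
  proof -
    have "{x \<in> space M. norm (v x - a) \<le> r} = {x \<in> space M. \<forall>u\<in>X. norm (ip u (v x) - ip u a) \<le> r * norm u}"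
      by (simp only: iff[OF r] ip_diff_right[OF H])
    also have "\<dots> \<in> sets M"
    proof (rule sets.sets_Collect_countable_All'[OF _ X])
      fix u
      have "(\<lambda>x. norm (ip u (v x) - ip u a)) \<in> borel_measurable M"
        by (rule measurable_compose[OF meas, where g = "\<lambda>k. norm (k - ip u a)"])
          (intro borel_measurable_continuous_onI continuous_intros)
      then show "{x \<in> space M. norm (ip u (v x) - ip u a) \<le> r * norm u} \<in> sets M"
        by measurable
    qed
    finally show ?thesis .
  qed
  show ?thesis
  proof (rule borel_measurableI)
    fix S :: "'u set" assume S: "open S"
    define I where "I = {(a, n :: nat). a \<in> X \<and> cball a (1 / real (Suc n)) \<subseteq> S}"
    have I: "countable I"
      by (rule countable_subset[of _ "X \<times> UNIV"]) (use X in \<open>auto simp: I_def\<close>)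
    have "v -` S \<inter> space M = (\<Union>(a, n)\<in>I. {x \<in> space M. norm (v x - a) \<le> 1 / real (Suc n)})"
    proof
      show "(\<Union>(a, n)\<in>I. {x \<in> space M. norm (v x - a) \<le> 1 / real (Suc n)}) \<subseteq> v -` S \<inter> space M"
        by (auto simp: I_def dist_norm norm_minus_commute subset_iff)
      show "v -` S \<inter> space M \<subseteq> (\<Union>(a, n)\<in>I. {x \<in> space M. norm (v x - a) \<le> 1 / real (Suc n)})"
      proof
        fix x assume x: "x \<in> v -` S \<inter> space M"
        then obtain e where e: "e > 0" "ball (v x) e \<subseteq> S" using S by (auto simp: open_contains_ball)
        obtain n where n: "inverse (real (Suc n)) < e / 2" using reals_Archimedean[of "e / 2"] e by auto
        obtain a where a: "a \<in> X" "dist (v x) a < 1 / real (Suc n)"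
          using dense[of "ball (v x) (1 / real (Suc n))"] by auto
        have "cball a (1 / real (Suc n)) \<subseteq> ball (v x) e"
        proof
          fix b assume "b \<in> cball a (1 / real (Suc n))"
          then have "dist (v x) b < 1 / real (Suc n) + 1 / real (Suc n)"
            using a(2) dist_triangle[of "v x" b a] by simp
          then show "b \<in> ball (v x) e" using n by (simp add: inverse_eq_divide)
        qed
        then have "(a, n) \<in> I" using a e by (auto simp: I_def)
        then show "x \<in> (\<Union>(a, n)\<in>I. {x \<in> space M. norm (v x - a) \<le> 1 / real (Suc n)})"
          using a(2) x by (auto simp: dist_norm intro!: bexI[of _ "(a, n)"])
      qed
    qed
    also have "\<dots> \<in> sets M"
      by (rule sets.countable_UN'[OF I]) (auto intro!: cball)
    finally show "v -` S \<inter> space M \<in> sets M" .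
  qed
qed

section \<open>Convolution with a strongly continuous family\<close>

lemma clamp_dist_le: "\<bar>max 0 (min T a) - max 0 (min T b)\<bar> \<le> \<bar>a - b\<bar>" for T a b :: real
  by (auto simp: max_def min_def abs_if)

locale bounded_operator_family =
  fixes G :: "real \<Rightarrow> 'w::{banach,second_countable_topology} \<Rightarrow> 'w" and T N :: real
  assumes T: "0 < T" and N: "0 \<le> N"
    and lin: "\<And>t. t \<in> {0..T} \<Longrightarrow> bounded_linear (G t)"
    and bound: "\<And>t x. t \<in> {0..T} \<Longrightarrow> norm (G t x) \<le> N * norm x"
    and cont: "\<And>x. continuous_on {0..T} (\<lambda>t. G t x)"
begin

text \<open>Freezing the family outside \<open>[0, T]\<close> makes convolutions bounded continuous functions on the
  whole real line.\<close>

definition H :: "real \<Rightarrow> 'w \<Rightarrow> 'w" where "H t = G (max 0 (min T t))"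

abbreviation "M \<equiv> lebesgue_on {0..T}"

definition conv :: "(real \<Rightarrow> 'w) \<Rightarrow> real \<Rightarrow> 'w" where
  "conv g t = (\<integral>s. indicator {..t} s *\<^sub>R H (t - s) (g s) \<partial>M)"

lemma clamp_mem: "max 0 (min T t) \<in> {0..T}" using T by auto

lemma H_eq: "t \<in> {0..T} \<Longrightarrow> H t = G t" by (auto simp: H_def max_def min_def)

lemma H_linear: "bounded_linear (H t)" unfolding H_def using clamp_mem by (rule lin)

lemma H_bound: "norm (H t x) \<le> N * norm x" unfolding H_def using clamp_mem by (rule bound)

lemma H_uniformly_continuous:
  assumes "e > 0"
  obtains d where "d > 0" and "\<And>a b. \<bar>a - b\<bar> < d \<Longrightarrow> norm (H a x - H b x) < e"
proof -
  have "uniformly_continuous_on {0..T} (\<lambda>t. G t x)"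
    by (intro compact_uniformly_continuous cont) simp
  then obtain d where d: "d > 0" "\<And>a b. a \<in> {0..T} \<Longrightarrow> b \<in> {0..T} \<Longrightarrow> dist b a < d \<Longrightarrow> dist (G b x) (G a x) < e"
    using assms unfolding uniformly_continuous_on_def by blast
  show ?thesis
  proof (rule that[OF d(1)])
    fix a b :: real assume "\<bar>a - b\<bar> < d"
    then have "dist (max 0 (min T a)) (max 0 (min T b)) < d"
      using clamp_dist_le[of T a b] by (simp add: dist_real_def)
    then show "norm (H a x - H b x) < e"
      unfolding H_def dist_norm[symmetric] by (intro d(2) clamp_mem)
  qed
qed

lemma H_continuous: "continuous_on UNIV (\<lambda>t. H t x)"
  unfolding continuous_on_iff
proof (intro ballI allI impI)
  fix a e :: real assume "e > 0"
  then obtain d where "d > 0" and d: "\<And>a b. \<bar>a - b\<bar> < d \<Longrightarrow> norm (H a x - H b x) < e"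
    using H_uniformly_continuous by blast
  then show "\<exists>d>0. \<forall>b\<in>UNIV. dist b a < d \<longrightarrow> dist (H b x) (H a x) < e"
    by (intro exI[of _ d]) (auto simp: dist_norm)
qed

lemma H_jointly_continuous: "continuous_on UNIV (\<lambda>p. H (fst p) (snd p))"
proof (rule continuous_at_imp_continuous_on, intro ballI)
  fix p :: "real \<times> 'w"
  obtain a x where p: "p = (a, x)" by (cases p)
  have "((\<lambda>q. norm (H (fst q) (snd q) - H a x)) \<longlongrightarrow> 0) (at p)"
  proof (rule Lim_null_comparison)
    show "\<forall>\<^sub>F q in at p. norm (norm (H (fst q) (snd q) - H a x)) \<le>
        N * norm (snd q - x) + norm (H (fst q) x - H a x)"
    proof (rule always_eventually, intro allI)
      fix q :: "real \<times> 'w"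
      have "H (fst q) (snd q) - H a x = H (fst q) (snd q - x) + (H (fst q) x - H a x)"
        by (simp add: linear_diff[OF bounded_linear.linear[OF H_linear]])
      also have "norm \<dots> \<le> norm (H (fst q) (snd q - x)) + norm (H (fst q) x - H a x)" by (rule norm_triangle_ineq)
      finally show "norm (norm (H (fst q) (snd q) - H a x)) \<le> N * norm (snd q - x) + norm (H (fst q) x - H a x)"
        using H_bound[of "fst q" "snd q - x"] by simp
    qed
    have fst: "(fst \<longlongrightarrow> a) (at p)" and snd: "(snd \<longlongrightarrow> x) (at p)"
      using tendsto_fst[OF tendsto_ident_at, of p] tendsto_snd[OF tendsto_ident_at, of p] by (simp_all add: p)
    have "isCont (\<lambda>t. H t x) a" using H_continuous by (simp add: continuous_on_eq_continuous_at)
    from isCont_tendsto_compose[OF this fst]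
    have "((\<lambda>q. H (fst q) x) \<longlongrightarrow> H a x) (at p)" .
    then have "((\<lambda>q. N * norm (snd q - x) + norm (H (fst q) x - H a x)) \<longlongrightarrow> N * norm (x - x) + norm (H a x - H a x)) (at p)"
      by (intro tendsto_intros snd)
    then show "((\<lambda>q. N * norm (snd q - x) + norm (H (fst q) x - H a x)) \<longlongrightarrow> 0) (at p)" by simp
  qed
  then have "((\<lambda>q. H (fst q) (snd q)) \<longlongrightarrow> H a x) (at p)"
    by (rule Lim_null[THEN iffD2, OF tendsto_norm_zero_cancel])
  then show "isCont (\<lambda>p. H (fst p) (snd p)) p" by (simp add: isCont_def p)
qed

lemma borel_measurable_M: "f \<in> borel_measurable borel \<Longrightarrow> f \<in> borel_measurable M"
  by (intro measurable_restrict_space1 measurable_completion) simp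

lemma finite_M: "finite_measure M"
  by (rule finite_measure_lebesgue_on) simp

lemma measurable_apply_H:
  assumes "g \<in> borel_measurable M" "\<tau> \<in> borel_measurable M"
  shows "(\<lambda>s. H (\<tau> s) (g s)) \<in> borel_measurable M"
proof -
  have "(\<lambda>s. (\<tau> s, g s)) \<in> M \<rightarrow>\<^sub>M borel \<Otimes>\<^sub>M borel" using assms by measurable
  then have "(\<lambda>s. (\<tau> s, g s)) \<in> borel_measurable M" by (simp add: borel_prod)
  from measurable_compose[OF this borel_measurable_continuous_onI[OF H_jointly_continuous]]
  show ?thesis by simp
qed

lemma measurable_convolution:
  assumes "g \<in> borel_measurable M"
  shows "(\<lambda>s. indicator {..t} s *\<^sub>R H (t - s) (g s)) \<in> borel_measurable M"
proof -
  have "(\<lambda>s. H (t - s) (g s)) \<in> borel_measurable M" "(indicator {..t} :: real \<Rightarrow> real) \<in> borel_measurable M"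
    by (intro measurable_apply_H assms borel_measurable_M; simp)+
  then show ?thesis by simp
qed

lemma norm_convolution_le: "norm (indicator {..t} s *\<^sub>R H (t - s) x) \<le> N * norm x"
  using H_bound[of "t - s" x] N by (auto simp: indicator_def)

lemma integrable_convolution:
  assumes "integrable M g"
  shows "integrable M (\<lambda>s. indicator {..t} s *\<^sub>R H (t - s) (g s))"
proof (rule Bochner_Integration.integrable_bound)
  show "integrable M (\<lambda>s. N * norm (g s))" using assms by simp
  show "(\<lambda>s. indicator {..t} s *\<^sub>R H (t - s) (g s)) \<in> borel_measurable M"
    using assms by (intro measurable_convolution) simp
  show "AE s in M. norm (indicator {..t} s *\<^sub>R H (t - s) (g s)) \<le> norm (N * norm (g s))"
    using norm_convolution_le N by (intro AE_I2) (simp add: abs_mult)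
qed

lemma norm_conv_le:
  assumes "integrable M g"
  shows "norm (conv g t) \<le> N * (\<integral>s. norm (g s) \<partial>M)"
proof -
  have "norm (conv g t) \<le> (\<integral>s. N * norm (g s) \<partial>M)"
    unfolding conv_def by (rule norm_integral_le_dominating) (use assms norm_convolution_le in auto)
  then show ?thesis by simp
qed

lemma conv_add:
  assumes "integrable M g" "integrable M h"
  shows "conv (\<lambda>s. g s + h s) t = conv g t + conv h t"
  unfolding conv_def
  by (subst Bochner_Integration.integral_add[symmetric])
    (simp_all add: assms integrable_convolution linear_add[OF bounded_linear.linear[OF H_linear]] scaleR_add_right)

lemma conv_diff:
  assumes "integrable M g" "integrable M h"
  shows "conv (\<lambda>s. g s - h s) t = conv g t - conv h t"
  unfolding conv_def
  by (subst Bochner_Integration.integral_diff[symmetric])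
    (simp_all add: assms integrable_convolution linear_diff[OF bounded_linear.linear[OF H_linear]] scaleR_diff_right)

lemma conv_scaleR: "conv (\<lambda>s. r *\<^sub>R g s) t = r *\<^sub>R conv g t"
proof -
  have "indicator {..t} s *\<^sub>R H (t - s) (r *\<^sub>R g s) = r *\<^sub>R (indicator {..t} s *\<^sub>R H (t - s) (g s))" for s
    by (simp add: linear_scale[OF bounded_linear.linear[OF H_linear]])
  then show ?thesis unfolding conv_def by (simp only: integral_scaleR_right)
qed

lemma conv_zero: "conv (\<lambda>s. 0) t = 0"
  using conv_scaleR[of 0 "\<lambda>_. 0" t] by simp

lemma conv_sum:
  fixes m :: nat
  assumes "\<And>j. j < m \<Longrightarrow> integrable M (g j)"
  shows "conv (\<lambda>s. \<Sum>j<m. g j s) t = (\<Sum>j<m. conv (g j) t)"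
  using assms
proof (induction m)
  case (Suc m)
  then have "integrable M (\<lambda>s. \<Sum>j<m. g j s)" by (intro Bochner_Integration.integrable_sum) auto
  then show ?case using Suc by (simp add: conv_add)
qed (simp add: conv_zero)

lemma conv_cong_AE:
  assumes "g \<in> borel_measurable M" "h \<in> borel_measurable M" "AE s in M. g s = h s"
  shows "conv g t = conv h t"
  unfolding conv_def
proof (rule integral_cong_AE)
  show "AE s in M. indicator {..t} s *\<^sub>R H (t - s) (g s) = indicator {..t} s *\<^sub>R H (t - s) (h s)"
    using assms(3) by eventually_elim simp
qed (intro measurable_convolution assms)+

lemma lebesgue_on_restrict: "t \<in> {0..T} \<Longrightarrow> lebesgue_on {0..t} = restrict_space M {0..t}"
  by (simp add: restrict_restrict_space Int_absorb1)

lemma interval_sets: "t \<in> {0..T} \<Longrightarrow> {0..t} \<inter> space M \<in> sets M"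
  by (simp add: sets_restrict_space_iff)

lemma convolution_integrable_on:
  assumes "integrable M g" "t \<in> {0..T}"
  shows "integrable (lebesgue_on {0..t}) (\<lambda>s. G (t - s) (g s))"
proof -
  have "integrable M (\<lambda>s. indicator {0..t} s *\<^sub>R G (t - s) (g s)) \<longleftrightarrow>
      integrable M (\<lambda>s. indicator {..t} s *\<^sub>R H (t - s) (g s))"
    using assms(2) by (intro Bochner_Integration.integrable_cong) (auto simp: indicator_def H_eq)
  then show ?thesis
    unfolding lebesgue_on_restrict[OF assms(2)] integrable_restrict_space[OF interval_sets[OF assms(2)]]
    using integrable_convolution[OF assms(1), of t] by blast
qed

lemma conv_eq:
  assumes "t \<in> {0..T}"
  shows "conv g t = (LINT s|lebesgue_on {0..t}. G (t - s) (g s))"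
proof -
  have "conv g t = (\<integral>s. indicator {0..t} s *\<^sub>R G (t - s) (g s) \<partial>M)"
    unfolding conv_def using assms
    by (intro Bochner_Integration.integral_cong) (auto simp: indicator_def H_eq)
  then show ?thesis
    unfolding lebesgue_on_restrict[OF assms] integral_restrict_space[OF interval_sets[OF assms]] .
qed

lemma conv_continuous:
  assumes g: "integrable M g"
  shows "continuous_on UNIV (conv g)"
proof (rule continuous_at_imp_continuous_on, intro ballI)
  fix t :: real
  have "(\<lambda>n. conv g (X n)) \<longlonglongrightarrow> conv g t" if X: "X \<longlonglongrightarrow> t" for X :: "nat \<Rightarrow> real"
    unfolding conv_def
  proof (rule integral_dominated_convergence[where w = "\<lambda>s. N * norm (g s)"])
    show "integrable M (\<lambda>s. N * norm (g s))" using g by simp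
    show "(\<lambda>s. indicator {..t} s *\<^sub>R H (t - s) (g s)) \<in> borel_measurable M"
      "(\<lambda>s. indicator {..X n} s *\<^sub>R H (X n - s) (g s)) \<in> borel_measurable M" for n
      using g by (intro measurable_convolution; simp)+
    show "AE s in M. norm (indicator {..X n} s *\<^sub>R H (X n - s) (g s)) \<le> N * norm (g s)" for n
      using norm_convolution_le by (intro AE_I2)
    have "AE s in lebesgue. s \<noteq> t" by (intro AE_completion AE_lborel_singleton)
    then have "AE s in M. s \<noteq> t" by (auto simp: AE_restrict_space_iff elim: eventually_mono)
    then show "AE s in M. (\<lambda>n. indicator {..X n} s *\<^sub>R H (X n - s) (g s)) \<longlonglongrightarrow> indicator {..t} s *\<^sub>R H (t - s) (g s)"
    proof eventually_elim
      case (elim s)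
      have "(\<lambda>n. indicator {..X n} s :: real) \<longlonglongrightarrow> indicator {..t} s"
      proof (rule tendsto_eventually)
        show "\<forall>\<^sub>F n in sequentially. (indicator {..X n} s :: real) = indicator {..t} s"
        proof (cases "s < t")
          case True
          then show ?thesis using order_tendstoD(1)[OF X True] by (auto elim!: eventually_mono simp: indicator_def)
        next
          case False
          then have "t < s" using elim by simp
          then show ?thesis using order_tendstoD(2)[OF X \<open>t < s\<close>] by (auto elim!: eventually_mono simp: indicator_def)
        qed
      qed
      moreover have "(\<lambda>n. H (X n - s) (g s)) \<longlonglongrightarrow> H (t - s) (g s)"
      proof (rule isCont_tendsto_compose[where g = "\<lambda>u. H u (g s)"])
        show "isCont (\<lambda>u. H u (g s)) (t - s)" using H_continuous by (simp add: continuous_on_eq_continuous_at)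
        show "(\<lambda>n. X n - s) \<longlonglongrightarrow> t - s" by (intro tendsto_intros X)
      qed
      ultimately show ?case by (rule tendsto_scaleR)
    qed
  qed
  then show "isCont (conv g) t" by (intro continuous_at_sequentially[THEN iffD2] allI impI) (simp add: o_def)
qed

definition bconv :: "(real \<Rightarrow> 'w) \<Rightarrow> real \<Rightarrow>\<^sub>C 'w" where "bconv g = Bcontfun (conv g)"

lemma bconv: "integrable M g \<Longrightarrow> apply_bcontfun (bconv g) = conv g"
  unfolding bconv_def
  by (intro Bcontfun_inverse bcontfun_normI[where b = "N * (\<integral>s. norm (g s) \<partial>M)"] conv_continuous norm_conv_le)

lemma dist_bconv_le:
  assumes "integrable M g" "integrable M h"
  shows "dist (bconv g) (bconv h) \<le> N * (\<integral>s. norm (g s - h s) \<partial>M)"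
proof (rule dist_bound)
  fix t
  have "dist (bconv g t) (bconv h t) = norm (conv (\<lambda>s. g s - h s) t)"
    by (simp add: bconv assms dist_norm conv_diff)
  also have "\<dots> \<le> N * (\<integral>s. norm (g s - h s) \<partial>M)" by (intro norm_conv_le Bochner_Integration.integrable_diff assms)
  finally show "dist (bconv g t) (bconv h t) \<le> N * (\<integral>s. norm (g s - h s) \<partial>M)" .
qed

end

lemma precompact_sum:
  fixes S :: "nat \<Rightarrow> 'a::real_normed_vector set" and m :: nat
  assumes "\<And>j. j < m \<Longrightarrow> precompact (S j)"
  shows "precompact {\<Sum>j<m. x j | x. \<forall>j<m. x j \<in> S j}"
  using assms
proof (induction m)
  case 0
  have "precompact {0 :: 'a}" by (intro compact_imp_precompact) simp
  then show ?case by (rule precompact_subset) auto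
next
  case (Suc m)
  have "precompact {\<Sum>j<m. x j | x. \<forall>j<m. x j \<in> S j}" by (rule Suc.IH) (simp add: Suc.prems)
  from precompact_plus[OF this Suc.prems[OF lessI]]
  show ?case
  proof (rule precompact_subset, intro subsetI)
    fix z assume "z \<in> {\<Sum>j<Suc m. x j | x. \<forall>j<Suc m. x j \<in> S j}"
    then obtain x where x: "z = (\<Sum>j<m. x j) + x m" "\<And>j. j < Suc m \<Longrightarrow> x j \<in> S j" by auto
    then have "(\<Sum>j<m. x j) \<in> {\<Sum>j<m. x j | x. \<forall>j<m. x j \<in> S j}" by auto
    then show "z \<in> {x + y | x y. x \<in> {\<Sum>j<m. x j | x. \<forall>j<m. x j \<in> S j} \<and> y \<in> S m}"
      using x by blast
  qed
qed

lemma precompact_bounded: "precompact (S :: 'a::real_normed_vector set) \<Longrightarrow> bounded S"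
proof -
  assume "precompact S"
  then obtain k where k: "finite k" "S \<subseteq> (\<Union>x\<in>k. ball x 1)" unfolding precompact_def by (meson zero_less_one)
  have "bounded (\<Union>x\<in>k. ball x 1)" using k(1) by (intro bounded_UN) auto
  then show ?thesis using k(2) by (rule bounded_subset)
qed

lemma integral_tail_small:
  fixes \<gamma> :: "'a \<Rightarrow> real"
  assumes int: "integrable M \<gamma>" and e: "e > 0"
  obtains K where "K > 0" and "(\<integral>s. indicator {s. \<gamma> s > K} s * \<bar>\<gamma> s\<bar> \<partial>M) \<le> e"
proof -
  have meas: "\<gamma> \<in> borel_measurable M" using int by simp
  have "(\<lambda>n. \<integral>s. indicator {s. \<gamma> s > real (Suc n)} s * \<bar>\<gamma> s\<bar> \<partial>M) \<longlonglongrightarrow> (\<integral>s. 0 \<partial>M)"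
  proof (rule integral_dominated_convergence[where w = "\<lambda>s. \<bar>\<gamma> s\<bar>"])
    show "integrable M (\<lambda>s. \<bar>\<gamma> s\<bar>)" using int by simp
    show "(\<lambda>s. indicator {s. \<gamma> s > real (Suc n)} s * \<bar>\<gamma> s\<bar>) \<in> borel_measurable M" for n
    proof -
      have "(\<lambda>s. (if \<gamma> s > real (Suc n) then 1 else 0) * \<bar>\<gamma> s\<bar>) \<in> borel_measurable M"
        using meas by measurable
      then show ?thesis by (simp add: indicator_def of_bool_def)
    qed
    show "AE s in M. norm (indicator {s. \<gamma> s > real (Suc n)} s * \<bar>\<gamma> s\<bar>) \<le> \<bar>\<gamma> s\<bar>" for n
      by (intro AE_I2) (simp add: indicator_def)
    show "AE s in M. (\<lambda>n. indicator {s. \<gamma> s > real (Suc n)} s * \<bar>\<gamma> s\<bar>) \<longlonglongrightarrow> 0"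
    proof (intro AE_I2 tendsto_eventually)
      fix s
      obtain n0 where n0: "\<gamma> s \<le> real n0" using real_arch_simple by blast
      show "\<forall>\<^sub>F n in sequentially. indicator {s. \<gamma> s > real (Suc n)} s * \<bar>\<gamma> s\<bar> = 0"
        using eventually_ge_at_top[of n0] by eventually_elim (use n0 in auto)
    qed
  qed simp
  then have "\<forall>\<^sub>F n in sequentially. (\<integral>s. indicator {s. \<gamma> s > real (Suc n)} s * \<bar>\<gamma> s\<bar> \<partial>M) < e"
    using e by (simp add: order_tendstoD(2))
  then obtain n where "(\<integral>s. indicator {s. \<gamma> s > real (Suc n)} s * \<bar>\<gamma> s\<bar> \<partial>M) < e"
    by (auto simp: eventually_sequentially)
  then show ?thesis by (intro that[of "real (Suc n)"]) auto
qed

context bounded_operator_family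
begin

lemma integral_one_M: "(\<integral>s. c \<partial>M) = c * T" for c :: real
  using T by (simp add: measure_restrict_space)

lemma integral_window_le:
  assumes "h \<ge> 0"
  shows "integrable M (indicator {a..a + h} :: real \<Rightarrow> real)" and "(\<integral>s. indicator {a..a + h} s \<partial>M) \<le> (h :: real)"
proof -
  have S: "{a..a + h} \<inter> {0..T} \<in> sets M" by (simp add: sets_restrict_space_iff)
  have eq: "(\<integral>s. indicator {a..a + h} s \<partial>M) = (\<integral>s. indicator ({a..a + h} \<inter> {0..T}) s \<partial>M)"
    by (intro Bochner_Integration.integral_cong) (auto simp: indicator_def)
  have "measure M ({a..a + h} \<inter> {0..T}) = measure lebesgue ({a..a + h} \<inter> {0..T})"
    by (simp add: measure_restrict_space)
  also have "\<dots> \<le> measure lebesgue {a..a + h}"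
    by (intro measure_mono_fmeasurable) auto
  also have "\<dots> = h" using assms by simp
  finally show "(\<integral>s. indicator {a..a + h} s \<partial>M) \<le> h" unfolding eq using S by simp
  have "integrable M (\<lambda>s. indicator ({a..a + h} \<inter> {0..T}) s :: real)"
    using S finite_measure.emeasure_finite[OF finite_M]
    by (intro integrable_real_indicator) (auto simp: top.not_eq_extremum[symmetric])
  then show "integrable M (indicator {a..a + h} :: real \<Rightarrow> real)"
    by (rule Bochner_Integration.integrable_cong[THEN iffD1, rotated -1]) (auto simp: indicator_def)
qed

lemma integrable_bounded:
  fixes g :: "real \<Rightarrow> 'b::{banach,second_countable_topology}"
  assumes "g \<in> borel_measurable M" "\<And>s. norm (g s) \<le> (K :: real)"
  shows "integrable M g"
  using assms by (intro finite_measure.integrable_const_bound[OF finite_M, where B = K]) auto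

text \<open>Convolutions of \<open>H y\<close> with a density \<open>\<theta>\<close> are approximated by splitting \<open>[0, T]\<close> into
  \<open>n\<close> cells. In place of the discontinuous cut-off \<open>s \<le> t\<close> a ramp is used, which is wrong on one
  cell only.\<close>

lemma precompact_conv_vector:
  fixes y :: 'w
  shows "precompact {bconv (\<lambda>s. \<theta> s *\<^sub>R y) | \<theta>. \<theta> \<in> borel_measurable M \<and> (\<forall>s. 0 \<le> \<theta> s \<and> \<theta> s \<le> 1)}"
proof (rule precompact_approx)
  fix e :: real assume e: "e > 0"
  define e' where "e' = e / (2 * T)"
  have e': "e' > 0" using e T by (simp add: e'_def)
  obtain d where d: "d > 0" and ucont: "\<And>a b. \<bar>a - b\<bar> < d \<Longrightarrow> norm (H a y - H b y) < e'"
    using H_uniformly_continuous[OF e'] by blast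
  define d' where "d' = min d (e / (8 * (N * norm y + 1)))"
  have Ny: "N * norm y \<ge> 0" using N by simp
  have d': "d' > 0" using d e Ny by (simp add: d'_def add_nonneg_pos)
  obtain n0 where "T / d' < real n0" using reals_Archimedean2 by blast
  moreover from this have "n0 > 0" using T d' by (intro gr0I) (auto simp: field_simps)
  ultimately have n0: "n0 > 0" "T / real n0 < d'" using d' by (simp_all add: pos_divide_less_eq mult.commute)
  define n where "n = n0"
  have n: "n > 0" using n0 by (simp add: n_def)
  define h where "h = T / real n"
  have h: "h > 0" "h < d" using n T n0 by (auto simp: h_def n_def d'_def)
  have hN: "4 * (N * norm y) * h \<le> e / 2"
  proof -
    have "h \<le> e / (8 * (N * norm y + 1))" using n0 by (simp add: h_def n_def d'_def)
    then have "h * (8 * (N * norm y + 1)) \<le> e" using Ny by (simp add: field_simps)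
    moreover have "h * (8 * (N * norm y)) \<le> h * (8 * (N * norm y + 1))" using h by (intro mult_left_mono) auto
    ultimately show ?thesis by (simp add: algebra_simps)
  qed
  define \<kappa> where "\<kappa> = (\<lambda>s. min (n - 1) (nat \<lfloor>s / h\<rfloor>))"
  have \<kappa>_less: "\<kappa> s < n" for s using n by (simp add: \<kappa>_def min_def) linarith
  have \<kappa>: "real (\<kappa> s) * h \<le> s" "s \<le> real (\<kappa> s) * h + h" if "s \<in> {0..T}" for s
  proof -
    have s0: "s / h \<ge> 0" using that h by simp
    have fl: "real (nat \<lfloor>s / h\<rfloor>) \<le> s / h" "s / h < real (nat \<lfloor>s / h\<rfloor>) + 1" using s0 by linarith+
    have "real (\<kappa> s) \<le> s / h" using fl(1) by (auto simp: \<kappa>_def min_def)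
    then show "real (\<kappa> s) * h \<le> s" using h by (simp add: field_simps)
    have "s / h \<le> real n" using that h(1) n T by (simp add: h_def field_simps)
    then have "s / h \<le> real (\<kappa> s) + 1"
      using fl(2) n by (auto simp: \<kappa>_def min_def of_nat_diff)
    then show "s \<le> real (\<kappa> s) * h + h" using h by (simp add: field_simps)
  qed
  define ramp where "ramp = (\<lambda>k t. max 0 (min 1 ((t - real k * h) / h)))"
  define v where "v = (\<lambda>k t. ramp k t *\<^sub>R H (t - real k * h) y)"
  have v_cont: "continuous_on UNIV (v k)" for k
  proof -
    have "continuous_on UNIV (\<lambda>t. H (t - real k * h) y)"
      by (rule continuous_on_compose2[OF H_continuous]) (auto intro!: continuous_intros)
    then show ?thesis unfolding v_def ramp_def using h by (intro continuous_intros) auto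
  qed
  have ramp01: "0 \<le> ramp k t" "ramp k t \<le> 1" for k t by (auto simp: ramp_def)
  have v_bound: "norm (v k t) \<le> N * norm y" for k t
  proof -
    have "ramp k t * norm (H (t - real k * h) y) \<le> 1 * (N * norm y)"
      using ramp01[of k t] H_bound by (intro mult_mono) auto
    then show ?thesis using ramp01 by (simp add: v_def)
  qed
  define V where "V = (\<lambda>k. Bcontfun (v k))"
  have V: "apply_bcontfun (V k) = v k" for k
    unfolding V_def by (intro Bcontfun_inverse bcontfun_normI[OF v_cont v_bound])
  have approx: "norm (indicator {..t} s *\<^sub>R H (t - s) y - v (\<kappa> s) t) \<le> e' + 2 * (N * norm y) * indicator {t - h..t - h + 2 * h} s"
    if s: "s \<in> {0..T}" for s t
  proof (cases "s \<in> {t - h..t - h + 2 * h}")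
    case True
    have "norm (indicator {..t} s *\<^sub>R H (t - s) y - v (\<kappa> s) t) \<le> N * norm y + N * norm y"
      using norm_triangle_ineq4 norm_convolution_le v_bound by (rule order_trans[OF _ add_mono])
    then show ?thesis using True e' by simp
  next
    case False
    show ?thesis
    proof (cases "s < t")
      case True
      then have st: "s \<le> t" "s < t - h" using False h by auto
      then have "(t - real (\<kappa> s) * h) / h \<ge> 1" using \<kappa>[OF s] h by (simp add: field_simps)
      then have "ramp (\<kappa> s) t = 1" by (simp add: ramp_def)
      then have "norm (indicator {..t} s *\<^sub>R H (t - s) y - v (\<kappa> s) t) = norm (H (t - s) y - H (t - real (\<kappa> s) * h) y)"
        using st by (simp add: v_def)
      also have "\<dots> < e'" using \<kappa>[OF s] h by (intro ucont) (auto simp: abs_if)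
      finally show ?thesis using False by simp
    next
      case *: False
      then have st: "s > t + h" using False h by auto
      then have "(t - real (\<kappa> s) * h) / h \<le> 0" using \<kappa>[OF s] h by (intro divide_nonpos_pos) auto
      then have "ramp (\<kappa> s) t = 0" by (simp add: ramp_def)
      then show ?thesis using st h False e' by (simp add: v_def)
    qed
  qed
  define S' where "S' = {\<Sum>k<n. a k *\<^sub>R V k | a. \<forall>k<n. \<bar>a k\<bar> \<le> T}"
  have "precompact S'" unfolding S'_def by (rule precompact_combinations)
  moreover have "\<exists>z\<in>S'. dist (bconv (\<lambda>s. \<theta> s *\<^sub>R y)) z \<le> e"
    if \<theta>: "\<theta> \<in> borel_measurable M" "\<forall>s. 0 \<le> \<theta> s \<and> \<theta> s \<le> 1" for \<theta>
  proof -
    define w where "w = (\<lambda>k s. \<theta> s * (if \<kappa> s = k then 1 else 0))"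
    have "\<kappa> \<in> measurable borel (count_space UNIV)" unfolding \<kappa>_def by measurable
    then have \<kappa>_meas: "\<kappa> \<in> measurable M (count_space UNIV)"
      by (intro measurable_restrict_space1 measurable_completion) simp
    have w_meas: "w k \<in> borel_measurable M" for k
    proof -
      have "(\<lambda>s. if \<kappa> s = k then 1 else 0 :: real) \<in> borel_measurable M"
        by (rule measurable_compose[OF \<kappa>_meas, where g = "\<lambda>j. if j = k then 1 else 0"]) simp
      then show ?thesis unfolding w_def using \<theta>(1) by simp
    qed
    have w01: "0 \<le> w k s" "w k s \<le> 1" for k s using \<theta>(2) by (auto simp: w_def)
    have w_int: "integrable M (w k)" for k
      by (rule integrable_bounded[OF w_meas, of k 1]) (use w01 in auto)
    define a where "a = (\<lambda>k. \<integral>s. w k s \<partial>M)"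
    have a: "\<bar>a k\<bar> \<le> T" for k
    proof -
      have "norm (\<integral>s. w k s \<partial>M) \<le> (\<integral>s. 1 \<partial>M)"
        by (rule norm_integral_le_dominating) (use w01 finite_measure.integrable_const[OF finite_M] in auto)
      then show ?thesis using integral_one_M[of 1] by (simp add: a_def)
    qed
    have g_int: "integrable M (\<lambda>s. \<theta> s *\<^sub>R y)"
    proof (rule integrable_bounded)
      show "(\<lambda>s. \<theta> s *\<^sub>R y) \<in> borel_measurable M" using \<theta>(1) by simp
      show "norm (\<theta> s *\<^sub>R y) \<le> norm y" for s using \<theta>(2) by (simp add: mult_left_le_one_le)
    qed
    have "dist (bconv (\<lambda>s. \<theta> s *\<^sub>R y) t) ((\<Sum>k<n. a k *\<^sub>R V k) t) \<le> e" for t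
    proof -
      have sum_int: "integrable M (\<lambda>s. \<Sum>k<n. w k s *\<^sub>R v k t)"
        by (intro Bochner_Integration.integrable_sum integrable_scaleR_left) (use w_int in auto)
      have w_sum: "(\<Sum>k<n. w k s *\<^sub>R v k t) = \<theta> s *\<^sub>R v (\<kappa> s) t" for s
      proof -
        have "(\<Sum>k<n. w k s *\<^sub>R v k t) = (\<Sum>k<n. if \<kappa> s = k then \<theta> s *\<^sub>R v k t else 0)"
          by (intro sum.cong) (auto simp: w_def)
        then show ?thesis using \<kappa>_less[of s] by simp
      qed
      have "(\<Sum>k<n. a k *\<^sub>R V k) t = (\<Sum>k<n. a k *\<^sub>R v k t)"
        by (induction n) (simp_all add: V)
      also have "\<dots> = (\<integral>s. (\<Sum>k<n. w k s *\<^sub>R v k t) \<partial>M)"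
        unfolding a_def using w_int by (subst Bochner_Integration.integral_sum) auto
      finally have "bconv (\<lambda>s. \<theta> s *\<^sub>R y) t - (\<Sum>k<n. a k *\<^sub>R V k) t =
          (\<integral>s. indicator {..t} s *\<^sub>R H (t - s) (\<theta> s *\<^sub>R y) - (\<Sum>k<n. w k s *\<^sub>R v k t) \<partial>M)"
        using integrable_convolution[OF g_int, of t] sum_int by (simp add: bconv[OF g_int] conv_def)
      also have "\<dots> = (\<integral>s. indicator {0..T} s *\<^sub>R (\<theta> s *\<^sub>R (indicator {..t} s *\<^sub>R H (t - s) y - v (\<kappa> s) t)) \<partial>M)"
        by (intro Bochner_Integration.integral_cong)
          (auto simp: w_sum linear_scale[OF bounded_linear.linear[OF H_linear]] scaleR_diff_right)
      finally have diff: "bconv (\<lambda>s. \<theta> s *\<^sub>R y) t - (\<Sum>k<n. a k *\<^sub>R V k) t =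
          (\<integral>s. indicator {0..T} s *\<^sub>R (\<theta> s *\<^sub>R (indicator {..t} s *\<^sub>R H (t - s) y - v (\<kappa> s) t)) \<partial>M)" .
      have i1: "integrable M (\<lambda>s. e')" by (rule finite_measure.integrable_const[OF finite_M])
      have i2: "integrable M (\<lambda>s. 2 * (N * norm y) * indicator {t - h..t - h + 2 * h} s)"
        using integral_window_le(1)[of "2 * h" "t - h"] h by (intro integrable_mult_right) auto
      have "norm (bconv (\<lambda>s. \<theta> s *\<^sub>R y) t - (\<Sum>k<n. a k *\<^sub>R V k) t) \<le> (\<integral>s. e' + 2 * (N * norm y) * indicator {t - h..t - h + 2 * h} s \<partial>M)"
        unfolding diff
      proof (rule norm_integral_le_dominating)
        show "integrable M (\<lambda>s. e' + 2 * (N * norm y) * indicator {t - h..t - h + 2 * h} s)"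
          by (rule Bochner_Integration.integrable_add[OF i1 i2])
        fix s
        show "norm (indicator {0..T} s *\<^sub>R (\<theta> s *\<^sub>R (indicator {..t} s *\<^sub>R H (t - s) y - v (\<kappa> s) t)))
          \<le> e' + 2 * (N * norm y) * indicator {t - h..t - h + 2 * h} s"
        proof (cases "s \<in> {0..T}")
          case True
          have "\<theta> s * norm (indicator {..t} s *\<^sub>R H (t - s) y - v (\<kappa> s) t) \<le> 1 * (e' + 2 * (N * norm y) * indicator {t - h..t - h + 2 * h} s)"
            using \<theta>(2) approx[OF True, of t] by (intro mult_mono) auto
          then show ?thesis using True \<theta>(2) by simp
        next
          case False
          have "0 \<le> e' + 2 * (N * norm y) * indicator {t - h..t - h + 2 * h} s"
            using e' N by (intro add_nonneg_nonneg mult_nonneg_nonneg) auto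
          then show ?thesis using False by simp
        qed
      qed
      also have "\<dots> = e' * T + 2 * (N * norm y) * (\<integral>s. indicator {t - h..t - h + 2 * h} s \<partial>M)"
        by (simp only: Bochner_Integration.integral_add[OF i1 i2] integral_one_M integral_mult_right_zero)
      also have "\<dots> \<le> e' * T + 2 * (N * norm y) * (2 * h)"
        using integral_window_le(2)[of "2 * h" "t - h"] h Ny by (intro add_left_mono mult_left_mono) auto
      also have "\<dots> \<le> e" using hN T by (simp add: e'_def algebra_simps)
      finally show ?thesis by (simp add: dist_norm)
    qed
    then have "dist (bconv (\<lambda>s. \<theta> s *\<^sub>R y)) (\<Sum>k<n. a k *\<^sub>R V k) \<le> e" by (rule dist_bound)
    moreover have "(\<Sum>k<n. a k *\<^sub>R V k) \<in> S'" unfolding S'_def using a by blast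
    ultimately show ?thesis by blast
  qed
  ultimately show "\<exists>S'. precompact S' \<and> (\<forall>x\<in>{bconv (\<lambda>s. \<theta> s *\<^sub>R y) | \<theta>. \<theta> \<in> borel_measurable M \<and> (\<forall>s. 0 \<le> \<theta> s \<and> \<theta> s \<le> 1)}. \<exists>z\<in>S'. dist x z \<le> e)"
    by (intro exI[of _ S']) blast
qed


lemma precompact_conv_precompact_values:
  assumes S: "precompact S"
  shows "precompact {bconv g | g. g \<in> borel_measurable M \<and> (\<forall>s. g s \<in> S)}"
proof (rule precompact_approx)
  fix e :: real assume e: "e > 0"
  define e' where "e' = e / (N * T + 1)"
  have NT: "N * T \<ge> 0" using N T by simp
  have e': "e' > 0" using e NT by (simp add: e'_def add_nonneg_pos)
  have e'_le: "N * (e' * T) \<le> e"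
  proof -
    have "N * (e' * T) \<le> e' * (N * T + 1)" using e' by (simp add: algebra_simps)
    also have "\<dots> = e" using NT by (simp add: e'_def)
    finally show ?thesis .
  qed
  obtain m :: nat and c \<theta> where "\<And>j. j < m \<Longrightarrow> c j \<in> S" and "\<And>j. continuous_on S (\<theta> j)"
    and \<theta>_meas: "\<And>j. \<theta> j \<in> borel_measurable borel"
    and \<theta>0: "\<And>j x. 0 \<le> \<theta> j x" and \<theta>1: "\<And>j x. j < m \<Longrightarrow> \<theta> j x \<le> 1"
    and "\<And>x. x \<in> S \<Longrightarrow> (\<Sum>j<m. \<theta> j x) = 1"
    and approx: "\<And>x y. x \<in> S \<Longrightarrow> (\<And>j. j < m \<Longrightarrow> dist (c j) x \<le> e' \<Longrightarrow> dist (y j) (c j) \<le> 0)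
          \<Longrightarrow> norm (x - (\<Sum>j<m. \<theta> j x *\<^sub>R (y j :: 'w))) \<le> e' + 0"
  proof (rule precompact_partition[OF S e', where d = 0], goal_cases)
    case (1 m c \<theta>)
    from 1(2-) show ?case by (rule 1(1))
  qed
  define Y where "Y = (\<lambda>j. {bconv (\<lambda>s. \<eta> s *\<^sub>R c j) | \<eta>. \<eta> \<in> borel_measurable M \<and> (\<forall>s. 0 \<le> \<eta> s \<and> \<eta> s \<le> 1)})"
  have "precompact {\<Sum>j<m. x j | x. \<forall>j<m. x j \<in> Y j}"
    by (rule precompact_sum) (simp add: Y_def precompact_conv_vector)
  moreover have "\<exists>z\<in>{\<Sum>j<m. x j | x. \<forall>j<m. x j \<in> Y j}. dist (bconv g) z \<le> e"
    if g: "g \<in> borel_measurable M" "\<forall>s. g s \<in> S" for g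
  proof -
    obtain B where B: "\<And>x. x \<in> S \<Longrightarrow> norm x \<le> B" using precompact_bounded[OF S] unfolding bounded_iff by blast
    have g_int: "integrable M g" by (rule integrable_bounded[of _ B]) (use g B in auto)
    define g' where "g' = (\<lambda>j s. \<theta> j (g s) *\<^sub>R c j)"
    have \<theta>g: "(\<lambda>s. \<theta> j (g s)) \<in> borel_measurable M" for j
      by (rule measurable_compose[OF g(1) \<theta>_meas])
    have g'_int: "integrable M (g' j)" if "j < m" for j
    proof (rule integrable_bounded[of _ "norm (c j)"])
      show "g' j \<in> borel_measurable M" unfolding g'_def using \<theta>g by simp
      show "norm (g' j s) \<le> norm (c j)" for s
        using \<theta>0[of j "g s"] \<theta>1[OF that, of "g s"] by (simp add: g'_def mult_left_le_one_le)
    qed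
    have "dist (bconv g) (bconv (\<lambda>s. \<Sum>j<m. g' j s)) \<le> N * (\<integral>s. norm (g s - (\<Sum>j<m. g' j s)) \<partial>M)"
      using g'_int by (intro dist_bconv_le g_int Bochner_Integration.integrable_sum) auto
    also have "\<dots> \<le> N * (\<integral>s. e' \<partial>M)"
    proof (intro mult_left_mono N integral_mono')
      show "integrable M (\<lambda>s. e')" by (rule finite_measure.integrable_const[OF finite_M])
      show "norm (g s - (\<Sum>j<m. g' j s)) \<le> e'" for s
        using approx[of "g s" c] g(2) by (simp add: g'_def)
    qed (use e' in simp)
    also have "\<dots> \<le> e" using e'_le by (simp only: integral_one_M)
    finally have "dist (bconv g) (bconv (\<lambda>s. \<Sum>j<m. g' j s)) \<le> e" .
    moreover have "bconv (\<lambda>s. \<Sum>j<m. g' j s) = (\<Sum>j<m. bconv (g' j))"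
    proof (rule bcontfun_eqI)
      fix t
      have sum_int: "integrable M (\<lambda>s. \<Sum>j<m. g' j s)"
        using g'_int by (intro Bochner_Integration.integrable_sum) auto
      have "(\<Sum>j<m. bconv (g' j)) t = (\<Sum>j<m. bconv (g' j) t)" by (induction m) simp_all
      then show "bconv (\<lambda>s. \<Sum>j<m. g' j s) t = (\<Sum>j<m. bconv (g' j)) t"
        using g'_int by (simp add: bconv[OF sum_int] bconv conv_sum)
    qed
    moreover have "bconv (g' j) \<in> Y j" if "j < m" for j
      unfolding Y_def g'_def using \<theta>g \<theta>0 \<theta>1[OF that]
      by (intro CollectI exI[of _ "\<lambda>s. \<theta> j (g s)"] conjI allI refl) auto
    ultimately show ?thesis by (intro bexI[of _ "\<Sum>j<m. bconv (g' j)"]) auto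
  qed
  ultimately show "\<exists>S'. precompact S' \<and> (\<forall>x\<in>{bconv g | g. g \<in> borel_measurable M \<and> (\<forall>s. g s \<in> S)}. \<exists>z\<in>S'. dist x z \<le> e)"
    by (intro exI[of _ "{\<Sum>j<m. x j | x. \<forall>j<m. x j \<in> Y j}"]) blast
qed

end

locale compact_operator_family = bounded_operator_family +
  assumes compact_approx: "\<exists>K\<ge>0. \<forall>\<delta>\<in>{0<..T}. \<forall>e>0. \<exists>P. bounded_linear P \<and> (\<forall>x. norm (P x) \<le> K * norm x) \<and>
    precompact (P ` cball 0 1) \<and> (\<forall>t\<in>{\<delta>..T}. \<forall>x. norm (G t x - G t (P x)) \<le> e * norm x)"
begin

lemma precompact_conv_bounded:
  assumes K: "K > 0"
  shows "precompact {bconv g | g. g \<in> borel_measurable M \<and> (\<forall>s. norm (g s) \<le> K)}"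
proof (rule precompact_approx)
  fix e :: real assume e: "e > 0"
  obtain K0 where K0: "K0 \<ge> 0" and PP: "\<forall>\<delta>\<in>{0<..T}. \<forall>e>0. \<exists>P. bounded_linear P \<and> (\<forall>x. norm (P x) \<le> K0 * norm x) \<and>
    precompact (P ` cball 0 1) \<and> (\<forall>t\<in>{\<delta>..T}. \<forall>x. norm (G t x - G t (P x)) \<le> e * norm x)"
    using compact_approx by (elim exE conjE)
  define b where "b = N * ((1 + K0) * K)"
  have b: "b \<ge> 0" using N K K0 by (simp add: b_def)
  define \<delta> where "\<delta> = min T (e / (2 * (b + 1)))"
  have \<delta>: "\<delta> \<in> {0<..T}" using T e b by (simp add: \<delta>_def)
  have b\<delta>: "b * \<delta> \<le> e / 2"
  proof -
    have "\<delta> \<le> e / (2 * (b + 1))" by (simp add: \<delta>_def)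
    then have "\<delta> * (2 * (b + 1)) \<le> e" using b by (simp add: pos_le_divide_eq)
    moreover have "\<delta> * (2 * b) \<le> \<delta> * (2 * (b + 1))" using \<delta> by (intro mult_left_mono) auto
    ultimately show ?thesis by (simp add: algebra_simps)
  qed
  define e1 where "e1 = e / (2 * (K * T))"
  have e1: "e1 > 0" using e K T by (simp add: e1_def)
  obtain P where P: "bounded_linear P" "\<And>x. norm (P x) \<le> K0 * norm x" "precompact (P ` cball 0 1)"
    and PG: "\<And>t x. t \<in> {\<delta>..T} \<Longrightarrow> norm (G t x - G t (P x)) \<le> e1 * norm x"
    using PP[rule_format, OF \<delta> e1] by blast
  have PH: "norm (H t x - H t (P x)) \<le> e1 * norm x" if "\<delta> \<le> t" for t x
    unfolding H_def using that \<delta> by (intro PG) auto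
  define S where "S = (*\<^sub>R) K ` (P ` cball 0 1)"
  have "precompact S" unfolding S_def by (intro precompact_scaleR P)
  then have "precompact {bconv g | g. g \<in> borel_measurable M \<and> (\<forall>s. g s \<in> S)}"
    by (rule precompact_conv_precompact_values)
  moreover have "\<exists>z\<in>{bconv g | g. g \<in> borel_measurable M \<and> (\<forall>s. g s \<in> S)}. dist (bconv g) z \<le> e"
    if g: "g \<in> borel_measurable M" "\<forall>s. norm (g s) \<le> K" for g
  proof -
    define p where "p = (\<lambda>s. P (g s))"
    have P_borel: "P \<in> borel_measurable borel"
      by (intro borel_measurable_continuous_onI linear_continuous_on P)
    have p_meas: "p \<in> borel_measurable M" unfolding p_def by (rule measurable_compose[OF g(1) P_borel])
    have p_S: "p s \<in> S" for s
    proof -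
      have "p s = K *\<^sub>R P ((1 / K) *\<^sub>R g s)"
        using K by (simp add: p_def linear_scale[OF bounded_linear.linear[OF P(1)]])
      moreover have "(1 / K) *\<^sub>R g s \<in> cball 0 1" using g(2) K by simp
      ultimately show ?thesis unfolding S_def by blast
    qed
    have p_bound: "norm (p s) \<le> K0 * K" for s
    proof -
      have "norm (p s) \<le> K0 * norm (g s)" unfolding p_def by (rule P(2))
      also have "\<dots> \<le> K0 * K" using g(2) K0 by (intro mult_left_mono) auto
      finally show ?thesis .
    qed
    have g_int: "integrable M g" by (rule integrable_bounded[of _ K]) (use g in auto)
    have p_int: "integrable M p" by (rule integrable_bounded[of _ "K0 * K"]) (use p_meas p_bound in auto)
    have "dist (bconv g t) (bconv p t) \<le> e" for t
    proof -
      have i1: "integrable M (\<lambda>s. e1 * K)" by (rule finite_measure.integrable_const[OF finite_M])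
      have win: "integrable M (indicator {t - \<delta>..t - \<delta> + \<delta>} :: real \<Rightarrow> real)" "(\<integral>s. indicator {t - \<delta>..t - \<delta> + \<delta>} s \<partial>M) \<le> \<delta>"
        using \<delta> by (intro integral_window_le; simp)+
      have i2: "integrable M (\<lambda>s. b * indicator {t - \<delta>..t - \<delta> + \<delta>} s)"
        using win(1) by (intro integrable_mult_right) auto
      have diff: "bconv g t - bconv p t = (\<integral>s. indicator {..t} s *\<^sub>R H (t - s) (g s) - indicator {..t} s *\<^sub>R H (t - s) (p s) \<partial>M)"
        using integrable_convolution[OF g_int, of t] integrable_convolution[OF p_int, of t]
        by (simp add: bconv g_int p_int conv_def)
      have "norm (bconv g t - bconv p t) \<le> (\<integral>s. e1 * K + b * indicator {t - \<delta>..t - \<delta> + \<delta>} s \<partial>M)"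
        unfolding diff
      proof (rule norm_integral_le_dominating)
        show "integrable M (\<lambda>s. e1 * K + b * indicator {t - \<delta>..t - \<delta> + \<delta>} s)"
          by (rule Bochner_Integration.integrable_add[OF i1 i2])
        fix s
        have nonneg: "e1 * K \<ge> 0" "b * indicator {t - \<delta>..t - \<delta> + \<delta>} s \<ge> 0" using e1 K b by simp_all
        consider "s > t" | "s \<le> t" "\<delta> \<le> t - s" | "s \<le> t" "t - s < \<delta>" by linarith
        then show "norm (indicator {..t} s *\<^sub>R H (t - s) (g s) - indicator {..t} s *\<^sub>R H (t - s) (p s))
          \<le> e1 * K + b * indicator {t - \<delta>..t - \<delta> + \<delta>} s"
        proof cases
          case 1
          then show ?thesis using nonneg by simp
        next
          case 2
          have "norm (H (t - s) (g s) - H (t - s) (p s)) \<le> e1 * norm (g s)"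
            unfolding p_def by (rule PH[OF 2(2)])
          also have "\<dots> \<le> e1 * K" using g(2) e1 by (intro mult_left_mono) auto
          finally show ?thesis using 2 nonneg by simp
        next
          case 3
          have "norm (H (t - s) (g s) - H (t - s) (p s)) \<le> N * K + N * (K0 * K)"
          proof (rule order_trans[OF norm_triangle_ineq4 add_mono])
            show "norm (H (t - s) (g s)) \<le> N * K"
              using H_bound[of "t - s" "g s"] g(2) N by (meson mult_left_mono order_trans)
            show "norm (H (t - s) (p s)) \<le> N * (K0 * K)"
              using H_bound[of "t - s" "p s"] p_bound[of s] N by (meson mult_left_mono order_trans)
          qed
          also have "\<dots> = b" by (simp add: b_def algebra_simps)
          finally show ?thesis using 3 nonneg by simp
        qed
      qed
      also have "\<dots> = e1 * K * T + b * (\<integral>s. indicator {t - \<delta>..t - \<delta> + \<delta>} s \<partial>M)"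
        by (subst Bochner_Integration.integral_add[OF i1 i2], subst integral_one_M, subst integral_mult_right_zero) (rule refl)
      also have "\<dots> \<le> e1 * K * T + b * \<delta>" using win(2) b by (intro add_left_mono mult_left_mono)
      also have "\<dots> \<le> e" using b\<delta> K T by (simp add: e1_def)
      finally show ?thesis by (simp only: dist_norm)
    qed
    then have "dist (bconv g) (bconv p) \<le> e" by (rule dist_bound)
    then show ?thesis using p_meas p_S by (intro bexI[of _ "bconv p"]) auto
  qed
  ultimately show "\<exists>S'. precompact S' \<and> (\<forall>x\<in>{bconv g | g. g \<in> borel_measurable M \<and> (\<forall>s. norm (g s) \<le> K)}. \<exists>z\<in>S'. dist x z \<le> e)"
    by (intro exI[of _ "{bconv g | g. g \<in> borel_measurable M \<and> (\<forall>s. g s \<in> S)}"]) blast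
qed

theorem precompact_conv_dominated:
  assumes \<gamma>: "integrable M \<gamma>"
  shows "precompact {bconv g | g. g \<in> borel_measurable M \<and> (\<forall>s. norm (g s) \<le> \<gamma> s)}"
proof (rule precompact_approx)
  fix e :: real assume e: "e > 0"
  have e': "e / (N + 1) > 0" using e N by simp
  obtain K where K: "K > 0" and tail: "(\<integral>s. indicator {s. \<gamma> s > K} s * \<bar>\<gamma> s\<bar> \<partial>M) \<le> e / (N + 1)"
    by (rule integral_tail_small[OF \<gamma> e'])
  have "precompact {bconv g | g. g \<in> borel_measurable M \<and> (\<forall>s. norm (g s) \<le> K)}"
    by (rule precompact_conv_bounded[OF K])
  moreover have "\<exists>z\<in>{bconv g | g. g \<in> borel_measurable M \<and> (\<forall>s. norm (g s) \<le> K)}. dist (bconv g) z \<le> e"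
    if g: "g \<in> borel_measurable M" "\<forall>s. norm (g s) \<le> \<gamma> s" for g
  proof -
    have \<gamma>_meas: "\<gamma> \<in> borel_measurable M" using \<gamma> by simp
    define p where "p = (\<lambda>s. (if \<gamma> s > K then 0 else 1) *\<^sub>R g s)"
    have ind_meas: "(\<lambda>s. if \<gamma> s > K then 0 else 1 :: real) \<in> borel_measurable M"
      using \<gamma>_meas by measurable
    have p_meas: "p \<in> borel_measurable M" unfolding p_def using ind_meas g(1) by (rule borel_measurable_scaleR)
    have p_bound: "norm (p s) \<le> K" for s using g(2)[rule_format, of s] K by (auto simp: p_def)
    have g_int: "integrable M g"
      by (rule Bochner_Integration.integrable_bound[OF \<gamma> g(1)]) (use g(2) in \<open>auto intro: order_trans[OF _ abs_ge_self]\<close>)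
    have p_int: "integrable M p" by (rule integrable_bounded[of _ K]) (use p_meas p_bound in auto)
    have tail_int: "integrable M (\<lambda>s. indicator {s. \<gamma> s > K} s * \<bar>\<gamma> s\<bar>)"
    proof (rule Bochner_Integration.integrable_bound[OF \<gamma>])
      have "(\<lambda>s. (if \<gamma> s > K then 1 else 0) * \<bar>\<gamma> s\<bar>) \<in> borel_measurable M" using \<gamma>_meas by measurable
      then show "(\<lambda>s. indicator {s. \<gamma> s > K} s * \<bar>\<gamma> s\<bar>) \<in> borel_measurable M" by (simp add: indicator_def of_bool_def)
    qed (intro AE_I2, simp add: indicator_def)
    have "dist (bconv g) (bconv p) \<le> N * (\<integral>s. norm (g s - p s) \<partial>M)" by (rule dist_bconv_le[OF g_int p_int])
    also have "\<dots> \<le> N * (\<integral>s. indicator {s. \<gamma> s > K} s * \<bar>\<gamma> s\<bar> \<partial>M)"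
    proof (intro mult_left_mono N integral_mono' tail_int)
      show "norm (g s - p s) \<le> indicator {s. \<gamma> s > K} s * \<bar>\<gamma> s\<bar>" for s
        using g(2)[rule_format, of s] by (auto simp: p_def indicator_def)
    qed simp
    also have "\<dots> \<le> N * (e / (N + 1))" using tail N by (intro mult_left_mono)
    also have "\<dots> \<le> e" using e N by (simp add: field_simps)
    finally show ?thesis using p_meas p_bound by (intro bexI[of _ "bconv p"]) auto
  qed
  ultimately show "\<exists>S'. precompact S' \<and> (\<forall>x\<in>{bconv g | g. g \<in> borel_measurable M \<and> (\<forall>s. norm (g s) \<le> \<gamma> s)}. \<exists>z\<in>S'. dist x z \<le> e)"
    by (intro exI[of _ "{bconv g | g. g \<in> borel_measurable M \<and> (\<forall>s. norm (g s) \<le> K)}"]) blast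
qed

end

section \<open>The control operator\<close>

lemma real_of_not_surj_to_cplx:
  assumes "\<not> surj (to_cplx :: 'k::rc_field \<Rightarrow> complex)"
  shows "(c :: 'k) = of_real (Re (to_cplx c))"
proof -
  have "Im (to_cplx c) = 0"
  proof (rule ccontr)
    assume ne: "Im (to_cplx c) \<noteq> 0"
    have "z = to_cplx (of_real (Re z - Im z / Im (to_cplx c) * Re (to_cplx c)) + of_real (Im z / Im (to_cplx c)) * c)" for z
      using ne by (simp only: to_cplx_add to_cplx_mult to_cplx_of_real) (simp add: complex_eq_iff)
    then have "\<exists>y. z = to_cplx (y :: 'k)" for z by (rule exI)
    then have "surj (to_cplx :: 'k \<Rightarrow> complex)" unfolding surj_def by (rule allI)
    then show False using assms by contradiction
  qed
  then have "to_cplx c = of_real (Re (to_cplx c))" by (simp add: complex_eq_iff)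
  then show ?thesis by (intro to_cplx_inj[of c]) (simp only: to_cplx_of_real)
qed

context normed_space_over
begin

lemma dual_bounded_linear:
  assumes "\<phi> \<in> dual scale UNIV norm"
  shows "bounded_linear \<phi>"
proof -
  obtain K where \<phi>: "linear_on scale (*) UNIV \<phi>" "\<And>x. norm (\<phi> x) \<le> K * norm x"
    using assms by (auto simp: dual_def)
  show ?thesis
  proof (rule bounded_linear_intro[where K = K])
    show "\<phi> (x + y) = \<phi> x + \<phi> y" for x y using \<phi>(1) by (simp add: linear_on_def)
    show "\<phi> (r *\<^sub>R x) = r *\<^sub>R \<phi> x" for r x
    proof -
      have "\<phi> (scale (of_real r) x) = of_real r * \<phi> x" using \<phi>(1) by (simp add: linear_on_def)
      then show ?thesis by (simp add: scale_of_real scaleR_conv_of_real)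
    qed
    show "norm (\<phi> x) \<le> norm x * K" for x using \<phi>(2)[of x] by (simp add: mult.commute)
  qed
qed

lemma dualI:
  assumes "bounded_linear \<phi>" "\<And>c x. \<phi> (scale c x) = c * \<phi> x"
  shows "\<phi> \<in> dual scale UNIV norm"
proof -
  obtain K where "\<And>x. norm (\<phi> x) \<le> norm x * K" using bounded_linear.bounded[OF assms(1)] by blast
  then have "\<forall>x\<in>UNIV. norm (\<phi> x) \<le> K * norm x" by (simp add: mult.commute)
  then show ?thesis
    using assms(2) linear_add[OF bounded_linear.linear[OF assms(1)]]
    unfolding dual_def linear_on_def by (intro CollectI conjI ballI allI exI[of _ K]) auto
qed

lemma dual_scale: "\<phi> \<in> dual scale UNIV norm \<Longrightarrow> \<phi> (scale c x) = c * \<phi> x"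
  by (simp add: dual_def linear_on_def)

lemma dual_eq_0:
  assumes "\<phi> \<in> dual scale UNIV norm" "\<And>x. Re (to_cplx (\<phi> x)) = 0"
  shows "\<phi> x = 0"
proof (rule ccontr)
  assume ne: "\<phi> x \<noteq> 0"
  have "\<phi> (scale (inverse (\<phi> x)) x) = 1" using dual_scale[OF assms(1)] ne by simp
  then show False using assms(2)[of "scale (inverse (\<phi> x)) x"] by (simp add: to_cplx_1)
qed

lemma ex_dual_Re:
  assumes \<psi>: "bounded_linear (\<psi> :: 'x::real_normed_vector \<Rightarrow> real)"
  obtains \<phi> where "\<phi> \<in> dual scale UNIV norm" and "\<And>x. Re (to_cplx (\<phi> x)) = \<psi> x"
proof (cases "surj (to_cplx :: 'k \<Rightarrow> complex)")
  case True
  define k where "k = inv (to_cplx :: 'k \<Rightarrow> complex)"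
  have k: "to_cplx (k z) = z" for z unfolding k_def by (rule surj_f_inv_f[OF True])
  define i where "i = k \<i>"
  define \<phi> where "\<phi> = (\<lambda>x. k (Complex (\<psi> x) (- \<psi> (scale i x))))"
  have c: "c = of_real (Re (to_cplx c)) + of_real (Im (to_cplx c)) * i" for c
    by (rule to_cplx_inj) (simp only: to_cplx_add to_cplx_mult to_cplx_of_real i_def k, simp add: complex_eq_iff)
  have ic: "i * c = of_real (Re (to_cplx c)) * i - of_real (Im (to_cplx c))" for c
    by (rule to_cplx_inj) (simp only: to_cplx_diff to_cplx_mult to_cplx_of_real i_def k, simp add: complex_eq_iff)
  note lin = linear_add[OF bounded_linear.linear[OF \<psi>]] linear_scale[OF bounded_linear.linear[OF \<psi>]]
    linear_diff[OF bounded_linear.linear[OF \<psi>]]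
  have \<psi>_scale: "\<psi> (scale c x) = Re (to_cplx c) * \<psi> x + Im (to_cplx c) * \<psi> (scale i x)" for c x
    by (subst c[of c]) (simp add: scale_left_distrib scale_scale[symmetric] scale_of_real lin del: scale_scale)
  have \<psi>_iscale: "\<psi> (scale i (scale c x)) = Re (to_cplx c) * \<psi> (scale i x) - Im (to_cplx c) * \<psi> x" for c x
  proof -
    have "scale i (scale c x) = scale (of_real (Re (to_cplx c)) * i - of_real (Im (to_cplx c))) x"
      by (simp add: ic)
    also have "\<dots> = Re (to_cplx c) *\<^sub>R scale i x - Im (to_cplx c) *\<^sub>R x"
      by (simp add: scale_left_diff_distrib scale_scale[symmetric] scale_of_real del: scale_scale)
    finally show ?thesis by (simp add: lin)
  qed
  have mult: "\<phi> (scale c x) = c * \<phi> x" for c x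
    by (rule to_cplx_inj) (simp only: \<phi>_def k to_cplx_mult \<psi>_scale[of c x] \<psi>_iscale[of c x], simp add: complex_eq_iff)
  obtain K where K: "\<And>x. norm (\<psi> x) \<le> norm x * K" using bounded_linear.bounded[OF \<psi>] by blast
  have "bounded_linear \<phi>"
  proof (rule bounded_linear_intro[where K = "K + norm i * K"])
    show "\<phi> (x + y) = \<phi> x + \<phi> y" for x y
      by (rule to_cplx_inj) (simp only: \<phi>_def k to_cplx_add scale_right_distrib lin(1), simp add: complex_eq_iff)
    show "\<phi> (r *\<^sub>R x) = r *\<^sub>R \<phi> x" for r x
      using mult[of "of_real r" x] unfolding scale_of_real scaleR_conv_of_real[symmetric] .
    show "norm (\<phi> x) \<le> norm x * (K + norm i * K)" for x
    proof -
      have "norm (\<phi> x) = cmod (Complex (\<psi> x) (- \<psi> (scale i x)))"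
        using norm_to_cplx[of "\<phi> x"] by (simp only: \<phi>_def k)
      also have "\<dots> \<le> \<bar>\<psi> x\<bar> + \<bar>\<psi> (scale i x)\<bar>" using cmod_le[of "Complex (\<psi> x) (- \<psi> (scale i x))"] by simp
      also have "\<dots> \<le> norm x * K + norm (scale i x) * K" using K[of x] K[of "scale i x"] by simp
      finally show ?thesis by (simp add: norm_scale algebra_simps)
    qed
  qed
  then have "\<phi> \<in> dual scale UNIV norm" using mult by (rule dualI)
  moreover have "Re (to_cplx (\<phi> x)) = \<psi> x" for x by (simp add: \<phi>_def k)
  ultimately show ?thesis by (rule that)
next
  case False
  define \<phi> where "\<phi> = (\<lambda>x. of_real (\<psi> x) :: 'k)"
  have mult: "\<phi> (scale c x) = c * \<phi> x" for c x
  proof -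
    define r where "r = Re (to_cplx c)"
    have c: "c = of_real r" unfolding r_def by (rule real_of_not_surj_to_cplx[OF False])
    have "\<psi> (scale (of_real r) x) = r * \<psi> x"
      by (simp only: scale_of_real linear_scale[OF bounded_linear.linear[OF \<psi>]] real_scaleR_def)
    then show ?thesis by (simp add: \<phi>_def c)
  qed
  have "bounded_linear \<phi>" unfolding \<phi>_def
    by (rule bounded_linear_compose[OF bounded_linear_of_real \<psi>])
  then have "\<phi> \<in> dual scale UNIV norm" using mult by (rule dualI)
  moreover have "Re (to_cplx (\<phi> x)) = \<psi> x" for x by (simp add: \<phi>_def to_cplx_of_real)
  ultimately show ?thesis by (rule that)
qed

end

lemma bounded_linear_Re_to_cplx: "bounded_linear (\<lambda>k :: 'k::rc_field. Re (to_cplx k))"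
proof (rule bounded_linear_intro[where K = 1])
  show "Re (to_cplx (r *\<^sub>R k)) = r *\<^sub>R Re (to_cplx k)" for r and k :: 'k
    by (simp add: scaleR_conv_of_real to_cplx_mult to_cplx_of_real)
  show "norm (Re (to_cplx k)) \<le> norm k * 1" for k :: 'k
    using abs_Re_le_cmod[of "to_cplx k"] by (simp add: norm_to_cplx)
qed (simp add: to_cplx_add)

locale control_system = compact_operator_family G T N
  for G :: "real \<Rightarrow> 'w::{banach,second_countable_topology} \<Rightarrow> 'w" and T N +
  fixes sW :: "'k::rc_field \<Rightarrow> 'w \<Rightarrow> 'w" and sU :: "'k \<Rightarrow> 'u::{banach,second_countable_topology} \<Rightarrow> 'u"
    and ip :: "'u \<Rightarrow> 'u \<Rightarrow> 'k" and B :: "'u \<Rightarrow> 'w"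
  assumes sW: "normed_space_over sW" and hilb: "hilbert_space_over sU ip"
    and B: "bounded_linear_over sU sW B" and G_scale: "\<And>t c x. t \<in> {0..T} \<Longrightarrow> G t (sW c x) = sW c (G t x)"
    and controllable: "approximately_controllable G B (\<lambda>_ _. 0) T"
begin

interpretation sW: normed_space_over sW by (rule sW)

abbreviation "X \<equiv> dual sW UNIV norm"

abbreviation "F \<equiv> control_operator G ip B T"

definition adj :: "('w \<Rightarrow> 'k) \<Rightarrow> real \<Rightarrow> 'u" where
  "adj \<phi> s = adjoint_to_hilbert ip B (\<phi> \<circ> H (T - s))"

lemma B_linear: "bounded_linear B" using B by (simp add: bounded_linear_over_def)

lemma B_measurable: "u \<in> borel_measurable M \<Longrightarrow> (\<lambda>s. B (u s)) \<in> borel_measurable M"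
  by (rule measurable_compose[OF _ borel_measurable_continuous_onI[OF linear_continuous_on[OF B_linear]]])

lemma dual_bound:
  assumes "\<phi> \<in> X"
  obtains K where "K \<ge> 0" and "\<And>x. norm (\<phi> x) \<le> K * norm x"
  using bounded_linear.nonneg_bounded[OF sW.dual_bounded_linear[OF assms]] by (metis mult.commute)

lemma dual_comp_H:
  assumes "\<phi> \<in> X"
  shows "linear_on sW (*) UNIV (\<phi> \<circ> H t)"
proof -
  have "H t (sW c x) = sW c (H t x)" for c x unfolding H_def using clamp_mem by (rule G_scale)
  then show ?thesis
    using assms linear_add[OF bounded_linear.linear[OF H_linear]] by (simp add: dual_def linear_on_def)
qed

lemma adj:
  assumes "\<phi> \<in> X"
  shows ip_adj: "ip u (adj \<phi> s) = \<phi> (H (T - s) (B u))"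
    and adj_bounded: "\<exists>K. \<forall>s. norm (adj \<phi> s) \<le> K"
proof -
  obtain K where K: "K \<ge> 0" "\<And>x. norm (\<phi> x) \<le> K * norm x" using dual_bound[OF assms] by blast
  have KN: "norm ((\<phi> \<circ> H (T - s)) x) \<le> (K * N) * norm x" for s x
  proof -
    have "norm (\<phi> (H (T - s) x)) \<le> K * norm (H (T - s) x)" by (rule K(2))
    also have "\<dots> \<le> K * (N * norm x)" by (intro mult_left_mono H_bound K(1))
    finally show ?thesis by (simp add: mult.assoc)
  qed
  have KN0: "K * N \<ge> 0" using K(1) N by simp
  show "ip u (adj \<phi> s) = \<phi> (H (T - s) (B u))"
    unfolding adj_def using adjoint_to_hilbert(1)[OF hilb B dual_comp_H[OF assms] KN KN0] by (simp only: comp_def)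
  show "\<exists>K. \<forall>s. norm (adj \<phi> s) \<le> K"
    unfolding adj_def using adjoint_to_hilbert(2)[OF hilb B dual_comp_H[OF assms] KN KN0] by blast
qed

lemma adj_unique: "(\<And>u. ip u v = \<phi> (H (T - s) (B u))) \<Longrightarrow> adj \<phi> s = v"
  unfolding adj_def by (rule adjoint_to_hilbert_unique[OF hilb]) simp

lemma adj_measurable:
  assumes "\<phi> \<in> X"
  shows "adj \<phi> \<in> borel_measurable M"
proof (rule weakly_measurable_imp_measurable[OF hilb])
  fix u
  have "continuous_on UNIV (\<lambda>s. H (T - s) (B u))"
    by (rule continuous_on_compose2[OF H_continuous]) (auto intro!: continuous_intros)
  then have "continuous_on UNIV (\<lambda>s. \<phi> (H (T - s) (B u)))"
    by (rule continuous_on_compose2[OF linear_continuous_on[OF sW.dual_bounded_linear[OF assms], of UNIV]]) simp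
  then show "(\<lambda>s. ip u (adj \<phi> s)) \<in> borel_measurable M"
    unfolding ip_adj[OF assms] by (intro borel_measurable_M borel_measurable_continuous_onI)
qed

lemma B_adj_integrable:
  assumes "\<phi> \<in> X"
  shows "integrable M (\<lambda>s. B (adj \<phi> s))"
proof -
  obtain K where K: "\<And>s. norm (adj \<phi> s) \<le> K" using adj_bounded[OF assms] by blast
  obtain b where b: "b \<ge> 0" "\<And>u. norm (B u) \<le> norm u * b" using bounded_linear.nonneg_bounded[OF B_linear] by blast
  show ?thesis
  proof (rule integrable_bounded)
    show "(\<lambda>s. B (adj \<phi> s)) \<in> borel_measurable M" by (intro B_measurable adj_measurable assms)
    show "norm (B (adj \<phi> s)) \<le> K * b" for s
      using b(2)[of "adj \<phi> s"] mult_right_mono[OF K[of s] b(1)] by linarith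
  qed
qed

lemma F_eq:
  assumes "t \<in> {0..T}"
  shows "F t \<phi> = conv (\<lambda>s. B (adj \<phi> s)) t"
  unfolding conv_eq[OF assms] control_operator_def
proof (rule Bochner_Integration.integral_cong)
  fix s assume "s \<in> space (lebesgue_on {0..t})"
  then have "T - s \<in> {0..T}" using assms by auto
  then have "H (T - s) = G (T - s)" by (rule H_eq)
  then show "G (t - s) (B (adjoint_to_hilbert ip B (\<phi> \<circ> G (T - s)))) = G (t - s) (B (adj \<phi> s))"
    by (simp only: adj_def)
qed simp

lemma dual_combination:
  fixes m :: nat
  assumes "\<forall>j<m. \<phi> j \<in> X"
  shows "(\<lambda>x. \<Sum>j<m. a j *\<^sub>R \<phi> j x) \<in> X"
proof (rule sW.dualI)
  show "bounded_linear (\<lambda>x. \<Sum>j<m. a j *\<^sub>R \<phi> j x)"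
    using sW.dual_bounded_linear[OF assms[rule_format]]
    by (intro bounded_linear_sum bounded_linear_compose[OF bounded_linear_scaleR_right]) auto
  show "(\<Sum>j<m. a j *\<^sub>R \<phi> j (sW c x)) = c * (\<Sum>j<m. a j *\<^sub>R \<phi> j x)" for c x
    using sW.dual_scale[OF assms[rule_format]] by (simp add: sum_distrib_left)
qed

lemma ip_combination: "ip u (\<Sum>j<m. a j *\<^sub>R v j) = (\<Sum>j<m. of_real (a j) * ip u (v j))" for m :: nat
proof (induction m)
  case 0
  have "ip u 0 = 0" using ip_add_right[OF hilb, of u 0 0] by simp
  then show ?case by simp
qed (simp add: ip_add_right[OF hilb] ip_scaleR_right[OF hilb])

lemma adj_combination:
  fixes m :: nat
  assumes "\<forall>j<m. \<phi> j \<in> X"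
  shows "adj (\<lambda>x. \<Sum>j<m. a j *\<^sub>R \<phi> j x) s = (\<Sum>j<m. a j *\<^sub>R adj (\<phi> j) s)"
  by (rule adj_unique) (simp add: ip_combination ip_adj[OF assms[rule_format]] scaleR_conv_of_real)

lemma F_combination:
  fixes m :: nat
  assumes "\<forall>j<m. \<phi> j \<in> X" "t \<in> {0..T}"
  shows "F t (\<lambda>x. \<Sum>j<m. a j *\<^sub>R \<phi> j x) = (\<Sum>j<m. a j *\<^sub>R F t (\<phi> j))"
proof -
  have "F t (\<lambda>x. \<Sum>j<m. a j *\<^sub>R \<phi> j x) = conv (\<lambda>s. \<Sum>j<m. a j *\<^sub>R B (adj (\<phi> j) s)) t"
    unfolding F_eq[OF assms(2)] adj_combination[OF assms(1)]
    by (simp add: linear_sum[OF bounded_linear.linear[OF B_linear]] linear_scale[OF bounded_linear.linear[OF B_linear]])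
  also have "\<dots> = (\<Sum>j<m. conv (\<lambda>s. a j *\<^sub>R B (adj (\<phi> j) s)) t)"
    by (rule conv_sum) (use B_adj_integrable[OF assms(1)[rule_format]] in auto)
  finally show ?thesis by (simp only: conv_scaleR F_eq[OF assms(2)])
qed

lemma dual_diff: "\<phi> \<in> X \<Longrightarrow> \<psi> \<in> X \<Longrightarrow> (\<lambda>x. \<phi> x - \<psi> x) \<in> X"
  using sW.dual_bounded_linear[of \<phi>] sW.dual_bounded_linear[of \<psi>] sW.dual_scale[of \<phi>] sW.dual_scale[of \<psi>]
  by (intro sW.dualI bounded_linear_sub) (simp_all add: right_diff_distrib)

lemma F_diff:
  assumes "\<phi> \<in> X" "\<psi> \<in> X" "t \<in> {0..T}"
  shows "F t (\<lambda>x. \<phi> x - \<psi> x) = F t \<phi> - F t \<psi>"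
proof -
  have "adj (\<lambda>x. \<phi> x - \<psi> x) s = adj \<phi> s - adj \<psi> s" for s
    by (rule adj_unique) (simp add: ip_diff_right[OF hilb] ip_adj assms)
  then show ?thesis unfolding F_eq[OF assms(3)]
    using conv_diff[OF B_adj_integrable[OF assms(1)] B_adj_integrable[OF assms(2)]]
    by (simp add: linear_diff[OF bounded_linear.linear[OF B_linear]])
qed

lemma Re_dual_conv:
  assumes \<phi>: "\<phi> \<in> X" and g: "integrable M (\<lambda>s. indicator {..T} s *\<^sub>R H (T - s) (B (u s)))"
  shows "Re (to_cplx (\<phi> (conv (\<lambda>s. B (u s)) T))) = (\<integral>s. Re (to_cplx (ip (u s) (adj \<phi> s))) \<partial>M)"
proof -
  have l: "bounded_linear (\<lambda>x. Re (to_cplx (\<phi> x)))"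
    by (rule bounded_linear_compose[OF bounded_linear_Re_to_cplx sW.dual_bounded_linear[OF \<phi>]])
  have "Re (to_cplx (\<phi> (conv (\<lambda>s. B (u s)) T))) =
      (\<integral>s. Re (to_cplx (\<phi> (indicator {..T} s *\<^sub>R H (T - s) (B (u s))))) \<partial>M)"
    unfolding conv_def by (rule integral_bounded_linear[OF l g, symmetric])
  also have "\<dots> = (\<integral>s. Re (to_cplx (ip (u s) (adj \<phi> s))) \<partial>M)"
    by (rule Bochner_Integration.integral_cong) (simp_all add: ip_adj[OF \<phi>])
  finally show ?thesis .
qed

lemma Re_dual_F:
  assumes "\<phi> \<in> X"
  shows "Re (to_cplx (\<phi> (F T \<phi>))) = (\<integral>s. (norm (adj \<phi> s))\<^sup>2 \<partial>M)"
proof -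
  have T: "T \<in> {0..T}" using T by simp
  show ?thesis
    unfolding F_eq[OF T] Re_dual_conv[OF assms integrable_convolution[OF B_adj_integrable[OF assms]]]
    by (simp only: ip_self[OF hilb] to_cplx_of_real Re_complex_of_real)
qed

text \<open>If the quadratic form of \<open>F(T)\<close> vanishes at \<open>\<phi>\<close>, then \<open>\<phi>\<close> annihilates every state that
  the linear system reaches from \<open>0\<close>; these states are dense.\<close>

lemma dual_eq_0_if_F:
  assumes \<phi>: "\<phi> \<in> X" and zero: "Re (to_cplx (\<phi> (F T \<phi>))) = 0"
  shows "\<phi> x = 0"
proof (rule sW.dual_eq_0[OF \<phi>])
  fix x
  have T0: "T \<in> {0..T}" "(0::real) \<in> {0..T}" using T by simp_all
  obtain K where K: "\<And>s. norm (adj \<phi> s) \<le> K" using adj_bounded[OF \<phi>] by blast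
  have K0: "K \<ge> 0" using K[of 0] norm_ge_zero order_trans by blast
  have meas: "(\<lambda>s. (norm (adj \<phi> s))\<^sup>2) \<in> borel_measurable M" using adj_measurable[OF \<phi>] by simp
  have "integrable M (\<lambda>s. (norm (adj \<phi> s))\<^sup>2)"
    by (rule integrable_bounded[OF meas, of "K\<^sup>2"]) (use power_mono[OF K norm_ge_zero, of _ 2] in auto)
  from integral_nonneg_eq_0_iff_AE[OF this] have ae: "AE s in M. adj \<phi> s = 0"
    using zero by (simp add: Re_dual_F[OF \<phi>])
  have reach: "Re (to_cplx (\<phi> (w T))) = 0" if "mild_solution G B (\<lambda>_ _. 0) T 0 u w" "u \<in> L2_controls T" for u w
  proof -
    have int: "integrable M (\<lambda>s. G (T - s) (B (u s)))" and
      w: "w T = G T 0 + (LINT s|M. G (T - s) (B (u s)))"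
      using that(1) T0 by (simp_all add: mild_solution_def)
    have "w T = conv (\<lambda>s. B (u s)) T"
      using w by (simp add: conv_eq[OF T0(1)] linear_0[OF bounded_linear.linear[OF lin[OF T0(1)]]])
    moreover have "integrable M (\<lambda>s. indicator {..T} s *\<^sub>R H (T - s) (B (u s)))"
      by (rule Bochner_Integration.integrable_cong[THEN iffD1, OF refl _ int]) (simp add: H_eq)
    ultimately have "Re (to_cplx (\<phi> (w T))) = (\<integral>s. Re (to_cplx (ip (u s) (adj \<phi> s))) \<partial>M)"
      using Re_dual_conv[OF \<phi>] by simp
    also have "\<dots> = 0"
    proof (rule integral_eq_zero_AE)
      show "AE s in M. Re (to_cplx (ip (u s) (adj \<phi> s))) = 0"
        using ae
      proof eventually_elim
        case (elim s)
        have "ip (u s) 0 = 0" using ip_add_right[OF hilb, of "u s" 0 0] by simp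
        then show ?case using elim by (simp add: to_cplx_0)
      qed
    qed
    finally show ?thesis .
  qed
  obtain c where c: "c \<ge> 0" "\<And>x. norm (\<phi> x) \<le> c * norm x" using dual_bound[OF \<phi>] by blast
  show "Re (to_cplx (\<phi> x)) = 0"
  proof (rule ccontr)
    assume ne: "Re (to_cplx (\<phi> x)) \<noteq> 0"
    define e where "e = \<bar>Re (to_cplx (\<phi> x))\<bar> / (c + 1)"
    have e: "e > 0" using ne c by (simp add: e_def)
    obtain u w where uw: "u \<in> L2_controls T" "mild_solution G B (\<lambda>_ _. 0) T 0 u w" "norm (w T - x) < e"
      using controllable e unfolding approximately_controllable_def by blast
    have "\<bar>Re (to_cplx (\<phi> x))\<bar> = \<bar>Re (to_cplx (\<phi> (w T - x)))\<bar>"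
      using reach[OF uw(2,1)] linear_diff[OF bounded_linear.linear[OF sW.dual_bounded_linear[OF \<phi>]], of "w T" x]
      by (simp add: to_cplx_diff)
    also have "\<dots> \<le> norm (\<phi> (w T - x))"
      using abs_Re_le_cmod[of "to_cplx (\<phi> (w T - x))"] by (simp add: norm_to_cplx)
    also have "\<dots> \<le> c * norm (w T - x)" by (rule c(2))
    also have "\<dots> \<le> c * e" using uw(3) c(1) by (intro mult_left_mono) auto
    also have "\<dots> < (c + 1) * e" using e by simp
    also have "\<dots> = \<bar>Re (to_cplx (\<phi> x))\<bar>" using c(1) by (simp add: e_def)
    finally show False by simp
  qed
qed

lemma F_inj: "inj_on (F T) X"
proof (rule inj_onI)
  fix \<phi> \<psi> assume *: "\<phi> \<in> X" "\<psi> \<in> X" "F T \<phi> = F T \<psi>"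
  have T: "T \<in> {0..T}" using T by simp
  have "F T (\<lambda>x. \<phi> x - \<psi> x) = 0" using F_diff[OF *(1,2) T] *(3) by simp
  then have "Re (to_cplx (\<phi> (F T (\<lambda>x. \<phi> x - \<psi> x)) - \<psi> (F T (\<lambda>x. \<phi> x - \<psi> x)))) = 0"
    using * by (simp add: linear_0[OF bounded_linear.linear[OF sW.dual_bounded_linear]] to_cplx_0)
  from dual_eq_0_if_F[OF dual_diff[OF *(1,2)] this] have "\<phi> x - \<psi> x = 0" for x .
  then show "\<phi> = \<psi>" by (intro ext) (simp only: right_minus_eq)
qed

lemma F_dense: "closure (F T ` X) = UNIV"
proof (rule ccontr)
  assume "closure (F T ` X) \<noteq> UNIV"
  then obtain x0 where x0: "x0 \<notin> closure (F T ` X)" by blast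
  have T: "T \<in> {0..T}" using T by simp
  have comb: "a *\<^sub>R F T \<phi> + b *\<^sub>R F T \<psi> \<in> F T ` X" if "\<phi> \<in> X" "\<psi> \<in> X" for a b \<phi> \<psi>
  proof -
    have m: "\<forall>j<2. (if j = 0 then \<phi> else \<psi>) \<in> X" using that by simp
    have "a *\<^sub>R F T \<phi> + b *\<^sub>R F T \<psi> = F T (\<lambda>x. a *\<^sub>R \<phi> x + b *\<^sub>R \<psi> x)"
      using F_combination[OF m T, of "\<lambda>j. if j = 0 then a else b"] by (simp add: numeral_2_eq_2)
    moreover have "(\<lambda>x. a *\<^sub>R \<phi> x + b *\<^sub>R \<psi> x) \<in> X"
      using dual_combination[OF m, of "\<lambda>j. if j = 0 then a else b"] by (simp add: numeral_2_eq_2)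
    ultimately show ?thesis by (rule image_eqI)
  qed
  have "(\<lambda>_. 0) \<in> X" by (rule sW.dualI) simp_all
  then have ex: "\<exists>\<phi>. \<phi> \<in> X" by blast
  have "subspace (F T ` X)"
  proof (rule subspaceI)
    obtain \<phi> where "\<phi> \<in> X" using ex by blast
    then show "0 \<in> F T ` X" using comb[of \<phi> \<phi> 0 0] by simp
    show "x + y \<in> F T ` X" if "x \<in> F T ` X" "y \<in> F T ` X" for x y
      using that comb[where a = 1 and b = 1] by auto
    show "c *\<^sub>R x \<in> F T ` X" if "x \<in> F T ` X" for c x
      using that comb[where a = c and b = 0] by auto
  qed
  then obtain \<psi> :: "'w \<Rightarrow> real" where \<psi>: "bounded_linear \<psi>" "\<And>x. x \<in> F T ` X \<Longrightarrow> \<psi> x = 0" "\<psi> x0 \<noteq> 0"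
    using ex_annihilating_functional[OF _ x0] by blast
  obtain \<phi> where \<phi>: "\<phi> \<in> X" "\<And>x. Re (to_cplx (\<phi> x)) = \<psi> x" using sW.ex_dual_Re[OF \<psi>(1)] by blast
  have "Re (to_cplx (\<phi> (F T \<phi>))) = 0" using \<phi> \<psi>(2) by simp
  from dual_eq_0_if_F[OF \<phi>(1) this] have "\<phi> x0 = 0" .
  then show False using \<phi>(2)[of x0] \<psi>(3) by (simp add: to_cplx_0)
qed

end

section \<open>Steering the semilinear system\<close>

lemma precompact_nonexpansive_image:
  assumes S: "precompact S" and h: "\<And>x y. dist (h x) (h y) \<le> dist x y"
  shows "precompact (h ` S)"
  unfolding precompact_def
proof (intro allI impI)
  fix e :: real assume "e > 0"
  then obtain k where k: "finite k" "S \<subseteq> (\<Union>x\<in>k. ball x e)" using S unfolding precompact_def by blast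
  have "h ` S \<subseteq> (\<Union>x\<in>h ` k. ball x e)"
  proof
    fix y assume "y \<in> h ` S"
    then obtain x where x: "x \<in> S" "y = h x" by blast
    then obtain c where "c \<in> k" "dist c x < e" using k(2) by auto
    then show "y \<in> (\<Union>x\<in>h ` k. ball x e)" using h[of c x] x by (auto intro!: bexI[of _ c])
  qed
  then show "\<exists>k. finite k \<and> h ` S \<subseteq> (\<Union>x\<in>k. ball x e)" using k(1) by (intro exI[of _ "h ` k"]) auto
qed

lemma nonexpansive_continuous_on:
  assumes "\<And>x y. dist (h x) (h y) \<le> dist x y"
  shows "continuous_on S h"
  unfolding continuous_on_iff using assms order_le_less_trans by blast

lemma measurable_lebesgue_on_AE_eq:
  fixes f g :: "real \<Rightarrow> 'b::topological_space"
  assumes S: "S \<in> sets lebesgue" and f: "f \<in> borel_measurable (lebesgue_on S)"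
    and ae: "AE s in lebesgue_on S. f s = g s"
  shows "g \<in> borel_measurable (lebesgue_on S)"
proof -
  obtain Z where Z: "Z \<in> null_sets (lebesgue_on S)" "{s \<in> space (lebesgue_on S). f s \<noteq> g s} \<subseteq> Z"
    using ae unfolding eventually_ae_filter by blast
  have null: "Y \<in> sets (lebesgue_on S)" if "Y \<subseteq> Z" for Y
  proof -
    have "Z \<in> null_sets lebesgue" "Z \<subseteq> S"
      using Z(1) S null_setsD2[OF Z(1)] by (auto simp: null_sets_restrict_space)
    then have "Y \<in> null_sets lebesgue" "Y \<subseteq> S" using null_sets_completion_subset[OF that] that by auto
    then show ?thesis using S by (auto simp: sets_restrict_space_iff)
  qed
  show ?thesis
  proof (rule borel_measurableI)
    fix A :: "'b set" assume "open A"
    then have fA: "f -` A \<inter> space (lebesgue_on S) \<in> sets (lebesgue_on S)" by (intro measurable_sets[OF f]) auto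
    have "g -` A \<inter> space (lebesgue_on S) = (f -` A \<inter> space (lebesgue_on S) - Z) \<union> (g -` A \<inter> space (lebesgue_on S) \<inter> Z)"
      using Z(2) by auto
    also have "\<dots> \<in> sets (lebesgue_on S)" by (intro sets.Un sets.Diff fA null) auto
    finally show "g -` A \<inter> space (lebesgue_on S) \<in> sets (lebesgue_on S)" .
  qed
qed

lemma caratheodory_measurable:
  fixes f :: "real \<Rightarrow> 'b::metric_space \<Rightarrow> 'c::metric_space"
  assumes S: "S \<in> sets lebesgue" and cont: "AE s in lebesgue_on S. continuous_on UNIV (f s)"
    and meas: "\<And>w. (\<lambda>s. f s w) \<in> borel_measurable (lebesgue_on S)" and x: "continuous_on UNIV x"
  shows "(\<lambda>s. f s (x s)) \<in> borel_measurable (lebesgue_on S)"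
proof -
  obtain Z where Z: "Z \<in> null_sets (lebesgue_on S)" "{s \<in> space (lebesgue_on S). \<not> continuous_on UNIV (f s)} \<subseteq> Z"
    using cont unfolding eventually_ae_filter by blast
  obtain c :: 'c where True by blast
  define f' where "f' = (\<lambda>s w. if s \<in> Z then c else f s w)"
  define X where "X = (\<lambda>n s. x (real_of_int \<lfloor>real (Suc n) * s\<rfloor> / real (Suc n)))"
  have f'_meas: "(\<lambda>s. f' s w) \<in> borel_measurable (lebesgue_on S)" for w
    unfolding f'_def using null_setsD2[OF Z(1)] meas
    by (intro measurable_If_set) auto
  have "(\<lambda>s. f' s (X n s)) \<in> borel_measurable (lebesgue_on S)" for n
  proof -
    have "(\<lambda>s. \<lfloor>real (Suc n) * s\<rfloor>) \<in> measurable borel (count_space UNIV)" by measurable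
    then have "(\<lambda>s. \<lfloor>real (Suc n) * s\<rfloor>) \<in> measurable (lebesgue_on S) (count_space UNIV)"
      by (intro measurable_restrict_space1 measurable_completion) simp
    from measurable_compose_countable[OF f'_meas this, of "\<lambda>i. x (real_of_int i / real (Suc n))"]
    show ?thesis unfolding X_def .
  qed
  moreover have "(\<lambda>n. f' s (X n s)) \<longlonglongrightarrow> f' s (x s)" if s: "s \<in> space (lebesgue_on S)" for s
  proof (cases "s \<in> Z")
    case False
    have lim: "(\<lambda>n. real_of_int \<lfloor>real (Suc n) * s\<rfloor> / real (Suc n)) \<longlonglongrightarrow> s"
    proof (rule real_tendsto_sandwich[where f = "\<lambda>n. s - inverse (real (Suc n))" and h = "\<lambda>n. s"])
      show "\<forall>\<^sub>F n in sequentially. s - inverse (real (Suc n)) \<le> real_of_int \<lfloor>real (Suc n) * s\<rfloor> / real (Suc n)"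
      proof (rule always_eventually, intro allI)
        fix n
        have "real (Suc n) * s - 1 \<le> real_of_int \<lfloor>real (Suc n) * s\<rfloor>" by linarith
        then have "(real (Suc n) * s - 1) / real (Suc n) \<le> real_of_int \<lfloor>real (Suc n) * s\<rfloor> / real (Suc n)"
          by (intro divide_right_mono) auto
        then show "s - inverse (real (Suc n)) \<le> real_of_int \<lfloor>real (Suc n) * s\<rfloor> / real (Suc n)"
          by (simp add: diff_divide_distrib inverse_eq_divide)
      qed
      show "\<forall>\<^sub>F n in sequentially. real_of_int \<lfloor>real (Suc n) * s\<rfloor> / real (Suc n) \<le> s"
      proof (rule always_eventually, intro allI)
        fix n
        have "real_of_int \<lfloor>real (Suc n) * s\<rfloor> / real (Suc n) \<le> (real (Suc n) * s) / real (Suc n)"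
          by (intro divide_right_mono) auto
        then show "real_of_int \<lfloor>real (Suc n) * s\<rfloor> / real (Suc n) \<le> s" by simp
      qed
      have "(\<lambda>n. s - inverse (real (Suc n))) \<longlonglongrightarrow> s - 0" by (intro tendsto_intros LIMSEQ_inverse_real_of_nat)
      then show "(\<lambda>n. s - inverse (real (Suc n))) \<longlonglongrightarrow> s" by simp
    qed simp
    have "isCont x s" using x by (simp add: continuous_on_eq_continuous_at)
    from isCont_tendsto_compose[OF this lim] have "(\<lambda>n. X n s) \<longlonglongrightarrow> x s" unfolding X_def .
    moreover have "isCont (f s) (x s)" using Z(2) s False by (auto simp: continuous_on_eq_continuous_at)
    ultimately have "(\<lambda>n. f s (X n s)) \<longlonglongrightarrow> f s (x s)" by (rule isCont_tendsto_compose[rotated])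
    then show ?thesis using False by (simp add: f'_def)
  qed (simp add: f'_def)
  ultimately have "(\<lambda>s. f' s (x s)) \<in> borel_measurable (lebesgue_on S)"
    by (rule borel_measurable_LIMSEQ_metric)
  moreover have "AE s in lebesgue_on S. f' s (x s) = f s (x s)"
    using AE_not_in[OF Z(1)] by eventually_elim (simp add: f'_def)
  ultimately show ?thesis by (rule measurable_lebesgue_on_AE_eq[OF S])
qed

context bounded_operator_family
begin

definition freeze :: "(real \<Rightarrow>\<^sub>C 'w) \<Rightarrow> real \<Rightarrow>\<^sub>C 'w" where
  "freeze y = Bcontfun (\<lambda>t. y (max 0 (min T t)))"

lemma freeze: "freeze y t = y (max 0 (min T t))"
proof -
  have "(\<lambda>t. y (max 0 (min T t))) \<in> bcontfun"
  proof (rule bcontfun_normI[where b = "norm y"])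
    show "continuous_on UNIV (\<lambda>t. y (max 0 (min T t)))"
      by (rule continuous_on_compose2[OF continuous_on_apply_bcontfun[of UNIV y]]) (auto intro!: continuous_intros)
  qed (rule norm_bounded)
  then show ?thesis unfolding freeze_def by (simp add: Bcontfun_inverse)
qed

lemma freeze_nonexpansive: "dist (freeze y) (freeze z) \<le> dist y z"
  by (rule dist_bound) (simp add: freeze dist_bounded)

end

instance bcontfun :: (metric_space, banach) banach ..

text \<open>The fixed point map uses the steering functionals \<open>\<phi> j\<close>, chosen for finitely many centres
  of the precompact set of targets \<open>p x\<close> and blended by a partition of unity; no continuous
  selection of an approximate inverse of \<open>F T\<close> is needed.\<close>

lemma (in control_system) semilinear_steering:
  fixes f :: "real \<Rightarrow> 'w \<Rightarrow> 'w" and \<gamma> :: "real \<Rightarrow> real"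
  assumes f_cont: "AE t in M. continuous_on UNIV (f t)"
    and f_meas: "\<And>w. (\<lambda>t. f t w) \<in> borel_measurable M"
    and \<gamma>: "integrable M \<gamma>" and f_bound: "AE t in M. \<forall>w. norm w \<le> r \<longrightarrow> norm (f t w) \<le> \<gamma> t"
    and L: "L \<ge> 1" and F_bound: "\<And>t y. t \<in> {0..T} \<Longrightarrow> y \<in> F T ` X \<Longrightarrow> norm (F t (inv_into X (F T) y)) \<le> L * norm y"
    and pos: "norm \<zeta>1 + N * norm \<zeta> + N * (\<integral>t. \<bar>\<gamma> t\<bar> \<partial>M) > 0"
    and ineq: "N * norm \<zeta> + N * (\<integral>t. \<bar>\<gamma> t\<bar> \<partial>M) + 2 * L * (norm \<zeta>1 + N * norm \<zeta> + N * (\<integral>t. \<bar>\<gamma> t\<bar> \<partial>M)) \<le> r"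
    and \<epsilon>: "\<epsilon> > 0"
  shows "\<exists>u\<in>L2_controls T. \<exists>w. mild_solution G B f T \<zeta> u w \<and> norm (w T - \<zeta>1) < \<epsilon>"
proof -
  have T_mem: "T \<in> {0..T}" using T by simp
  have sets: "{0..T} \<in> sets lebesgue" by simp
  define \<Gamma> where "\<Gamma> = (\<integral>t. \<bar>\<gamma> t\<bar> \<partial>M)"
  define R where "R = norm \<zeta>1 + N * norm \<zeta> + N * \<Gamma>"
  have R: "R > 0" using pos by (simp add: R_def \<Gamma>_def)
  have r_ineq: "N * norm \<zeta> + N * \<Gamma> + 2 * L * R \<le> r" using ineq by (simp add: R_def \<Gamma>_def)
  have \<Gamma>0: "\<Gamma> \<ge> 0" unfolding \<Gamma>_def by (intro integral_nonneg_AE) simp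
  have LR: "2 * L * R \<ge> 0" using L R by simp
  have r: "r \<ge> 0" using r_ineq LR N \<Gamma>0 by (meson add_nonneg_nonneg mult_nonneg_nonneg norm_ge_zero order_trans)
  have \<gamma>_abs: "integrable M (\<lambda>t. \<bar>\<gamma> t\<bar>)" using \<gamma> by simp
  define C where "C = cball (0 :: real \<Rightarrow>\<^sub>C 'w) r"
  have C_D: "norm (x t) \<le> r" if "x \<in> C" for x :: "real \<Rightarrow>\<^sub>C 'w" and t
    using norm_bounded[of x t] that by (simp add: C_def)
  define g :: "(real \<Rightarrow>\<^sub>C 'w) \<Rightarrow> real \<Rightarrow> 'w"
    where "g = (\<lambda>x s. if norm (f s (x s)) \<le> \<bar>\<gamma> s\<bar> then f s (x s) else 0)"
  have g_bound: "norm (g x s) \<le> \<bar>\<gamma> s\<bar>" for x s by (simp add: g_def)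
  have fx_meas: "(\<lambda>s. f s (x s)) \<in> borel_measurable M" for x :: "real \<Rightarrow>\<^sub>C 'w"
    by (rule caratheodory_measurable[OF sets f_cont f_meas]) simp
  have g_meas: "g x \<in> borel_measurable M" for x
  proof -
    have "\<gamma> \<in> borel_measurable M" using \<gamma> by simp
    then show ?thesis unfolding g_def using fx_meas[of x] by measurable
  qed
  have g_int: "integrable M (g x)" for x
    by (rule Bochner_Integration.integrable_bound[OF \<gamma>_abs g_meas]) (intro AE_I2, simp add: g_bound)
  have g_ae: "AE s in M. g x s = f s (x s)" if "x \<in> C" for x
    using f_bound
  proof eventually_elim
    case (elim s)
    then have "norm (f s (x s)) \<le> \<gamma> s" using C_D[OF that] by blast
    then have "norm (f s (x s)) \<le> \<bar>\<gamma> s\<bar>" by simp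
    then show ?case by (simp add: g_def)
  qed
  have g_norm: "(\<integral>s. norm (g x s) \<partial>M) \<le> \<Gamma>" for x
    unfolding \<Gamma>_def by (rule integral_mono) (use g_int \<gamma>_abs g_bound in auto)
  define p where "p = (\<lambda>x. \<zeta>1 - G T \<zeta> - bconv (g x) T)"
  define S where "S = p ` C"
  have conv_g: "norm (bconv (g x) t) \<le> N * \<Gamma>" for x t
  proof -
    have "norm (bconv (g x) t) \<le> N * (\<integral>s. norm (g x s) \<partial>M)" unfolding bconv[OF g_int] by (rule norm_conv_le[OF g_int])
    also have "\<dots> \<le> N * \<Gamma>" by (intro mult_left_mono g_norm N)
    finally show ?thesis .
  qed
  have p_norm: "norm (p x) \<le> R" for x
  proof -
    have "norm (p x) \<le> norm (\<zeta>1 - G T \<zeta>) + norm (bconv (g x) T)" unfolding p_def by (rule norm_triangle_ineq4)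
    moreover have "norm (\<zeta>1 - G T \<zeta>) \<le> norm \<zeta>1 + norm (G T \<zeta>)" by (rule norm_triangle_ineq4)
    ultimately show ?thesis using conv_g[of x T] bound[OF T_mem, of \<zeta>] by (simp add: R_def)
  qed
  define Y where "Y = {bconv g | g. g \<in> borel_measurable M \<and> (\<forall>s. norm (g s) \<le> \<bar>\<gamma> s\<bar>)}"
  have Y: "precompact Y" unfolding Y_def by (rule precompact_conv_dominated[OF \<gamma>_abs])
  have gY: "bconv (g x) \<in> Y" for x unfolding Y_def using g_meas g_bound by blast
  have S: "precompact S"
  proof (rule precompact_subset)
    show "precompact ((\<lambda>y :: real \<Rightarrow>\<^sub>C 'w. \<zeta>1 - G T \<zeta> - y T) ` Y)"
    proof (rule precompact_nonexpansive_image[OF Y])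
      fix y z :: "real \<Rightarrow>\<^sub>C 'w"
      have "dist (\<zeta>1 - G T \<zeta> - y T) (\<zeta>1 - G T \<zeta> - z T) = dist (y T) (z T)"
        by (simp add: dist_norm norm_minus_commute)
      then show "dist (\<zeta>1 - G T \<zeta> - y T) (\<zeta>1 - G T \<zeta> - z T) \<le> dist y z" using dist_bounded[of y T z] by simp
    qed
    show "S \<subseteq> (\<lambda>y :: real \<Rightarrow>\<^sub>C 'w. \<zeta>1 - G T \<zeta> - y T) ` Y" unfolding S_def p_def using gY by blast
  qed
  define e where "e = min (\<epsilon> / 2) R / 2"
  have e: "e > 0" "2 * e < \<epsilon>" "2 * e \<le> R" using \<epsilon> R by (auto simp: e_def)
  obtain m :: nat and c \<theta> where "\<And>j. j < m \<Longrightarrow> c j \<in> S" and \<theta>_cont: "\<And>j. continuous_on S (\<theta> j)"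
    and "\<And>j. \<theta> j \<in> borel_measurable borel"
    and \<theta>0: "\<And>j x. 0 \<le> \<theta> j x" and \<theta>1: "\<And>j x. j < m \<Longrightarrow> \<theta> j x \<le> 1"
    and "\<And>x. x \<in> S \<Longrightarrow> (\<Sum>j<m. \<theta> j x) = 1"
    and approx: "\<And>x y. x \<in> S \<Longrightarrow> (\<And>j. j < m \<Longrightarrow> dist (c j) x \<le> e \<Longrightarrow> dist (y j) (c j) \<le> e)
          \<Longrightarrow> norm (x - (\<Sum>j<m. \<theta> j x *\<^sub>R (y j :: 'w))) \<le> e + e"
  proof (rule precompact_partition[OF S e(1), where d = e], goal_cases)
    case (1 m c \<theta>)
    from 1(2-) show ?case by (rule 1(1))
  qed
  have "\<exists>\<phi>. \<phi> \<in> X \<and> dist (F T \<phi>) (c j) \<le> e" for j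
  proof -
    have "c j \<in> closure (F T ` X)" by (simp add: F_dense)
    then obtain y where "y \<in> F T ` X" "dist y (c j) < e" using e(1) unfolding closure_approachable by blast
    then show ?thesis by (auto intro: less_imp_le)
  qed
  then obtain \<phi> where \<phi>: "\<And>j. \<phi> j \<in> X" "\<And>j. dist (F T (\<phi> j)) (c j) \<le> e" by metis
  have \<phi>X: "\<forall>j<m. \<phi> j \<in> X" using \<phi>(1) by blast
  define \<chi>' where "\<chi>' = (\<lambda>q x. \<Sum>j<m. \<theta> j q *\<^sub>R \<phi> j x)"
  have \<chi>X: "\<chi>' q \<in> X" for q unfolding \<chi>'_def by (rule dual_combination[OF \<phi>X])
  have F_\<chi>: "F t (\<chi>' q) = (\<Sum>j<m. \<theta> j q *\<^sub>R F t (\<phi> j))" if "t \<in> {0..T}" for t q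
    unfolding \<chi>'_def by (rule F_combination[OF \<phi>X that])
  have steer: "norm (q - F T (\<chi>' q)) \<le> 2 * e" if "q \<in> S" for q
    using approx[OF that, of "\<lambda>j. F T (\<phi> j)"] \<phi>(2) by (simp add: F_\<chi>[OF T_mem])
  have control_bound: "norm (F t (\<chi>' (p x))) \<le> 2 * L * R" if "t \<in> {0..T}" "x \<in> C" for t x
  proof -
    let ?q = "p x"
    have q: "?q \<in> S" using that(2) by (simp add: S_def)
    have "norm (F T (\<chi>' ?q)) \<le> norm ?q + norm (?q - F T (\<chi>' ?q))"
      using norm_triangle_ineq4[of ?q "?q - F T (\<chi>' ?q)"] by simp
    then have le: "norm (F T (\<chi>' ?q)) \<le> 2 * R" using steer[OF q] p_norm[of x] e(3) by linarith
    have "norm (F t (\<chi>' ?q)) \<le> L * norm (F T (\<chi>' ?q))"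
      using F_bound[OF that(1), of "F T (\<chi>' ?q)"] \<chi>X by (simp add: inv_into_f_f[OF F_inj])
    also have "\<dots> \<le> L * (2 * R)" using le L by (intro mult_left_mono) auto
    finally show ?thesis by simp
  qed
  define z0 where "z0 = Bcontfun (\<lambda>t. H t \<zeta>)"
  have z0: "apply_bcontfun z0 = (\<lambda>t. H t \<zeta>)"
    unfolding z0_def by (intro Bcontfun_inverse bcontfun_normI[OF H_continuous H_bound])
  define \<Psi> where "\<Psi> = (\<lambda>j. bconv (\<lambda>s. B (adj (\<phi> j) s)))"
  have \<Psi>_apply: "apply_bcontfun (\<Psi> j) = conv (\<lambda>s. B (adj (\<phi> j) s))" for j
    unfolding \<Psi>_def by (rule bconv[OF B_adj_integrable[OF \<phi>(1)]])
  define \<Phi> where "\<Phi> = (\<lambda>x. freeze (z0 + bconv (g x) + (\<Sum>j<m. \<theta> j (p x) *\<^sub>R \<Psi> j)))"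
  have sum_apply: "(\<Sum>j<m. \<theta> j q *\<^sub>R \<Psi> j) t = F t (\<chi>' q)" if "t \<in> {0..T}" for t q
  proof -
    have "(\<Sum>j<m. \<theta> j q *\<^sub>R \<Psi> j) t = (\<Sum>j<m. \<theta> j q *\<^sub>R \<Psi> j t)" by (induction m) simp_all
    also have "\<dots> = (\<Sum>j<m. \<theta> j q *\<^sub>R F t (\<phi> j))" by (simp only: F_eq[OF that] \<Psi>_apply)
    finally show ?thesis by (simp only: F_\<chi>[OF that])
  qed
  have \<Phi>_apply: "\<Phi> x t = H t' \<zeta> + conv (g x) t' + F t' (\<chi>' (p x))" if "t' = max 0 (min T t)" for x t t'
    using sum_apply[OF clamp_mem, of "p x" t] by (simp add: \<Phi>_def freeze that z0 bconv[OF g_int])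
  have maps: "\<Phi> ` C \<subseteq> C"
  proof
    fix y assume "y \<in> \<Phi> ` C"
    then obtain x where x: "x \<in> C" "y = \<Phi> x" by blast
    have "norm (\<Phi> x) \<le> r"
    proof (rule norm_bound)
      fix t
      define t' where "t' = max 0 (min T t)"
      have t': "t' \<in> {0..T}" unfolding t'_def by (rule clamp_mem)
      have "norm (\<Phi> x t) \<le> norm (H t' \<zeta> + conv (g x) t') + norm (F t' (\<chi>' (p x)))"
        unfolding \<Phi>_apply[OF t'_def] by (rule norm_triangle_ineq)
      also have "\<dots> \<le> (N * norm \<zeta> + N * \<Gamma>) + 2 * L * R"
        using norm_triangle_ineq[of "H t' \<zeta>" "conv (g x) t'"] H_bound[of t' \<zeta>] conv_g[of x t'] control_bound[OF t' x(1)]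
        by (simp add: bconv[OF g_int])
      also have "\<dots> \<le> r" using r_ineq by simp
      finally show "norm (\<Phi> x t) \<le> r" .
    qed
    then show "y \<in> C" using x by (simp add: C_def)
  qed
  have compact: "precompact (\<Phi> ` C)"
  proof (rule precompact_subset)
    define W where "W = {y + z | y z. y \<in> {y + z | y z. y \<in> {z0} \<and> z \<in> Y} \<and> z \<in> {\<Sum>j<m. a j *\<^sub>R \<Psi> j | a. \<forall>j<m. \<bar>a j\<bar> \<le> 1}}"
    have "precompact {z0}" by (intro compact_imp_precompact) simp
    then have "precompact W" unfolding W_def by (intro precompact_plus Y precompact_combinations)
    then show "precompact (freeze ` W)" by (rule precompact_nonexpansive_image) (rule freeze_nonexpansive)
    show "\<Phi> ` C \<subseteq> freeze ` W"
    proof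
      fix y assume "y \<in> \<Phi> ` C"
      then obtain x where x: "y = \<Phi> x" by blast
      have "z0 + bconv (g x) \<in> {y + z | y z. y \<in> {z0} \<and> z \<in> Y}" using gY by blast
      moreover have "(\<Sum>j<m. \<theta> j (p x) *\<^sub>R \<Psi> j) \<in> {\<Sum>j<m. a j *\<^sub>R \<Psi> j | a. \<forall>j<m. \<bar>a j\<bar> \<le> 1}"
        using \<theta>0 \<theta>1 by (intro CollectI exI[of _ "\<lambda>j. \<theta> j (p x)"] conjI refl) auto
      ultimately have "z0 + bconv (g x) + (\<Sum>j<m. \<theta> j (p x) *\<^sub>R \<Psi> j) \<in> W" unfolding W_def by blast
      then show "y \<in> freeze ` W" unfolding x \<Phi>_def by (rule imageI)
    qed
  qed
  have g_cont: "continuous_on C (\<lambda>x. bconv (g x))"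
    unfolding continuous_on_sequentially
  proof (intro allI ballI impI, elim conjE)
    fix x :: "nat \<Rightarrow> real \<Rightarrow>\<^sub>C 'w" and y assume y: "y \<in> C" and x: "\<forall>n. x n \<in> C" "x \<longlonglongrightarrow> y"
    have "(\<lambda>n. \<integral>s. norm (g (x n) s - g y s) \<partial>M) \<longlonglongrightarrow> (\<integral>s. 0 \<partial>M)"
    proof (rule integral_dominated_convergence[where w = "\<lambda>s. 2 * \<bar>\<gamma> s\<bar>"])
      show "integrable M (\<lambda>s. 2 * \<bar>\<gamma> s\<bar>)" using \<gamma>_abs by simp
      show "(\<lambda>s. norm (g (x n) s - g y s)) \<in> borel_measurable M" for n using g_meas by simp
      show "AE s in M. norm (norm (g (x n) s - g y s)) \<le> 2 * \<bar>\<gamma> s\<bar>" for n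
      proof (intro AE_I2)
        fix s
        show "norm (norm (g (x n) s - g y s)) \<le> 2 * \<bar>\<gamma> s\<bar>"
          using norm_triangle_ineq4[of "g (x n) s" "g y s"] g_bound[of "x n" s] g_bound[of y s] by simp
      qed
      have "AE s in M. \<forall>n. g (x n) s = f s (x n s)" unfolding AE_all_countable using g_ae x(1) by blast
      then show "AE s in M. (\<lambda>n. norm (g (x n) s - g y s)) \<longlonglongrightarrow> 0"
        using g_ae[OF y] f_cont
      proof eventually_elim
        case (elim s)
        have "(\<lambda>n. x n s) \<longlonglongrightarrow> y s"
        proof (rule metric_tendsto_imp_tendsto[OF x(2)])
          show "\<forall>\<^sub>F n in sequentially. dist (x n s) (y s) \<le> dist (x n) y"
            by (intro always_eventually allI dist_bounded)
        qed
        then have "(\<lambda>n. f s (x n s)) \<longlonglongrightarrow> f s (y s)"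
          using elim(3) by (intro isCont_tendsto_compose[where g = "f s"]) (auto simp: continuous_on_eq_continuous_at)
        then have "(\<lambda>n. norm (f s (x n s) - f s (y s))) \<longlonglongrightarrow> norm (f s (y s) - f s (y s))"
          by (intro tendsto_intros)
        then show ?case using elim(1,2) by simp
      qed
    qed simp
    then have "(\<lambda>n. N * (\<integral>s. norm (g (x n) s - g y s) \<partial>M)) \<longlonglongrightarrow> N * 0" by (intro tendsto_intros) simp
    then have lim: "(\<lambda>n. N * (\<integral>s. norm (g (x n) s - g y s) \<partial>M)) \<longlonglongrightarrow> 0" by simp
    have "(\<lambda>n. dist (bconv (g (x n))) (bconv (g y))) \<longlonglongrightarrow> 0"
    proof (rule tendsto_sandwich[OF _ _ tendsto_const lim])
      show "\<forall>\<^sub>F n in sequentially. dist (bconv (g (x n))) (bconv (g y)) \<le> N * (\<integral>s. norm (g (x n) s - g y s) \<partial>M)"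
        by (intro always_eventually allI dist_bconv_le g_int)
    qed simp
    then show "((\<lambda>x. bconv (g x)) \<circ> x) \<longlonglongrightarrow> bconv (g y)"
      unfolding o_def by (rule tendsto_dist_iff[THEN iffD2])
  qed
  have eval_cont: "continuous_on UNIV (\<lambda>y :: real \<Rightarrow>\<^sub>C 'w. y T)"
    by (rule nonexpansive_continuous_on) (rule dist_bounded)
  have p_cont: "continuous_on C p"
    unfolding p_def by (intro continuous_intros continuous_on_compose2[OF eval_cont g_cont]) auto
  have "continuous_on C (\<lambda>x. \<theta> j (p x))" for j
    by (rule continuous_on_compose2[OF \<theta>_cont p_cont]) (simp add: S_def)
  then have cont_inner: "continuous_on C (\<lambda>x. z0 + bconv (g x) + (\<Sum>j<m. \<theta> j (p x) *\<^sub>R \<Psi> j))"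
    by (intro continuous_intros g_cont)
  have freeze_cont: "continuous_on UNIV freeze"
    by (rule nonexpansive_continuous_on) (rule freeze_nonexpansive)
  have \<Phi>_cont: "continuous_on C \<Phi>"
    unfolding \<Phi>_def by (rule continuous_on_compose2[OF freeze_cont cont_inner]) simp
  obtain x where x: "x \<in> C" "\<Phi> x = x"
  proof (rule schauder_fixed_point[OF _ _ _ maps \<Phi>_cont compact])
    show "convex C" "closed C" "C \<noteq> {}" using r by (auto simp: C_def)
  qed
  define q where "q = p x"
  have q: "q \<in> S" using x(1) by (simp add: q_def S_def)
  define u where "u = adj (\<chi>' q)"
  have u_meas: "u \<in> borel_measurable M" unfolding u_def by (rule adj_measurable[OF \<chi>X])
  obtain K where K: "\<And>s. norm (u s) \<le> K" using adj_bounded[OF \<chi>X] unfolding u_def by blast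
  have u_L2: "u \<in> L2_controls T"
    unfolding L2_controls_def
  proof (intro CollectI conjI u_meas integrable_bounded)
    show "(\<lambda>s. (norm (u s))\<^sup>2) \<in> borel_measurable M" using u_meas by simp
    show "norm ((norm (u s))\<^sup>2) \<le> K\<^sup>2" for s using power_mono[OF K norm_ge_zero, of s 2] by simp
  qed
  have Bu_int: "integrable M (\<lambda>s. B (u s))" unfolding u_def by (rule B_adj_integrable[OF \<chi>X])
  have Bf_int: "integrable M (\<lambda>s. B (u s) + f s (x s))"
  proof (rule Bochner_Integration.integrable_add[OF Bu_int])
    show "integrable M (\<lambda>s. f s (x s))"
      by (rule integrable_cong_AE_imp[OF g_int[of x] fx_meas]) (use g_ae[OF x(1)] in \<open>auto elim: eventually_mono\<close>)
  qed
  have x_eq: "x t = G t \<zeta> + conv (g x) t + F t (\<chi>' q)" if "t \<in> {0..T}" for t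
  proof -
    have "t = max 0 (min T t)" using that by auto
    from \<Phi>_apply[OF this, of x] show ?thesis by (simp only: x(2) H_eq[OF that] q_def)
  qed
  have "mild_solution G B f T \<zeta> u x"
    unfolding mild_solution_def
  proof (intro conjI ballI)
    show "continuous_on {0..T} x" by simp
    fix t assume t: "t \<in> {0..T}"
    show "integrable (lebesgue_on {0..t}) (\<lambda>s. G (t - s) (B (u s) + f s (x s)))"
      by (rule convolution_integrable_on[OF Bf_int t])
    have "x t = G t \<zeta> + (conv (\<lambda>s. B (u s)) t + conv (g x) t)"
      using x_eq[OF t] by (simp add: F_eq[OF t] u_def)
    also have "conv (\<lambda>s. B (u s)) t + conv (g x) t = conv (\<lambda>s. B (u s) + g x s) t"
      by (rule conv_add[OF Bu_int g_int, symmetric])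
    also have "\<dots> = conv (\<lambda>s. B (u s) + f s (x s)) t"
    proof (rule conv_cong_AE)
      show "(\<lambda>s. B (u s) + g x s) \<in> borel_measurable M" using Bu_int g_int[of x] by simp
      show "(\<lambda>s. B (u s) + f s (x s)) \<in> borel_measurable M" using Bf_int by simp
      show "AE s in M. B (u s) + g x s = B (u s) + f s (x s)"
        using g_ae[OF x(1)] by eventually_elim simp
    qed
    finally show "x t = G t \<zeta> + (LINT s|lebesgue_on {0..t}. G (t - s) (B (u s) + f s (x s)))"
      by (simp only: conv_eq[OF t])
  qed
  moreover have "norm (x T - \<zeta>1) < \<epsilon>"
  proof -
    have "x T - \<zeta>1 = - (q - F T (\<chi>' q))"
      using x_eq[OF T_mem] by (simp add: q_def p_def bconv[OF g_int])
    then have "norm (x T - \<zeta>1) = norm (q - F T (\<chi>' q))" by (simp only: norm_minus_cancel)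
    then show ?thesis using steer[OF q] e(2) by simp
  qed
  ultimately show ?thesis using u_L2 by blast
qed

theorem theorem3p14:
  fixes sW :: "'k::rc_field \<Rightarrow> 'w::{banach,second_countable_topology} \<Rightarrow> 'w"
    and sU :: "'k \<Rightarrow> 'u::{banach,second_countable_topology} \<Rightarrow> 'u"
    and ip :: "'u \<Rightarrow> 'u \<Rightarrow> 'k"
    and D :: "'w set" and A :: "'w \<Rightarrow> 'w" and B :: "'u \<Rightarrow> 'w"
    and G :: "real \<Rightarrow> 'w \<Rightarrow> 'w" and f :: "real \<Rightarrow> 'w \<Rightarrow> 'w"
    and \<gamma> :: "real \<Rightarrow> real \<Rightarrow> real"
    and T \<alpha> \<beta> \<nu> N L :: real
  assumes "normed_space_over sW" and "super_reflexive sW"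
    and "uniformly_smooth TYPE('w)" and "strictly_convex TYPE('w)"
    and "hilbert_space_over sU ip"
    and "T > 0" and "\<alpha> > 0" and "\<beta> \<ge> 0" and "0 < \<nu>" and "\<nu> < 1"
    and "module.subspace sW D" and "linear_on sW sW D A"
    and "closed_op D A" and "closure D = UNIV"
    and "sectorial sW D A (\<nu> * pi / 2)" and "compact_resolvent sW D A"
    and "resolvent_family sW D A (memory_kernel \<alpha> \<beta> \<nu>) G"
    and "\<forall>t\<in>{0..T}. onorm (G t) \<le> N"
    and "bounded_linear_over sU sW B"
    and "AE t in lebesgue_on {0..T}. continuous_on UNIV (f t)"
    and "\<forall>w. (\<lambda>t. f t w) \<in> borel_measurable (lebesgue_on {0..T})"
    and "\<forall>r>0. integrable (lebesgue_on {0..T}) (\<gamma> r) \<and>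
           (AE t in lebesgue_on {0..T}. 0 < \<gamma> r t) \<and>
           (AE t in lebesgue_on {0..T}. \<forall>w. norm w \<le> r \<longrightarrow> norm (f t w) \<le> \<gamma> r t)"
    and "approximately_controllable G B (\<lambda>_ _. 0) T"
    and "L \<ge> 1"
    and "\<forall>t\<in>{0..T}. \<forall>y\<in>control_operator G ip B T T ` dual sW UNIV norm.
           norm (control_operator G ip B T t
                 (inv_into (dual sW UNIV norm) (control_operator G ip B T T) y)) \<le> L * norm y"
    and "\<forall>\<zeta>::'w. \<forall>\<zeta>1::'w. \<exists>r>0.
           N * norm \<zeta> + N * (LINT t|lebesgue_on {0..T}. \<bar>\<gamma> r t\<bar>)
           + 2 * L * (norm \<zeta>1 + N * norm \<zeta> + N * (LINT t|lebesgue_on {0..T}. \<bar>\<gamma> r t\<bar>)) \<le> r"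
  shows "approximately_controllable G B f T"
proof -
  have sW: "normed_space_over sW" and hilb: "hilbert_space_over sU ip" and T: "T > 0"
    and G: "resolvent_family sW D A (memory_kernel \<alpha> \<beta> \<nu>) G" and N_bound: "\<forall>t\<in>{0..T}. onorm (G t) \<le> N"
    and B: "bounded_linear_over sU sW B" and L: "L \<ge> 1"
    and controllable: "approximately_controllable G B (\<lambda>_ _. 0) T"
    and f_cont: "AE t in lebesgue_on {0..T}. continuous_on UNIV (f t)"
    and f_meas: "\<forall>w. (\<lambda>t. f t w) \<in> borel_measurable (lebesgue_on {0..T})"
    by fact+
  have G_lin: "bounded_linear (G t)" and G_scale: "G t (sW c x) = sW c (G t x)"
    and G_cont: "continuous_on {0..} (\<lambda>t. G t x)" and G0: "G 0 x = x" if "t \<in> {0..T}" for t c x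
    using G that unfolding resolvent_family_def bounded_linear_over_def linear_on_def by auto
  have T_mem: "T \<in> {0..T}" "0 \<in> {0..T}" using T by simp_all
  have G_bound: "norm (G t x) \<le> N * norm x" if "t \<in> {0..T}" for t x
  proof -
    have "norm (G t x) \<le> onorm (G t) * norm x" by (rule onorm[OF G_lin[OF that]])
    also have "\<dots> \<le> N * norm x" using N_bound that by (intro mult_right_mono) auto
    finally show ?thesis .
  qed
  have N0: "N \<ge> 0" using onorm_pos_le[OF G_lin[OF T_mem(1)]] N_bound T_mem(1) by (meson order_trans)
  interpret bounded_operator_family G T N
  proof (rule bounded_operator_family.intro[OF T N0 G_lin G_bound])
    show "continuous_on {0..T} (\<lambda>t. G t x)" for x
      by (rule continuous_on_subset[OF G_cont[OF T_mem(1)]]) auto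
  qed
  obtain C K where C: "C \<ge> 0" and K: "K \<ge> 0"
    and P: "\<forall>\<mu>>0. \<exists>P. bounded_linear P \<and> (\<forall>x. norm (P x) \<le> K * norm x) \<and>
      precompact (P ` cball 0 1) \<and> (\<forall>t\<in>{0<..T}. \<forall>x. norm (G t x - G t (P x)) \<le> C / (t\<^sup>2 * \<mu>) * norm x)"
    using resolvent_family_compact_approximation[OF sW T \<open>\<alpha> > 0\<close> \<open>\<beta> \<ge> 0\<close> \<open>0 < \<nu>\<close> \<open>\<nu> < 1\<close>
      \<open>module.subspace sW D\<close> \<open>linear_on sW sW D A\<close> \<open>sectorial sW D A (\<nu> * pi / 2)\<close> \<open>compact_resolvent sW D A\<close> G N_bound]
    by (elim exE conjE)
  have "compact_operator_family G T N"
  proof (rule compact_operator_family.intro[OF bounded_operator_family_axioms compact_operator_family_axioms.intro])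
    show "\<exists>K\<ge>0. \<forall>\<delta>\<in>{0<..T}. \<forall>e>0. \<exists>P. bounded_linear P \<and> (\<forall>x. norm (P x) \<le> K * norm x) \<and>
      precompact (P ` cball 0 1) \<and> (\<forall>t\<in>{\<delta>..T}. \<forall>x. norm (G t x - G t (P x)) \<le> e * norm x)"
    proof (intro exI[of _ K] conjI K ballI allI impI)
      fix \<delta> e :: real assume \<delta>: "\<delta> \<in> {0<..T}" and e: "e > 0"
      define \<mu> where "\<mu> = (C + 1) / (\<delta>\<^sup>2 * e)"
      have \<mu>: "\<mu> > 0" using C \<delta> e by (simp add: \<mu>_def)
      obtain P where P: "bounded_linear P" "\<forall>x. norm (P x) \<le> K * norm x" "precompact (P ` cball 0 1)"
        and PG: "\<And>t x. t \<in> {0<..T} \<Longrightarrow> norm (G t x - G t (P x)) \<le> C / (t\<^sup>2 * \<mu>) * norm x"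
        using P[rule_format, OF \<mu>] by blast
      have "norm (G t x - G t (P x)) \<le> e * norm x" if t: "t \<in> {\<delta>..T}" for t x
      proof -
        have pos: "\<delta>\<^sup>2 > 0" using \<delta> by simp
        have "\<delta>\<^sup>2 * \<mu> \<le> t\<^sup>2 * \<mu>" using t \<delta> \<mu> by (intro mult_right_mono power_mono) auto
        moreover have \<delta>\<mu>: "\<delta>\<^sup>2 * \<mu> = (C + 1) / e" using pos by (simp add: \<mu>_def)
        moreover have "(C + 1) / e > 0" using C e by simp
        ultimately have "C / (t\<^sup>2 * \<mu>) \<le> C / ((C + 1) / e)" using C by (intro frac_le) auto
        also have "\<dots> \<le> e" using C e by (simp add: pos_divide_le_eq)
        finally have "C / (t\<^sup>2 * \<mu>) * norm x \<le> e * norm x" by (intro mult_right_mono) auto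
        then show ?thesis using PG[of t x] t \<delta> by auto
      qed
      then show "\<exists>P. bounded_linear P \<and> (\<forall>x. norm (P x) \<le> K * norm x) \<and>
          precompact (P ` cball 0 1) \<and> (\<forall>t\<in>{\<delta>..T}. \<forall>x. norm (G t x - G t (P x)) \<le> e * norm x)"
        using P by (intro exI[of _ P]) simp
    qed
  qed
  then interpret control_system G T N sW sU ip B
    by (rule control_system.intro[OF _ control_system_axioms.intro]) (fact sW hilb B G_scale controllable)+
  show ?thesis
    unfolding approximately_controllable_def
  proof (intro allI impI)
    fix \<zeta> \<zeta>1 :: 'w and \<epsilon> :: real assume \<epsilon>: "\<epsilon> > 0"
    show "\<exists>u\<in>L2_controls T. \<exists>w. mild_solution G B f T \<zeta> u w \<and> norm (w T - \<zeta>1) < \<epsilon>"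
    proof (cases "\<forall>x :: 'w. x = 0")
      case True
      then have eq: "x = y" for x y :: 'w by metis
      have "mild_solution G B f T \<zeta> (\<lambda>_. 0) (\<lambda>_. 0)"
        unfolding mild_solution_def
      proof (intro conjI ballI)
        fix t
        have "(\<lambda>s. G (t - s) (B 0 + f s 0)) = (\<lambda>s. 0)" by (intro ext) (rule eq)
        then show "integrable (lebesgue_on {0..t}) (\<lambda>s. G (t - s) (B 0 + f s 0))" by simp
      qed (auto intro: eq)
      moreover have "(\<lambda>_. 0) \<in> L2_controls T" by (simp add: L2_controls_def)
      moreover have "norm (0 - \<zeta>1) < \<epsilon>" using \<epsilon> eq[of \<zeta>1 0] by simp
      ultimately show ?thesis by blast
    next
      case False
      then obtain x :: 'w where "x \<noteq> 0" by blast
      then have "N > 0" using G_bound[OF T_mem(2), of x] G0[OF T_mem(2), of x] N0 by (cases "N = 0") auto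
      obtain r where r: "r > 0" and ineq: "N * norm \<zeta> + N * (LINT t|lebesgue_on {0..T}. \<bar>\<gamma> r t\<bar>)
           + 2 * L * (norm \<zeta>1 + N * norm \<zeta> + N * (LINT t|lebesgue_on {0..T}. \<bar>\<gamma> r t\<bar>)) \<le> r"
        using assms(26) by meson
      have \<gamma>: "integrable (lebesgue_on {0..T}) (\<gamma> r)" "AE t in lebesgue_on {0..T}. 0 < \<gamma> r t"
        "AE t in lebesgue_on {0..T}. \<forall>w. norm w \<le> r \<longrightarrow> norm (f t w) \<le> \<gamma> r t"
        using assms(22) r by blast+
      have "(LINT t|lebesgue_on {0..T}. \<bar>\<gamma> r t\<bar>) > 0"
      proof (rule ccontr)
        assume "\<not> (LINT t|lebesgue_on {0..T}. \<bar>\<gamma> r t\<bar>) > 0"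
        moreover have "(LINT t|lebesgue_on {0..T}. \<bar>\<gamma> r t\<bar>) \<ge> 0" by (intro integral_nonneg_AE) simp
        ultimately have "AE t in lebesgue_on {0..T}. \<bar>\<gamma> r t\<bar> = 0"
          using integral_nonneg_eq_0_iff_AE[of "lebesgue_on {0..T}" "\<lambda>t. \<bar>\<gamma> r t\<bar>"] \<gamma>(1) by simp
        then have "AE t in lebesgue_on {0..T}. False" using \<gamma>(2) by eventually_elim simp
        then have "AE t in lebesgue_on {0..T}. \<not> True" by simp
        then have "emeasure (lebesgue_on {0..T}) {t \<in> space (lebesgue_on {0..T}). True} = 0"
          by (rule emeasure_eq_0_AE)
        also have "{t \<in> space (lebesgue_on {0..T}). True} = {0..T}" by auto
        also have "emeasure (lebesgue_on {0..T}) {0..T} = ennreal T"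
          using T by (simp add: emeasure_restrict_space)
        finally show False using T by simp
      qed
      then have pos: "norm \<zeta>1 + N * norm \<zeta> + N * (LINT t|lebesgue_on {0..T}. \<bar>\<gamma> r t\<bar>) > 0"
        using \<open>N > 0\<close> by (intro add_nonneg_pos add_nonneg_nonneg mult_pos_pos mult_nonneg_nonneg) auto
      show ?thesis
        by (rule semilinear_steering[OF f_cont f_meas[rule_format] \<gamma>(1,3) L _ pos ineq \<epsilon>])
          (use assms(25) in blast)
    qed
  qed
qed

end
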